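(* Let $N\in\mathbb{N}$, let $X_1,\dots,X_N,Y_1,\dots,Y_N$ be Polish spaces, $X=\prod_t X_t$, $Y=\prod_t Y_t$, and let $\mu\in\mathcal P(X)$, $\nu\in\mathcal P(Y)$ both satisfy the continuous disintegration assumption. Then the set $\mathrm{Cpl}_{bc}(\mu,\nu)\cap\mathrm{Cpl}_{biM}(\mu,\nu)$ of biadapted Monge couplings is weakly dense in $\mathrm{Cpl}_{bc}(\mu,\nu)$, i.e. its weak closure equals $\mathrm{Cpl}_{bc}(\mu,\nu)$. Moreover, if $p\in[1,\infty)$ and $\mu,\nu$ have finite $p$-th moments with respect to compatible metrics $d_X,d_Y$, then $\mathrm{Cpl}_{bc}(\mu,\nu)\cap\mathrm{Cpl}_{biM}(\mu,\nu)$ is also dense in $\mathrm{Cpl}_{bc}(\mu,\nu)$ with respect to $\mathcal W_p$ (for the product metric $d_{X\times Y}^p=d_X^p+d_Y^p$).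
   Context: Continuous disintegration assumption: $\mu$ admits a disintegration $d\mu(x_{1:N})=d\mu_1(x_1)\,d\mu^{x_1}(x_2)\cdots d\mu^{x_{1:N-1}}(x_N)$ with Borel kernels $x_{1:t}\mapsto\mu^{x_{1:t}}\in\mathcal P(X_{t+1})$ such that $\mu_1$ is continuous (no atoms) and $\mu^{x_{1:t}}$ is continuous for every $t<N$ and every $x_{1:t}\in X_1\times\dots\times X_t$. $\mathrm{Cpl}_{biM}(\mu,\nu)=\{(\mathrm{id},T)_\ast\mu: T:X\to Y \text{ Borel bijection}, T_\ast\mu=\nu\}$. For $t<N$, $\mathcal F^X_t$ (resp. $\mathcal F^Y_t$) is the $\sigma$-algebra generated by the first $t$ coordinates. $\pi\in\mathrm{Cpl}(\mu,\nu)$ with disintegration $\pi(dx,dy)=\mu(dx)\pi^x(dy)$ is causal if for all $t<N$, $B\in\mathcal F^Y_t$, $x\mapsto\pi^x(B)$ is $\mathcal F^X_t$-measurable; bicausal if also its image under $(x,y)\mapsto(y,x)$ is causal from $\nu$ to $\mu$; $\mathrm{Cpl}_{bc}(\mu,\nu)$ is the set of bicausal couplings. $\mathcal W_p$ is the $p$-Wasserstein distance $\mathcal W_p^p(\alpha,\beta)=\inf_{\gamma\in\mathrm{Cpl}(\alpha,\beta)}\int d^p\,d\gamma$. *)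

theory Defs
  imports "HOL-Probability.Probability"
begin

definition Polish_space :: "'a topology \<Rightarrow> bool" where
  "Polish_space T \<longleftrightarrow> completely_metrizable_space T \<and> separable_space T"

definition borel_of :: "'a topology \<Rightarrow> 'a measure" where
  "borel_of T = sigma (topspace T) {U. openin T U}"

definition prodM :: "nat \<Rightarrow> (nat \<Rightarrow> 'a topology) \<Rightarrow> (nat \<Rightarrow> 'a) measure" where
  "prodM n X = PiM {..<n} (\<lambda>t. borel_of (X t))"

definition filtM :: "nat \<Rightarrow> nat \<Rightarrow> (nat \<Rightarrow> 'a topology) \<Rightarrow> (nat \<Rightarrow> 'a) measure" where
  "filtM N t X = vimage_algebra (space (prodM N X)) (\<lambda>x. restrict x {..<t}) (prodM t X)"

text \<open>Successive composition mu_1(dx_1) K_1^{x_1}(dx_2) ... of kernels; K t maps a prefix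
  (x_0,...,x_{t-1}) to a measure on X t.\<close>

fun seqcomp :: "(nat \<Rightarrow> 'a topology) \<Rightarrow> (nat \<Rightarrow> (nat \<Rightarrow> 'a) \<Rightarrow> 'a measure) \<Rightarrow> nat
    \<Rightarrow> (nat \<Rightarrow> 'a) measure" where
  "seqcomp X K 0 = return (prodM 0 X) (\<lambda>_. undefined)"
| "seqcomp X K (Suc t) =
     bind (seqcomp X K t) (\<lambda>x. distr (K t x) (prodM (Suc t) X) (\<lambda>y. x(t := y)))"

definition cont_disint :: "nat \<Rightarrow> (nat \<Rightarrow> 'a topology) \<Rightarrow> (nat \<Rightarrow> 'a) measure \<Rightarrow> bool" where
  "cont_disint N X \<mu> \<longleftrightarrow>
     (\<exists>K. (\<forall>t<N. K t \<in> prodM t X \<rightarrow>\<^sub>M prob_algebra (borel_of (X t))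
               \<and> (\<forall>x\<in>space (prodM t X). \<forall>a. emeasure (K t x) {a} = 0))
          \<and> \<mu> = seqcomp X K N)"

definition Cpl :: "'a measure \<Rightarrow> 'b measure \<Rightarrow> ('a \<times> 'b) measure set" where
  "Cpl \<alpha> \<beta> = {\<pi>. sets \<pi> = sets (\<alpha> \<Otimes>\<^sub>M \<beta>) \<and> distr \<pi> \<alpha> fst = \<alpha> \<and> distr \<pi> \<beta> snd = \<beta>}"

definition causal :: "nat \<Rightarrow> (nat \<Rightarrow> 'a topology) \<Rightarrow> (nat \<Rightarrow> 'b topology)
    \<Rightarrow> (nat \<Rightarrow> 'a) measure \<Rightarrow> ((nat \<Rightarrow> 'a) \<times> (nat \<Rightarrow> 'b)) measure \<Rightarrow> bool" where
  "causal N X Y \<mu> \<pi> \<longleftrightarrow>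
     (\<exists>k \<in> prodM N X \<rightarrow>\<^sub>M prob_algebra (prodM N Y).
        \<pi> = bind \<mu> (\<lambda>x. distr (k x) (prodM N X \<Otimes>\<^sub>M prodM N Y) (\<lambda>y. (x, y)))
      \<and> (\<forall>t<N. \<forall>B \<in> sets (filtM N t Y).
            (\<lambda>x. emeasure (k x) B) \<in> borel_measurable (filtM N t X)))"

definition Cpl_bc :: "nat \<Rightarrow> (nat \<Rightarrow> 'a topology) \<Rightarrow> (nat \<Rightarrow> 'b topology)
    \<Rightarrow> (nat \<Rightarrow> 'a) measure \<Rightarrow> (nat \<Rightarrow> 'b) measure \<Rightarrow> ((nat \<Rightarrow> 'a) \<times> (nat \<Rightarrow> 'b)) measure set" where
  "Cpl_bc N X Y \<mu> \<nu> = {\<pi> \<in> Cpl \<mu> \<nu>. causal N X Y \<mu> \<pi>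
       \<and> causal N Y X \<nu> (distr \<pi> (prodM N Y \<Otimes>\<^sub>M prodM N X) (\<lambda>(x, y). (y, x)))}"

definition Cpl_biM :: "'a measure \<Rightarrow> 'b measure \<Rightarrow> ('a \<times> 'b) measure set" where
  "Cpl_biM \<mu> \<nu> = {distr \<mu> (\<mu> \<Otimes>\<^sub>M \<nu>) (\<lambda>x. (x, T x)) | T.
       T \<in> \<mu> \<rightarrow>\<^sub>M \<nu> \<and> bij_betw T (space \<mu>) (space \<nu>) \<and> distr \<mu> \<nu> T = \<nu>}"

definition Cb :: "'c topology \<Rightarrow> ('c \<Rightarrow> real) set" where
  "Cb T = {f. continuous_map T euclideanreal f \<and> (\<exists>B. \<forall>z\<in>topspace T. \<bar>f z\<bar> \<le> B)}"

text \<open>Closure of S inside the ambient set P of probability measures, w.r.t. the weak topology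
  (generated by the maps rho -> integral f d rho, f bounded continuous on T).\<close>

definition weak_closure :: "'c topology \<Rightarrow> 'c measure set \<Rightarrow> 'c measure set \<Rightarrow> 'c measure set" where
  "weak_closure T P S = {\<pi> \<in> P. \<forall>F \<epsilon>. finite F \<and> F \<subseteq> Cb T \<and> \<epsilon> > 0 \<longrightarrow>
      (\<exists>\<rho>\<in>S. \<forall>f\<in>F. \<bar>(\<integral>z. f z \<partial>\<rho>) - (\<integral>z. f z \<partial>\<pi>)\<bar> < \<epsilon>)}"

definition Wp_pow :: "real \<Rightarrow> ('c \<Rightarrow> 'c \<Rightarrow> real) \<Rightarrow> 'c measure \<Rightarrow> 'c measure \<Rightarrow> ennreal" where
  "Wp_pow p d \<alpha> \<beta> = (INF \<gamma> \<in> Cpl \<alpha> \<beta>. \<integral>\<^sup>+ z. ennreal (d (fst z) (snd z) powr p) \<partial>\<gamma>)"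

definition prod_metric_p :: "real \<Rightarrow> ('a \<Rightarrow> 'a \<Rightarrow> real) \<Rightarrow> ('b \<Rightarrow> 'b \<Rightarrow> real)
    \<Rightarrow> ('a \<times> 'b) \<Rightarrow> ('a \<times> 'b) \<Rightarrow> real" where
  "prod_metric_p p dX dY z w = (dX (fst z) (fst w) powr p + dY (snd z) (snd w) powr p) powr (1 / p)"

end

theory Submission
  imports Defs
begin

text \<open>
  Because the kernels are atomless, each of the two laws is isomorphic to the uniform law on the cube
  \<open>[0, 1]\<^sup>N\<close> by maps that are adapted in both directions and inverse to each other almost surely:
  in every coordinate one applies the conditional distribution function and, backwards, a generalised
  inverse of it. Cut the cube into small cells. Causality of a coupling in both directions says that,
  given the pair of cells of the past, the next cell of either path is still uniform, so the conditional
  law of the next pair of cells is, up to a factor, a doubly stochastic matrix. It is realised by exchanging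
  subintervals of \<open>[0, 1]\<close>, and composing these exchanges over time gives an adapted isomorphism
  whose graph coupling charges every pair of cells like the given coupling. Both sides contain null
  copies of the Cantor space, hence the map can be corrected on a null set to a Borel bijection. Two
  couplings that agree on pairs of cells can be coupled so that the cells coincide, and since a Borel set is
  approximately a union of cells, this forces weak and Wasserstein proximity as the cells shrink.

  Conversely, causality amounts to integrating bounded functions of the first path against
  sets of the past of the second one, where the first factor may be replaced by its conditional
  expectation given the past. These identities are linear in the coupling, and as the marginals are
  fixed they survive weak limits.\<close>

section \<open>Standard Borel spaces\<close>

text \<open>A standard space is taken to be a measurable retract of the Cantor space: an encoder
  with a decoder that is measurable on all codes. This spares the theorem on Borel images
  throughout. The maps to the cube are merely measurable, so paths in one cell need not be close;
  closeness enters only through probabilities of sets, uniformly over all pairs of random paths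
  sharing their cells, because the Monge coupling changes with the mesh. The uniform law of the cube
  is what lets the cell masses be reproduced exactly rather than approximately. The repaired
  bijection is in general not adapted. This does no harm, because bicausality and the Monge property
  are both properties of the coupling, which ignores null sets: one measure is at once the graph law
  of an adapted map and of a bijection. On the closedness side the difficulty is that conditional
  kernels are fixed only almost surely, while causality asks for a single kernel that is measurable
  with respect to every past simultaneously.\<close>

definition bitM :: "(nat \<Rightarrow> bool) measure" where
  "bitM = PiM UNIV (\<lambda>_. count_space UNIV)"

text \<open>Base 4 with digits 0 and 1 only: a tail is at most 1/3 of the unit of its position, so
  no two digit sequences collide and the floor of a shifted value reads off digits exactly.
  \<open>dec\<close> is total on the reals, as a decoder must be.\<close>

definition enc :: "(nat \<Rightarrow> bool) \<Rightarrow> real" where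
  "enc b = (\<Sum>n. of_bool (b n) * (1/4) ^ Suc n)"

definition dec :: "real \<Rightarrow> nat \<Rightarrow> bool" where
  "dec y n = odd \<lfloor>4 ^ Suc n * y\<rfloor>"

lemma space_bitM [simp]: "space bitM = UNIV"
  by (simp add: bitM_def space_PiM)

lemma measurable_bitM_component [measurable]: "(\<lambda>b. b n) \<in> bitM \<rightarrow>\<^sub>M count_space UNIV"
  unfolding bitM_def by simp

lemma measurable_bitMI:
  assumes "\<And>n. (\<lambda>x. f x n) \<in> M \<rightarrow>\<^sub>M count_space UNIV"
  shows "f \<in> M \<rightarrow>\<^sub>M bitM"
  unfolding bitM_def by (rule measurable_PiM_single') (auto intro: assms)

lemma summable_enc: "summable (\<lambda>n. of_bool (b n) * (1/4::real) ^ Suc n)"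
  by (rule summable_comparison_test'[where g = "\<lambda>n. (1/4) ^ Suc n" and N = 0])
     (auto intro!: summable_mult summable_geometric)

lemma enc_bounds: "0 \<le> enc b" "enc b \<le> 1/3"
proof -
  show "0 \<le> enc b" unfolding enc_def by (intro suminf_nonneg summable_enc) auto
  have s: "(\<lambda>n. (1/4::real) ^ Suc n) sums (1/3)"
    using sums_mult[OF geometric_sums[of "1/4::real"], of "1/4"] by simp
  have "enc b \<le> (\<Sum>n. (1/4::real) ^ Suc n)"
    unfolding enc_def by (intro suminf_le summable_enc sums_summable[OF s]) auto
  then show "enc b \<le> 1/3" using s by (simp add: sums_iff)
qed

text \<open>Multiplication by 4^(n+1) splits the code into an integer \<open>Z\<close> built from
  the digits up to n and a tail in [0, 1/3]. All digits before the n-th enter \<open>Z\<close> with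
  a factor divisible by 4, so its parity is the n-th digit.\<close>

lemma dec_enc [simp]: "dec (enc b) = b"
proof
  fix n
  define Z :: int where "Z = (\<Sum>i\<le>n. of_bool (b i) * 4 ^ (n - i))"
  have "enc b = (\<Sum>i. of_bool (b (i + Suc n)) * (1/4) ^ Suc (i + Suc n)) + (\<Sum>i<Suc n. of_bool (b i) * (1/4::real) ^ Suc i)"
    unfolding enc_def by (rule suminf_split_initial_segment[OF summable_enc])
  also have "(\<Sum>i. of_bool (b (i + Suc n)) * (1/4::real) ^ Suc (i + Suc n)) = (1/4) ^ Suc n * enc (\<lambda>i. b (i + Suc n))"
    unfolding enc_def by (subst suminf_mult[OF summable_enc, symmetric]) (auto simp: power_add field_simps)
  finally have "4 ^ Suc n * enc b = enc (\<lambda>i. b (i + Suc n)) + 4 ^ Suc n * (\<Sum>i<Suc n. of_bool (b i) * (1/4::real) ^ Suc i)"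
    by (simp add: field_simps)
  also have "4 ^ Suc n * (\<Sum>i<Suc n. of_bool (b i) * (1/4::real) ^ Suc i) = (\<Sum>i<Suc n. of_bool (b i) * 4 ^ (n - i))"
    unfolding sum_distrib_left
  proof (rule sum.cong)
    fix i assume "i \<in> {..<Suc n}"
    then have "(4::real) ^ Suc n = 4 ^ (n - i) * 4 ^ Suc i"
      by (simp add: power_add[symmetric])
    then show "4 ^ Suc n * (of_bool (b i) * (1/4::real) ^ Suc i) = of_bool (b i) * 4 ^ (n - i)"
      by (simp add: power_one_over field_simps)
  qed simp
  also have "\<dots> = of_int Z" by (simp add: Z_def lessThan_Suc_atMost)
  finally have "4 ^ Suc n * enc b = enc (\<lambda>i. b (i + Suc n)) + of_int Z" .
  then have fl: "\<lfloor>4 ^ Suc n * enc b\<rfloor> = Z"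
    using enc_bounds[of "\<lambda>i. b (i + Suc n)"] by (intro floor_unique) auto
  have "Z = (\<Sum>i<n. of_bool (b i) * 4 ^ (n - i)) + of_bool (b n)"
    by (simp add: Z_def lessThan_Suc_atMost[symmetric])
  moreover have "even (\<Sum>i<n. of_bool (b i) * (4::int) ^ (n - i))"
    by (rule dvd_sum) auto
  ultimately have "odd Z = b n" by simp
  then show "dec (enc b) n = b n" unfolding dec_def fl .
qed

lemma measurable_enc [measurable]: "enc \<in> borel_measurable bitM"
  unfolding enc_def by measurable

lemma measurable_dec [measurable]: "dec \<in> borel \<rightarrow>\<^sub>M bitM"
proof (rule measurable_bitMI)
  fix n show "(\<lambda>x. dec x n) \<in> borel \<rightarrow>\<^sub>M count_space UNIV"
    unfolding dec_def by measurable
qed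

text \<open>Nonempty standard Borel spaces, described as measurable retracts of the Cantor space.
  The decoder \<open>r\<close> is defined on every code, so the image of the encoding is the Borel
  set where \<open>e (r b) = b\<close>; totality of \<open>r\<close> also forces the space to be
  nonempty.\<close>

definition standard :: "'a measure \<Rightarrow> bool" where
  "standard M \<longleftrightarrow> (\<exists>e r. e \<in> M \<rightarrow>\<^sub>M bitM \<and> r \<in> bitM \<rightarrow>\<^sub>M M \<and> (\<forall>x\<in>space M. r (e x) = x))"

lemma standardE:
  assumes "standard M"
  obtains e r where "e \<in> M \<rightarrow>\<^sub>M bitM" "r \<in> bitM \<rightarrow>\<^sub>M M" "\<And>x. x \<in> space M \<Longrightarrow> r (e x) = x"
  using assms unfolding standard_def by blast

lemma standard_realE:
  assumes "standard M"
  obtains e r where "e \<in> borel_measurable M" "r \<in> borel \<rightarrow>\<^sub>M M" "\<And>x. x \<in> space M \<Longrightarrow> r (e x) = x"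
    "\<And>x. 0 \<le> e x" "\<And>x. e x < (1::real)"
proof -
  obtain e r where [measurable]: "e \<in> M \<rightarrow>\<^sub>M bitM" "r \<in> bitM \<rightarrow>\<^sub>M M" and er: "\<And>x. x \<in> space M \<Longrightarrow> r (e x) = x"
    using standardE[OF assms] by blast
  show ?thesis
  proof (rule that[of "\<lambda>x. enc (e x)" "\<lambda>y. r (dec y)"])
    show "enc (e x) < 1" for x using enc_bounds(2)[of "e x"] by linarith
  qed (auto simp: er enc_bounds)
qed

lemma standard_sets_eq: "sets M = sets M' \<Longrightarrow> standard M \<Longrightarrow> standard M'"
  unfolding standard_def using measurable_cong_sets[of M M' bitM bitM] measurable_cong_sets[of bitM bitM M M']
    sets_eq_imp_space_eq[of M M'] by simp

text \<open>\<open>e\<close> is injective on the space because \<open>r\<close> undoes it, so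
  equality of two measurable maps becomes equality of two real functions. The diagonal of an
  arbitrary measurable space need not be measurable.\<close>

lemma measurable_eq_standard:
  assumes "standard M" and [measurable]: "f \<in> N \<rightarrow>\<^sub>M M" "g \<in> N \<rightarrow>\<^sub>M M"
  shows "{x\<in>space N. f x = g x} \<in> sets N"
proof -
  obtain e r where [measurable]: "e \<in> borel_measurable M" "r \<in> borel \<rightarrow>\<^sub>M M"
    and er: "\<And>x. x \<in> space M \<Longrightarrow> r (e x) = x"
    and "\<And>x. 0 \<le> e x" "\<And>x. e x < (1::real)"
    by (rule standard_realE[OF assms(1)]) (rule that)
  have "{x\<in>space N. f x = g x} = {x\<in>space N. e (f x) = (e (g x)::real)}"
    using er measurable_space[OF assms(2)] measurable_space[OF assms(3)] by (auto, metis)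
  also have "\<dots> \<in> sets N" by measurable
  finally show ?thesis .
qed

text \<open>The codes of the n coordinates are interleaved into a single bit sequence by the pairing
  function on the naturals; decoding reads each coordinate back from its own subsequence.\<close>

lemma standard_PiM_finite:
  assumes st: "\<And>i. i < n \<Longrightarrow> standard (M i)"
  shows "standard (PiM {..<n::nat} M)"
proof -
  have "\<forall>i\<in>{..<n}. \<exists>er. fst er \<in> M i \<rightarrow>\<^sub>M bitM \<and> snd er \<in> bitM \<rightarrow>\<^sub>M M i \<and> (\<forall>x\<in>space (M i). snd er (fst er x) = x)"
    using st unfolding standard_def by force
  then obtain er where er: "\<And>i. i < n \<Longrightarrow> fst (er i) \<in> M i \<rightarrow>\<^sub>M bitM \<and> snd (er i) \<in> bitM \<rightarrow>\<^sub>M M i \<and> (\<forall>x\<in>space (M i). snd (er i) (fst (er i) x) = x)"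
    unfolding bchoice_iff by auto
  define e where "e x = (\<lambda>k. case prod_decode k of (i, j) \<Rightarrow> if i < n then fst (er i) (x i) j else False)" for x :: "nat \<Rightarrow> 'a"
  define r where "r b = (\<lambda>i\<in>{..<n}. snd (er i) (\<lambda>j. b (prod_encode (i, j))))" for b :: "nat \<Rightarrow> bool"
  have "e \<in> PiM {..<n} M \<rightarrow>\<^sub>M bitM"
  proof (rule measurable_bitMI)
    fix k obtain i j where k: "prod_decode k = (i, j)" by force
    show "(\<lambda>x. e x k) \<in> PiM {..<n} M \<rightarrow>\<^sub>M count_space UNIV"
    proof (cases "i < n")
      case True
      then have [measurable]: "fst (er i) \<in> M i \<rightarrow>\<^sub>M bitM" and i: "i \<in> {..<n}" using er by auto
      note measurable_component_singleton[OF i, of M, measurable]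
      have "(\<lambda>x. fst (er i) (x i) j) \<in> PiM {..<n} M \<rightarrow>\<^sub>M count_space UNIV"
        by measurable
      then show ?thesis using True by (simp add: e_def k)
    qed (simp add: e_def k)
  qed
  moreover have "r \<in> bitM \<rightarrow>\<^sub>M PiM {..<n} M"
    unfolding r_def
  proof (rule measurable_restrict)
    fix i assume "i \<in> {..<n}"
    then have [measurable]: "snd (er i) \<in> bitM \<rightarrow>\<^sub>M M i" using er by auto
    have [measurable]: "(\<lambda>b j. b (prod_encode (i, j))) \<in> bitM \<rightarrow>\<^sub>M bitM"
      by (rule measurable_bitMI) measurable
    show "(\<lambda>b. snd (er i) (\<lambda>j. b (prod_encode (i, j)))) \<in> bitM \<rightarrow>\<^sub>M M i" by measurable
  qed
  moreover have "r (e x) = x" if "x \<in> space (PiM {..<n} M)" for x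
  proof
    fix i show "r (e x) i = x i"
      using that er[of i] by (cases "i < n") (auto simp: r_def e_def space_PiM PiE_iff extensional_def)
  qed
  ultimately show ?thesis unfolding standard_def by blast
qed

section \<open>Polish spaces are standard\<close>

lemma space_borel_of [simp]: "space (borel_of T) = topspace T"
  unfolding borel_of_def by (simp add: space_measure_of_conv)

lemma borel_of_open [intro]: "openin T U \<Longrightarrow> U \<in> sets (borel_of T)"
  unfolding borel_of_def by (subst sets_measure_of) (auto dest: openin_subset)

lemma Polish_spaceE:
  assumes "Polish_space T" "topspace T \<noteq> {}"
  obtains d a where "Metric_space (topspace T) d" "Metric_space.mcomplete (topspace T) d"
    "Metric_space.mtopology (topspace T) d = T" "range a \<subseteq> topspace T"
    "\<And>x \<epsilon>. x \<in> topspace T \<Longrightarrow> \<epsilon> > 0 \<Longrightarrow> \<exists>n::nat. d x (a n) < \<epsilon>"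
proof -
  obtain M d where M: "Metric_space M d" "Metric_space.mcomplete M d" "T = Metric_space.mtopology M d"
    using assms unfolding Polish_space_def completely_metrizable_space_def by blast
  interpret Metric_space M d by fact
  have tM: "topspace T = M" using M(3) by simp
  obtain C where C: "countable C" "C \<subseteq> topspace T" "T closure_of C = topspace T"
    using assms unfolding Polish_space_def separable_space_def by blast
  have "C \<noteq> {}" using C(3) assms(2) closure_of_empty[of T] by metis
  then have ra: "range (from_nat_into C) = C" using C(1) by (simp add: range_from_nat_into)
  show ?thesis
  proof (rule that[of d "from_nat_into C"])
    fix x and \<epsilon> :: real assume "x \<in> topspace T" "\<epsilon> > 0"
    then have "x \<in> mtopology closure_of C" using C M by simp
    then obtain y where "y \<in> C" "y \<in> mball x \<epsilon>"
      using \<open>\<epsilon> > 0\<close> unfolding metric_closure_of by auto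
    then have "y \<in> C" "d x y < \<epsilon>" by auto
    then show "\<exists>n. d x (from_nat_into C n) < \<epsilon>" using ra by (metis imageE)
  qed (use M C ra tM in auto)
qed

text \<open>Every open set is the union of the countably many balls with dense centre and rational
  radius that it contains, so the index set \<open>I\<close> is countable and preimages of balls are
  enough.\<close>

lemma (in Metric_space) measurable_borel_of_mballs:
  fixes a :: "nat \<Rightarrow> 'a"
  assumes a: "range a \<subseteq> M" and dense: "\<And>x \<epsilon>. x \<in> M \<Longrightarrow> \<epsilon> > 0 \<Longrightarrow> \<exists>n. d x (a n) < \<epsilon>"
    and fsp: "f \<in> space N \<rightarrow> M"
    and f: "\<And>m q. {x\<in>space N. d (f x) (a m) < q} \<in> sets N"
  shows "f \<in> N \<rightarrow>\<^sub>M borel_of mtopology"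
  unfolding borel_of_def
proof (rule measurable_measure_of)
  show "{U. openin mtopology U} \<subseteq> Pow (topspace mtopology)" by (auto simp: openin_mtopology)
  show "f \<in> space N \<rightarrow> topspace mtopology" using fsp by simp
  fix U assume "U \<in> {U. openin mtopology U}"
  then have U: "openin mtopology U" by simp
  define I where "I = {(m, q). q \<in> \<rat> \<and> mball (a m) q \<subseteq> U}"
  have "I \<subseteq> UNIV \<times> \<rat>" by (auto simp: I_def)
  then have "countable I" by (rule countable_subset) (auto simp: countable_rat)
  have "f -` U \<inter> space N = (\<Union>(m, q)\<in>I. {x\<in>space N. d (f x) (a m) < q})"
  proof (intro equalityI subsetI)
    fix x assume x: "x \<in> f -` U \<inter> space N"
    then obtain r where r: "r > 0" "mball (f x) r \<subseteq> U" using U by (auto simp: openin_mtopology)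
    have fx: "f x \<in> M" using x fsp by auto
    \<comment> \<open>A centre within r/3 and a rational radius between r/3 and r/2: the ball
      catches \<open>f x\<close>, and r/3 + r/2 < r keeps it inside the ball of radius r.\<close>
    obtain m where m: "d (f x) (a m) < r/3" using dense[OF fx, of "r/3"] r by auto
    have am: "a m \<in> M" using a by auto
    obtain q where q: "q \<in> \<rat>" "r/3 < q" "q < r/2"
      using Rats_dense_in_real[of "r/3" "r/2"] r by auto
    have "mball (a m) q \<subseteq> mball (f x) r"
    proof
      fix z assume z: "z \<in> mball (a m) q"
      then have "d (f x) z \<le> d (f x) (a m) + d (a m) z" using fx am by (intro triangle) auto
      then show "z \<in> mball (f x) r" using m q z fx r by auto
    qed
    then have "(m, q) \<in> I" using q r by (auto simp: I_def)
    moreover have "d (f x) (a m) < q" using m q by auto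
    ultimately show "x \<in> (\<Union>(m, q)\<in>I. {x\<in>space N. d (f x) (a m) < q})" using x by blast
  next
    fix x assume "x \<in> (\<Union>(m, q)\<in>I. {x\<in>space N. d (f x) (a m) < q})"
    then obtain m q where mq: "(m, q) \<in> I" "x \<in> space N" "d (f x) (a m) < q" by auto
    moreover have "f x \<in> M" "a m \<in> M" using mq fsp a by auto
    ultimately show "x \<in> f -` U \<inter> space N" unfolding I_def by (auto simp: commute subset_iff)
  qed
  also have "\<dots> \<in> sets N" using \<open>countable I\<close> f by (intro sets.countable_UN') auto
  finally show "f -` U \<inter> space N \<in> sets N" .
qed

text \<open>A point is encoded by the indices of the first dense point at distance less than
  \<open>2\<^sup>-\<^sup>k\<close>; completeness makes the decoding, a limit of dense points, globally measurable,
  so no measurability of images is needed.\<close>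

lemma standard_Polish:
  assumes "Polish_space T" "topspace T \<noteq> {}"
  shows "standard (borel_of T)"
proof -
  obtain d a where MS: "Metric_space (topspace T) d" and mc: "Metric_space.mcomplete (topspace T) d"
    and mt: "Metric_space.mtopology (topspace T) d = T" and a: "range a \<subseteq> topspace T"
    and dense: "\<And>x \<epsilon>. x \<in> topspace T \<Longrightarrow> \<epsilon> > 0 \<Longrightarrow> \<exists>n::nat. d x (a n) < \<epsilon>"
    using Polish_spaceE[OF assms] by blast
  interpret Metric_space "topspace T" d by fact
  have aM: "a n \<in> topspace T" for n using a by auto
  define e where "e x k = (case prod_decode k of (k, n) \<Rightarrow> d x (a n) < (1/2) ^ k)" for x k
  define s where "s b k = a (LEAST n. b (prod_encode (k, n)))" for b k
  define L where "L b x = limitin T (s b) x sequentially" for b x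
  \<comment> \<open>Codes that give no Cauchy sequence are decoded to \<open>a 0\<close>, so that
    \<open>r\<close> is total.\<close>
  define r where "r b = (if MCauchy (s b) then (SOME x. L b x) else a 0)" for b
  have rL: "L b (r b)" if "MCauchy (s b)" for b
  proof -
    have "\<exists>x. L b x" using mc that unfolding mcomplete_def L_def mt by blast
    then show ?thesis unfolding r_def using that someI_ex by simp
  qed
  have sM: "s b k \<in> topspace T" for b k by (simp add: s_def aM)
  have rM: "r b \<in> topspace T" for b
  proof (cases "MCauchy (s b)")
    case True then show ?thesis using rL limitin_topspace unfolding L_def by metis
  qed (simp add: r_def aM)
  have s_meas [measurable]: "(\<lambda>b. d (s b k) z) \<in> borel_measurable bitM" for k z
  proof -
    have "(\<lambda>b. LEAST n. b (prod_encode (k, n))) \<in> bitM \<rightarrow>\<^sub>M count_space UNIV" by measurable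
    then show ?thesis unfolding s_def by measurable
  qed
  have s_meas2 [measurable]: "(\<lambda>b. d (s b k) (s b l)) \<in> borel_measurable bitM" for k l
  proof -
    have [measurable]: "(\<lambda>b. LEAST n. b (prod_encode (k, n))) \<in> bitM \<rightarrow>\<^sub>M count_space UNIV" for k by measurable
    have "(\<lambda>b. d (a (LEAST n. b (prod_encode (k, n)))) (a (LEAST n. b (prod_encode (l, n))))) \<in> borel_measurable bitM"
      by (rule measurable_compose_countable'[where I = UNIV and f = "\<lambda>i b. d (a i) (a (LEAST n. b (prod_encode (l, n))))"])
         measurable
    then show ?thesis by (simp add: s_def)
  qed
  \<comment> \<open>Thresholds \<open>1 / Suc j\<close> turn the Cauchy property into countably many
    conditions on measurable functions, so the set of convergent codes is measurable.\<close>
  have Cau: "MCauchy (s b) \<longleftrightarrow> (\<forall>j::nat. \<exists>K. \<forall>k\<ge>K. \<forall>l\<ge>K. d (s b k) (s b l) < 1 / Suc j)" for b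
  proof
    assume C: "MCauchy (s b)"
    then show "\<forall>j::nat. \<exists>K. \<forall>k\<ge>K. \<forall>l\<ge>K. d (s b k) (s b l) < 1 / Suc j"
      unfolding MCauchy_def by (metis of_nat_0_less_iff zero_less_Suc zero_less_divide_1_iff)
  next
    assume *: "\<forall>j::nat. \<exists>K. \<forall>k\<ge>K. \<forall>l\<ge>K. d (s b k) (s b l) < 1 / Suc j"
    show "MCauchy (s b)" unfolding MCauchy_def
    proof (intro conjI allI impI)
      show "range (s b) \<subseteq> topspace T" using sM by auto
      fix \<epsilon> :: real assume "\<epsilon> > 0"
      then obtain j where "1 / Suc j < \<epsilon>" using nat_approx_posE by blast
      then show "\<exists>N. \<forall>n n'. N \<le> n \<longrightarrow> N \<le> n' \<longrightarrow> d (s b n) (s b n') < \<epsilon>"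
        using * by (meson less_trans)
    qed
  qed
  have MC: "{b \<in> space bitM. MCauchy (s b)} \<in> sets bitM"
  proof -
    have "{b \<in> space bitM. MCauchy (s b)} =
      (\<Inter>j. \<Union>K. \<Inter>k\<in>{K..}. \<Inter>l\<in>{K..}. {b \<in> space bitM. d (s b k) (s b l) < 1 / Suc j})"
      unfolding Cau by (rule set_eqI) (simp only: INT_iff UN_iff mem_Collect_eq space_bitM UNIV_I Ball_def Bex_def atLeast_iff simp_thms)
    also have "\<dots> \<in> sets bitM"
      using borel_measurable_less[OF s_meas2 borel_measurable_const]
      by (intro sets.countable_INT sets.countable_UN sets.countable_INT') auto
    finally show ?thesis .
  qed
  \<comment> \<open>The limit itself is not computed: its distances to fixed points are limits of
    measurable real functions, which is all that \<open>measurable_borel_of_mballs\<close> asks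
    for.\<close>
  have lim_d: "(\<lambda>k. d (s b k) z) \<longlonglongrightarrow> d (r b) z" if "MCauchy (s b)" "z \<in> topspace T" for b z
  proof -
    have *: "(\<lambda>k. d (s b k) (r b)) \<longlonglongrightarrow> 0"
      using rL[OF that(1)] limitin_metric_dist_null[of "s b" "r b" sequentially] unfolding L_def mt by auto
    have "\<bar>d (s b k) z - d (r b) z\<bar> \<le> d (s b k) (r b)" for k
      using triangle[OF sM[of b k] rM[of b] that(2)] triangle[OF rM[of b] sM[of b k] that(2)]
      by (auto simp: commute)
    then have "(\<lambda>k. d (s b k) z - d (r b) z) \<longlonglongrightarrow> 0"
      by (intro Lim_null_comparison[OF _ *]) auto
    then show ?thesis by (simp add: LIM_zero_iff)
  qed
  have "e \<in> borel_of T \<rightarrow>\<^sub>M bitM"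
  proof (rule measurable_bitMI)
    fix k :: nat obtain i n where k: "prod_decode k = (i, n)" by force
    have "{x \<in> topspace T. d x (a n) < (1/2)^i} = mball (a n) ((1/2)^i)" using aM by (auto simp: commute)
    moreover have "\<dots> \<in> sets (borel_of T)" using openin_mball[of "a n" "(1/2)^i"] mt by auto
    ultimately have "Measurable.pred (borel_of T) (\<lambda>x. d x (a n) < (1/2)^i)" unfolding pred_def by simp
    then show "(\<lambda>x. e x k) \<in> borel_of T \<rightarrow>\<^sub>M count_space UNIV"
      by (simp add: e_def k)
  qed
  moreover have "r \<in> bitM \<rightarrow>\<^sub>M borel_of mtopology"
  proof (rule measurable_borel_of_mballs[OF a dense])
    fix m q
    have lm: "(\<lambda>b. lim (\<lambda>k. d (s b k) (a m))) \<in> borel_measurable bitM"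
      by (rule borel_measurable_lim_metric[OF s_meas])
    have eq: "d (r b) (a m) = (if MCauchy (s b) then lim (\<lambda>k. d (s b k) (a m)) else d (a 0) (a m))" for b
      using lim_d[OF _ aM, THEN limI] by (auto simp: r_def)
    have "(\<lambda>b. d (r b) (a m)) \<in> borel_measurable bitM"
      unfolding eq by (rule measurable_If[OF lm borel_measurable_const MC])
    then show "{b \<in> space bitM. d (r b) (a m) < q} \<in> sets bitM"
      by (rule borel_measurable_less[OF _ borel_measurable_const])
  qed (use rM in auto)
  moreover have "r (e x) = x" if x: "x \<in> topspace T" for x
  proof -
    have close: "d (s (e x) k) x < (1/2)^k" for k
    proof -
      have "\<exists>n. e x (prod_encode (k, n))" using dense[OF x, of "(1/2)^k"] by (auto simp: e_def)
      then have "e x (prod_encode (k, LEAST n. e x (prod_encode (k, n))))" by (rule LeastI_ex)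
      then show ?thesis by (simp add: e_def s_def commute)
    qed
    have "(\<lambda>k. (1/2::real)^k) \<longlonglongrightarrow> 0" by (rule LIMSEQ_realpow_zero) auto
    then have "(\<lambda>k. d (s (e x) k) x) \<longlonglongrightarrow> 0"
      by (rule tendsto_sandwich[of "\<lambda>_. 0", rotated 2, OF tendsto_const]) (auto intro!: always_eventually less_imp_le[OF close])
    then have l: "limitin mtopology (s (e x)) x sequentially"
      unfolding limitin_metric_dist_null using x sM by auto
    then have C: "MCauchy (s (e x))" using convergent_imp_MCauchy[OF _ l] sM by auto
    then show ?thesis using limitin_metric_unique[OF l, of "r (e x)"] rL[OF C] unfolding L_def mt by auto
  qed
  ultimately show ?thesis unfolding standard_def mt by auto
qed

section \<open>Semidirect products and disintegration\<close>

definition sdp :: "'a measure \<Rightarrow> 'b measure \<Rightarrow> ('a \<Rightarrow> 'b measure) \<Rightarrow> ('a \<times> 'b) measure" where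
  "sdp M S k = bind M (\<lambda>x. distr (k x) (M \<Otimes>\<^sub>M S) (\<lambda>y. (x, y)))"

lemma prob_kernelD:
  assumes "k \<in> M \<rightarrow>\<^sub>M prob_algebra S" "x \<in> space M"
  shows "prob_space (k x)" "sets (k x) = sets S" "space (k x) = space S"
proof -
  show "prob_space (k x)" and S: "sets (k x) = sets S"
    using measurable_space[OF assms] by (auto simp: space_prob_algebra)
  show "space (k x) = space S" by (rule sets_eq_imp_space_eq[OF S])
qed

lemma measure_eqI_rectangles:
  assumes "finite_measure P" and P: "sets P = sets (M \<Otimes>\<^sub>M S)" and Q: "sets Q = sets (M \<Otimes>\<^sub>M S)"
    and eq: "\<And>A B. A \<in> sets M \<Longrightarrow> B \<in> sets S \<Longrightarrow> emeasure P (A \<times> B) = emeasure Q (A \<times> B)"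
  shows "P = Q"
proof (rule measure_eqI_generator_eq[OF Int_stable_pair_measure_generator[of M S] pair_measure_closed])
  interpret finite_measure P by fact
  show "sets P = sigma_sets (space M \<times> space S) {a \<times> b |a b. a \<in> sets M \<and> b \<in> sets S}"
    "sets Q = sigma_sets (space M \<times> space S) {a \<times> b |a b. a \<in> sets M \<and> b \<in> sets S}"
    using P Q by (simp_all add: sets_pair_measure)
  show "range (\<lambda>_. space M \<times> space S) \<subseteq> {a \<times> b |a b. a \<in> sets M \<and> b \<in> sets S}" by auto
  show "emeasure P ((\<lambda>_. space M \<times> space S) (i::nat)) \<noteq> \<infinity>" for i by simp
qed (use eq in auto)

context
  fixes M :: "'a measure" and S :: "'b measure" and k
  assumes M: "prob_space M" and k[measurable]: "k \<in> M \<rightarrow>\<^sub>M prob_algebra S"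
begin

interpretation M: prob_space M by (rule M)

lemma kernel_pair: "(\<lambda>x. distr (k x) (M \<Otimes>\<^sub>M S) (\<lambda>y. (x, y))) \<in> M \<rightarrow>\<^sub>M prob_algebra (M \<Otimes>\<^sub>M S)"
  by measurable

lemma M_in_prob_algebra: "M \<in> space (prob_algebra M)"
  by (simp add: space_prob_algebra M)

lemma sets_sdp [simp, measurable_cong]: "sets (sdp M S k) = sets (M \<Otimes>\<^sub>M S)"
  unfolding sdp_def by (rule sets_bind'[OF M_in_prob_algebra kernel_pair])

lemma space_sdp [simp]: "space (sdp M S k) = space M \<times> space S"
  using sets_eq_imp_space_eq[OF sets_sdp] by (simp add: space_pair_measure)

lemma prob_space_sdp: "prob_space (sdp M S k)"
  unfolding sdp_def by (rule prob_space_bind'[OF M_in_prob_algebra kernel_pair])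

lemma nn_integral_sdp:
  assumes f[measurable]: "f \<in> borel_measurable (M \<Otimes>\<^sub>M S)"
  shows "(\<integral>\<^sup>+z. f z \<partial>sdp M S k) = (\<integral>\<^sup>+x. \<integral>\<^sup>+y. f (x, y) \<partial>k x \<partial>M)"
proof -
  have "(\<integral>\<^sup>+z. f z \<partial>sdp M S k) = (\<integral>\<^sup>+x. \<integral>\<^sup>+z. f z \<partial>distr (k x) (M \<Otimes>\<^sub>M S) (\<lambda>y. (x, y)) \<partial>M)"
    unfolding sdp_def by (rule nn_integral_bind[OF f measurable_prob_algebraD[OF kernel_pair]])
  also have "\<dots> = (\<integral>\<^sup>+x. \<integral>\<^sup>+y. f (x, y) \<partial>k x \<partial>M)"
  proof (rule nn_integral_cong)
    fix x assume x: "x \<in> space M"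
    note [measurable_cong] = prob_kernelD(2)[OF k x]
    show "(\<integral>\<^sup>+z. f z \<partial>distr (k x) (M \<Otimes>\<^sub>M S) (\<lambda>y. (x, y))) = (\<integral>\<^sup>+y. f (x, y) \<partial>k x)"
      using x by (subst nn_integral_distr) auto
  qed
  finally show ?thesis .
qed

lemma AE_sdp:
  assumes P[measurable]: "Measurable.pred (M \<Otimes>\<^sub>M S) P"
  shows "(AE z in sdp M S k. P z) \<longleftrightarrow> (AE x in M. AE y in k x. P (x, y))"
proof -
  have "(AE z in sdp M S k. P z) \<longleftrightarrow> (AE x in M. AE z in distr (k x) (M \<Otimes>\<^sub>M S) (\<lambda>y. (x, y)). P z)"
    unfolding sdp_def by (rule AE_bind[OF measurable_prob_algebraD[OF kernel_pair] P])
  also have "\<dots> \<longleftrightarrow> (AE x in M. AE y in k x. P (x, y))"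
  proof (rule AE_cong)
    fix x assume x: "x \<in> space M"
    note [measurable_cong] = prob_kernelD(2)[OF k x]
    show "(AE z in distr (k x) (M \<Otimes>\<^sub>M S) (\<lambda>y. (x, y)). P z) \<longleftrightarrow> (AE y in k x. P (x, y))"
      using x by (subst AE_distr_iff) auto
  qed
  finally show ?thesis .
qed

lemma emeasure_sdp_times:
  assumes [measurable]: "A \<in> sets M" "B \<in> sets S"
  shows "emeasure (sdp M S k) (A \<times> B) = (\<integral>\<^sup>+x. emeasure (k x) B * indicator A x \<partial>M)"
proof -
  have "emeasure (sdp M S k) (A \<times> B) = (\<integral>\<^sup>+z. indicator (A \<times> B) z \<partial>sdp M S k)" by simp
  also have "\<dots> = (\<integral>\<^sup>+x. \<integral>\<^sup>+y. indicator (A \<times> B) (x, y) \<partial>k x \<partial>M)"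
    by (rule nn_integral_sdp) measurable
  also have "\<dots> = (\<integral>\<^sup>+x. emeasure (k x) B * indicator A x \<partial>M)"
  proof (rule nn_integral_cong)
    fix x assume x: "x \<in> space M"
    note [measurable_cong, simp] = prob_kernelD(2)[OF k x]
    have "(\<integral>\<^sup>+y. indicator (A \<times> B) (x, y) \<partial>k x) = (\<integral>\<^sup>+y. indicator A x * indicator B y \<partial>k x)"
      by (simp add: indicator_times)
    then show "(\<integral>\<^sup>+y. indicator (A \<times> B) (x, y) \<partial>k x) = emeasure (k x) B * indicator A x"
      by (simp add: nn_integral_cmult mult.commute)
  qed
  finally show ?thesis .
qed

lemma distr_fst_sdp: "distr (sdp M S k) M fst = M"
proof (rule measure_eqI)
  fix A assume "A \<in> sets (distr (sdp M S k) M fst)"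
  then have A[measurable]: "A \<in> sets M" by simp
  have "emeasure (distr (sdp M S k) M fst) A = emeasure (sdp M S k) (A \<times> space S)"
    using sets.sets_into_space[OF A] by (subst emeasure_distr) (auto intro!: arg_cong2[where f = emeasure])
  also have "\<dots> = (\<integral>\<^sup>+x. emeasure (k x) (space S) * indicator A x \<partial>M)"
    by (rule emeasure_sdp_times) auto
  also have "\<dots> = (\<integral>\<^sup>+x. indicator A x \<partial>M)"
  proof (rule nn_integral_cong)
    fix x assume x: "x \<in> space M"
    have "emeasure (k x) (space S) = 1"
      using prob_space.emeasure_space_1[OF prob_kernelD(1)[OF k x]] prob_kernelD(3)[OF k x] by simp
    then show "emeasure (k x) (space S) * indicator A x = indicator A x" by simp
  qed
  finally show "emeasure (distr (sdp M S k) M fst) A = emeasure M A" by simp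
qed simp

end

lemma sdp_eqI:
  assumes M: "prob_space M" and k: "k \<in> M \<rightarrow>\<^sub>M prob_algebra S" and P: "sets P = sets (M \<Otimes>\<^sub>M S)"
    and eq: "\<And>A B. A \<in> sets M \<Longrightarrow> B \<in> sets S \<Longrightarrow> emeasure P (A \<times> B) = (\<integral>\<^sup>+x. emeasure (k x) B * indicator A x \<partial>M)"
  shows "P = sdp M S k"
proof (rule measure_eqI_rectangles[symmetric])
  interpret prob_space "sdp M S k" by (rule prob_space_sdp[OF M k])
  show "finite_measure (sdp M S k)" by unfold_locales
qed (use P eq emeasure_sdp_times[OF M k] sets_sdp[OF M k] in auto)

section \<open>The uniform law and generalised inverses of distribution functions\<close>

definition unif :: "real measure" where "unif = uniform_measure lborel {0<..<1}"

lemma sets_unif [simp, measurable_cong]: "sets unif = sets borel" and space_unif [simp]: "space unif = UNIV"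
  by (simp_all add: unif_def)

lemma prob_space_unif: "prob_space unif"
  unfolding unif_def by (rule prob_space_uniform_measure) auto

lemma emeasure_unif: "A \<in> sets borel \<Longrightarrow> emeasure unif A = emeasure lborel (A \<inter> {0<..<1})"
  unfolding unif_def by (subst emeasure_uniform_measure) (auto simp: Int_commute divide_ennreal_def)

lemma AE_unif: "AE u in unif. 0 < u \<and> u < 1"
  unfolding unif_def by (rule AE_uniform_measureI) auto

lemma emeasure_unif_atMost: "0 \<le> c \<Longrightarrow> c \<le> 1 \<Longrightarrow> emeasure unif {..c} = ennreal c"
proof -
  assume c: "0 \<le> c" "c \<le> 1"
  have "emeasure unif {..c} = emeasure lborel ({..c} \<inter> {0<..<1})" by (rule emeasure_unif) simp
  also have "\<dots> = emeasure lborel {0<..<c}"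
  proof (rule emeasure_eq_AE)
    show "AE x in lborel. (x \<in> {..c} \<inter> {0<..<1}) = (x \<in> {0<..<c})"
      using AE_lborel_singleton[of c] by eventually_elim (use c in auto)
  qed auto
  also have "\<dots> = ennreal c" using c by simp
  finally show ?thesis .
qed

text \<open>The quantile theorem \<open>distr_I_eq_M\<close> speaks of the restricted Lebesgue
  measure; this passes to \<open>unif\<close>, which lives on all reals.\<close>

lemma distr_unif_eq: "distr (restrict_space lborel {0<..<1::real}) borel f = distr unif borel f"
  if f[measurable]: "f \<in> borel_measurable borel" for f :: "real \<Rightarrow> real"
proof (rule measure_eqI)
  fix A assume "A \<in> sets (distr (restrict_space lborel {0<..<1::real}) borel f)"
  then have [measurable]: "A \<in> sets borel" by simp
  have "f \<in> measurable (restrict_space lborel {0<..<1}) borel" by (rule measurable_restrict_space1) simp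
  then show "emeasure (distr (restrict_space lborel {0<..<1::real}) borel f) A = emeasure (distr unif borel f) A"
    by (simp add: emeasure_distr emeasure_unif emeasure_restrict_space space_restrict_space Int_commute
        measurable_sets_borel[OF f])
qed simp

text \<open>At the infimum the distribution function is at least u, to the left of it below u.
  Absence of atoms makes it continuous, and letting the argument increase to the infimum yields
  equality.\<close>

lemma cdf_right_inverse:
  assumes P: "cdf_distribution P" and at: "\<And>a. measure P {a} = 0" and u: "0 < u" "u < 1"
  shows "cdf P (Inf {x. u \<le> cdf P x}) = u"
proof -
  interpret cdf_distribution P by fact
  let ?i = "Inf {x. u \<le> cdf P x}"
  have ge: "u \<le> cdf P ?i" using pseudoinverse[OF u] by blast
  have lt: "cdf P x < u" if "x < ?i" for x using pseudoinverse[OF u, of x] that by force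
  have "isCont (cdf P) ?i" using isCont_cdf at by blast
  then have "(cdf P \<longlongrightarrow> cdf P ?i) (at_left ?i)"
    by (metis continuous_at_imp_continuous_within continuous_within isCont_def filterlim_at_split)
  then have "cdf P ?i \<le> u"
    by (rule tendsto_upperbound) (auto simp: eventually_at_filter intro!: always_eventually less_imp_le lt)
  with ge show ?thesis by simp
qed

text \<open>Dyadic numbers increasing strictly from below to \<open>s\<close>.\<close>

definition dya :: "real \<Rightarrow> nat \<Rightarrow> real" where
  "dya s n = (of_int \<lceil>2 ^ n * s\<rceil> - 1) / 2 ^ n"

lemma dya_less: "dya s n < s"
proof -
  have "of_int \<lceil>2 ^ n * s\<rceil> - 1 < 2 ^ n * s" by linarith
  then show ?thesis unfolding dya_def by (simp add: field_simps)
qed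

lemma dya_nonneg: "0 < s \<Longrightarrow> 0 \<le> dya s n"
proof -
  assume "0 < s"
  then have "0 < \<lceil>2 ^ n * s\<rceil>" by simp
  then have "(1::real) \<le> of_int \<lceil>2 ^ n * s\<rceil>" by linarith
  then show ?thesis unfolding dya_def by simp
qed

lemma dya_Rats: "dya s n \<in> \<rat>"
  unfolding dya_def by (intro Rats_divide Rats_diff Rats_of_int Rats_1 Rats_power) simp

lemma dya_ge: "s - (1/2) ^ n \<le> dya s n"
proof -
  have "2 ^ n * s \<le> of_int \<lceil>2 ^ n * s\<rceil>" by simp
  then show ?thesis unfolding dya_def by (simp add: field_simps power_one_over)
qed

lemma incseq_dya: "incseq (dya s)"
proof (rule incseq_SucI)
  fix n
  have "of_int \<lceil>2 ^ n * s\<rceil> - 1 < 2 ^ n * s" by linarith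
  then have "(2 * (\<lceil>2 ^ n * s\<rceil> - 1)::int) < 2 ^ Suc n * s" by simp
  then have "2 * (\<lceil>2 ^ n * s\<rceil> - 1) \<le> \<lceil>2 ^ Suc n * s\<rceil> - 1" by linarith
  then have "real_of_int (2 * (\<lceil>2 ^ n * s\<rceil> - 1)) \<le> real_of_int (\<lceil>2 ^ Suc n * s\<rceil> - 1)"
    by (simp only: of_int_le_iff)
  then have "2 * (of_int \<lceil>2 ^ n * s\<rceil> - 1) \<le> (of_int \<lceil>2 ^ Suc n * s\<rceil> - 1 :: real)"
    by (simp only: of_int_mult of_int_diff of_int_1 of_int_numeral)
  then have "2 * (of_int \<lceil>2 ^ n * s\<rceil> - 1) / 2 ^ Suc n \<le> (of_int \<lceil>2 ^ Suc n * s\<rceil> - 1 :: real) / 2 ^ Suc n"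
    by (rule divide_right_mono) simp
  moreover have "2 * (of_int \<lceil>2 ^ n * s\<rceil> - 1) / 2 ^ Suc n = dya s n" unfolding dya_def power_Suc by (rule mult_divide_mult_cancel_left) simp
  ultimately show "dya s n \<le> dya s (Suc n)" unfolding dya_def by simp
qed

lemma dya_exceeds: "q < s \<Longrightarrow> \<exists>n. q \<le> dya s n"
proof -
  assume "q < s"
  then obtain n where "(1/2) ^ n < s - q" using real_arch_pow_inv[of "s - q" "1/2"] by auto
  then show ?thesis using dya_ge[of s n] by (intro exI[of _ n]) linarith
qed

text \<open>Only rational points enter, so that the inverse stays measurable in a parameter of \<open>g\<close>.\<close>

definition qinv :: "(real \<Rightarrow> real) \<Rightarrow> real \<Rightarrow> real" where
  "qinv g u = Inf (insert 1 {q. q \<in> \<rat> \<and> 0 \<le> q \<and> q < 1 \<and> u \<le> g q})"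

text \<open>The strict inequality turns into an existence statement over rationals, hence into a
  countable union once \<open>g\<close> depends on a parameter. The inserted 1 keeps the set of
  candidates nonempty and is the value when no rational qualifies.\<close>

lemma qinv_less: "qinv g u < s \<longleftrightarrow> 1 < s \<or> (\<exists>q\<in>\<rat>. 0 \<le> q \<and> q < 1 \<and> q < s \<and> u \<le> g q)"
  unfolding qinv_def
  by (subst cInf_less_iff) (auto intro!: bdd_belowI[of _ 0])

lemma measurable_qinv:
  assumes g: "\<And>q. (\<lambda>x. g x q) \<in> borel_measurable M"
  shows "(\<lambda>(x, u). qinv (g x) u) \<in> borel_measurable (M \<Otimes>\<^sub>M borel)"
proof (rule borel_measurableI_less)
  fix s
  note [measurable] = g
  have "{z \<in> space (M \<Otimes>\<^sub>M borel). (case z of (x, u) \<Rightarrow> qinv (g x) u) < s} =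
    {z \<in> space (M \<Otimes>\<^sub>M borel). 1 < s} \<union>
    (\<Union>q\<in>{q\<in>\<rat>. 0 \<le> q \<and> q < 1 \<and> q < s}. {z \<in> space (M \<Otimes>\<^sub>M borel). snd z \<le> g (fst z) q})"
    by (auto simp: qinv_less)
  also have "\<dots> \<in> sets (M \<Otimes>\<^sub>M borel)"
    by (intro sets.Un sets.countable_UN') (auto intro: countable_subset[OF _ countable_rat])
  finally show "{z \<in> space (M \<Otimes>\<^sub>M borel). (case z of (x, u) \<Rightarrow> qinv (g x) u) < s} \<in> sets (M \<Otimes>\<^sub>M borel)" .
qed

text \<open>Only monotonicity on rationals is at hand, no right-continuity. The event that the
  inverse is strictly below s depends only on values of \<open>g\<close> to the left of s, which the
  dyadic numbers exhaust from below; this is why half-lines \<open>{..<s}\<close> are used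
  afterwards.\<close>

lemma emeasure_qinv_less:
  assumes g: "\<And>q. 0 \<le> g q" "\<And>q. g q \<le> 1" and s: "0 < s" "s \<le> 1"
    and mono: "\<And>q q'. q \<in> \<rat> \<Longrightarrow> q' \<in> \<rat> \<Longrightarrow> 0 \<le> q \<Longrightarrow> q \<le> q' \<Longrightarrow> q' < 1 \<Longrightarrow> g q \<le> g q'"
  shows "emeasure unif {u. qinv g u < s} = (SUP n. ennreal (g (dya s n)))"
proof -
  have "{u. qinv g u < s} = (\<Union>n. {..g (dya s n)})"
  proof (intro equalityI subsetI)
    fix u assume "u \<in> {u. qinv g u < s}"
    then obtain q where q: "q \<in> \<rat>" "0 \<le> q" "q < 1" "q < s" "u \<le> g q" using s by (auto simp: qinv_less)
    then obtain n where n: "q \<le> dya s n" using dya_exceeds by blast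
    have "g q \<le> g (dya s n)" using q n s dya_less[of s n] by (intro mono dya_Rats) auto
    then show "u \<in> (\<Union>n. {..g (dya s n)})" using q by (auto intro: order_trans)
  next
    fix u assume "u \<in> (\<Union>n. {..g (dya s n)})"
    then obtain n where "u \<le> g (dya s n)" by auto
    then show "u \<in> {u. qinv g u < s}"
      using dya_Rats[of s n] dya_less[of s n] dya_nonneg[of s n] s
      by (auto simp: qinv_less intro!: bexI[of _ "dya s n"])
  qed
  moreover have "incseq (\<lambda>n. {..g (dya s n)})"
    using incseq_dya[of s] dya_less[of s] dya_nonneg[of s] s
    by (auto simp: incseq_def le_less_trans intro!: mono dya_Rats less_le_trans[OF dya_less])
  then have "(SUP n. emeasure unif {..g (dya s n)}) = emeasure unif (\<Union>n. {..g (dya s n)})"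
    by (intro SUP_emeasure_incseq) auto
  ultimately show ?thesis using g by (simp add: emeasure_unif_atMost)
qed

section \<open>Existence of disintegrations\<close>

lemma measure_eqI_lessThan_real:
  fixes P Q :: "real measure"
  assumes "finite_measure P" "sets P = sets borel" "sets Q = sets borel"
    and "\<And>s. emeasure P {..<s} = emeasure Q {..<s}"
  shows "P = Q"
proof (rule measure_eqI_generator_eq[where E = "range lessThan" and \<Omega> = UNIV and A = "\<lambda>i::nat. {..<real i}"])
  interpret finite_measure P by fact
  show "Int_stable (range (lessThan :: real \<Rightarrow> _))"
    by (auto simp: Int_stable_def intro: image_eqI[of _ _ "min _ _"])
  show "sets P = sigma_sets UNIV (range lessThan)" "sets Q = sigma_sets UNIV (range lessThan)"
    unfolding assms(2,3) by (simp_all add: borel_Iio)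
  show "(\<Union>i. {..<real i}) = UNIV" using reals_Archimedean2 by auto
  show "emeasure P {..<real i} \<noteq> \<infinity>" for i by simp
qed (use assms in auto)

text \<open>The conditional distribution function at q is the Radon-Nikodym derivative of the part
  of P whose second coordinate is at most q. Monotonicity in q holds almost surely and on the
  rationals only. Defining the kernel as the image of \<open>unif\<close> under the generalised
  inverse yields a probability measure for every x, also where monotonicity fails, so no repair on a
  null set is called for.\<close>

lemma disintegration_real:
  fixes P :: "('a \<times> real) measure"
  assumes M: "prob_space M" and P: "sets P = sets (M \<Otimes>\<^sub>M borel)" "distr P M fst = M"
    and bd: "AE z in P. 0 \<le> snd z \<and> snd z < 1"
  shows "\<exists>k\<in>M \<rightarrow>\<^sub>M prob_algebra borel. P = sdp M borel k"
proof -
  note [measurable_cong] = P(1)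
  interpret M: prob_space M by fact
  have "prob_space (distr P M fst)" using M P(2) by simp
  then interpret P: prob_space P by (rule prob_space_distrD[rotated]) measurable
  have spP: "space P = space M \<times> UNIV" using sets_eq_imp_space_eq[OF P(1)] by (simp add: space_pair_measure)
  have fst_eq: "emeasure P (A \<times> UNIV) = emeasure M A" if [measurable]: "A \<in> sets M" for A
  proof -
    have "emeasure M A = emeasure (distr P M fst) A" using P(2) by simp
    also have "\<dots> = emeasure P (fst -` A \<inter> space P)" by (rule emeasure_distr) measurable
    also have "fst -` A \<inter> space P = A \<times> UNIV" using sets.sets_into_space[OF that] by (auto simp: spP)
    finally show ?thesis by simp
  qed
  \<comment> \<open>\<open>\<nu> B\<close> is the measure A \<mapsto> P(A \<times> B), written as
    the image of a density so that Radon-Nikodym applies to it.\<close>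
  define \<nu> where "\<nu> B = distr (density P (indicator (space M \<times> B))) M fst" for B
  have emeasure_\<nu>: "emeasure (\<nu> B) A = emeasure P (A \<times> B)" if [measurable]: "A \<in> sets M" "B \<in> sets borel" for A B
  proof -
    have "emeasure (\<nu> B) A = emeasure (density P (indicator (space M \<times> B))) (fst -` A \<inter> space P)"
      unfolding \<nu>_def by (subst emeasure_distr) auto
    also have "\<dots> = (\<integral>\<^sup>+z. indicator (space M \<times> B) z * indicator (fst -` A \<inter> space P) z \<partial>P)"
      by (rule emeasure_density) measurable
    also have "\<dots> = (\<integral>\<^sup>+z. indicator (A \<times> B) z \<partial>P)"
      using sets.sets_into_space[OF that(1)]
      by (intro nn_integral_cong) (auto simp: indicator_def spP)
    finally show ?thesis by simp
  qed
  define G where "G B = RN_deriv M (\<nu> B)" for B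
  have G_meas [measurable]: "G B \<in> borel_measurable M" for B unfolding G_def by measurable
  have sets_\<nu>: "sets (\<nu> B) = sets M" for B by (simp add: \<nu>_def)
  have dens: "density M (G B) = \<nu> B" if [measurable]: "B \<in> sets borel" for B
    unfolding G_def
  proof (rule M.density_RN_deriv[OF _ sets_\<nu>])
    show "absolutely_continuous M (\<nu> B)" unfolding absolutely_continuous_def
    proof
      fix A assume A: "A \<in> null_sets M"
      then have [measurable]: "A \<in> sets M" by auto
      have "emeasure P (A \<times> B) \<le> emeasure P (A \<times> UNIV)" by (intro emeasure_mono) auto
      then show "A \<in> null_sets (\<nu> B)" using A fst_eq[of A] emeasure_\<nu>[of A B] sets_\<nu> by (auto simp: null_sets_def)
    qed
  qed
  have G_int: "(\<integral>\<^sup>+x. G B x * indicator A x \<partial>M) = emeasure P (A \<times> B)"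
    if [measurable]: "A \<in> sets M" "B \<in> sets borel" for A B
    using emeasure_\<nu>[OF that] dens[OF that(2)] by (metis emeasure_density G_meas that(1))
  have uniq: "AE x in M. f x = G B x"
    if [measurable]: "f \<in> borel_measurable M" "B \<in> sets borel"
      and f: "\<And>A. A \<in> sets M \<Longrightarrow> (\<integral>\<^sup>+x. f x * indicator A x \<partial>M) = emeasure P (A \<times> B)" for f B
    unfolding G_def
  proof (rule M.RN_deriv_unique[OF that(1)])
    show "density M f = \<nu> B"
    proof (rule measure_eqI)
      fix A assume "A \<in> sets (density M f)"
      then have [measurable]: "A \<in> sets M" by simp
      show "emeasure (density M f) A = emeasure (\<nu> B) A"
        using f[of A] emeasure_\<nu>[of A B] by (simp add: emeasure_density)
    qed (simp add: sets_\<nu>)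
  qed
  have G_add: "AE x in M. G B x + G B' x = G (B \<union> B') x"
    if [measurable]: "B \<in> sets borel" "B' \<in> sets borel" and "B \<inter> B' = {}" for B B'
  proof (rule uniq)
    fix A assume [measurable]: "A \<in> sets M"
    have "(\<integral>\<^sup>+x. (G B x + G B' x) * indicator A x \<partial>M) = (\<integral>\<^sup>+x. G B x * indicator A x \<partial>M) + (\<integral>\<^sup>+x. G B' x * indicator A x \<partial>M)"
      by (simp add: distrib_right nn_integral_add)
    also have "\<dots> = emeasure P (A \<times> B) + emeasure P (A \<times> B')" by (simp add: G_int)
    also have "\<dots> = emeasure P ((A \<times> B) \<union> (A \<times> B'))"
      using that(3) by (intro plus_emeasure) auto
    finally show "(\<integral>\<^sup>+x. (G B x + G B' x) * indicator A x \<partial>M) = emeasure P (A \<times> (B \<union> B'))"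
      by (simp add: Sigma_Un_distrib2)
  qed measurable
  have G_mono: "AE x in M. G B x \<le> G B' x" if [measurable]: "B \<in> sets borel" "B' \<in> sets borel" and "B \<subseteq> B'" for B B'
  proof -
    have "AE x in M. G B x + G (B' - B) x = G (B \<union> (B' - B)) x" by (rule G_add) auto
    moreover have "B \<union> (B' - B) = B'" using that(3) by auto
    ultimately show ?thesis by (auto elim!: eventually_mono simp: le_iff_add intro: sym)
  qed
  have G_UNIV: "AE x in M. 1 = G UNIV x"
    by (rule uniq) (auto simp: fst_eq)
  \<comment> \<open>The derivative is determined up to null sets and may exceed 1 there; the
    truncation gives values in [0, 1] for every x, as \<open>emeasure_qinv_less\<close>
    requires.\<close>
  define g where "g x q = min 1 (enn2real (G {..q} x))" for x q
  have g_meas [measurable]: "(\<lambda>x. g x q) \<in> borel_measurable M" for q unfolding g_def by measurable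
  have g01: "0 \<le> g x q" "g x q \<le> 1" for x q by (auto simp: g_def)
  have gG: "AE x in M. ennreal (g x q) = G {..q} x" for q
  proof -
    have "AE x in M. G {..q} x \<le> G UNIV x" by (rule G_mono) auto
    then show ?thesis using G_UNIV
  proof eventually_elim
    fix x assume "G {..q} x \<le> G UNIV x" "1 = G UNIV x"
    then have le: "G {..q} x \<le> 1" by simp
    then have "enn2real (G {..q} x) \<le> 1" by (metis enn2real_1 enn2real_mono ennreal_one_less_top)
    moreover have "G {..q} x < top" using le by (rule le_less_trans) simp
    ultimately show "ennreal (g x q) = G {..q} x" by (simp add: g_def)
  qed
  qed
  have g_mono: "AE x in M. \<forall>q\<in>\<rat>. \<forall>q'\<in>\<rat>. q \<le> q' \<longrightarrow> g x q \<le> g x q'"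
  proof (intro AE_ball_countable'[OF _ countable_rat])
    fix q q' :: real
    show "AE x in M. q \<le> q' \<longrightarrow> g x q \<le> g x q'"
    proof (cases "q \<le> q'")
      case True
      then have "AE x in M. G {..q} x \<le> G {..q'} x" by (intro G_mono) auto
      then show ?thesis using gG[of q] gG[of q']
      proof eventually_elim
        case (elim x)
        then have "ennreal (g x q) \<le> ennreal (g x q')" by simp
        then show ?case using g01 by simp
      qed
    qed simp
  qed
  define k where "k x = distr unif borel (qinv (g x))" for x
  have qm [measurable]: "(\<lambda>(x, u). qinv (g x) u) \<in> borel_measurable (M \<Otimes>\<^sub>M borel)"
    by (rule measurable_qinv) measurable
  have k_meas [measurable]: "k \<in> M \<rightarrow>\<^sub>M prob_algebra borel"
    unfolding k_def
  proof (rule measurable_distr_prob_space2[where M = borel])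
    show "(\<lambda>x. unif) \<in> M \<rightarrow>\<^sub>M prob_algebra borel"
      by (rule measurable_const) (simp add: space_prob_algebra prob_space_unif)
  qed (rule qm)
  have k_less: "emeasure (k x) {..<s} = emeasure unif {u. qinv (g x) u < s}" if x: "x \<in> space M" for x s
  proof -
    have "qinv (g x) \<in> borel_measurable borel"
      using measurable_Pair2[OF qm x] by simp
    then have "qinv (g x) \<in> borel_measurable unif" by simp
    then show ?thesis unfolding k_def by (subst emeasure_distr) (auto intro!: arg_cong2[where f = emeasure])
  qed
  have key: "emeasure P (A \<times> {..<s}) = (\<integral>\<^sup>+x. emeasure (k x) {..<s} * indicator A x \<partial>M)"
    if A[measurable]: "A \<in> sets M" for A s
  proof -
    \<comment> \<open>Outside (0, 1] both sides are trivial, since P and the kernels give mass to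
      [0, 1] only.\<close>
    consider "s \<le> 0" | "1 < s" | "0 < s" "s \<le> 1" by linarith
    then show ?thesis
    proof cases
      case 1
      then have "emeasure (k x) {..<s} = 0" if "x \<in> space M" for x
      proof -
        have "{u. qinv (g x) u < s} = {}" using 1 by (auto simp: qinv_less)
        then show ?thesis using k_less[OF that, of s] by simp
      qed
      then have "(\<integral>\<^sup>+x. emeasure (k x) {..<s} * indicator A x \<partial>M) = (\<integral>\<^sup>+x. 0 \<partial>M)"
        by (intro nn_integral_cong) auto
      moreover have "emeasure P (A \<times> {..<s}) = emeasure P {}"
      proof (rule emeasure_eq_AE)
        show "AE z in P. (z \<in> A \<times> {..<s}) = (z \<in> {})" using bd by eventually_elim (use 1 in auto)
      qed auto
      ultimately show ?thesis by simp
    next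
      case 2
      have "emeasure (k x) {..<s} = 1" if "x \<in> space M" for x
      proof -
        have "{u. qinv (g x) u < s} = UNIV" using 2 by (auto simp: qinv_less)
        then show ?thesis using k_less[OF that, of s] prob_space.emeasure_space_1[OF prob_space_unif] by simp
      qed
      then have "(\<integral>\<^sup>+x. emeasure (k x) {..<s} * indicator A x \<partial>M) = (\<integral>\<^sup>+x. indicator A x \<partial>M)"
        by (intro nn_integral_cong) auto
      also have "\<dots> = emeasure P (A \<times> UNIV)" by (simp add: fst_eq)
      also have "\<dots> = emeasure P (A \<times> {..<s})"
      proof (rule emeasure_eq_AE)
        show "AE z in P. (z \<in> A \<times> UNIV) = (z \<in> A \<times> {..<s})" using bd by eventually_elim (use 2 in auto)
      qed auto
      finally show ?thesis by simp
    next
      case 3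
      have "(\<integral>\<^sup>+x. emeasure (k x) {..<s} * indicator A x \<partial>M) =
        (\<integral>\<^sup>+x. (SUP n. G {..dya s n} x * indicator A x) \<partial>M)"
      proof (rule nn_integral_cong_AE)
        have "AE x in M. \<forall>n. ennreal (g x (dya s n)) = G {..dya s n} x" using gG by (subst AE_all_countable) auto
        then show "AE x in M. emeasure (k x) {..<s} * indicator A x = (SUP n. G {..dya s n} x * indicator A x)"
          using g_mono AE_space
        proof eventually_elim
          case (elim x)
          have "emeasure (k x) {..<s} = (SUP n. ennreal (g x (dya s n)))"
            unfolding k_less[OF elim(3)] using elim 3 g01 by (intro emeasure_qinv_less) auto
          then show ?case using elim by (simp add: SUP_mult_right_ennreal)
        qed
      qed
      also have "\<dots> = (SUP n. \<integral>\<^sup>+x. G {..dya s n} x * indicator A x \<partial>M)"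
      proof (rule nn_integral_monotone_convergence_SUP_AE)
        fix n
        have "AE x in M. G {..dya s n} x \<le> G {..dya s (Suc n)} x"
          using incseq_dya[of s] by (intro G_mono) (auto simp: incseq_Suc_iff intro: order_trans)
        then show "AE x in M. G {..dya s n} x * indicator A x \<le> G {..dya s (Suc n)} x * indicator A x"
          by eventually_elim (auto intro: mult_right_mono)
      qed measurable
      also have "\<dots> = (SUP n. emeasure P (A \<times> {..dya s n}))" by (simp add: G_int)
      also have "\<dots> = emeasure P (\<Union>n. A \<times> {..dya s n})"
        using incseq_dya[of s] by (intro SUP_emeasure_incseq) (auto simp: incseq_def intro: order_trans)
      also have "(\<Union>n. A \<times> {..dya s n}) = A \<times> {..<s}"
        using dya_less[of s] dya_exceeds[of _ s] by (auto intro: le_less_trans)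
      finally show ?thesis by simp
    qed
  qed
  show ?thesis
  proof (intro bexI[OF _ k_meas] sdp_eqI[OF M k_meas P(1)])
    fix A B assume A[measurable]: "A \<in> sets M" and B: "B \<in> sets (borel::real measure)"
    interpret Q: prob_space "sdp M borel k" by (rule prob_space_sdp[OF M k_meas])
    note [measurable_cong] = sets_sdp[OF M k_meas]
    \<comment> \<open>With A fixed, both sides become finite measures on the line, and agreement on
      the half-lines \<open>{..<s}\<close> extends to all Borel sets B.\<close>
    define R where "R P = distr (density P (indicator (A \<times> UNIV))) borel snd" for P :: "('a \<times> real) measure"
    have R: "emeasure (R P') B = emeasure P' (A \<times> B)"
      if P'[measurable_cong]: "sets P' = sets (M \<Otimes>\<^sub>M borel)" and [measurable]: "B \<in> sets borel" for P' B
    proof -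
      have sp: "space P' = space M \<times> UNIV" using sets_eq_imp_space_eq[OF P'] by (simp add: space_pair_measure)
      have "emeasure (R P') B = emeasure (density P' (indicator (A \<times> UNIV))) (snd -` B \<inter> space P')"
        unfolding R_def by (subst emeasure_distr) auto
      also have "\<dots> = (\<integral>\<^sup>+z. indicator (A \<times> UNIV) z * indicator (snd -` B \<inter> space P') z \<partial>P')"
        by (rule emeasure_density) measurable
      also have "\<dots> = (\<integral>\<^sup>+z. indicator (A \<times> B) z \<partial>P')"
        by (intro nn_integral_cong) (auto simp: indicator_def sp)
      finally show ?thesis by simp
    qed
    have "R P = R (sdp M borel k)"
    proof (rule measure_eqI_lessThan_real)
      show "finite_measure (R P)"
      proof
        have "space (R P) = UNIV" by (simp add: R_def)
        then show "emeasure (R P) (space (R P)) \<noteq> \<infinity>" using R[OF P(1), of UNIV] by simp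
      qed
      fix s show "emeasure (R P) {..<s} = emeasure (R (sdp M borel k)) {..<s}"
        by (simp add: R P sets_sdp[OF M k_meas] key emeasure_sdp_times[OF M k_meas])
    qed (simp_all add: R_def)
    then have "emeasure P (A \<times> B) = emeasure (sdp M borel k) (A \<times> B)"
      using R[OF P(1) B] R[OF sets_sdp[OF M k_meas] B] by simp
    then show "emeasure P (A \<times> B) = (\<integral>\<^sup>+x. emeasure (k x) B * indicator A x \<partial>M)"
      using B by (simp add: emeasure_sdp_times[OF M k_meas])
  qed
qed

text \<open>The second coordinate is encoded in [0, 1), disintegrated there, and the kernels are
  pushed back by \<open>r\<close>. As \<open>r\<close> is total, the resulting kernel takes its
  values in S without any almost-sure clause.\<close>

theorem disintegration:
  assumes M: "prob_space M" and S: "standard S"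
    and P: "sets P = sets (M \<Otimes>\<^sub>M S)" "distr P M fst = M"
  shows "\<exists>k\<in>M \<rightarrow>\<^sub>M prob_algebra S. P = sdp M S k"
proof -
  obtain e r where e[measurable]: "e \<in> borel_measurable S" and r[measurable]: "r \<in> borel \<rightarrow>\<^sub>M S"
    and er: "\<And>x. x \<in> space S \<Longrightarrow> r (e x) = x" and e01: "\<And>x. 0 \<le> e x" "\<And>x. e x < (1::real)"
    by (rule standard_realE[OF S]) (rule that)
  note [measurable_cong] = P(1)
  define P' where "P' = distr P (M \<Otimes>\<^sub>M borel) (\<lambda>z. (fst z, e (snd z)))"
  have "\<exists>k\<in>M \<rightarrow>\<^sub>M prob_algebra borel. P' = sdp M borel k"
  proof (rule disintegration_real[OF M])
    show "distr P' M fst = M" using P(2) unfolding P'_def by (subst distr_distr) (auto simp: comp_def)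
    show "AE z in P'. 0 \<le> snd z \<and> snd z < 1"
      unfolding P'_def by (subst AE_distr_iff) (auto simp: e01)
  qed (simp add: P'_def)
  then obtain k' where k'[measurable]: "k' \<in> M \<rightarrow>\<^sub>M prob_algebra borel" and P': "P' = sdp M borel k'" by blast
  define k where "k x = distr (k' x) S r" for x
  have k: "k \<in> M \<rightarrow>\<^sub>M prob_algebra S" unfolding k_def by measurable
  show ?thesis
  proof (intro bexI[OF _ k] sdp_eqI[OF M k P(1)])
    fix A B assume A[measurable]: "A \<in> sets M" and B[measurable]: "B \<in> sets S"
    have rB: "r -` B \<in> sets borel" using measurable_sets[OF r B] by simp
    have "emeasure P (A \<times> B) = emeasure P ((\<lambda>z. (fst z, e (snd z))) -` (A \<times> (r -` B)) \<inter> space P)"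
      using sets.sets_into_space[OF A] sets.sets_into_space[OF B] sets_eq_imp_space_eq[OF P(1)] er
      by (intro arg_cong2[where f = emeasure]) (auto simp: space_pair_measure)
    also have "\<dots> = emeasure P' (A \<times> (r -` B))"
      unfolding P'_def using rB by (subst emeasure_distr) auto
    also have "\<dots> = (\<integral>\<^sup>+x. emeasure (k' x) (r -` B) * indicator A x \<partial>M)"
      unfolding P' using rB by (intro emeasure_sdp_times[OF M k']) auto
    also have "\<dots> = (\<integral>\<^sup>+x. emeasure (k x) B * indicator A x \<partial>M)"
    proof (rule nn_integral_cong)
      fix x assume x: "x \<in> space M"
      note [measurable_cong] = prob_kernelD(2)[OF k' x]
      show "emeasure (k' x) (r -` B) * indicator A x = emeasure (k x) B * indicator A x"
        unfolding k_def using prob_kernelD(3)[OF k' x] by (subst emeasure_distr) auto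
    qed
    finally show "emeasure P (A \<times> B) = (\<integral>\<^sup>+x. emeasure (k x) B * indicator A x \<partial>M)" .
  qed
qed

section \<open>Atomless measures on standard spaces\<close>

text \<open>The encoding is injective on the space, so each of its fibres is empty or a single
  point, which carries no mass.\<close>

lemma standard_distr_atomless:
  assumes r: "\<And>x. x \<in> space S \<Longrightarrow> r (e x) = x" and [measurable]: "e \<in> borel_measurable S"
    and P: "prob_space P" and sP[measurable_cong]: "sets P = sets S"
    and at: "\<And>a. emeasure P {a} = 0"
  shows "cdf_distribution (distr P borel e)" "measure (distr P borel e) {a} = 0"
proof -
  interpret P: prob_space P by fact
  show "cdf_distribution (distr P borel e)"
    unfolding cdf_distribution_def by (rule P.real_distribution_distr) measurable
  have "emeasure (distr P borel e) {a} = emeasure P {x \<in> space P. e x = a}"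
    by (subst emeasure_distr) (auto intro!: arg_cong2[where f = emeasure])
  also have "\<dots> \<le> emeasure P {r a}"
  proof (cases "\<exists>x\<in>space P. e x = a")
    case True
    then obtain x where x: "x \<in> space S" "e x = a" using sets_eq_imp_space_eq[OF sP] by auto
    have "{x \<in> space P. e x = a} = {r a}"
      using x r sets_eq_imp_space_eq[OF sP] by (auto, metis)
    then show ?thesis by simp
  next
    case False
    then have "{x \<in> space P. e x = a} = {}" by auto
    then show ?thesis by (metis emeasure_empty zero_le)
  qed
  finally show "measure (distr P borel e) {a} = 0" using at by (simp add: measure_def)
qed

text \<open>The conditional quantile transform with a parameter. \<open>F\<close> undoes
  \<open>Q\<close> for almost every u, as distribution functions without atoms attain each level;
  the composition in the other order is left to the general symmetry of \<open>adapted_iso\<close>.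
  The image law comes from \<open>distr_I_eq_M\<close> along the embedding \<open>e\<close>.\<close>

lemma quantile_kernel:
  assumes S: "standard S" and K[measurable]: "K \<in> M \<rightarrow>\<^sub>M prob_algebra S"
    and at: "\<And>x a. x \<in> space M \<Longrightarrow> emeasure (K x) {a} = 0"
  obtains Q F where "Q \<in> M \<Otimes>\<^sub>M borel \<rightarrow>\<^sub>M S" "F \<in> borel_measurable (M \<Otimes>\<^sub>M S)"
    "\<And>x. x \<in> space M \<Longrightarrow> distr unif S (\<lambda>u. Q (x, u)) = K x"
    "\<And>x. x \<in> space M \<Longrightarrow> AE u in unif. F (x, Q (x, u)) = u"
proof -
  obtain e r where e[measurable]: "e \<in> borel_measurable S" and r[measurable]: "r \<in> borel \<rightarrow>\<^sub>M S"
    and er: "\<And>x. x \<in> space S \<Longrightarrow> r (e x) = x" and e01: "\<And>x. 0 \<le> e x" "\<And>x. e x < (1::real)"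
    by (rule standard_realE[OF S]) (rule that)
  define C where "C x s = measure (K x) {y \<in> space S. e y \<le> s}" for x s
  define I where "I x u = (if 0 < u \<and> u < 1 then Inf {s. u \<le> C x s} else 0)" for x u
  have Cm [measurable]: "(\<lambda>x. C x s) \<in> borel_measurable M" for s
    unfolding C_def using measurable_prob_algebraD[OF K] by measurable
  have C: "cdf (distr (K x) borel e) = C x" if x: "x \<in> space M" for x
  proof
    fix s note [measurable_cong] = prob_kernelD(2)[OF K x]
    show "cdf (distr (K x) borel e) s = C x s"
      unfolding cdf_def C_def using prob_kernelD(3)[OF K x]
      by (subst measure_distr) (auto intro!: arg_cong2[where f = measure])
  qed
  have cd: "cdf_distribution (distr (K x) borel e)" and na: "measure (distr (K x) borel e) {a} = 0"
    if x: "x \<in> space M" for x a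
    by (rule standard_distr_atomless[OF er e prob_kernelD(1,2)[OF K x] at[OF x]]; assumption)+
  \<comment> \<open>The Galois connection between quantile and distribution function: for fixed s
    only the value \<open>C x s\<close> enters, whence joint measurability of
    \<open>I\<close>.\<close>
  have I_le: "I x u \<le> s \<longleftrightarrow> (if 0 < u \<and> u < 1 then u \<le> C x s else 0 \<le> s)" if x: "x \<in> space M" for x u s
  proof -
    interpret cdf_distribution "distr (K x) borel e" by (rule cd[OF x])
    show ?thesis using pseudoinverse[of u s] by (auto simp: I_def C[OF x])
  qed
  have Im [measurable]: "(\<lambda>z. I (fst z) (snd z)) \<in> borel_measurable (M \<Otimes>\<^sub>M borel)"
  proof (rule borel_measurableI_le)
    fix s
    have "{z \<in> space (M \<Otimes>\<^sub>M borel). I (fst z) (snd z) \<le> s} =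
      {z \<in> space (M \<Otimes>\<^sub>M borel). if 0 < snd z \<and> snd z < 1 then snd z \<le> C (fst z) s else 0 \<le> s}"
      using I_le by (auto simp: space_pair_measure)
    also have "\<dots> \<in> sets (M \<Otimes>\<^sub>M borel)" by measurable
    finally show "{z \<in> space (M \<Otimes>\<^sub>M borel). I (fst z) (snd z) \<le> s} \<in> sets (M \<Otimes>\<^sub>M borel)" .
  qed
  define Q where "Q z = r (I (fst z) (snd z))" for z
  define F where "F z = C (fst z) (e (snd z))" for z
  have Qm[measurable]: "Q \<in> M \<Otimes>\<^sub>M borel \<rightarrow>\<^sub>M S" unfolding Q_def by measurable
  have Fm: "F \<in> borel_measurable (M \<Otimes>\<^sub>M S)"
    unfolding F_def C_def
  proof (rule measure_measurable_subprob_algebra2[where N = S])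
    have "{w \<in> space ((M \<Otimes>\<^sub>M S) \<Otimes>\<^sub>M S). e (snd w) \<le> e (snd (fst w))} \<in> sets ((M \<Otimes>\<^sub>M S) \<Otimes>\<^sub>M S)"
      by measurable
    also have "{w \<in> space ((M \<Otimes>\<^sub>M S) \<Otimes>\<^sub>M S). e (snd w) \<le> e (snd (fst w))}
      = (SIGMA z:space (M \<Otimes>\<^sub>M S). {y \<in> space S. e y \<le> e (snd z)})"
      by (auto simp: space_pair_measure)
    finally show "(SIGMA z:space (M \<Otimes>\<^sub>M S). {y \<in> space S. e y \<le> e (snd z)}) \<in> sets ((M \<Otimes>\<^sub>M S) \<Otimes>\<^sub>M S)" .
    show "(\<lambda>z. K (fst z)) \<in> M \<Otimes>\<^sub>M S \<rightarrow>\<^sub>M subprob_algebra S"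
      using measurable_prob_algebraD[OF K] by measurable
  qed
  have Ix [measurable]: "I x \<in> borel_measurable borel" if x: "x \<in> space M" for x
    using measurable_Pair2[OF Im x] by simp
  have PI: "distr unif borel (I x) = distr (K x) borel e" if x: "x \<in> space M" for x
  proof -
    interpret cdf_distribution "distr (K x) borel e" by (rule cd[OF x])
    have "distr unif borel (I x) = distr (restrict_space lborel {0<..<1}) borel (I x)"
      by (rule distr_unif_eq[symmetric, OF Ix[OF x]])
    also have "\<dots> = distr (restrict_space lborel {0<..<1}) borel (\<lambda>\<omega>. Inf {s. \<omega> \<le> C x s})"
      by (rule distr_cong) (auto simp: space_restrict_space I_def)
    also have "\<dots> = distr (K x) borel e" using distr_I_eq_M by (simp add: C[OF x])
    finally show ?thesis .
  qed
  show ?thesis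
  proof (rule that[OF Qm Fm])
    fix x assume x: "x \<in> space M"
    note [measurable_cong, simp] = prob_kernelD(2)[OF K x]
    note [measurable] = Ix[OF x]
    have "distr unif S (\<lambda>u. Q (x, u)) = distr (distr unif borel (I x)) S r"
      by (subst distr_distr) (auto simp: Q_def comp_def)
    also have "\<dots> = distr (K x) S (\<lambda>y. r (e y))"
      unfolding PI[OF x] by (subst distr_distr) (auto simp: comp_def)
    also have "\<dots> = distr (K x) S (\<lambda>y. y)"
      by (rule distr_cong) (auto simp: er prob_kernelD(3)[OF K x])
    also have "\<dots> = K x" by (rule distr_id2) simp
    finally show "distr unif S (\<lambda>u. Q (x, u)) = K x" .
    \<comment> \<open>\<open>e\<close> after \<open>r\<close> is the identity only on the range of
      \<open>e\<close>; the law of the quantile is concentrated there.\<close>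
    have "AE s in distr (K x) borel e. e (r s) = s"
      by (subst AE_distr_iff) (auto simp: er prob_kernelD(3)[OF K x])
    then have "AE u in unif. e (r (I x u)) = I x u"
      unfolding PI[OF x, symmetric] by (subst (asm) AE_distr_iff) auto
    then show "AE u in unif. F (x, Q (x, u)) = u"
      using AE_unif
    proof eventually_elim
      case (elim u)
      then have "C x (I x u) = u"
        using cdf_right_inverse[OF cd[OF x] na[OF x], of u] by (simp add: C[OF x] I_def)
      then show ?case using elim by (simp add: F_def Q_def)
    qed
  qed
qed

text \<open>Restricting to a compact subset of the image of the embedding into the reals keeps the
  generalised inverse of the distribution function inside that image, for \<^emph>\<open>every\<close> argument.\<close>

lemma embed_unit_interval:
  assumes S: "standard S" and P: "prob_space P" and sP: "sets P = sets S"
    and at: "\<And>a. emeasure P {a} = 0"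
  obtains i F where "i \<in> borel \<rightarrow>\<^sub>M S" "F \<in> borel_measurable S" "\<And>u. 0 < u \<Longrightarrow> u < (1::real) \<Longrightarrow> F (i u) = u"
proof -
  interpret P: prob_space P by fact
  note [measurable_cong] = sP
  obtain e r where e[measurable]: "e \<in> borel_measurable S" and r[measurable]: "r \<in> borel \<rightarrow>\<^sub>M S"
    and er: "\<And>x. x \<in> space S \<Longrightarrow> r (e x) = x" and e01: "\<And>x. 0 \<le> e x" "\<And>x. e x < (1::real)"
    by (rule standard_realE[OF S]) (rule that)
  define R where "R = distr P borel e"
  have Rc: "cdf_distribution R" and Ra: "measure R {a} = 0" for a
    unfolding R_def by (rule standard_distr_atomless[OF er e P sP at]; assumption)+
  interpret R: cdf_distribution R by (rule Rc)
  have sR: "sets R = sets borel" by (simp add: R_def)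
  \<comment> \<open>This is the range of \<open>e\<close>, recognised as a Borel set by the
    retraction.\<close>
  define G where "G = {s. e (r s) = s}"
  have G[measurable]: "G \<in> sets borel" unfolding G_def by measurable
  have "AE s in R. s \<in> G"
    unfolding R_def G_def using sets_eq_imp_space_eq[OF sP] by (subst AE_distr_iff) (auto simp: er)
  then have "emeasure R G = 1" using R.emeasure_eq_1_AE[of G] by (simp add: sR)
  also have "emeasure R G = (SUP K\<in>{K. K \<subseteq> G \<and> compact K}. emeasure R K)"
    by (rule inner_regular) (auto simp: sR)
  finally have "0 < (SUP K\<in>{K. K \<subseteq> G \<and> compact K}. emeasure R K)" by simp
  \<comment> \<open>Inner regularity only has to supply positive mass; the law \<open>D\<close>
    conditioned on K is again atomless.\<close>
  then obtain K where K: "K \<subseteq> G" "compact K" "0 < emeasure R K"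
    by (auto simp: less_SUP_iff)
  have [measurable]: "K \<in> sets borel" using K(2) by (rule borel_compact)
  define D where "D = uniform_measure R K"
  have emD: "emeasure D A = emeasure R (K \<inter> A) / emeasure R K" if "A \<in> sets borel" for A
    unfolding D_def using that by (intro emeasure_uniform_measure) (auto simp: sR)
  have Dd: "cdf_distribution D"
    unfolding cdf_distribution_def real_distribution_def real_distribution_axioms_def D_def
    using K(3) by (auto intro!: prob_space_uniform_measure simp: sR)
  interpret D: cdf_distribution D by (rule Dd)
  have Da: "measure D {a} = 0" for a
  proof -
    have "emeasure R (K \<inter> {a}) \<le> emeasure R {a}" by (intro emeasure_mono) (auto simp: sR)
    also have "\<dots> = 0" using Ra[of a] by (simp add: R.emeasure_eq_measure)
    finally show ?thesis by (simp add: measure_def emD)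
  qed
  define I where "I u = (if 0 < u \<and> u < 1 then Inf {s. u \<le> cdf D s} else 0)" for u
  have Im[measurable]: "I \<in> borel_measurable borel"
  proof (rule borel_measurableI_le)
    fix s
    have "{u \<in> space borel. I u \<le> s} = {u. if 0 < u \<and> u < 1 then u \<le> cdf D s else 0 \<le> s}"
      using D.pseudoinverse[of _ s] by (auto simp: I_def)
    also have "\<dots> \<in> sets borel" by measurable
    finally show "{u \<in> space borel. I u \<le> s} \<in> sets borel" .
  qed
  \<comment> \<open>If the inverse missed the closed set K, a left neighbourhood of it would carry
    no mass of \<open>D\<close>, the distribution function would be constant there, and the infimum
    would lie further left.\<close>
  have IK: "I u \<in> K" if u: "0 < u" "u < 1" for u
  proof (rule ccontr)
    assume nK: "I u \<notin> K"
    have "open (- K)" using K(2) by (simp add: compact_imp_closed open_Compl)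
    then obtain \<epsilon> where \<epsilon>: "\<epsilon> > 0" "ball (I u) \<epsilon> \<subseteq> - K" using nK by (meson ComplI openE)
    define s where "s = I u - \<epsilon> / 2"
    have "K \<inter> {s<..I u} = {}" using \<epsilon> by (auto simp: s_def ball_def dist_real_def subset_eq)
    then have "emeasure D {s<..I u} = 0" by (simp add: emD)
    moreover have "emeasure D {s<..I u} = cdf D (I u) - cdf D s"
      using \<epsilon>(1) by (intro D.emeasure_Ioc) (simp add: s_def)
    ultimately have "cdf D (I u) \<le> cdf D s" by (simp add: ennreal_eq_0_iff)
    moreover have "u \<le> cdf D (I u)" using D.pseudoinverse[OF u, of "I u"] u by (simp add: I_def)
    ultimately have "I u \<le> s" using D.pseudoinverse[OF u, of s] u by (simp add: I_def)
    then show False using \<epsilon>(1) by (simp add: s_def)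
  qed
  show ?thesis
  proof (rule that[of "\<lambda>u. r (I u)" "\<lambda>y. cdf D (e y)"])
    fix u :: real assume u: "0 < u" "u < 1"
    have "e (r (I u)) = I u" using IK[OF u] K(1) by (auto simp: G_def)
    then show "cdf D (e (r (I u))) = u" using cdf_right_inverse[OF Dd Da u] u by (simp add: I_def)
  qed measurable
qed

section \<open>Measurable bijections\<close>

lemma standard_real: "standard (borel :: real measure)"
proof -
  have "completely_metrizable_space euclideanreal"
    using completely_metrizable_space_euclidean by blast
  moreover have "separable_space euclideanreal"
  proof -
    have "second_countable euclideanreal"
      unfolding second_countable_def using ex_countable_basis[where 'a = real]
      by (metis open_openin topological_basisE topological_basis_def)
    then show ?thesis by (rule second_countable_imp_separable_space)
  qed
  ultimately have "standard (borel_of euclideanreal)"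
    by (intro standard_Polish) (auto simp: Polish_space_def)
  then show ?thesis
    by (rule standard_sets_eq[rotated]) (simp add: borel_of_def borel_def)
qed

text \<open>The classical construction with Borel stages: since \<open>g'\<close> undoes
  \<open>g\<close> on B, the image of S under \<open>g\<close> is the set of points of A that
  \<open>g\<close> after \<open>g'\<close> fixes and that \<open>g'\<close> sends into S. Off
  \<open>D\<close> the bijection uses \<open>g'\<close> itself in place of an inverse of
  \<open>g\<close>, so the resulting map is measurable as soon as \<open>D\<close> is.\<close>

lemma measurable_Schroeder_Bernstein:
  assumes stM: "standard M" and stN: "standard N"
    and A: "A \<in> sets M" and B: "B \<in> sets N"
    and [measurable]: "f \<in> M \<rightarrow>\<^sub>M N" "f' \<in> N \<rightarrow>\<^sub>M M" "g \<in> N \<rightarrow>\<^sub>M M" "g' \<in> M \<rightarrow>\<^sub>M N"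
    and f: "\<And>x. x \<in> A \<Longrightarrow> f x \<in> B" "\<And>x. x \<in> A \<Longrightarrow> f' (f x) = x"
    and g: "\<And>y. y \<in> B \<Longrightarrow> g y \<in> A" "\<And>y. y \<in> B \<Longrightarrow> g' (g y) = y"
  obtains D where "D \<in> sets M" "bij_betw (\<lambda>x. if x \<in> D then f x else g' x) A B"
proof -
  have gfix: "{x \<in> space M. g (g' x) = x} \<in> sets M" by (rule measurable_eq_standard[OF stM]) measurable
  have ffix: "{y \<in> space N. f (f' y) = y} \<in> sets N" by (rule measurable_eq_standard[OF stN]) measurable
  have im_g: "g ` S \<in> sets M" if S: "S \<in> sets N" "S \<subseteq> B" for S
  proof -
    have "g ` S = {x \<in> space M. g (g' x) = x} \<inter> (g' -` S \<inter> space M) \<inter> A"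
    proof (intro equalityI subsetI)
      fix z assume "z \<in> g ` S"
      then obtain y where y: "y \<in> S" "z = g y" by blast
      then have "y \<in> B" using S(2) by auto
      then show "z \<in> {x \<in> space M. g (g' x) = x} \<inter> (g' -` S \<inter> space M) \<inter> A"
        using y g[of y] sets.sets_into_space[OF A] by auto
    next
      fix z assume "z \<in> {x \<in> space M. g (g' x) = x} \<inter> (g' -` S \<inter> space M) \<inter> A"
      then have "g' z \<in> S" "z = g (g' z)" by auto
      then show "z \<in> g ` S" by blast
    qed
    then show ?thesis using S gfix A by simp
  qed
  have im_f: "f ` S \<in> sets N" if S: "S \<in> sets M" "S \<subseteq> A" for S
  proof -
    have "f ` S = {y \<in> space N. f (f' y) = y} \<inter> (f' -` S \<inter> space N) \<inter> B"
    proof (intro equalityI subsetI)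
      fix z assume "z \<in> f ` S"
      then obtain y where y: "y \<in> S" "z = f y" by blast
      then have "y \<in> A" using S(2) by auto
      then show "z \<in> {y \<in> space N. f (f' y) = y} \<inter> (f' -` S \<inter> space N) \<inter> B"
        using y f[of y] sets.sets_into_space[OF B] by auto
    next
      fix z assume "z \<in> {y \<in> space N. f (f' y) = y} \<inter> (f' -` S \<inter> space N) \<inter> B"
      then have "f' z \<in> S" "z = f (f' z)" by auto
      then show "z \<in> f ` S" by blast
    qed
    then show ?thesis using S ffix B by simp
  qed
  \<comment> \<open>Stage n consists of the points whose ancestry under \<open>g\<close> after
    \<open>f\<close> begins n rounds back, in A outside the image of B.\<close>
  define C where "C n = ((\<lambda>S. g ` f ` S) ^^ n) (A - g ` B)" for n
  have C0: "C 0 = A - g ` B" and CS: "C (Suc n) = g ` f ` C n" for n by (simp_all add: C_def)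
  have CA: "C n \<in> sets M \<and> C n \<subseteq> A" for n
  proof (induction n)
    case 0 then show ?case using A im_g[OF B] by (auto simp: C0)
  next
    case (Suc n)
    have "f ` C n \<in> sets N" "f ` C n \<subseteq> B" using Suc im_f f by auto
    then show ?case unfolding CS using im_g g by auto
  qed
  define D where "D = (\<Union>n. C n)"
  define h where "h x = (if x \<in> D then f x else g' x)" for x
  have D: "D \<in> sets M" "D \<subseteq> A" using CA by (auto simp: D_def)
  have gfD: "g (f x) \<in> D" if "x \<in> D" for x using that CS unfolding D_def by blast
  have nD: "x \<in> g ` B" if "x \<in> A" "x \<notin> D" for x using that C0 unfolding D_def by blast
  have inD: "\<exists>x\<in>D. y = f x" if y: "y \<in> B" "g y \<in> D" for y
  proof -
    obtain n where n: "g y \<in> C n" using y by (auto simp: D_def)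
    with y(1) C0 obtain m where "n = Suc m" by (cases n) auto
    with n CS obtain x where x: "x \<in> C m" "g y = g (f x)" by auto
    have "f x \<in> B" using x(1) CA f by blast
    then have "y = f x" using x(2) g(2) y(1) by metis
    then show ?thesis using x(1) by (auto simp: D_def)
  qed
  have "bij_betw h A B"
  proof (rule bij_betwI')
    fix x y assume xy: "x \<in> A" "y \<in> A"
    have aux: False if a: "x \<in> D" "y \<in> A" "y \<notin> D" "f x = g' y" for x y
    proof -
      obtain w where w: "w \<in> B" "y = g w" using nD[OF a(2,3)] by blast
      then have "y = g (f x)" using a(4) g by simp
      then show False using gfD[OF a(1)] a(3) by simp
    qed
    show "(h x = h y) = (x = y)"
    proof
      assume e: "h x = h y"
      consider "x \<in> D" "y \<in> D" | "x \<in> D" "y \<notin> D" | "x \<notin> D" "y \<in> D" | "x \<notin> D" "y \<notin> D" by blast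
      then show "x = y"
      proof cases
        case 1 then show ?thesis using e xy f(2) by (metis h_def)
      next
        case 2 then show ?thesis using e xy aux[of x y] by (simp add: h_def)
      next
        case 3 then show ?thesis using e xy aux[of y x] by (simp add: h_def)
      next
        case 4
        then obtain v w where "v \<in> B" "x = g v" "w \<in> B" "y = g w" using nD xy by blast
        then show ?thesis using e 4 g(2) by (simp add: h_def)
      qed
    qed simp
  next
    fix x assume x: "x \<in> A"
    show "h x \<in> B"
    proof (cases "x \<in> D")
      case False
      then obtain v where "v \<in> B" "x = g v" using nD x by blast
      then show ?thesis using False g by (simp add: h_def)
    qed (use x f in \<open>simp add: h_def\<close>)
  next
    fix y assume y: "y \<in> B"
    show "\<exists>x\<in>A. y = h x"
    proof (cases "g y \<in> D")
      case True
      then obtain x where "x \<in> D" "y = f x" using inD y by blast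
      then show ?thesis using D by (auto simp: h_def)
    next
      case False
      then show ?thesis using y g by (intro bexI[of _ "g y"]) (auto simp: h_def)
    qed
  qed
  then show ?thesis using that D(1) unfolding h_def by blast
qed

text \<open>A reservoir for repairs: whatever is left over in a standard space embeds into the
  Cantor space and hence into A, at no cost in mass. \<open>F\<close> is a global left inverse, the
  form in which \<open>measurable_Schroeder_Bernstein\<close> takes its maps.\<close>

definition null_cantor :: "'a measure \<Rightarrow> bool" where
  "null_cantor M \<longleftrightarrow> (\<exists>A i F. A \<in> null_sets M \<and> i \<in> bitM \<rightarrow>\<^sub>M M \<and> F \<in> M \<rightarrow>\<^sub>M bitM \<and> (\<forall>b. i b \<in> A \<and> F (i b) = b))"

text \<open>Uncountably many disjoint copies of the Cantor space cannot all have positive mass.\<close>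

lemma null_cantorI:
  fixes F0 :: "'a \<Rightarrow> real"
  assumes P: "prob_space P" and [measurable]: "i0 \<in> borel \<rightarrow>\<^sub>M P" "F0 \<in> borel_measurable P"
    and i0: "\<And>u. 0 < u \<Longrightarrow> u < 1 \<Longrightarrow> F0 (i0 u) = u"
  shows "null_cantor P"
proof -
  interpret P: prob_space P by fact
  \<comment> \<open>\<open>s\<close> occupies the even and \<open>b\<close> the odd positions:
    fixing \<open>s\<close> and varying \<open>b\<close> yields disjoint copies of the Cantor space,
    one for each \<open>s\<close>.\<close>
  define J where "J s b = (\<lambda>n. if even n then s (n div 2) else b (n div 2))" for s b :: "nat \<Rightarrow> bool"
  define ev where "ev c = (\<lambda>n. c (2 * n))" for c :: "nat \<Rightarrow> bool"
  define od where "od c = (\<lambda>n. c (2 * n + 1))" for c :: "nat \<Rightarrow> bool"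
  have [simp]: "ev (J s b) = s" "od (J s b) = b" for s b by (auto simp: ev_def od_def J_def)
  have [measurable]: "ev \<in> bitM \<rightarrow>\<^sub>M bitM" "od \<in> bitM \<rightarrow>\<^sub>M bitM" "J s \<in> bitM \<rightarrow>\<^sub>M bitM" for s
    unfolding ev_def od_def J_def by (rule measurable_bitMI; measurable)+
  define E where "E x = enc (ev (dec (2 * F0 x - 1)))" for x
  have [measurable]: "E \<in> borel_measurable P" unfolding E_def by measurable
  interpret E: prob_space "distr P borel E" by (rule P.prob_space_distr) measurable
  \<comment> \<open>A law on the line has countably many atoms, whereas \<open>enc\<close> takes
    uncountably many values; some copy is therefore null.\<close>
  have "countable {c. measure (distr P borel E) {c} \<noteq> 0}" by (rule E.countable_support)
  moreover have "uncountable (range enc)"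
  proof
    obtain e r where er: "\<And>x::real. x \<in> space borel \<Longrightarrow> r (e x) = x" "e \<in> borel \<rightarrow>\<^sub>M bitM" "r \<in> bitM \<rightarrow>\<^sub>M borel"
      by (rule standardE[OF standard_real]) (rule that)
    assume "countable (range enc)"
    then have "countable (UNIV :: (nat \<Rightarrow> bool) set)"
      by (rule countable_image_inj_on) (metis dec_enc injI)
    then have "countable (range e)" by (rule countable_subset[rotated]) simp
    then have "countable (UNIV :: real set)"
      by (rule countable_image_inj_on) (metis er(1) UNIV_I space_borel injI)
    then show False using uncountable_UNIV_real by simp
  qed
  ultimately obtain s where s: "measure (distr P borel E) {enc s} = 0"
    using countable_subset[of "range enc" "{c. measure (distr P borel E) {c} \<noteq> 0}"] by blast
  define A where "A = {x \<in> space P. E x = enc s}"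
  \<comment> \<open>The code lies in [0, 1/3] and may be 0; moved to [1/2, 2/3] it falls in the open
    interval where \<open>F0\<close> undoes \<open>i0\<close>. The expression
    \<open>2 * F0 x - 1\<close> reverses the shift.\<close>
  define i where "i b = i0 ((enc (J s b) + 1) / 2)" for b
  define F where "F x = od (dec (2 * F0 x - 1))" for x
  have A[measurable]: "A \<in> sets P" unfolding A_def by measurable
  have "measure P A = measure (distr P borel E) {enc s}"
    by (subst measure_distr) (auto simp: A_def intro!: arg_cong2[where f = measure])
  then have "A \<in> null_sets P" using s by (auto simp: null_sets_def P.emeasure_eq_measure)
  moreover have [measurable]: "i \<in> bitM \<rightarrow>\<^sub>M P" unfolding i_def by measurable
  moreover have "F \<in> P \<rightarrow>\<^sub>M bitM" unfolding F_def by measurable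
  moreover have Fi: "2 * F0 (i b) - 1 = enc (J s b)" for b
    unfolding i_def using enc_bounds[of "J s b"] by (subst i0) (auto simp: field_simps)
  moreover have "i b \<in> A" for b
    using measurable_space[of i bitM P b] by (simp add: A_def E_def Fi)
  moreover have "F (i b) = b" for b by (simp add: F_def Fi)
  ultimately show ?thesis unfolding null_cantor_def by blast
qed

text \<open>Both sides give up null sets containing copies of the Cantor space; what is left over on
  either side then embeds into the other side.\<close>

lemma everywhere_bijection:
  assumes M: "prob_space M" "standard M" "null_cantor M"
    and N: "prob_space N" "standard N" "null_cantor N"
    and T[measurable]: "T \<in> M \<rightarrow>\<^sub>M N" and S[measurable]: "S \<in> N \<rightarrow>\<^sub>M M"
    and d: "distr M N T = N" and inv: "AE x in M. S (T x) = x"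
  obtains T' where "T' \<in> M \<rightarrow>\<^sub>M N" "bij_betw T' (space M) (space N)" "AE x in M. T' x = T x"
proof -
  obtain A i F where A: "A \<in> null_sets M" and i[measurable]: "i \<in> bitM \<rightarrow>\<^sub>M M" and [measurable]: "F \<in> M \<rightarrow>\<^sub>M bitM"
    and iF: "\<And>b. i b \<in> A" "\<And>b. F (i b) = b" using M(3) unfolding null_cantor_def by blast
  obtain B j G where B: "B \<in> null_sets N" and j[measurable]: "j \<in> bitM \<rightarrow>\<^sub>M N" and [measurable]: "G \<in> N \<rightarrow>\<^sub>M bitM"
    and jG: "\<And>b. j b \<in> B" "\<And>b. G (j b) = b" using N(3) unfolding null_cantor_def by blast
  obtain e r where [measurable]: "e \<in> M \<rightarrow>\<^sub>M bitM" "r \<in> bitM \<rightarrow>\<^sub>M M" and er: "\<And>x. x \<in> space M \<Longrightarrow> r (e x) = x"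
    by (rule standardE[OF M(2)]) (rule that)
  obtain e' r' where [measurable]: "e' \<in> N \<rightarrow>\<^sub>M bitM" "r' \<in> bitM \<rightarrow>\<^sub>M N" and er': "\<And>x. x \<in> space N \<Longrightarrow> r' (e' x) = x"
    by (rule standardE[OF N(2)]) (rule that)
  have [measurable]: "A \<in> sets M" "B \<in> sets N" using A B by auto
  have st: "{x \<in> space M. S (T x) = x} \<in> sets M" by (rule measurable_eq_standard[OF M(2)]) measurable
  have ts: "{y \<in> space N. T (S y) = y} \<in> sets N" by (rule measurable_eq_standard[OF N(2)]) measurable
  \<comment> \<open>The part where nothing has to be changed: \<open>S\<close> undoes
    \<open>T\<close>, and neither end lies in a reservoir. Its complement is null, as the reservoirs
    are.\<close>
  define X1 where "X1 = {x \<in> space M. S (T x) = x} \<inter> {x \<in> space M. x \<notin> A \<and> T x \<notin> B}"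
  define Y1 where "Y1 = {y \<in> space N. T (S y) = y} \<inter> {y \<in> space N. S y \<notin> A \<and> y \<notin> B}"
  have X1[measurable]: "X1 \<in> sets M" unfolding X1_def by (intro sets.Int st) measurable
  have Y1[measurable]: "Y1 \<in> sets N" unfolding Y1_def by (intro sets.Int ts) measurable
  have bT: "bij_betw T X1 Y1"
    by (rule bij_betw_byWitness[where f' = S])
       (use measurable_space[OF T] measurable_space[OF S] in \<open>auto simp: X1_def Y1_def\<close>)
  \<comment> \<open>\<open>X1\<close> and \<open>Y1\<close> avoid A and B, so the embeddings through
    the Cantor space map each leftover into the other one.\<close>
  obtain D where D[measurable]: "D \<in> sets M"
    and bD: "bij_betw (\<lambda>x. if x \<in> D then j (e x) else r' (F x)) (space M - X1) (space N - Y1)"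
  proof (rule measurable_Schroeder_Bernstein[OF M(2) N(2), of "space M - X1" "space N - Y1"
        "\<lambda>x. j (e x)" "\<lambda>y. r (G y)" "\<lambda>y. i (e' y)" "\<lambda>x. r' (F x)"])
    fix x assume "x \<in> space M - X1"
    show "j (e x) \<in> space N - Y1" using jG(1)[of "e x"] measurable_space[OF j, of "e x"] by (auto simp: Y1_def)
    show "r (G (j (e x))) = x" using \<open>x \<in> space M - X1\<close> by (simp add: jG er)
  next
    fix y assume "y \<in> space N - Y1"
    show "i (e' y) \<in> space M - X1" using iF(1)[of "e' y"] measurable_space[OF i, of "e' y"] by (auto simp: X1_def)
    show "r' (F (i (e' y))) = y" using \<open>y \<in> space N - Y1\<close> by (simp add: iF er')
  qed (use that in auto)
  define T' where "T' x = (if x \<in> X1 then T x else if x \<in> D then j (e x) else r' (F x))" for x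
  have "bij_betw T' (X1 \<union> (space M - X1)) (Y1 \<union> (space N - Y1))"
  proof (rule bij_betw_combine)
    show "bij_betw T' X1 Y1" using bT by (rule bij_betw_cong[THEN iffD1, rotated]) (simp add: T'_def)
    show "bij_betw T' (space M - X1) (space N - Y1)"
      using bD by (rule bij_betw_cong[THEN iffD1, rotated]) (simp add: T'_def)
  qed auto
  moreover have "X1 \<union> (space M - X1) = space M" "Y1 \<union> (space N - Y1) = space N"
    by (auto simp: X1_def Y1_def)
  moreover have "T' \<in> M \<rightarrow>\<^sub>M N" unfolding T'_def by measurable
  moreover have "AE x in M. T' x = T x"
  proof -
    have "AE y in distr M N T. y \<notin> B" unfolding d using B by (rule AE_not_in)
    then have "AE x in M. T x \<notin> B" by (subst (asm) AE_distr_iff) auto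
    with inv AE_not_in[OF A] AE_space show ?thesis
      by eventually_elim (simp add: T'_def X1_def)
  qed
  ultimately show ?thesis using that by metis
qed

section \<open>Path spaces, filtrations and kernels\<close>

lemma space_prodM: "space (prodM n X) = PiE {..<n} (\<lambda>t. topspace (X t))"
  by (simp add: prodM_def space_PiM)

lemma prodM_measurable_component:
  "t < n \<Longrightarrow> f \<in> M \<rightarrow>\<^sub>M prodM n X \<Longrightarrow> (\<lambda>x. f x t) \<in> M \<rightarrow>\<^sub>M borel_of (X t)"
  unfolding prodM_def by (rule measurable_compose[OF _ measurable_component_singleton]) auto

lemma measurable_prefix: "s \<le> t \<Longrightarrow> (\<lambda>x. restrict x {..<s}) \<in> prodM t X \<rightarrow>\<^sub>M prodM s X"
  unfolding prodM_def by (rule measurable_restrict_subset) auto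

lemma prefix_id: "x \<in> space (prodM n X) \<Longrightarrow> restrict x {..<n} = x"
  by (auto simp: space_prodM PiE_def extensional_restrict)

lemma prefix_prefix: "s \<le> t \<Longrightarrow> restrict (restrict x {..<t}) {..<s} = restrict x {..<s::nat}"
  by (auto simp: restrict_def)

lemma prefix_upd: "s \<le> t \<Longrightarrow> restrict (x(t := a)) {..<s} = restrict x {..<s::nat}"
  by (auto simp: restrict_def)

lemma measurable_upd:
  "(\<lambda>z. (fst z)(t := snd z)) \<in> prodM t X \<Otimes>\<^sub>M borel_of (X t) \<rightarrow>\<^sub>M prodM (Suc t) X"
  using measurable_add_dim[of t "{..<t}" "\<lambda>t. borel_of (X t)"]
  by (simp add: prodM_def lessThan_Suc split_beta')

lemma upd_in_space: "x \<in> space (prodM t X) \<Longrightarrow> a \<in> topspace (X t) \<Longrightarrow> x(t := a) \<in> space (prodM (Suc t) X)"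
  using measurable_space[OF measurable_upd, of "(x, a)" t X] by (simp add: space_pair_measure)

lemma space_filtM [simp]: "space (filtM N t X) = space (prodM N X)"
  by (simp add: filtM_def)

lemma measurable_from_filtM: "t \<le> N \<Longrightarrow> (\<lambda>x. restrict x {..<t}) \<in> filtM N t X \<rightarrow>\<^sub>M prodM t X"
  unfolding filtM_def using measurable_space[OF measurable_prefix[of t N X]]
  by (intro measurable_vimage_algebra1) auto

lemma measurable_to_filtM:
  assumes "t \<le> N" "f \<in> space M \<rightarrow> space (prodM N X)" "(\<lambda>x. restrict (f x) {..<t}) \<in> M \<rightarrow>\<^sub>M prodM t X"
  shows "f \<in> M \<rightarrow>\<^sub>M filtM N t X"
  unfolding filtM_def using assms by (intro measurable_vimage_algebra2) auto

lemma sets_filtM: "sets (filtM N t X) = {(\<lambda>x. restrict x {..<t}) -` A \<inter> space (prodM N X) | A. A \<in> sets (prodM t X)}"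
  if "t \<le> N"
  unfolding filtM_def using measurable_space[OF measurable_prefix[OF that, of X]]
  by (subst sets_vimage_algebra2) auto

lemma filtM_subset: "t \<le> N \<Longrightarrow> B \<in> sets (filtM N t X) \<Longrightarrow> B \<in> sets (prodM N X)"
  using measurable_sets[OF measurable_prefix[of t N X]] by (auto simp: sets_filtM)

lemma subalgebra_filtM: "t \<le> N \<Longrightarrow> subalgebra (prodM N X) (filtM N t X)"
  unfolding subalgebra_def using filtM_subset by auto

lemma standard_prodM: "(\<And>t. t < n \<Longrightarrow> standard (borel_of (X t))) \<Longrightarrow> standard (prodM n X)"
  unfolding prodM_def by (rule standard_PiM_finite)

definition kern :: "nat \<Rightarrow> (nat \<Rightarrow> 'a topology) \<Rightarrow> (nat \<Rightarrow> (nat \<Rightarrow> 'a) \<Rightarrow> 'a measure) \<Rightarrow> bool" where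
  "kern n X K \<longleftrightarrow> (\<forall>t<n. K t \<in> prodM t X \<rightarrow>\<^sub>M prob_algebra (borel_of (X t)))"

lemma seqcomp_sets_prob:
  assumes "kern n X K" "t \<le> n"
  shows "sets (seqcomp X K t) = sets (prodM t X) \<and> prob_space (seqcomp X K t)"
  using assms(2)
proof (induction t)
  case 0
  then show ?case by (auto intro!: prob_space_return simp: space_prodM)
next
  case (Suc t)
  then have IH: "sets (seqcomp X K t) = sets (prodM t X)" "prob_space (seqcomp X K t)" by auto
  have [measurable]: "K t \<in> prodM t X \<rightarrow>\<^sub>M prob_algebra (borel_of (X t))" using assms(1) Suc by (auto simp: kern_def)
  have "(\<lambda>x. distr (K t x) (prodM (Suc t) X) (\<lambda>y. x(t := y))) \<in> prodM t X \<rightarrow>\<^sub>M prob_algebra (prodM (Suc t) X)"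
    using measurable_upd[of t X] by (intro measurable_distr_prob_space2[where M = "borel_of (X t)"]) (simp_all add: split_beta')
  moreover have "seqcomp X K t \<in> space (prob_algebra (prodM t X))" using IH by (simp add: space_prob_algebra)
  ultimately show ?case unfolding seqcomp.simps
    using sets_bind'[of "seqcomp X K t" "prodM t X"] prob_space_bind'[of "seqcomp X K t" "prodM t X"] by blast
qed

text \<open>Separates the random choice of the next coordinate from its insertion into the path: one
  step is an \<open>sdp\<close>, for which integrals and null sets are iterated, followed by an
  image.\<close>

lemma seqcomp_Suc:
  assumes "kern n X K" "t < n"
  shows "seqcomp X K (Suc t) =
    distr (sdp (seqcomp X K t) (borel_of (X t)) (K t)) (prodM (Suc t) X) (\<lambda>z. (fst z)(t := snd z))"
proof -
  have M: "sets (seqcomp X K t) = sets (prodM t X)" "prob_space (seqcomp X K t)"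
    using seqcomp_sets_prob[OF assms(1)] assms(2) by auto
  note [measurable_cong] = M(1)
  have K: "K t \<in> prodM t X \<rightarrow>\<^sub>M prob_algebra (borel_of (X t))" using assms by (auto simp: kern_def)
  then have K': "K t \<in> seqcomp X K t \<rightarrow>\<^sub>M prob_algebra (borel_of (X t))" by measurable
  interpret prob_space "seqcomp X K t" by (rule M(2))
  have up[measurable]: "(\<lambda>z. (fst z)(t := snd z)) \<in> seqcomp X K t \<Otimes>\<^sub>M borel_of (X t) \<rightarrow>\<^sub>M prodM (Suc t) X"
    using measurable_upd[of t X] by measurable
  have "distr (sdp (seqcomp X K t) (borel_of (X t)) (K t)) (prodM (Suc t) X) (\<lambda>z. (fst z)(t := snd z)) =
    bind (seqcomp X K t) (\<lambda>x. distr (distr (K t x) (seqcomp X K t \<Otimes>\<^sub>M borel_of (X t)) (\<lambda>y. (x, y))) (prodM (Suc t) X) (\<lambda>z. (fst z)(t := snd z)))"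
    unfolding sdp_def
    by (rule distr_bind[OF measurable_prob_algebraD[OF kernel_pair[OF M(2) K']] not_empty up])
  also have "\<dots> = seqcomp X K (Suc t)"
    unfolding seqcomp.simps
  proof (rule bind_cong)
    fix x assume x: "x \<in> space (seqcomp X K t)"
    note [measurable_cong] = prob_kernelD(2)[OF K' x]
    have [measurable]: "Pair x \<in> K t x \<rightarrow>\<^sub>M seqcomp X K t \<Otimes>\<^sub>M borel_of (X t)"
      unfolding measurable_cong_sets[OF prob_kernelD(2)[OF K' x] refl] by (rule measurable_Pair1'[OF x])
    show "distr (distr (K t x) (seqcomp X K t \<Otimes>\<^sub>M borel_of (X t)) (\<lambda>y. (x, y))) (prodM (Suc t) X) (\<lambda>z. (fst z)(t := snd z))
      = distr (K t x) (prodM (Suc t) X) (\<lambda>y. x(t := y))"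
      by (subst distr_distr) (auto simp: comp_def)
  qed simp
  finally show ?thesis by simp
qed

lemma seqcomp_prefix:
  assumes k: "kern n X K" and "s \<le> t" "t \<le> n"
  shows "distr (seqcomp X K t) (prodM s X) (\<lambda>x. restrict x {..<s}) = seqcomp X K s"
  using assms(2,3)
proof (induction t rule: dec_induct)
  case base
  have M: "sets (seqcomp X K s) = sets (prodM s X)" using seqcomp_sets_prob[OF k base] by simp
  have "distr (seqcomp X K s) (prodM s X) (\<lambda>x. restrict x {..<s}) = distr (seqcomp X K s) (prodM s X) (\<lambda>x. x)"
    by (rule distr_cong) (auto simp: prefix_id sets_eq_imp_space_eq[OF M])
  also have "\<dots> = seqcomp X K s" by (rule distr_id2) (simp add: M)
  finally show ?case .
next
  case (step t)
  have M: "sets (seqcomp X K t) = sets (prodM t X)" "prob_space (seqcomp X K t)"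
    using seqcomp_sets_prob[OF k] step by auto
  note [measurable_cong] = M(1)
  have "K t \<in> prodM t X \<rightarrow>\<^sub>M prob_algebra (borel_of (X t))" using k step by (auto simp: kern_def)
  then have K': "K t \<in> seqcomp X K t \<rightarrow>\<^sub>M prob_algebra (borel_of (X t))" by measurable
  note [measurable_cong] = sets_sdp[OF M(2) K']
  note [measurable] = measurable_upd[of t X]
  have [measurable]: "(\<lambda>x. restrict x {..<s}) \<in> prodM t X \<rightarrow>\<^sub>M prodM s X" "(\<lambda>x. restrict x {..<s}) \<in> prodM (Suc t) X \<rightarrow>\<^sub>M prodM s X"
    using step by (auto intro!: measurable_prefix)
  have "distr (seqcomp X K (Suc t)) (prodM s X) (\<lambda>x. restrict x {..<s})
      = distr (sdp (seqcomp X K t) (borel_of (X t)) (K t)) (prodM s X) (\<lambda>z. restrict (fst z) {..<s})"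
    using step by (subst seqcomp_Suc[OF k]) (simp_all add: distr_distr comp_def prefix_upd)
  also have "\<dots> = distr (distr (sdp (seqcomp X K t) (borel_of (X t)) (K t)) (seqcomp X K t) fst) (prodM s X) (\<lambda>x. restrict x {..<s})"
    by (subst distr_distr) (auto simp: comp_def)
  also have "\<dots> = seqcomp X K s" unfolding distr_fst_sdp[OF M(2) K'] by (rule step.IH) (use step in simp)
  finally show ?case .
qed

section \<open>Adapted isomorphisms\<close>

definition adapted :: "nat \<Rightarrow> (nat \<Rightarrow> 'a topology) \<Rightarrow> (nat \<Rightarrow> 'b topology) \<Rightarrow> ((nat \<Rightarrow> 'a) \<Rightarrow> (nat \<Rightarrow> 'b)) \<Rightarrow> bool" where
  "adapted N X Y T \<longleftrightarrow> T \<in> prodM N X \<rightarrow>\<^sub>M prodM N Y \<and> (\<forall>t<N. T \<in> filtM N t X \<rightarrow>\<^sub>M filtM N t Y)"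

text \<open>Measurability and adaptedness hold at every path in both directions, inversion only
  almost surely and in one order. The asymmetry disappears by \<open>adapted_iso_sym\<close> and
  keeps the conditions to be checked at each time step few.\<close>

definition adapted_iso :: "nat \<Rightarrow> (nat \<Rightarrow> 'a topology) \<Rightarrow> (nat \<Rightarrow> 'b topology) \<Rightarrow> (nat \<Rightarrow> 'a) measure \<Rightarrow>
    (nat \<Rightarrow> 'b) measure \<Rightarrow> ((nat \<Rightarrow> 'a) \<Rightarrow> (nat \<Rightarrow> 'b)) \<Rightarrow> ((nat \<Rightarrow> 'b) \<Rightarrow> (nat \<Rightarrow> 'a)) \<Rightarrow> bool" where
  "adapted_iso N X Y \<mu> \<nu> T S \<longleftrightarrow> adapted N X Y T \<and> adapted N Y X S \<and> distr \<mu> \<nu> T = \<nu> \<and> (AE x in \<mu>. S (T x) = x)"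

definition path_measure :: "nat \<Rightarrow> (nat \<Rightarrow> 'a topology) \<Rightarrow> (nat \<Rightarrow> 'a) measure \<Rightarrow> bool" where
  "path_measure N X \<mu> \<longleftrightarrow> sets \<mu> = sets (prodM N X) \<and> prob_space \<mu> \<and> standard (prodM N X)"

lemma adapted_comp: "adapted N X Y T \<Longrightarrow> adapted N Y Z T' \<Longrightarrow> adapted N X Z (\<lambda>x. T' (T x))"
  unfolding adapted_def by (blast intro: measurable_compose[of T _ _ T'])

text \<open>The second inversion is the identity T (S (T x)) = T x read along the image law of
  \<open>T\<close>. Passing from x to y = T x needs the set of fixed points of \<open>T\<close>
  after \<open>S\<close> to be measurable, which is where standardness enters.\<close>

lemma adapted_iso_sym:
  assumes \<mu>: "path_measure N X \<mu>" and \<nu>: "path_measure N Y \<nu>" and T: "adapted_iso N X Y \<mu> \<nu> T S"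
  shows "adapted_iso N Y X \<nu> \<mu> S T"
proof -
  have [measurable_cong]: "sets \<mu> = sets (prodM N X)" "sets \<nu> = sets (prodM N Y)"
    using \<mu> \<nu> by (auto simp: path_measure_def)
  have [measurable]: "T \<in> prodM N X \<rightarrow>\<^sub>M prodM N Y" "S \<in> prodM N Y \<rightarrow>\<^sub>M prodM N X"
    and d: "distr \<mu> \<nu> T = \<nu>" and inv: "AE x in \<mu>. S (T x) = x"
    using T by (auto simp: adapted_iso_def adapted_def)
  have "distr \<nu> \<mu> S = distr (distr \<mu> \<nu> T) \<mu> S" by (simp add: d)
  also have "\<dots> = distr \<mu> \<mu> (\<lambda>x. S (T x))" by (subst distr_distr) (auto simp: comp_def)
  also have "\<dots> = distr \<mu> \<mu> (\<lambda>x. x)" by (rule distr_cong_AE) (use inv in auto)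
  also have "\<dots> = \<mu>" by (rule distr_id)
  finally have 1: "distr \<nu> \<mu> S = \<mu>" .
  have "{y \<in> space \<nu>. T (S y) = y} \<in> sets \<nu>"
  proof (rule measurable_eq_standard)
    show "standard (prodM N Y)" using \<nu> by (simp add: path_measure_def)
  qed measurable
  then have "(AE y in distr \<mu> \<nu> T. T (S y) = y) \<longleftrightarrow> (AE x in \<mu>. T (S (T x)) = T x)"
    by (intro AE_distr_iff) auto
  moreover have "AE x in \<mu>. T (S (T x)) = T x" using inv by eventually_elim simp
  ultimately have "AE y in distr \<mu> \<nu> T. T (S y) = y" by blast
  then have "AE y in \<nu>. T (S y) = y" unfolding d .
  with 1 T show ?thesis by (simp add: adapted_iso_def)
qed

lemma adapted_iso_trans:
  assumes [measurable_cong]: "sets \<mu> = sets (prodM N X)" "sets \<nu> = sets (prodM N Y)" "sets \<rho> = sets (prodM N Z)"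
    and T: "adapted_iso N X Y \<mu> \<nu> T S" "adapted_iso N Y Z \<nu> \<rho> T' S'"
  shows "adapted_iso N X Z \<mu> \<rho> (\<lambda>x. T' (T x)) (\<lambda>z. S (S' z))"
proof -
  have [measurable]: "T \<in> prodM N X \<rightarrow>\<^sub>M prodM N Y" "T' \<in> prodM N Y \<rightarrow>\<^sub>M prodM N Z"
    using T by (auto simp: adapted_iso_def adapted_def)
  have d: "distr \<mu> \<nu> T = \<nu>" "distr \<nu> \<rho> T' = \<rho>" using T by (auto simp: adapted_iso_def)
  have "distr \<mu> \<rho> (\<lambda>x. T' (T x)) = distr (distr \<mu> \<nu> T) \<rho> T'" by (subst distr_distr) (auto simp: comp_def)
  then have 1: "distr \<mu> \<rho> (\<lambda>x. T' (T x)) = \<rho>" by (simp add: d)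
  have "AE y in distr \<mu> \<nu> T. S' (T' y) = y" using T(2) unfolding d by (simp add: adapted_iso_def)
  then have "AE x in \<mu>. S' (T' (T x)) = T x" by (rule AE_distrD[rotated]) measurable
  moreover have "AE x in \<mu>. S (T x) = x" using T(1) by (simp add: adapted_iso_def)
  ultimately have "AE x in \<mu>. S (S' (T' (T x))) = x" by eventually_elim simp
  with 1 T show ?thesis by (auto simp: adapted_iso_def intro: adapted_comp)
qed

lemma adapted_extend:
  assumes T: "adapted n X Y T" and g: "g \<in> prodM n X \<Otimes>\<^sub>M borel_of (X n) \<rightarrow>\<^sub>M borel_of (Y n)"
  shows "adapted (Suc n) X Y (\<lambda>x. (T (restrict x {..<n}))(n := g (restrict x {..<n}, x n)))"
proof -
  let ?T = "\<lambda>x. (T (restrict x {..<n}))(n := g (restrict x {..<n}, x n))"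
  have Tm[measurable]: "T \<in> prodM n X \<rightarrow>\<^sub>M prodM n Y" using T by (simp add: adapted_def)
  note g[measurable]
  have pre[measurable]: "(\<lambda>x. restrict x {..<n}) \<in> prodM (Suc n) X \<rightarrow>\<^sub>M prodM n X" by (rule measurable_prefix) simp
  have m: "?T \<in> prodM (Suc n) X \<rightarrow>\<^sub>M prodM (Suc n) Y"
  proof -
    have "(\<lambda>x. (T (restrict x {..<n}), g (restrict x {..<n}, x n))) \<in> prodM (Suc n) X \<rightarrow>\<^sub>M prodM n Y \<Otimes>\<^sub>M borel_of (Y n)"
      by (intro measurable_Pair measurable_compose[OF pre Tm] measurable_compose[OF _ g] pre
          prodM_measurable_component[OF lessI measurable_ident_sets]) simp
    from measurable_compose[OF this measurable_upd] show ?thesis by simp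
  qed
  moreover have "?T \<in> filtM (Suc n) t X \<rightarrow>\<^sub>M filtM (Suc n) t Y" if t: "t < Suc n" for t
  proof (rule measurable_to_filtM)
    show "?T \<in> space (filtM (Suc n) t X) \<rightarrow> space (prodM (Suc n) Y)"
      using measurable_space[OF m] by auto
    have "(\<lambda>x. restrict (T (restrict x {..<n})) {..<t}) \<in> filtM (Suc n) t X \<rightarrow>\<^sub>M prodM t Y"
    \<comment> \<open>For the full past t = n the clause on filtrations in n steps is silent, since
      it ranges over t < n; measurability of \<open>T\<close> itself takes its place.\<close>
    proof (cases "t = n")
      case True
      have "(\<lambda>x. restrict (T x) {..<n}) \<in> prodM n X \<rightarrow>\<^sub>M prodM n Y"
        using measurable_compose[OF Tm measurable_prefix[of n n]] by simp
      from measurable_compose[OF measurable_from_filtM[of n "Suc n"] this] show ?thesis by (simp add: True)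
    next
      case False
      then have "T \<in> filtM n t X \<rightarrow>\<^sub>M filtM n t Y" using T t by (auto simp: adapted_def)
      moreover have "(\<lambda>x. restrict x {..<n}) \<in> filtM (Suc n) t X \<rightarrow>\<^sub>M filtM n t X"
      proof (rule measurable_to_filtM)
        show "(\<lambda>x. restrict x {..<n}) \<in> space (filtM (Suc n) t X) \<rightarrow> space (prodM n X)"
          using measurable_space[OF pre] by auto
        show "(\<lambda>x. restrict (restrict x {..<n}) {..<t}) \<in> filtM (Suc n) t X \<rightarrow>\<^sub>M prodM t X"
          unfolding prefix_prefix[OF less_Suc_eq_le[THEN iffD1, OF t]]
          using t by (intro measurable_from_filtM) simp
      qed (use t in simp)
      moreover have "(\<lambda>x. restrict x {..<t}) \<in> filtM n t Y \<rightarrow>\<^sub>M prodM t Y"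
        using t by (intro measurable_from_filtM) simp
      ultimately show ?thesis by (auto intro: measurable_compose)
    qed
    then show "(\<lambda>x. restrict (?T x) {..<t}) \<in> filtM (Suc n) t X \<rightarrow>\<^sub>M prodM t Y"
      using t by (simp add: prefix_upd)
  qed (use t in simp)
  ultimately show ?thesis by (simp add: adapted_def)
qed

text \<open>The induction step for all isomorphisms: once the pasts are matched by \<open>T\<close>,
  it suffices that \<open>g\<close> carries the conditional law at x to the one at
  \<open>T x\<close> and that \<open>h\<close> recovers the new coordinate, both for almost every
  past. The function \<open>h\<close> sees the past on the Y side, hence its argument
  \<open>T x\<close>.\<close>

lemma adapted_iso_extend:
  assumes K: "kern (Suc n) X K" and J: "kern (Suc n) Y J"
    and stX: "standard (prodM (Suc n) X)" and stb: "standard (borel_of (X n))"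
    and T: "adapted_iso n X Y (seqcomp X K n) (seqcomp Y J n) T S"
    and g[measurable]: "g \<in> prodM n X \<Otimes>\<^sub>M borel_of (X n) \<rightarrow>\<^sub>M borel_of (Y n)"
    and h[measurable]: "h \<in> prodM n Y \<Otimes>\<^sub>M borel_of (Y n) \<rightarrow>\<^sub>M borel_of (X n)"
    and push: "AE x in seqcomp X K n. distr (K n x) (borel_of (Y n)) (\<lambda>s. g (x, s)) = J n (T x)"
    and inv: "AE x in seqcomp X K n. AE s in K n x. h (T x, g (x, s)) = s"
  shows "adapted_iso (Suc n) X Y (seqcomp X K (Suc n)) (seqcomp Y J (Suc n))
    (\<lambda>x. (T (restrict x {..<n}))(n := g (restrict x {..<n}, x n)))
    (\<lambda>y. (S (restrict y {..<n}))(n := h (restrict y {..<n}, y n)))"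
    (is "adapted_iso _ _ _ _ _ ?T ?S")
proof -
  let ?\<mu> = "seqcomp X K n" and ?\<nu> = "seqcomp Y J n"
  have M: "sets ?\<mu> = sets (prodM n X)" "prob_space ?\<mu>" using seqcomp_sets_prob[OF K] by auto
  have N: "sets ?\<nu> = sets (prodM n Y)" "prob_space ?\<nu>" using seqcomp_sets_prob[OF J] by auto
  have M1: "sets (seqcomp X K (Suc n)) = sets (prodM (Suc n) X)" using seqcomp_sets_prob[OF K order_refl] by blast
  have N1: "sets (seqcomp Y J (Suc n)) = sets (prodM (Suc n) Y)" using seqcomp_sets_prob[OF J order_refl] by blast
  note [measurable_cong] = M(1) N(1) M1 N1
  have Tm[measurable]: "T \<in> prodM n X \<rightarrow>\<^sub>M prodM n Y" and Sm[measurable]: "S \<in> prodM n Y \<rightarrow>\<^sub>M prodM n X"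
    and d: "distr ?\<mu> ?\<nu> T = ?\<nu>" and ST: "AE x in ?\<mu>. S (T x) = x"
    using T by (auto simp: adapted_iso_def adapted_def)
  have Kn: "K n \<in> prodM n X \<rightarrow>\<^sub>M prob_algebra (borel_of (X n))" using K by (auto simp: kern_def)
  have Jn: "J n \<in> prodM n Y \<rightarrow>\<^sub>M prob_algebra (borel_of (Y n))" using J by (auto simp: kern_def)
  have Kn': "K n \<in> ?\<mu> \<rightarrow>\<^sub>M prob_algebra (borel_of (X n))" using Kn by measurable
  have Jn': "J n \<in> ?\<nu> \<rightarrow>\<^sub>M prob_algebra (borel_of (Y n))" using Jn by measurable
  note [measurable_cong] = sets_sdp[OF M(2) Kn'] sets_sdp[OF N(2) Jn']
  note [measurable] = measurable_upd[of n X] measurable_upd[of n Y]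
  have a: "adapted (Suc n) X Y ?T" "adapted (Suc n) Y X ?S"
    using T g h by (auto intro!: adapted_extend simp: adapted_iso_def)
  have [measurable]: "?T \<in> prodM (Suc n) X \<rightarrow>\<^sub>M prodM (Suc n) Y" "?S \<in> prodM (Suc n) Y \<rightarrow>\<^sub>M prodM (Suc n) X"
    using a by (auto simp: adapted_def)
  have Tup: "?T (x(n := s)) = (T x)(n := g (x, s))" if "x \<in> space (prodM n X)" for x s
    using prefix_id[OF that] by (simp add: prefix_upd)
  have Sup: "?S (y(n := s)) = (S y)(n := h (y, s))" if "y \<in> space (prodM n Y)" for y s
    using prefix_id[OF that] by (simp add: prefix_upd)
  let ?P = "sdp ?\<mu> (borel_of (X n)) (K n)"
  have spP: "z \<in> space ?P \<Longrightarrow> fst z \<in> space (prodM n X)" for z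
    using space_sdp[OF M(2) Kn'] sets_eq_imp_space_eq[OF M(1)] by auto
  interpret P: prob_space ?P by (rule prob_space_sdp[OF M(2) Kn'])
  \<comment> \<open>The transported past and the new coordinate are disintegrated along the law of
    \<open>T\<close>: the conditional law of the coordinate is \<open>J n (T x)\<close>, a function
    of \<open>T x\<close> alone.\<close>
  have push2: "distr ?P (?\<nu> \<Otimes>\<^sub>M borel_of (Y n)) (\<lambda>z. (T (fst z), g z)) = sdp ?\<nu> (borel_of (Y n)) (J n)"
  proof (rule sdp_eqI[OF N(2) Jn'])
    fix A B assume [measurable]: "A \<in> sets ?\<nu>" and B[measurable]: "B \<in> sets (borel_of (Y n))"
    have "emeasure (distr ?P (?\<nu> \<Otimes>\<^sub>M borel_of (Y n)) (\<lambda>z. (T (fst z), g z))) (A \<times> B) =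
        (\<integral>\<^sup>+z. indicator (A \<times> B) (T (fst z), g z) \<partial>?P)"
      by (subst nn_integral_indicator[symmetric]) (auto simp: nn_integral_distr simp del: nn_integral_indicator)
    also have "\<dots> = (\<integral>\<^sup>+x. \<integral>\<^sup>+s. indicator (A \<times> B) (T x, g (x, s)) \<partial>K n x \<partial>?\<mu>)"
      by (subst nn_integral_sdp[OF M(2) Kn']) auto
    also have "\<dots> = (\<integral>\<^sup>+x. emeasure (J n (T x)) B * indicator A (T x) \<partial>?\<mu>)"
    proof (rule nn_integral_cong_AE)
      show "AE x in ?\<mu>. (\<integral>\<^sup>+s. indicator (A \<times> B) (T x, g (x, s)) \<partial>K n x) = emeasure (J n (T x)) B * indicator A (T x)"
        using push AE_space
      proof eventually_elim
        case (elim x)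
        note x = elim(2)
        have x': "x \<in> space (prodM n X)" using x sets_eq_imp_space_eq[OF M(1)] by simp
        note [measurable_cong] = prob_kernelD(2)[OF Kn' x]
        have gx[measurable]: "(\<lambda>s. g (x, s)) \<in> K n x \<rightarrow>\<^sub>M borel_of (Y n)" using x' by measurable
        have "(\<integral>\<^sup>+s. indicator (A \<times> B) (T x, g (x, s)) \<partial>K n x) = (\<integral>\<^sup>+s. indicator A (T x) * indicator B (g (x, s)) \<partial>K n x)"
          by (simp add: indicator_times)
        also have "\<dots> = indicator A (T x) * (\<integral>\<^sup>+s. indicator B (g (x, s)) \<partial>K n x)"
          by (rule nn_integral_cmult) measurable
        also have "(\<integral>\<^sup>+s. indicator B (g (x, s)) \<partial>K n x) = (\<integral>\<^sup>+s. indicator B s \<partial>distr (K n x) (borel_of (Y n)) (\<lambda>s. g (x, s)))"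
          by (subst nn_integral_distr) auto
        also have "\<dots> = emeasure (J n (T x)) B"
          using B prob_kernelD(2)[OF Jn measurable_space[OF Tm x']]
          by (subst nn_integral_indicator) (simp_all add: elim(1))
        finally show ?case by (simp add: mult.commute)
      qed
    qed
    also have "\<dots> = (\<integral>\<^sup>+y. emeasure (J n y) B * indicator A y \<partial>distr ?\<mu> ?\<nu> T)"
      using measurable_prob_algebraD[OF Jn] by (subst nn_integral_distr) auto
    finally show "emeasure (distr ?P (?\<nu> \<Otimes>\<^sub>M borel_of (Y n)) (\<lambda>z. (T (fst z), g z))) (A \<times> B)
      = (\<integral>\<^sup>+y. emeasure (J n y) B * indicator A y \<partial>?\<nu>)" by (simp add: d)
  qed simp
  have "distr (seqcomp X K (Suc n)) (seqcomp Y J (Suc n)) ?T = distr (seqcomp X K (Suc n)) (prodM (Suc n) Y) ?T"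
    by (rule distr_cong) (simp_all add: N1 del: seqcomp.simps)
  also have "\<dots> = distr ?P (prodM (Suc n) Y) (\<lambda>z. ?T ((fst z)(n := snd z)))"
    unfolding seqcomp_Suc[OF K lessI] by (subst distr_distr) (auto simp: comp_def)
  also have "\<dots> = distr ?P (prodM (Suc n) Y) (\<lambda>z. (T (fst z))(n := g z))"
    by (intro distr_cong refl) (simp only: Tup[OF spP] prod.collapse)
  also have "\<dots> = distr (distr ?P (?\<nu> \<Otimes>\<^sub>M borel_of (Y n)) (\<lambda>z. (T (fst z), g z))) (prodM (Suc n) Y) (\<lambda>z. (fst z)(n := snd z))"
    by (subst distr_distr) (auto simp: comp_def)
  also have "\<dots> = seqcomp Y J (Suc n)" unfolding push2 seqcomp_Suc[OF J lessI] ..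
  finally have 1: "distr (seqcomp X K (Suc n)) (seqcomp Y J (Suc n)) ?T = seqcomp Y J (Suc n)" .
  have hm: "{z \<in> space (prodM n X \<Otimes>\<^sub>M borel_of (X n)). h (T (fst z), g z) = snd z} \<in> sets (prodM n X \<Otimes>\<^sub>M borel_of (X n))"
    by (rule measurable_eq_standard[OF stb]) measurable
  have "AE z in ?P. h (T (fst z), g z) = snd z"
    using hm inv by (subst AE_sdp[OF M(2) Kn']) (auto simp: pred_def)
  moreover have "AE z in ?P. S (T (fst z)) = fst z"
  proof -
    have "AE x in distr ?P ?\<mu> fst. S (T x) = x" unfolding distr_fst_sdp[OF M(2) Kn'] by (rule ST)
    then show ?thesis by (rule AE_distrD[rotated]) measurable
  qed
  ultimately have "AE z in ?P. ?S (?T ((fst z)(n := snd z))) = (fst z)(n := snd z)"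
    using AE_space
  proof eventually_elim
    case (elim z)
    have x: "fst z \<in> space (prodM n X)" by (rule spP[OF elim(3)])
    show ?case using elim measurable_space[OF Tm x] by (simp only: Tup[OF x] Sup[OF measurable_space[OF Tm x]] prod.collapse)
  qed
  moreover have "{x \<in> space (prodM (Suc n) X). ?S (?T x) = x} \<in> sets (prodM (Suc n) X)"
    by (rule measurable_eq_standard[OF stX]) measurable
  ultimately have "AE x in seqcomp X K (Suc n). ?S (?T x) = x"
    unfolding seqcomp_Suc[OF K lessI] by (subst AE_distr_iff) auto
  with 1 a show ?thesis unfolding adapted_iso_def by simp
qed

section \<open>The uniform law on the cube\<close>

abbreviation RR :: "nat \<Rightarrow> real topology" where "RR \<equiv> \<lambda>_. euclideanreal"

text \<open>A composition of constant kernels on the real line, so that the cube law is itself a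
  path law and the results on \<open>seqcomp\<close> apply to it. Only the open unit cube is
  charged.\<close>

definition cube :: "nat \<Rightarrow> (nat \<Rightarrow> real) measure" where
  "cube n = seqcomp RR (\<lambda>_ _. unif) n"

lemma borel_of_real [simp]: "borel_of euclideanreal = borel"
  by (simp add: borel_of_def borel_def)

lemma unif_in_prob_algebra: "unif \<in> space (prob_algebra borel)"
  by (simp add: space_prob_algebra prob_space_unif)

lemma kern_unif: "kern n RR (\<lambda>_ _. unif)"
  unfolding kern_def by (auto intro!: measurable_const unif_in_prob_algebra)

lemma standard_cube: "standard (prodM n RR)"
  by (rule standard_prodM) (simp add: standard_real)

lemma sets_cube [measurable_cong]: "sets (cube n) = sets (prodM n RR)" and prob_space_cube: "prob_space (cube n)"
  unfolding cube_def using seqcomp_sets_prob[OF kern_unif order_refl] by auto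

lemma path_measure_cube: "path_measure n RR (cube n)"
  by (simp add: path_measure_def sets_cube prob_space_cube standard_cube)

lemma adapted_0: "adapted 0 X Y (\<lambda>_ _. undefined)"
  unfolding adapted_def by (intro conjI allI impI measurable_const) (simp_all add: space_prodM)

text \<open>The triangular (Knothe-Rosenblatt) transform: coordinate n of the cube is fed into the
  quantile function of the kernel taken at the path already built. The inverse evaluates the
  conditional distribution function at the actual past of the path.\<close>

lemma iso_cube:
  assumes "kern n X K" and st: "\<And>t. t < n \<Longrightarrow> standard (borel_of (X t))"
    and at: "\<And>t x a. t < n \<Longrightarrow> x \<in> space (prodM t X) \<Longrightarrow> emeasure (K t x) {a} = 0"
  shows "\<exists>T S. adapted_iso n RR X (cube n) (seqcomp X K n) T S"
  using assms
proof (induction n)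
  case 0
  have "adapted_iso 0 RR X (cube 0) (seqcomp X K 0) (\<lambda>_ _. undefined) (\<lambda>_ _. undefined)"
  proof -
    have "distr (cube 0) (seqcomp X K 0) (\<lambda>_ _. undefined) = seqcomp X K 0"
    proof -
      have "distr (cube 0) (seqcomp X K 0) (\<lambda>_ _. undefined) = return (seqcomp X K 0) (\<lambda>_. undefined)"
        unfolding cube_def seqcomp.simps(1) by (rule distr_return) (auto simp: space_prodM intro!: measurable_const)
      also have "\<dots> = seqcomp X K 0" unfolding seqcomp.simps(1) by (rule fun_cong[OF return_sets_cong]) (rule sets_return)
      finally show ?thesis .
    qed
    moreover have "AE x in cube 0. (\<lambda>_. undefined) = x"
      using AE_space by eventually_elim (auto simp: cube_def space_prodM)
    ultimately show ?thesis unfolding adapted_iso_def by (intro conjI adapted_0)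
  qed
  then show ?case by blast
next
  case (Suc n)
  have k: "kern n X K" using Suc(2) by (auto simp: kern_def)
  obtain T S where T: "adapted_iso n RR X (cube n) (seqcomp X K n) T S"
    using Suc.IH[OF k] Suc.prems(2,3) less_SucI by metis
  have Kn: "K n \<in> prodM n X \<rightarrow>\<^sub>M prob_algebra (borel_of (X n))" using Suc(2) by (auto simp: kern_def)
  obtain Q F where Q[measurable]: "Q \<in> prodM n X \<Otimes>\<^sub>M borel \<rightarrow>\<^sub>M borel_of (X n)"
    and F[measurable]: "F \<in> borel_measurable (prodM n X \<Otimes>\<^sub>M borel_of (X n))"
    and QK: "\<And>x. x \<in> space (prodM n X) \<Longrightarrow> distr unif (borel_of (X n)) (\<lambda>u. Q (x, u)) = K n x"
    and FQ: "\<And>x. x \<in> space (prodM n X) \<Longrightarrow> AE u in unif. F (x, Q (x, u)) = u"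
    by (rule quantile_kernel[OF Suc.prems(2)[OF lessI] Kn Suc.prems(3)[OF lessI]]) (assumption, rule that)
  have Tm[measurable]: "T \<in> prodM n RR \<rightarrow>\<^sub>M prodM n X" using T by (auto simp: adapted_iso_def adapted_def)
  have sp: "AE u in cube n. T u \<in> space (prodM n X)"
    using AE_space by eventually_elim (use measurable_space[OF Tm] in \<open>simp add: sets_eq_imp_space_eq[OF sets_cube]\<close>)
  have "adapted_iso (Suc n) RR X (cube (Suc n)) (seqcomp X K (Suc n))
      (\<lambda>x. (T (restrict x {..<n}))(n := (\<lambda>z. Q (T (fst z), snd z)) (restrict x {..<n}, x n)))
      (\<lambda>y. (S (restrict y {..<n}))(n := F (restrict y {..<n}, y n)))"
    unfolding cube_def
  proof (rule adapted_iso_extend[OF kern_unif Suc.prems(1) standard_cube])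
    show "adapted_iso n RR X (seqcomp RR (\<lambda>_ _. unif) n) (seqcomp X K n) T S" using T by (simp add: cube_def)
    show "AE x in seqcomp RR (\<lambda>_ _. unif) n. distr unif (borel_of (X n)) (\<lambda>s. Q (T (fst (x, s)), snd (x, s))) = K n (T x)"
      using sp unfolding cube_def by eventually_elim (simp add: QK)
    show "AE x in seqcomp RR (\<lambda>_ _. unif) n. AE s in unif. F (T x, Q (T (fst (x, s)), snd (x, s))) = s"
      using sp unfolding cube_def by eventually_elim (simp add: FQ)
  qed (simp_all add: standard_real)
  then show ?case by blast
qed

section \<open>Interval exchanges and prescribed cell masses\<close>

lemma emeasure_unif_atLeast: "A \<in> sets borel \<Longrightarrow> emeasure unif A = emeasure lborel (A \<inter> {0..<1})"
  unfolding emeasure_unif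
proof (rule emeasure_eq_AE)
  show "AE x in lborel. (x \<in> A \<inter> {0<..<1}) = (x \<in> A \<inter> {0..<1})"
    using AE_lborel_singleton[of 0] by eventually_elim auto
qed auto

text \<open>The intervals are laid end to end from c. Half-open intervals tile exactly, and length
  zero gives an empty piece without further case distinction.\<close>

lemma interval_partition:
  fixes l :: "'i \<Rightarrow> real"
  assumes "finite P" "\<And>p. p \<in> P \<Longrightarrow> 0 \<le> l p"
  shows "\<exists>a. disjoint_family_on (\<lambda>p. {a p..<a p + l p}) P \<and> (\<Union>p\<in>P. {a p..<a p + l p}) = {c..<c + sum l P}"
  using assms
proof (induction P)
  case empty
  then show ?case by (simp add: disjoint_family_on_def)
next
  case (insert q P)
  then obtain a where a: "disjoint_family_on (\<lambda>p. {a p..<a p + l p}) P" "(\<Union>p\<in>P. {a p..<a p + l p}) = {c..<c + sum l P}"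
    by auto
  let ?b = "a(q := c + sum l P)"
  have eq: "{?b p..<?b p + l p} = {a p..<a p + l p}" if "p \<in> P" for p using that insert by auto
  have nn: "0 \<le> sum l P" "0 \<le> l q" using insert by (auto intro: sum_nonneg)
  have "(\<Union>p\<in>insert q P. {?b p..<?b p + l p}) = {?b q..<?b q + l q} \<union> (\<Union>p\<in>P. {?b p..<?b p + l p})" by simp
  also have "(\<Union>p\<in>P. {?b p..<?b p + l p}) = {c..<c + sum l P}" unfolding a(2)[symmetric] by (rule SUP_cong[OF refl eq])
  also have "{?b q..<?b q + l q} \<union> {c..<c + sum l P} = {c..<c + sum l (insert q P)}"
    using nn insert(1,2) by auto
  finally have "(\<Union>p\<in>insert q P. {?b p..<?b p + l p}) = {c..<c + sum l (insert q P)}" .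
  moreover have "disjoint_family_on (\<lambda>p. {?b p..<?b p + l p}) (insert q P)"
  proof -
    have "{?b q..<?b q + l q} \<inter> (\<Union>p\<in>P. {?b p..<?b p + l p}) = {}"
      using eq a(2) by auto
    moreover have "disjoint_family_on (\<lambda>p. {?b p..<?b p + l p}) P"
      using a(1) eq unfolding disjoint_family_on_def by metis
    ultimately show ?thesis using insert(2) by (subst disjoint_family_on_insert) auto
  qed
  ultimately show ?case by (intro exI[of _ ?b] conjI)
qed

text \<open>Each piece is moved by a translation, so Lebesgue measure is preserved piece by piece;
  exchanging the roles of a and b gives the inverse on [0, 1), which carries
  \<open>unif\<close>.\<close>

lemma interval_exchange:
  fixes a b l :: "'i \<Rightarrow> real"
  assumes P: "finite P"
    and I: "disjoint_family_on (\<lambda>p. {a p..<a p + l p}) P" "(\<Union>p\<in>P. {a p..<a p + l p}) = {0..<1}"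
    and J: "disjoint_family_on (\<lambda>p. {b p..<b p + l p}) P" "(\<Union>p\<in>P. {b p..<b p + l p}) = {0..<1}"
  obtains \<tau> \<tau>' where "\<tau> \<in> borel_measurable borel" "\<tau>' \<in> borel_measurable borel" "distr unif borel \<tau> = unif"
    "AE u in unif. \<tau>' (\<tau> u) = u" "\<And>p u. p \<in> P \<Longrightarrow> u \<in> {a p..<a p + l p} \<Longrightarrow> \<tau> u \<in> {b p..<b p + l p}"
proof -
  \<comment> \<open>At most one summand is active, so on the pieces the sum is the translation of
    the piece containing u. As a finite sum of Borel functions it is measurable.\<close>
  define X where "X a b u = (\<Sum>p\<in>P. indicator {a p..<a p + l p} u * (u - a p + b p))" for a b :: "'i \<Rightarrow> real" and u
  have Xp: "X a b u = u - a p + b p"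
    if "disjoint_family_on (\<lambda>p. {a p..<a p + l p}) P" "p \<in> P" "u \<in> {a p..<a p + l p}" for a b p u
  proof -
    have "X a b u = (\<Sum>q\<in>P. if q = p then u - a p + b p else 0)"
      unfolding X_def
    proof (rule sum.cong)
      fix q assume "q \<in> P"
      then have "q \<noteq> p \<Longrightarrow> u \<notin> {a q..<a q + l q}"
        using that unfolding disjoint_family_on_def by blast
      then show "indicator {a q..<a q + l q} u * (u - a q + b q) = (if q = p then u - a p + b p else 0)"
        using that(3) by auto
    qed simp
    then show ?thesis using P that(2) by simp
  qed
  have m[measurable]: "X a b \<in> borel_measurable borel" for a b unfolding X_def by measurable
  have im: "X a b u \<in> {b p..<b p + l p}" if "p \<in> P" "u \<in> {a p..<a p + l p}" for p u
    using Xp[OF I(1) that] that(2) by auto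
  have "distr unif borel (X a b) = unif"
  proof (rule measure_eqI)
    fix S assume "S \<in> sets (distr unif borel (X a b))"
    then have S[measurable]: "S \<in> sets borel" by simp
    have "emeasure (distr unif borel (X a b)) S = emeasure lborel ((X a b -` S) \<inter> (\<Union>p\<in>P. {a p..<a p + l p}))"
      unfolding I(2) by (subst emeasure_distr) (auto simp: emeasure_unif_atLeast measurable_sets_borel[OF m])
    also have "(X a b -` S) \<inter> (\<Union>p\<in>P. {a p..<a p + l p}) = (\<Union>p\<in>P. (+) (b p - a p) -` (S \<inter> {b p..<b p + l p}))"
    proof (intro set_eqI iffI)
      fix u assume "u \<in> (X a b -` S) \<inter> (\<Union>p\<in>P. {a p..<a p + l p})"
      then obtain p where p: "p \<in> P" "u \<in> {a p..<a p + l p}" "X a b u \<in> S" by auto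
      then have "b p - a p + u \<in> S \<inter> {b p..<b p + l p}" using Xp[OF I(1) p(1,2), of b] by (auto simp: algebra_simps)
      then show "u \<in> (\<Union>p\<in>P. (+) (b p - a p) -` (S \<inter> {b p..<b p + l p}))" using p(1) by blast
    next
      fix u assume "u \<in> (\<Union>p\<in>P. (+) (b p - a p) -` (S \<inter> {b p..<b p + l p}))"
      then obtain p where p: "p \<in> P" "b p - a p + u \<in> S" "b p - a p + u \<in> {b p..<b p + l p}" by auto
      then have u: "u \<in> {a p..<a p + l p}" by auto
      have "X a b u = b p - a p + u" using Xp[OF I(1) p(1) u, of b] by simp
      then show "u \<in> (X a b -` S) \<inter> (\<Union>p\<in>P. {a p..<a p + l p})" using p u by auto
    qed
    also have "emeasure lborel \<dots> = (\<Sum>p\<in>P. emeasure lborel ((+) (b p - a p) -` (S \<inter> {b p..<b p + l p})))"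
    proof (rule sum_emeasure[symmetric])
      show "disjoint_family_on (\<lambda>p. (+) (b p - a p) -` (S \<inter> {b p..<b p + l p})) P"
        using I(1) unfolding disjoint_family_on_def
      proof (intro ballI impI)
        fix p q assume *: "\<forall>m\<in>P. \<forall>n\<in>P. m \<noteq> n \<longrightarrow> {a m..<a m + l m} \<inter> {a n..<a n + l n} = {}" "p \<in> P" "q \<in> P" "p \<noteq> q"
        have "(+) (b p - a p) -` (S \<inter> {b p..<b p + l p}) \<subseteq> {a p..<a p + l p}" for p by auto
        then show "(+) (b p - a p) -` (S \<inter> {b p..<b p + l p}) \<inter> (+) (b q - a q) -` (S \<inter> {b q..<b q + l q}) = {}"
          using * by blast
      qed
      show "(\<lambda>p. (+) (b p - a p) -` (S \<inter> {b p..<b p + l p})) ` P \<subseteq> sets lborel"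
        by (auto intro!: measurable_sets_borel[where M = borel])
    qed (rule P)
    also have "\<dots> = (\<Sum>p\<in>P. emeasure lborel (S \<inter> {b p..<b p + l p}))"
    proof (rule sum.cong)
      fix p assume "p \<in> P"
      have "emeasure lborel (S \<inter> {b p..<b p + l p}) = emeasure (distr lborel borel ((+) (b p - a p))) (S \<inter> {b p..<b p + l p})"
        by (simp add: lborel_distr_plus)
      then show "emeasure lborel ((+) (b p - a p) -` (S \<inter> {b p..<b p + l p})) = emeasure lborel (S \<inter> {b p..<b p + l p})"
        by (subst (asm) emeasure_distr) auto
    qed simp
    also have "\<dots> = emeasure lborel (\<Union>p\<in>P. S \<inter> {b p..<b p + l p})"
    proof (intro sum_emeasure P)
      show "disjoint_family_on (\<lambda>p. S \<inter> {b p..<b p + l p}) P"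
        using J(1) unfolding disjoint_family_on_def by (meson Int_lower2 disjoint_iff subsetD)
    qed auto
    also have "\<dots> = emeasure unif S"
      using J(2) by (simp add: emeasure_unif_atLeast Int_UN_distrib[symmetric])
    finally show "emeasure (distr unif borel (X a b)) S = emeasure unif S" .
  qed simp
  moreover have "AE u in unif. X b a (X a b u) = u"
    using AE_unif
  proof eventually_elim
    case (elim u)
    then have "u \<in> (\<Union>p\<in>P. {a p..<a p + l p})" unfolding I(2) by simp
    then obtain p where p: "p \<in> P" "u \<in> {a p..<a p + l p}" by blast
    then show ?case using Xp[OF J(1) p(1) im[OF p]] Xp[OF I(1) p] by simp
  qed
  ultimately show ?thesis using that[OF m m] im by blast
qed

section \<open>Cells of the unit interval\<close>

definition cell :: "nat \<Rightarrow> real \<Rightarrow> nat" where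
  "cell m u = (if 0 \<le> u \<and> u < 1 then nat \<lfloor>real m * u\<rfloor> else 0)"

lemma measurable_cell [measurable]: "cell m \<in> borel \<rightarrow>\<^sub>M count_space UNIV"
  unfolding cell_def by measurable

text \<open>The default value 0 outside [0, 1) makes the bound hold for every real, so cell vectors
  range over a finite set without an almost-sure clause.\<close>

lemma cell_less: "0 < m \<Longrightarrow> cell m u < m"
  unfolding cell_def by (auto simp: nat_less_iff floor_less_iff)

lemma cell_eq_iff:
  assumes "0 < m" "0 \<le> u" "u < 1"
  shows "cell m u = i \<longleftrightarrow> u \<in> {real i / m..<real i / m + 1 / m}"
proof -
  have "cell m u = i \<longleftrightarrow> \<lfloor>real m * u\<rfloor> = int i" using assms by (auto simp: cell_def)
  also have "\<dots> \<longleftrightarrow> real i \<le> real m * u \<and> real m * u < real i + 1" by (simp add: floor_eq_iff)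
  also have "\<dots> \<longleftrightarrow> u \<in> {real i / m..<real i / m + 1 / m}" using assms by (auto simp: field_simps)
  finally show ?thesis .
qed

lemma cell_interval_subset:
  fixes i m :: nat
  shows "i < m \<Longrightarrow> {real i / m..<real i / m + 1 / m} \<subseteq> {0..<1}"
proof -
  assume "i < m"
  then have "real i + 1 \<le> real m" by linarith
  then have "real i / m + 1 / m \<le> 1" using \<open>i < m\<close> by (simp add: field_simps)
  moreover have "0 \<le> real i / m" by simp
  ultimately show ?thesis unfolding subset_eq Ball_def atLeastLessThan_iff by (intro allI impI) linarith
qed

lemma emeasure_unif_cell: "i < m \<Longrightarrow> emeasure unif {u. cell m u = i} = ennreal (1 / m)"
proof -
  assume i: "i < m"
  then have "emeasure unif {u. cell m u = i} = emeasure lborel ({u. cell m u = i} \<inter> {0..<1})"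
    by (intro emeasure_unif_atLeast) measurable
  also have "{u. cell m u = i} \<inter> {0..<1} = {real i / m..<real i / m + 1 / m}"
  proof (intro set_eqI iffI)
    fix u assume "u \<in> {u. cell m u = i} \<inter> {0..<1}"
    then show "u \<in> {real i / m..<real i / m + 1 / m}" using cell_eq_iff[of m u i] i by (simp del: atLeastLessThan_iff) auto
  next
    fix u assume u: "u \<in> {real i / m..<real i / m + 1 / m}"
    then have "u \<in> {0..<1}" using cell_interval_subset[OF i] by blast
    then show "u \<in> {u. cell m u = i} \<inter> {0..<1}" using u cell_eq_iff[of m u i] i by auto
  qed
  finally show ?thesis by simp
qed

text \<open>Cell i is cut into pieces of lengths M i j over j, and cell j into pieces of the same
  lengths over i; the row and column sums 1/m say precisely that both families fill their cells.
  Moving piece (i, j) of the first cutting onto piece (i, j) of the second takes mass M i j from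
  cell i to cell j.\<close>

lemma doubly_stochastic_exchange:
  assumes m: "0 < m" and nn: "\<And>i j. i < m \<Longrightarrow> j < m \<Longrightarrow> 0 \<le> M i j"
    and row: "\<And>i. i < m \<Longrightarrow> (\<Sum>j<m. M i j) = 1 / m" and col: "\<And>j. j < m \<Longrightarrow> (\<Sum>i<m. M i j) = 1 / m"
  shows "\<exists>\<tau> \<tau>'. \<tau> \<in> borel_measurable borel \<and> \<tau>' \<in> borel_measurable borel \<and> distr unif borel \<tau> = unif \<and>
    (AE u in unif. \<tau>' (\<tau> u) = u) \<and>
    (\<forall>i<m. \<forall>j<m. emeasure unif {u. cell m u = i \<and> cell m (\<tau> u) = j} = ennreal (M i j))"
proof -
  \<comment> \<open>Used for \<open>M\<close> and for its transpose, to cut the source and the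
    target cells.\<close>
  have part: "\<exists>a. \<forall>i<m. disjoint_family_on (\<lambda>j. {a i j..<a i j + R i j}) {..<m} \<and>
      (\<Union>j<m. {a i j..<a i j + R i j}) = {real i / m..<real i / m + 1 / m}"
    if "\<And>i j. i < m \<Longrightarrow> j < m \<Longrightarrow> 0 \<le> R i j" "\<And>i. i < m \<Longrightarrow> (\<Sum>j<m. R i j) = 1 / m" for R :: "nat \<Rightarrow> nat \<Rightarrow> real"
  proof -
    have "\<forall>i. \<exists>a. i < m \<longrightarrow> disjoint_family_on (\<lambda>j. {a j..<a j + R i j}) {..<m} \<and>
      (\<Union>j<m. {a j..<a j + R i j}) = {real i / m..<real i / m + 1 / m}"
    proof
      fix i
      show "\<exists>a. i < m \<longrightarrow> disjoint_family_on (\<lambda>j. {a j..<a j + R i j}) {..<m} \<and>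
        (\<Union>j<m. {a j..<a j + R i j}) = {real i / m..<real i / m + 1 / m}"
      proof (cases "i < m")
        case True
        then show ?thesis using interval_partition[of "{..<m}" "R i" "real i / m"] that by auto
      qed simp
    qed
    then show ?thesis by (rule choice[THEN exE]) blast
  qed
  have "\<exists>a. \<forall>i<m. disjoint_family_on (\<lambda>j. {a i j..<a i j + M i j}) {..<m} \<and>
      (\<Union>j<m. {a i j..<a i j + M i j}) = {real i / m..<real i / m + 1 / m}"
    by (rule part) (use nn row in auto)
  then obtain a where a': "\<forall>i<m. disjoint_family_on (\<lambda>j. {a i j..<a i j + M i j}) {..<m} \<and>
      (\<Union>j<m. {a i j..<a i j + M i j}) = {real i / m..<real i / m + 1 / m}" by (rule exE)
  then have a: "\<And>i. i < m \<Longrightarrow> disjoint_family_on (\<lambda>j. {a i j..<a i j + M i j}) {..<m}"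
      "\<And>i. i < m \<Longrightarrow> (\<Union>j<m. {a i j..<a i j + M i j}) = {real i / m..<real i / m + 1 / m}"
    by simp_all
  have "\<exists>b. \<forall>j<m. disjoint_family_on (\<lambda>i. {b j i..<b j i + M i j}) {..<m} \<and>
      (\<Union>i<m. {b j i..<b j i + M i j}) = {real j / m..<real j / m + 1 / m}"
    by (rule part[of "\<lambda>j i. M i j"]) (use nn col in auto)
  then obtain b where "\<forall>j<m. disjoint_family_on (\<lambda>i. {b j i..<b j i + M i j}) {..<m} \<and>
      (\<Union>i<m. {b j i..<b j i + M i j}) = {real j / m..<real j / m + 1 / m}" by (rule exE)
  then have b: "\<And>j. j < m \<Longrightarrow> disjoint_family_on (\<lambda>i. {b j i..<b j i + M i j}) {..<m}"
      "\<And>j. j < m \<Longrightarrow> (\<Union>i<m. {b j i..<b j i + M i j}) = {real j / m..<real j / m + 1 / m}"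
    by simp_all
  let ?P = "{..<m} \<times> {..<m}"
  define A where "A p = {a (fst p) (snd p)..<a (fst p) (snd p) + M (fst p) (snd p)}" for p
  define B where "B p = {b (snd p) (fst p)..<b (snd p) (fst p) + M (fst p) (snd p)}" for p
  have Acell: "u \<in> {0..<1} \<and> cell m u = fst p" if "p \<in> ?P" "u \<in> A p" for p u
  proof -
    have "u \<in> (\<Union>j<m. {a (fst p) j..<a (fst p) j + M (fst p) j})" "fst p < m"
      using that by (auto simp: A_def)
    then have 1: "u \<in> {real (fst p) / m..<real (fst p) / m + 1 / m}" using a(2) by blast
    then have "u \<in> {0..<1}" using cell_interval_subset[OF \<open>fst p < m\<close>] by blast
    with 1 show ?thesis using cell_eq_iff[of m u "fst p"] m by auto
  qed
  have Bcell: "u \<in> {0..<1} \<and> cell m u = snd p" if "p \<in> ?P" "u \<in> B p" for p u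
  proof -
    have "u \<in> (\<Union>i<m. {b (snd p) i..<b (snd p) i + M i (snd p)})" "snd p < m"
      using that by (auto simp: B_def)
    then have 1: "u \<in> {real (snd p) / m..<real (snd p) / m + 1 / m}" using b(2) by blast
    then have "u \<in> {0..<1}" using cell_interval_subset[OF \<open>snd p < m\<close>] by blast
    with 1 show ?thesis using cell_eq_iff[of m u "snd p"] m by auto
  qed
  have cov: "u \<in> {real (cell m u) / m..<real (cell m u) / m + 1 / m}" "cell m u < m" if "u \<in> {0..<1}" for u
    using cell_eq_iff[of m u "cell m u"] cell_less[OF m] that m by auto
  have dA: "disjoint_family_on A ?P"
    unfolding disjoint_family_on_def
  proof (intro ballI impI)
    fix p q assume pq: "p \<in> ?P" "q \<in> ?P" "p \<noteq> q"
    show "A p \<inter> A q = {}"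
    proof (cases "fst p = fst q")
      case True
      then have "snd p \<noteq> snd q" using pq by (auto simp: prod_eq_iff)
      then have "{a (fst p) (snd p)..<a (fst p) (snd p) + M (fst p) (snd p)} \<inter> {a (fst p) (snd q)..<a (fst p) (snd q) + M (fst p) (snd q)} = {}"
        using pq(1,2) unfolding mem_Times_iff lessThan_iff by (intro disjoint_family_onD[OF a(1)]) simp_all
      then show ?thesis by (simp only: A_def True)
    next
      case False
      show ?thesis
      proof (rule equals0I)
        fix u assume "u \<in> A p \<inter> A q"
        then have "cell m u = fst p" "cell m u = fst q" using Acell[OF pq(1), of u] Acell[OF pq(2), of u] by simp_all
        then show False using False by simp
      qed
    qed
  qed
  have dB: "disjoint_family_on B ?P"
    unfolding disjoint_family_on_def
  proof (intro ballI impI)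
    fix p q assume pq: "p \<in> ?P" "q \<in> ?P" "p \<noteq> q"
    show "B p \<inter> B q = {}"
    proof (cases "snd p = snd q")
      case True
      then have "fst p \<noteq> fst q" using pq by (auto simp: prod_eq_iff)
      then have "{b (snd p) (fst p)..<b (snd p) (fst p) + M (fst p) (snd p)} \<inter> {b (snd p) (fst q)..<b (snd p) (fst q) + M (fst q) (snd p)} = {}"
        using pq(1,2) unfolding mem_Times_iff lessThan_iff by (intro disjoint_family_onD[OF b(1), of "snd p" "fst p" "fst q"]) simp_all
      then show ?thesis by (simp only: B_def True)
    next
      case False
      show ?thesis
      proof (rule equals0I)
        fix u assume "u \<in> B p \<inter> B q"
        then have "cell m u = snd p" "cell m u = snd q" using Bcell[OF pq(1), of u] Bcell[OF pq(2), of u] by simp_all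
        then show False using False by simp
      qed
    qed
  qed
  have uA: "(\<Union>p\<in>?P. A p) = {0..<1}"
  proof (intro equalityI subsetI)
    fix u :: real assume "u \<in> {0..<1}"
    then have "u \<in> (\<Union>j<m. {a (cell m u) j..<a (cell m u) j + M (cell m u) j})" using cov a(2) by blast
    then obtain j where "j < m" "u \<in> A (cell m u, j)" by (auto simp: A_def)
    then show "u \<in> (\<Union>p\<in>?P. A p)" using cell_less[OF m, of u] by blast
  qed (use Acell in blast)
  have uB: "(\<Union>p\<in>?P. B p) = {0..<1}"
  proof (intro equalityI subsetI)
    fix u :: real assume "u \<in> {0..<1}"
    then have "u \<in> (\<Union>i<m. {b (cell m u) i..<b (cell m u) i + M i (cell m u)})" using cov b(2) by blast
    then obtain i where "i < m" "u \<in> B (i, cell m u)" by (auto simp: B_def)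
    then show "u \<in> (\<Union>p\<in>?P. B p)" using cell_less[OF m, of u] by blast
  qed (use Bcell in blast)
  obtain \<tau> \<tau>' where \<tau>: "\<tau> \<in> borel_measurable borel" "\<tau>' \<in> borel_measurable borel" "distr unif borel \<tau> = unif"
    "AE u in unif. \<tau>' (\<tau> u) = u" and map: "\<And>p u. p \<in> ?P \<Longrightarrow> u \<in> A p \<Longrightarrow> \<tau> u \<in> B p"
    by (rule interval_exchange[of ?P "\<lambda>p. a (fst p) (snd p)" "\<lambda>p. M (fst p) (snd p)" "\<lambda>p. b (snd p) (fst p)",
          OF _ dA[unfolded A_def] uA[unfolded A_def] dB[unfolded B_def] uB[unfolded B_def], folded A_def B_def])
       (simp, rule that)
  note [measurable] = \<tau>(1)
  have "emeasure unif {u. cell m u = i \<and> cell m (\<tau> u) = j} = ennreal (M i j)" if ij: "i < m" "j < m" for i j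
  proof -
    have "emeasure unif {u. cell m u = i \<and> cell m (\<tau> u) = j} = emeasure lborel ({u. cell m u = i \<and> cell m (\<tau> u) = j} \<inter> {0..<1})"
      by (rule emeasure_unif_atLeast) measurable
    also have "{u. cell m u = i \<and> cell m (\<tau> u) = j} \<inter> {0..<1} = A (i, j)"
    proof (intro equalityI subsetI)
      fix u assume u: "u \<in> {u. cell m u = i \<and> cell m (\<tau> u) = j} \<inter> {0..<1}"
      then obtain p where p: "p \<in> ?P" "u \<in> A p" using uA by blast
      have "p = (i, j)" using Acell[OF p] Bcell[OF p(1) map[OF p]] u by (auto simp: prod_eq_iff)
      then show "u \<in> A (i, j)" using p by simp
    next
      fix u assume u: "u \<in> A (i, j)"
      have p: "(i, j) \<in> ?P" using ij by simp
      show "u \<in> {u. cell m u = i \<and> cell m (\<tau> u) = j} \<inter> {0..<1}"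
        using Acell[OF p u] Bcell[OF p map[OF p u]] by simp
    qed
    also have "emeasure lborel (A (i, j)) = ennreal (M i j)" using nn[OF ij] by (simp add: A_def)
    finally show ?thesis .
  qed
  then show ?thesis using \<tau> by blast
qed

definition cv :: "nat \<Rightarrow> nat \<Rightarrow> (nat \<Rightarrow> real) \<Rightarrow> nat list" where
  "cv m n u = map (\<lambda>s. cell m (u s)) [0..<n]"

definition cells :: "nat \<Rightarrow> nat \<Rightarrow> nat list set" where
  "cells m n = {a. length a = n \<and> set a \<subseteq> {..<m}}"

lemma cv_0 [simp]: "cv m 0 u = []"
  by (simp add: cv_def)

lemma cv_Suc: "cv m (Suc n) u = cv m n u @ [cell m (u n)]"
  by (simp add: cv_def)

lemma cv_cong: "(\<And>s. s < n \<Longrightarrow> u s = v s) \<Longrightarrow> cv m n u = cv m n v"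
  by (simp add: cv_def)

lemma cv_in_cells: "0 < m \<Longrightarrow> cv m n u \<in> cells m n"
  by (auto simp: cells_def cv_def cell_less)

lemma finite_cells: "finite (cells m n)"
  using finite_lists_length_eq[of "{..<m}" n] by (simp add: cells_def conj_commute)

lemma cells_SucE:
  assumes "a \<in> cells m (Suc n)"
  obtains a' i where "a = a' @ [i]" "a' \<in> cells m n" "i < m"
  using assms by (cases a rule: rev_cases) (auto simp: cells_def)

lemma measurable_cv:
  assumes "\<And>s. s < n \<Longrightarrow> (\<lambda>x. f x s) \<in> borel_measurable M"
  shows "(\<lambda>x. cv m n (f x)) \<in> M \<rightarrow>\<^sub>M count_space UNIV"
  using assms
proof (induction n)
  case (Suc n)
  have [measurable]: "(\<lambda>x. f x n) \<in> borel_measurable M" by (rule Suc.prems) simp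
  have [measurable]: "(\<lambda>x. cv m n (f x)) \<in> M \<rightarrow>\<^sub>M count_space UNIV" by (rule Suc.IH) (rule Suc.prems, simp)
  have "(\<lambda>x. (\<lambda>a x. a @ [cell m (f x n)]) (cv m n (f x)) x) \<in> M \<rightarrow>\<^sub>M count_space UNIV"
  proof (rule measurable_compose_countable[where f = "\<lambda>a x. a @ [cell m (f x n)]" and g = "\<lambda>x. cv m n (f x)"])
    fix a show "(\<lambda>x. a @ [cell m (f x n)]) \<in> M \<rightarrow>\<^sub>M count_space UNIV" by measurable
  qed measurable
  then show ?case by (simp add: cv_Suc)
qed simp

lemma measurable_cv_prodM: "f \<in> M \<rightarrow>\<^sub>M prodM N RR \<Longrightarrow> n \<le> N \<Longrightarrow> (\<lambda>x. cv m n (f x)) \<in> M \<rightarrow>\<^sub>M count_space UNIV"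
  using prodM_measurable_component[of _ N f M RR] by (intro measurable_cv) simp

lemma kern_cube_Suc:
  "cube (Suc n) = distr (sdp (cube n) borel (\<lambda>_. unif)) (prodM (Suc n) RR) (\<lambda>z. (fst z)(n := snd z))"
  using seqcomp_Suc[OF kern_unif lessI, of n] by (simp add: cube_def)

text \<open>The law of the pair of cell sequences is built one step at a time: given the cells so far, the
  conditional law of the next pair of cells is doubly stochastic, and an interval exchange realises it.\<close>

lemma adapted_iso_prescribed_cells:
  assumes m: "0 < m" and p0: "p 0 [] [] = 1" and nn: "\<And>t a b. 0 \<le> p t a b"
    and row: "\<And>t a b i. t < N \<Longrightarrow> a \<in> cells m t \<Longrightarrow> b \<in> cells m t \<Longrightarrow> i < m \<Longrightarrow>
       (\<Sum>j<m. p (Suc t) (a @ [i]) (b @ [j])) = p t a b / m"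
    and col: "\<And>t a b j. t < N \<Longrightarrow> a \<in> cells m t \<Longrightarrow> b \<in> cells m t \<Longrightarrow> j < m \<Longrightarrow>
       (\<Sum>i<m. p (Suc t) (a @ [i]) (b @ [j])) = p t a b / m"
  shows "\<exists>T S. adapted_iso N RR RR (cube N) (cube N) T S \<and>
    (\<forall>a\<in>cells m N. \<forall>b\<in>cells m N. emeasure (cube N) {u \<in> space (cube N). cv m N u = a \<and> cv m N (T u) = b} = ennreal (p N a b))"
  using row col
proof (induction N)
  case 0
  have 1: "adapted 0 RR RR (\<lambda>u. u)" by (auto simp: adapted_def)
  have "adapted_iso 0 RR RR (cube 0) (cube 0) (\<lambda>u. u) (\<lambda>u. u)"
    unfolding adapted_iso_def using 1 by (auto simp: distr_id)
  moreover have "emeasure (cube 0) (space (cube 0)) = 1"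
    by (rule prob_space.emeasure_space_1[OF prob_space_cube])
  ultimately show ?case using p0 by (intro exI[of _ "\<lambda>u. u"]) (auto simp: cells_def)
next
  case (Suc n)
  have "\<exists>T S. adapted_iso n RR RR (cube n) (cube n) T S \<and>
    (\<forall>a\<in>cells m n. \<forall>b\<in>cells m n. emeasure (cube n) {u \<in> space (cube n). cv m n u = a \<and> cv m n (T u) = b} = ennreal (p n a b))"
    by (rule Suc.IH) (use Suc.prems in auto)
  then obtain T S where T: "adapted_iso n RR RR (cube n) (cube n) T S"
    and mass: "\<And>a b. a \<in> cells m n \<Longrightarrow> b \<in> cells m n \<Longrightarrow>
      emeasure (cube n) {u \<in> space (cube n). cv m n u = a \<and> cv m n (T u) = b} = ennreal (p n a b)" by blast
  have Tm[measurable]: "T \<in> prodM n RR \<rightarrow>\<^sub>M prodM n RR" and Sm[measurable]: "S \<in> prodM n RR \<rightarrow>\<^sub>M prodM n RR"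
    using T by (auto simp: adapted_iso_def adapted_def)
  \<comment> \<open>Conditional law of the next pair of cells given the cells so far. Where these
    have mass zero any admissible matrix will do; the constant 1/m^2 has row and column sums
    1/m.\<close>
  define M where "M a b i j = (if p n a b = 0 then 1 / real m ^ 2 else p (Suc n) (a @ [i]) (b @ [j]) / p n a b)" for a b i j
  define Ex where "Ex a b \<tau> \<tau>' \<longleftrightarrow> \<tau> \<in> borel_measurable borel \<and> \<tau>' \<in> borel_measurable borel \<and> distr unif borel \<tau> = unif \<and>
    (AE u in unif. \<tau>' (\<tau> u) = u) \<and>
    (\<forall>i<m. \<forall>j<m. emeasure unif {u. cell m u = i \<and> cell m (\<tau> u) = j} = ennreal (M a b i j))" for a b \<tau> \<tau>'
  have "\<exists>\<tau> \<tau>'. Ex a b \<tau> \<tau>'" if ab: "a \<in> cells m n" "b \<in> cells m n" for a b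
    unfolding Ex_def
  proof (rule doubly_stochastic_exchange[OF m])
    show "0 \<le> M a b i j" for i j using nn by (simp add: M_def)
    show "(\<Sum>j<m. M a b i j) = 1 / m" if "i < m" for i
      using Suc.prems(1)[OF lessI ab that] m
      by (cases "p n a b = 0") (simp_all add: M_def power2_eq_square sum_divide_distrib[symmetric])
    show "(\<Sum>i<m. M a b i j) = 1 / m" if "j < m" for j
      using Suc.prems(2)[OF lessI ab that] m
      by (cases "p n a b = 0") (simp_all add: M_def power2_eq_square sum_divide_distrib[symmetric])
  qed
  then obtain \<tau> \<tau>' where "\<And>a b. a \<in> cells m n \<Longrightarrow> b \<in> cells m n \<Longrightarrow> Ex a b (\<tau> a b) (\<tau>' a b)" by metis
  note \<tau> = this[unfolded Ex_def]
  have cvm[measurable]: "cv m n \<in> prodM n RR \<rightarrow>\<^sub>M count_space (cells m n)"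
    using measurable_cv_prodM[of "\<lambda>x. x" "prodM n RR" n n m] cv_in_cells[OF m]
    by (subst measurable_count_space_eq2_countable) (auto simp: finite_cells countable_finite measurable_count_space_eq2_countable)
  \<comment> \<open>The exchange to be applied depends on the past only through finitely many cell
    vectors, so joint measurability is a gluing of finitely many measurable functions.\<close>
  have comp: "(\<lambda>z. f (cv m n (c (fst z))) (cv m n (d (fst z))) (snd z)) \<in> borel_measurable (prodM n RR \<Otimes>\<^sub>M borel)"
    if f: "\<And>a b. a \<in> cells m n \<Longrightarrow> b \<in> cells m n \<Longrightarrow> f a b \<in> borel_measurable borel"
      and [measurable]: "c \<in> prodM n RR \<rightarrow>\<^sub>M prodM n RR" "d \<in> prodM n RR \<rightarrow>\<^sub>M prodM n RR"
    for f :: "nat list \<Rightarrow> nat list \<Rightarrow> real \<Rightarrow> real" and c d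
  proof (rule measurable_compose_countable'[where I = "cells m n" and g = "\<lambda>z. cv m n (c (fst z))"
        and f = "\<lambda>a z. f a (cv m n (d (fst z))) (snd z)"])
    fix a assume a: "a \<in> cells m n"
    show "(\<lambda>z. f a (cv m n (d (fst z))) (snd z)) \<in> borel_measurable (prodM n RR \<Otimes>\<^sub>M borel)"
    proof (rule measurable_compose_countable'[where I = "cells m n" and g = "\<lambda>z. cv m n (d (fst z))"
          and f = "\<lambda>b z. f a b (snd z)"])
      fix b assume "b \<in> cells m n"
      note [measurable] = f[OF a this]
      show "(\<lambda>z. f a b (snd z)) \<in> borel_measurable (prodM n RR \<Otimes>\<^sub>M borel)" by measurable
    qed (auto simp: finite_cells countable_finite)
  qed (auto simp: finite_cells countable_finite)
  define g where "g z = \<tau> (cv m n (fst z)) (cv m n (T (fst z))) (snd z)" for z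
  \<comment> \<open>The inverse step sees only the transported past: it reads the target cells off
    directly and recovers the source cells through \<open>S\<close>.\<close>
  define h where "h z = \<tau>' (cv m n (S (fst z))) (cv m n (fst z)) (snd z)" for z
  have g[measurable]: "g \<in> borel_measurable (prodM n RR \<Otimes>\<^sub>M borel)"
    unfolding g_def using \<tau> by (intro comp[of \<tau> "\<lambda>x. x"]) auto
  have h[measurable]: "h \<in> borel_measurable (prodM n RR \<Otimes>\<^sub>M borel)"
    unfolding h_def using \<tau> by (intro comp[of \<tau>' S "\<lambda>x. x"]) auto
  let ?T = "\<lambda>x. (T (restrict x {..<n}))(n := g (restrict x {..<n}, x n))"
  let ?S = "\<lambda>y. (S (restrict y {..<n}))(n := h (restrict y {..<n}, y n))"
  have iso: "adapted_iso (Suc n) RR RR (cube (Suc n)) (cube (Suc n)) ?T ?S"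
    unfolding cube_def
  proof (rule adapted_iso_extend[OF kern_unif kern_unif standard_cube])
    show "adapted_iso n RR RR (seqcomp RR (\<lambda>_ _. unif) n) (seqcomp RR (\<lambda>_ _. unif) n) T S"
      using T by (simp add: cube_def)
    show "AE x in seqcomp RR (\<lambda>_ _. unif) n. distr unif (borel_of euclideanreal) (\<lambda>s. g (x, s)) = unif"
      using \<tau> cv_in_cells[OF m] by (simp add: g_def)
    have "AE x in cube n. S (T x) = x" using T by (simp add: adapted_iso_def)
    then show "AE x in seqcomp RR (\<lambda>_ _. unif) n. AE s in unif. h (T x, g (x, s)) = s"
      unfolding cube_def[symmetric]
      by eventually_elim (use \<tau> cv_in_cells[OF m] in \<open>simp add: g_def h_def\<close>)
  qed (simp_all add: standard_real)
  have uk: "(\<lambda>_. unif) \<in> cube n \<rightarrow>\<^sub>M prob_algebra borel" by (rule measurable_const[OF unif_in_prob_algebra])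
  note [measurable_cong] = sets_cube sets_sdp[OF prob_space_cube uk]
  have "emeasure (cube (Suc n)) {u \<in> space (cube (Suc n)). cv m (Suc n) u = a' \<and> cv m (Suc n) (?T u) = b'} = ennreal (p (Suc n) a' b')"
    if ab': "a' \<in> cells m (Suc n)" "b' \<in> cells m (Suc n)" for a' b'
  proof -
    obtain a i where a: "a' = a @ [i]" "a \<in> cells m n" "i < m" using cells_SucE[OF ab'(1)] .
    obtain b j where b: "b' = b @ [j]" "b \<in> cells m n" "j < m" using cells_SucE[OF ab'(2)] .
    note [measurable] = measurable_upd[of n RR, simplified]
    have Tm'[measurable]: "?T \<in> prodM (Suc n) RR \<rightarrow>\<^sub>M prodM (Suc n) RR" using iso by (simp add: adapted_iso_def adapted_def)
    have [measurable]: "cv m (Suc n) \<in> prodM (Suc n) RR \<rightarrow>\<^sub>M count_space UNIV"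
      "(\<lambda>u. cv m (Suc n) (?T u)) \<in> prodM (Suc n) RR \<rightarrow>\<^sub>M count_space UNIV"
      using measurable_cv_prodM[of "\<lambda>x. x" "prodM (Suc n) RR" "Suc n" "Suc n" m] measurable_cv_prodM[OF Tm' order_refl, of m] by auto
    have [measurable]: "cv m n \<in> prodM n RR \<rightarrow>\<^sub>M count_space UNIV" "(\<lambda>u. cv m n (T u)) \<in> prodM n RR \<rightarrow>\<^sub>M count_space UNIV"
      using measurable_cv_prodM[of "\<lambda>x. x" "prodM n RR" n n m] measurable_cv_prodM[OF Tm order_refl, of m] by auto
    have sp: "x(n := s) \<in> space (prodM (Suc n) RR)" if "x \<in> space (prodM n RR)" for x s
      using upd_in_space[OF that, of s] by simp
    have cvT: "cv m (Suc n) (?T (x(n := s))) = cv m n (T x) @ [cell m (g (x, s))]"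
        "cv m (Suc n) (x(n := s)) = cv m n x @ [cell m s]" if "x \<in> space (prodM n RR)" for x s
    proof -
      have "restrict (x(n := s)) {..<n} = x" using prefix_id[OF that] by (simp add: prefix_upd)
      moreover have "cv m n (y(n := r)) = cv m n y" for y and r :: real by (rule cv_cong) simp
      ultimately show "cv m (Suc n) (?T (x(n := s))) = cv m n (T x) @ [cell m (g (x, s))]"
        "cv m (Suc n) (x(n := s)) = cv m n x @ [cell m s]" by (simp_all add: cv_Suc)
    qed
    have "{u \<in> space (prodM (Suc n) RR). cv m (Suc n) u = a' \<and> cv m (Suc n) (?T u) = b'} \<in> sets (prodM (Suc n) RR)"
      by measurable
    then have "emeasure (cube (Suc n)) {u \<in> space (cube (Suc n)). cv m (Suc n) u = a' \<and> cv m (Suc n) (?T u) = b'} =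
      emeasure (sdp (cube n) borel (\<lambda>_. unif)) {z \<in> space (prodM n RR \<Otimes>\<^sub>M borel). cv m n (fst z) = a \<and> cell m (snd z) = i \<and>
          cv m n (T (fst z)) = b \<and> cell m (g z) = j}"
      unfolding sets_eq_imp_space_eq[OF sets_cube] unfolding kern_cube_Suc
    proof (subst emeasure_distr)
      have "(\<lambda>z. (fst z)(n := snd z)) -` {u \<in> space (prodM (Suc n) RR). cv m (Suc n) u = a' \<and> cv m (Suc n) (?T u) = b'} \<inter> space (sdp (cube n) borel (\<lambda>_. unif))
        = {z \<in> space (prodM n RR \<Otimes>\<^sub>M borel). cv m n (fst z) = a \<and> cell m (snd z) = i \<and> cv m n (T (fst z)) = b \<and> cell m (g z) = j}"
      proof (rule set_eqI)
        fix z
        show "z \<in> (\<lambda>z. (fst z)(n := snd z)) -` {u \<in> space (prodM (Suc n) RR). cv m (Suc n) u = a' \<and> cv m (Suc n) (?T u) = b'} \<inter> space (sdp (cube n) borel (\<lambda>_. unif))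
          \<longleftrightarrow> z \<in> {z \<in> space (prodM n RR \<Otimes>\<^sub>M borel). cv m n (fst z) = a \<and> cell m (snd z) = i \<and> cv m n (T (fst z)) = b \<and> cell m (g z) = j}"
        proof (cases "fst z \<in> space (prodM n RR)")
          case True
          show ?thesis
            using True cvT[OF True, of "snd z"] sp[OF True, of "snd z"] space_sdp[OF prob_space_cube uk]
              sets_eq_imp_space_eq[OF sets_cube, of n]
            by (auto simp: space_pair_measure mem_Times_iff a(1) b(1))
        next
          case False
          then show ?thesis
            using space_sdp[OF prob_space_cube uk] sets_eq_imp_space_eq[OF sets_cube, of n]
            by (auto simp: space_pair_measure mem_Times_iff)
        qed
      qed
      then show "emeasure (sdp (cube n) borel (\<lambda>_. unif)) ((\<lambda>z. (fst z)(n := snd z)) -` {u \<in> space (prodM (Suc n) RR). cv m (Suc n) u = a' \<and> cv m (Suc n) (?T u) = b'} \<inter> space (sdp (cube n) borel (\<lambda>_. unif))) =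
        emeasure (sdp (cube n) borel (\<lambda>_. unif)) {z \<in> space (prodM n RR \<Otimes>\<^sub>M borel). cv m n (fst z) = a \<and> cell m (snd z) = i \<and> cv m n (T (fst z)) = b \<and> cell m (g z) = j}"
        by (simp only:)
    qed auto
    also have "\<dots> = (\<integral>\<^sup>+x. \<integral>\<^sup>+s. indicator {z \<in> space (prodM n RR \<Otimes>\<^sub>M borel). cv m n (fst z) = a \<and> cell m (snd z) = i \<and>
          cv m n (T (fst z)) = b \<and> cell m (g z) = j} (x, s) \<partial>unif \<partial>cube n)"
      by (subst nn_integral_sdp[OF prob_space_cube uk, symmetric]) (auto simp: nn_integral_indicator)
    also have "\<dots> = (\<integral>\<^sup>+x. ennreal (M a b i j) * indicator {u \<in> space (cube n). cv m n u = a \<and> cv m n (T u) = b} x \<partial>cube n)"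
    proof (rule nn_integral_cong)
      fix x assume x: "x \<in> space (cube n)"
      then have x': "x \<in> space (prodM n RR)" using sets_eq_imp_space_eq[OF sets_cube] by simp
      note [measurable] = conjunct1[OF \<tau>[OF a(2) b(2)]]
      show "(\<integral>\<^sup>+s. indicator {z \<in> space (prodM n RR \<Otimes>\<^sub>M borel). cv m n (fst z) = a \<and> cell m (snd z) = i \<and>
          cv m n (T (fst z)) = b \<and> cell m (g z) = j} (x, s) \<partial>unif) =
        ennreal (M a b i j) * indicator {u \<in> space (cube n). cv m n u = a \<and> cv m n (T u) = b} x"
      proof (cases "cv m n x = a \<and> cv m n (T x) = b")
        case True
        have "(\<integral>\<^sup>+s. indicator {z \<in> space (prodM n RR \<Otimes>\<^sub>M borel). cv m n (fst z) = a \<and> cell m (snd z) = i \<and>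
          cv m n (T (fst z)) = b \<and> cell m (g z) = j} (x, s) \<partial>unif) = (\<integral>\<^sup>+s. indicator {s. cell m s = i \<and> cell m (\<tau> a b s) = j} s \<partial>unif)"
          using True x' by (intro nn_integral_cong) (auto simp: indicator_def space_pair_measure g_def)
        also have "\<dots> = emeasure unif {s. cell m s = i \<and> cell m (\<tau> a b s) = j}" by (rule nn_integral_indicator) measurable
        also have "\<dots> = ennreal (M a b i j)" using \<tau>[OF a(2) b(2)] a(3) b(3) by blast
        finally show ?thesis using True x by simp
      next
        case False
        then show ?thesis by (auto simp: indicator_def)
      qed
    qed
    also have "\<dots> = ennreal (M a b i j) * emeasure (cube n) {u \<in> space (cube n). cv m n u = a \<and> cv m n (T u) = b}"
      by (rule nn_integral_cmult_indicator) measurable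
    also have "\<dots> = ennreal (M a b i j * p n a b)"
      using mass[OF a(2) b(2)] nn by (simp add: ennreal_mult'' )
    \<comment> \<open>For a null past the product is 0, and so is the prescribed mass, being a
      summand of a row with sum 0.\<close>
    also have "M a b i j * p n a b = p (Suc n) a' b'"
    proof (cases "p n a b = 0")
      case True
      have "p (Suc n) (a @ [i]) (b @ [j]) \<le> (\<Sum>j<m. p (Suc n) (a @ [i]) (b @ [j]))"
        using b(3) nn by (intro member_le_sum) auto
      then show ?thesis using Suc.prems(1)[OF lessI a(2) b(2) a(3)] True nn[of "Suc n" "a @ [i]" "b @ [j]"] a b by simp
    next
      case False then show ?thesis using a b by (simp add: M_def)
    qed
    finally show ?thesis .
  qed
  with iso show ?case by blast
qed

section \<open>Causal couplings\<close>

lemma bind_eq_sdp: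
  assumes "sets \<mu> = sets M'"
  shows "bind \<mu> (\<lambda>x. distr (k x) (M' \<Otimes>\<^sub>M S) (\<lambda>y. (x, y))) = sdp \<mu> S k"
proof -
  have "sets (M' \<Otimes>\<^sub>M S) = sets (\<mu> \<Otimes>\<^sub>M S)" by (rule sets_pair_measure_cong) (use assms in auto)
  then have "distr (k x) (M' \<Otimes>\<^sub>M S) (\<lambda>y. (x, y)) = distr (k x) (\<mu> \<Otimes>\<^sub>M S) (\<lambda>y. (x, y))" for x
    by (intro distr_cong) auto
  then show ?thesis unfolding sdp_def by simp
qed

text \<open>The kernel is the Dirac mass at \<open>T x\<close>, so its value on B is the indicator
  of B at \<open>T x\<close>; measurability of this in the past is the adaptedness of
  \<open>T\<close>.\<close>

lemma causal_monge:
  assumes \<mu>: "sets \<mu> = sets (prodM N X)" "prob_space \<mu>" and T: "adapted N X Y T"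
  shows "causal N X Y \<mu> (distr \<mu> (prodM N X \<Otimes>\<^sub>M prodM N Y) (\<lambda>x. (x, T x)))"
  unfolding causal_def
proof (intro bexI conjI allI impI ballI)
  have Tm[measurable]: "T \<in> prodM N X \<rightarrow>\<^sub>M prodM N Y" using T by (simp add: adapted_def)
  note [measurable_cong] = \<mu>(1)
  show k: "(\<lambda>x. return (prodM N Y) (T x)) \<in> prodM N X \<rightarrow>\<^sub>M prob_algebra (prodM N Y)" by measurable
  then have k': "(\<lambda>x. return (prodM N Y) (T x)) \<in> \<mu> \<rightarrow>\<^sub>M prob_algebra (prodM N Y)" by measurable
  show "distr \<mu> (prodM N X \<Otimes>\<^sub>M prodM N Y) (\<lambda>x. (x, T x)) =
    bind \<mu> (\<lambda>x. distr (return (prodM N Y) (T x)) (prodM N X \<Otimes>\<^sub>M prodM N Y) (\<lambda>y. (x, y)))"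
    unfolding bind_eq_sdp[OF \<mu>(1)]
  proof (rule sdp_eqI[OF \<mu>(2) k'])
    show "sets (distr \<mu> (prodM N X \<Otimes>\<^sub>M prodM N Y) (\<lambda>x. (x, T x))) = sets (\<mu> \<Otimes>\<^sub>M prodM N Y)"
      unfolding sets_distr by (rule sets_pair_measure_cong) (use \<mu> in auto)
    fix A B assume [measurable]: "A \<in> sets \<mu>" "B \<in> sets (prodM N Y)"
    have [measurable]: "A \<in> sets (prodM N X)" using \<open>A \<in> sets \<mu>\<close> \<mu> by simp
    have "emeasure (distr \<mu> (prodM N X \<Otimes>\<^sub>M prodM N Y) (\<lambda>x. (x, T x))) (A \<times> B)
      = (\<integral>\<^sup>+x. indicator (A \<times> B) (x, T x) \<partial>\<mu>)"
      by (subst nn_integral_indicator[symmetric]) (auto simp: nn_integral_distr simp del: nn_integral_indicator)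
    also have "\<dots> = (\<integral>\<^sup>+x. emeasure (return (prodM N Y) (T x)) B * indicator A x \<partial>\<mu>)"
      by (intro nn_integral_cong) (simp add: indicator_times mult.commute)
    finally show "emeasure (distr \<mu> (prodM N X \<Otimes>\<^sub>M prodM N Y) (\<lambda>x. (x, T x))) (A \<times> B)
      = (\<integral>\<^sup>+x. emeasure (return (prodM N Y) (T x)) B * indicator A x \<partial>\<mu>)" .
  qed
  fix t B assume t: "t < N" and B: "B \<in> sets (filtM N t Y)"
  have "T \<in> filtM N t X \<rightarrow>\<^sub>M filtM N t Y" using T t by (simp add: adapted_def)
  then have "(\<lambda>x. indicator B (T x) :: ennreal) \<in> borel_measurable (filtM N t X)"
    using B by (intro measurable_compose[OF _ borel_measurable_indicator])
  moreover have "B \<in> sets (prodM N Y)" using filtM_subset[OF _ B] t by simp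
  ultimately show "(\<lambda>x. emeasure (return (prodM N Y) (T x)) B) \<in> borel_measurable (filtM N t X)" by simp
qed

text \<open>Read backwards, the graph law of \<open>T\<close> is the graph law of \<open>S\<close>,
  because x = S (T x) almost surely. Adaptedness of both maps thus gives causality in both
  directions.\<close>

lemma adapted_iso_Cpl_bc:
  assumes \<mu>: "path_measure N X \<mu>" and \<nu>: "path_measure N Y \<nu>" and T: "adapted_iso N X Y \<mu> \<nu> T S"
  shows "distr \<mu> (\<mu> \<Otimes>\<^sub>M \<nu>) (\<lambda>x. (x, T x)) \<in> Cpl_bc N X Y \<mu> \<nu>"
proof -
  have s: "sets \<mu> = sets (prodM N X)" "sets \<nu> = sets (prodM N Y)" and p: "prob_space \<mu>" "prob_space \<nu>"
    using \<mu> \<nu> by (auto simp: path_measure_def)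
  note [measurable_cong] = s
  have [measurable]: "T \<in> prodM N X \<rightarrow>\<^sub>M prodM N Y" "S \<in> prodM N Y \<rightarrow>\<^sub>M prodM N X"
    and d: "distr \<mu> \<nu> T = \<nu>" and inv: "AE x in \<mu>. S (T x) = x" using T by (auto simp: adapted_iso_def adapted_def)
  have sp: "sets (\<mu> \<Otimes>\<^sub>M \<nu>) = sets (prodM N X \<Otimes>\<^sub>M prodM N Y)" "sets (\<nu> \<Otimes>\<^sub>M \<mu>) = sets (prodM N Y \<Otimes>\<^sub>M prodM N X)"
    by (intro sets_pair_measure_cong s)+
  let ?\<rho> = "distr \<mu> (\<mu> \<Otimes>\<^sub>M \<nu>) (\<lambda>x. (x, T x))"
  have r: "?\<rho> = distr \<mu> (prodM N X \<Otimes>\<^sub>M prodM N Y) (\<lambda>x. (x, T x))" by (rule distr_cong) (auto simp: sp)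
  have "distr ?\<rho> \<mu> fst = \<mu>" by (subst distr_distr) (auto simp: comp_def distr_id)
  moreover have "distr ?\<rho> \<nu> snd = \<nu>" by (subst distr_distr) (auto simp: comp_def d)
  ultimately have "?\<rho> \<in> Cpl \<mu> \<nu>" by (simp add: Cpl_def)
  moreover have "causal N X Y \<mu> ?\<rho>"
    unfolding r using T by (intro causal_monge s p) (simp add: adapted_iso_def)
  moreover have "distr ?\<rho> (prodM N Y \<Otimes>\<^sub>M prodM N X) (\<lambda>(x, y). (y, x)) = distr \<nu> (prodM N Y \<Otimes>\<^sub>M prodM N X) (\<lambda>y. (y, S y))"
  proof -
    have "distr \<nu> (prodM N Y \<Otimes>\<^sub>M prodM N X) (\<lambda>y. (y, S y)) = distr (distr \<mu> \<nu> T) (prodM N Y \<Otimes>\<^sub>M prodM N X) (\<lambda>y. (y, S y))"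
      by (simp add: d)
    also have "\<dots> = distr \<mu> (prodM N Y \<Otimes>\<^sub>M prodM N X) (\<lambda>x. (T x, S (T x)))"
      by (subst distr_distr) (auto simp: comp_def)
    also have "\<dots> = distr \<mu> (prodM N Y \<Otimes>\<^sub>M prodM N X) (\<lambda>x. (T x, x))"
      by (rule distr_cong_AE) (use inv in auto)
    also have "\<dots> = distr ?\<rho> (prodM N Y \<Otimes>\<^sub>M prodM N X) (\<lambda>(x, y). (y, x))"
      by (subst distr_distr) (auto simp: comp_def)
    finally show ?thesis by simp
  qed
  moreover have "causal N Y X \<nu> (distr \<nu> (prodM N Y \<Otimes>\<^sub>M prodM N X) (\<lambda>y. (y, S y)))"
    using T by (intro causal_monge s p) (simp add: adapted_iso_def)
  ultimately show ?thesis by (simp add: Cpl_bc_def)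
qed

text \<open>The bijection supplied by \<open>everywhere_bijection\<close> need not be adapted. It
  agrees with \<open>T\<close> almost everywhere, hence has the same graph law, and the conclusion
  concerns this law only.\<close>

lemma adapted_iso_Cpl_biM:
  assumes \<mu>: "path_measure N X \<mu>" "null_cantor \<mu>" and \<nu>: "path_measure N Y \<nu>" "null_cantor \<nu>"
    and T: "adapted_iso N X Y \<mu> \<nu> T S"
  shows "distr \<mu> (\<mu> \<Otimes>\<^sub>M \<nu>) (\<lambda>x. (x, T x)) \<in> Cpl_biM \<mu> \<nu>"
proof -
  have s: "sets \<mu> = sets (prodM N X)" "sets \<nu> = sets (prodM N Y)" and p: "prob_space \<mu>" "prob_space \<nu>"
    and st: "standard (prodM N X)" "standard (prodM N Y)"
    using \<mu> \<nu> by (auto simp: path_measure_def)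
  note [measurable_cong] = s
  have T1[measurable]: "T \<in> prodM N X \<rightarrow>\<^sub>M prodM N Y" "S \<in> prodM N Y \<rightarrow>\<^sub>M prodM N X"
    and d: "distr \<mu> \<nu> T = \<nu>" and inv: "AE x in \<mu>. S (T x) = x" using T by (auto simp: adapted_iso_def adapted_def)
  have m: "T \<in> \<mu> \<rightarrow>\<^sub>M \<nu>" "S \<in> \<nu> \<rightarrow>\<^sub>M \<mu>" by measurable
  obtain T' where T': "T' \<in> \<mu> \<rightarrow>\<^sub>M \<nu>" "bij_betw T' (space \<mu>) (space \<nu>)" "AE x in \<mu>. T' x = T x"
    by (rule everywhere_bijection[of \<mu> \<nu> T S, OF p(1) standard_sets_eq[OF s(1)[symmetric] st(1)] \<mu>(2) p(2)
          standard_sets_eq[OF s(2)[symmetric] st(2)] \<nu>(2) m d inv]) (rule that)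
  note [measurable] = T'(1)
  have "distr \<mu> \<nu> T' = distr \<mu> \<nu> T" by (rule distr_cong_AE) (use T' in auto)
  moreover have "distr \<mu> (\<mu> \<Otimes>\<^sub>M \<nu>) (\<lambda>x. (x, T x)) = distr \<mu> (\<mu> \<Otimes>\<^sub>M \<nu>) (\<lambda>x. (x, T' x))"
    by (rule distr_cong_AE) (use T' in auto)
  ultimately show ?thesis using T' d unfolding Cpl_biM_def by auto
qed

text \<open>An event D with conditional probability c given the past of the first path keeps it when
  the past of the second path is added. On the sigma-algebra of the past, restricting \<mu> to D and
  multiplying it by c give the same measure, and by causality the conditional probability of B is
  measurable there.\<close>

lemma causal_cond_indep:
  assumes \<mu>: "sets \<mu> = sets (prodM N X)" "prob_space \<mu>" and c: "causal N X Y \<mu> \<pi>" and t: "t < N"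
    and A: "A \<in> sets (filtM N t X)" and B: "B \<in> sets (filtM N t Y)" and D: "D \<in> sets (prodM N X)"
    and ind: "\<And>A. A \<in> sets (filtM N t X) \<Longrightarrow> emeasure \<mu> (A \<inter> D) = c * emeasure \<mu> A"
  shows "emeasure \<pi> ((A \<inter> D) \<times> B) = c * emeasure \<pi> (A \<times> B)"
proof -
  obtain k where k: "k \<in> prodM N X \<rightarrow>\<^sub>M prob_algebra (prodM N Y)"
    and \<pi>: "\<pi> = sdp \<mu> (prodM N Y) k"
    and ad: "(\<lambda>x. emeasure (k x) B) \<in> borel_measurable (filtM N t X)"
    using c t B unfolding causal_def bind_eq_sdp[OF \<mu>(1)] by blast
  note [measurable_cong] = \<mu>(1)
  have k': "k \<in> \<mu> \<rightarrow>\<^sub>M prob_algebra (prodM N Y)" using k by measurable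
  let ?F = "filtM N t X"
  have sub: "C \<in> sets ?F \<Longrightarrow> C \<in> sets \<mu>" for C using filtM_subset[of t N C X] t \<mu> by simp
  have B': "B \<in> sets (prodM N Y)" using filtM_subset[OF _ B] t by simp
  have D'[measurable]: "D \<in> sets \<mu>" using D \<mu> by simp
  have A'[measurable]: "A \<in> sets \<mu>" using sub[OF A] .
  have idm[measurable]: "(\<lambda>x. x) \<in> \<mu> \<rightarrow>\<^sub>M ?F"
  proof (rule measurableI)
    fix x assume "x \<in> space \<mu>"
    then show "x \<in> space ?F" unfolding space_filtM sets_eq_imp_space_eq[OF \<mu>(1)] .
  next
    fix C assume C: "C \<in> sets ?F"
    show "(\<lambda>x. x) -` C \<inter> space \<mu> \<in> sets \<mu>" using sub[OF C] by (intro sets.Int) (simp_all add: vimage_ident)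
  qed
  have eq: "distr (density \<mu> (indicator D)) ?F (\<lambda>x. x) = distr (density \<mu> (\<lambda>_. c)) ?F (\<lambda>x. x)"
  proof (rule measure_eqI)
    fix C assume "C \<in> sets (distr (density \<mu> (indicator D)) ?F (\<lambda>x. x))"
    then have C: "C \<in> sets ?F" by simp
    have [measurable]: "C \<in> sets \<mu>" by (rule sub[OF C])
    have "C \<subseteq> space \<mu>" using sets.sets_into_space[OF \<open>C \<in> sets \<mu>\<close>] .
    then have "emeasure (distr (density \<mu> (indicator D)) ?F (\<lambda>x. x)) C = (\<integral>\<^sup>+x. indicator D x * indicator C x \<partial>\<mu>)"
      using C by (subst emeasure_distr) (auto simp: emeasure_density Int_absorb2)
    also have "\<dots> = (\<integral>\<^sup>+x. indicator (C \<inter> D) x \<partial>\<mu>)" by (intro nn_integral_cong) (auto simp: indicator_def)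
    also have "\<dots> = c * emeasure \<mu> C" using ind[OF C] by simp
    also have "\<dots> = (\<integral>\<^sup>+x. c * indicator C x \<partial>\<mu>)" by (simp add: nn_integral_cmult)
    also have "\<dots> = emeasure (distr (density \<mu> (\<lambda>_. c)) ?F (\<lambda>x. x)) C"
      using C \<open>C \<subseteq> space \<mu>\<close> by (subst emeasure_distr) (auto simp: emeasure_density Int_absorb2)
    finally show "emeasure (distr (density \<mu> (indicator D)) ?F (\<lambda>x. x)) C = emeasure (distr (density \<mu> (\<lambda>_. c)) ?F (\<lambda>x. x)) C" .
  qed simp
  define f where "f x = emeasure (k x) B * indicator A x" for x
  have f: "f \<in> borel_measurable ?F" unfolding f_def using A ad by measurable
  have f'[measurable]: "f \<in> borel_measurable \<mu>" using measurable_compose[OF idm f] by simp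
  have "emeasure \<pi> ((A \<inter> D) \<times> B) = (\<integral>\<^sup>+x. indicator D x * f x \<partial>\<mu>)"
    unfolding \<pi> using emeasure_sdp_times[OF \<mu>(2) k' _ B', of "A \<inter> D"]
    by (simp add: f_def indicator_inter_arith mult_ac)
  also have "\<dots> = (\<integral>\<^sup>+x. f x \<partial>distr (density \<mu> (indicator D)) ?F (\<lambda>x. x))"
    using f by (subst nn_integral_distr) (auto simp: nn_integral_density)
  also have "\<dots> = (\<integral>\<^sup>+x. c * f x \<partial>\<mu>)"
    unfolding eq using f by (subst nn_integral_distr) (auto simp: nn_integral_density)
  also have "\<dots> = c * emeasure \<pi> (A \<times> B)"
    unfolding \<pi> nn_integral_cmult[OF f'] using emeasure_sdp_times[OF \<mu>(2) k' A' B'] by (simp add: f_def[abs_def])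
  finally show ?thesis .
qed

text \<open>Dropping the coordinates after t reduces the claim to the last step of
  \<open>cube (Suc t)\<close>, an \<open>sdp\<close> with constant kernel, where the event becomes a
  rectangle.\<close>

lemma cube_indep:
  assumes t: "t < N" and C: "C \<in> sets (filtM N t RR)" and E[measurable]: "E \<in> sets borel"
  shows "emeasure (cube N) (C \<inter> {u \<in> space (prodM N RR). u t \<in> E}) = emeasure unif E * emeasure (cube N) C"
proof -
  obtain C' where C'[measurable]: "C' \<in> sets (prodM t RR)" and CC: "C = (\<lambda>x. restrict x {..<t}) -` C' \<inter> space (prodM N RR)"
    using C t by (auto simp: sets_filtM)
  have spc: "space (cube n) = space (prodM n RR)" for n by (rule sets_eq_imp_space_eq[OF sets_cube])
  have pre: "(\<lambda>x. restrict x {..<s}) \<in> cube n \<rightarrow>\<^sub>M prodM s RR" if "s \<le> n" for s n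
    using measurable_prefix[OF that, of RR] measurable_cong_sets[OF sets_cube refl] by blast
  have dis: "distr (cube N) (prodM s RR) (\<lambda>x. restrict x {..<s}) = cube s" if "s \<le> N" for s
    unfolding cube_def by (rule seqcomp_prefix[OF kern_unif that order_refl])
  have 1: "emeasure (cube N) C = emeasure (cube t) C'"
    using t by (subst dis[symmetric]) (auto simp: emeasure_distr pre CC spc)
  define C2 where "C2 = (\<lambda>w. restrict w {..<t}) -` C' \<inter> space (prodM (Suc t) RR) \<inter> {w \<in> space (prodM (Suc t) RR). w t \<in> E}"
  have wt[measurable]: "(\<lambda>w. w t) \<in> borel_measurable (prodM (Suc t) RR)"
    using prodM_measurable_component[OF lessI, of "\<lambda>x. x" "prodM (Suc t) RR" t RR] by simp
  have C2[measurable]: "C2 \<in> sets (prodM (Suc t) RR)"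
    unfolding C2_def using measurable_sets[OF measurable_prefix C', of "Suc t"] by auto
  have "C \<inter> {u \<in> space (prodM N RR). u t \<in> E} = (\<lambda>x. restrict x {..<Suc t}) -` C2 \<inter> space (cube N)"
    using measurable_space[OF measurable_prefix, of "Suc t" N _ RR] t
    by (auto simp: C2_def CC spc prefix_prefix simp del: restrict_restrict)
  then have "emeasure (cube N) (C \<inter> {u \<in> space (prodM N RR). u t \<in> E}) = emeasure (cube (Suc t)) C2"
    using t by (subst dis[symmetric]) (auto simp: emeasure_distr pre C2)
  also have "\<dots> = emeasure (sdp (cube t) borel (\<lambda>_. unif)) (C' \<times> E)"
  proof -
    have uk: "(\<lambda>_. unif) \<in> cube t \<rightarrow>\<^sub>M prob_algebra borel" by (rule measurable_const[OF unif_in_prob_algebra])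
    note [measurable_cong] = sets_cube sets_sdp[OF prob_space_cube uk]
    note [measurable] = measurable_upd[of t RR, simplified]
    have sub: "C' \<subseteq> space (prodM t RR)" by (rule sets.sets_into_space[OF C'])
    have "(\<lambda>z. (fst z)(t := snd z)) -` C2 \<inter> space (sdp (cube t) borel (\<lambda>_. unif)) = C' \<times> E"
    proof (intro set_eqI)
      fix z
      show "z \<in> (\<lambda>z. (fst z)(t := snd z)) -` C2 \<inter> space (sdp (cube t) borel (\<lambda>_. unif)) \<longleftrightarrow> z \<in> C' \<times> E"
      proof (cases "fst z \<in> space (prodM t RR)")
        case True
        then show ?thesis
          using prefix_id[OF True] upd_in_space[OF True, of "snd z"] space_sdp[OF prob_space_cube uk]
          by (auto simp: C2_def prefix_upd spc mem_Times_iff)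
      next
        case False
        then show ?thesis using sub space_sdp[OF prob_space_cube uk] by (auto simp: spc mem_Times_iff)
      qed
    qed
    then show ?thesis unfolding kern_cube_Suc by (subst emeasure_distr) auto
  qed
  also have "\<dots> = emeasure unif E * emeasure (cube t) C'"
  proof -
    have uk: "(\<lambda>_. unif) \<in> cube t \<rightarrow>\<^sub>M prob_algebra borel" by (rule measurable_const[OF unif_in_prob_algebra])
    note [measurable_cong] = sets_cube
    show ?thesis by (subst emeasure_sdp_times[OF prob_space_cube uk]) (auto simp: nn_integral_cmult_indicator)
  qed
  finally show ?thesis using 1 by simp
qed

text \<open>An event A of the past of X corresponds to its preimage under \<open>\<Theta>\<close>,
  which belongs to the past of the cube because the inverse is adapted; independence is then read
  off in the cube.\<close>

lemma iso_cube_indep: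
  assumes \<mu>: "sets \<mu> = sets (prodM N X)" and t: "t < N" and I: "adapted_iso N X RR \<mu> (cube N) \<Phi> \<Theta>"
    and A: "A \<in> sets (filtM N t X)" and E: "E \<in> sets borel"
  shows "emeasure \<mu> (A \<inter> {x \<in> space (prodM N X). \<Phi> x t \<in> E}) = emeasure unif E * emeasure \<mu> A"
proof -
  note [measurable_cong] = \<mu> sets_cube
  have m[measurable]: "\<Phi> \<in> prodM N X \<rightarrow>\<^sub>M prodM N RR" "\<Theta> \<in> prodM N RR \<rightarrow>\<^sub>M prodM N X"
    and d: "distr \<mu> (cube N) \<Phi> = cube N" and inv: "AE x in \<mu>. \<Theta> (\<Phi> x) = x"
    and ad: "\<Theta> \<in> filtM N t RR \<rightarrow>\<^sub>M filtM N t X"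
    using I t by (auto simp: adapted_iso_def adapted_def)
  have comp[measurable]: "(\<lambda>u. u t) \<in> borel_measurable (prodM N RR)"
    using prodM_measurable_component[OF t, of "\<lambda>x. x" "prodM N RR" RR] by simp
  have A'[measurable]: "A \<in> sets (prodM N X)" using filtM_subset[OF _ A] t by simp
  define C where "C = \<Theta> -` A \<inter> space (prodM N RR)"
  have C: "C \<in> sets (filtM N t RR)" using measurable_sets[OF ad A] by (simp add: C_def)
  have C'[measurable]: "C \<in> sets (prodM N RR)" using filtM_subset[OF _ C] t by simp
  note [measurable] = E
  have key: "emeasure \<mu> (A \<inter> {x \<in> space (prodM N X). \<Phi> x t \<in> E}) = emeasure (cube N) (C \<inter> {u \<in> space (prodM N RR). u t \<in> E})"
    if E[measurable]: "E \<in> sets borel" for E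
  proof -
    have "emeasure (cube N) (C \<inter> {u \<in> space (prodM N RR). u t \<in> E}) = emeasure (distr \<mu> (cube N) \<Phi>) (C \<inter> {u \<in> space (prodM N RR). u t \<in> E})"
      by (simp add: d)
    also have "\<dots> = emeasure \<mu> (\<Phi> -` (C \<inter> {u \<in> space (prodM N RR). u t \<in> E}) \<inter> space \<mu>)"
      by (rule emeasure_distr) auto
    also have "\<dots> = emeasure \<mu> (A \<inter> {x \<in> space (prodM N X). \<Phi> x t \<in> E})"
    proof (rule emeasure_eq_AE)
      show "AE x in \<mu>. (x \<in> \<Phi> -` (C \<inter> {u \<in> space (prodM N RR). u t \<in> E}) \<inter> space \<mu>) = (x \<in> A \<inter> {x \<in> space (prodM N X). \<Phi> x t \<in> E})"
        using inv AE_space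
        by eventually_elim (use measurable_space[OF m(1)] sets_eq_imp_space_eq[OF \<mu>] in \<open>auto simp: C_def\<close>)
    qed auto
    finally show ?thesis by simp
  qed
  \<comment> \<open>The instance E = UNIV of \<open>key\<close> identifies the masses of A and
    C.\<close>
  have "A \<inter> {x \<in> space (prodM N X). \<Phi> x t \<in> UNIV} = A" "C \<inter> {u \<in> space (prodM N RR). u t \<in> UNIV} = C"
    using sets.sets_into_space[OF A'] sets.sets_into_space[OF C'] by auto
  then show ?thesis using key[OF E] key[of UNIV] cube_indep[OF t C E] by simp
qed

lemma cv_prefix: "cv m t (restrict u {..<t}) = cv m t u"
  by (rule cv_cong) simp

lemma cv_in_filtM:
  assumes "t \<le> N" and \<Phi>: "\<Phi> \<in> filtM N t X \<rightarrow>\<^sub>M filtM N t RR"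
  shows "{x \<in> space (prodM N X). cv m t (\<Phi> x) = a} \<in> sets (filtM N t X)"
proof -
  have "(\<lambda>x. cv m t (restrict (\<Phi> x) {..<t})) \<in> filtM N t X \<rightarrow>\<^sub>M count_space UNIV"
    by (rule measurable_cv_prodM[OF measurable_compose[OF \<Phi> measurable_from_filtM[OF assms(1)]] order_refl])
  then have "(\<lambda>x. cv m t (\<Phi> x)) \<in> filtM N t X \<rightarrow>\<^sub>M count_space UNIV"
    unfolding cv_prefix .
  from measurable_sets[OF this, of "{a}"] show ?thesis by (simp add: vimage_def Int_def conj_commute)
qed

text \<open>Summing over j forgets the next cell of the second path. What remains are events of both
  pasts and the next cell of the first path, which has conditional probability 1/m given its own
  past and, by causality, also given both.\<close>

lemma causal_cell_row:
  assumes \<mu>: "sets \<mu> = sets (prodM N X)" "prob_space \<mu>" and c: "causal N X Y \<mu> \<pi>"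
    and \<pi>: "prob_space \<pi>" "sets \<pi> = sets (prodM N X \<Otimes>\<^sub>M prodM N Y)"
    and I: "adapted_iso N X RR \<mu> (cube N) \<Phi> \<Theta>" and \<Psi>: "adapted N Y RR \<Psi>"
    and t: "t < N" and i: "i < m"
  shows "(\<Sum>j<m. measure \<pi> {z \<in> space \<pi>. cv m (Suc t) (\<Phi> (fst z)) = a @ [i] \<and> cv m (Suc t) (\<Psi> (snd z)) = b @ [j]})
    = measure \<pi> {z \<in> space \<pi>. cv m t (\<Phi> (fst z)) = a \<and> cv m t (\<Psi> (snd z)) = b} / m"
proof -
  interpret \<pi>: prob_space \<pi> by fact
  note [measurable_cong] = \<pi>(2)
  have m: "0 < m" using i by simp
  have \<Phi>m[measurable]: "\<Phi> \<in> prodM N X \<rightarrow>\<^sub>M prodM N RR" and \<Psi>m[measurable]: "\<Psi> \<in> prodM N Y \<rightarrow>\<^sub>M prodM N RR"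
    and ad: "\<Phi> \<in> filtM N t X \<rightarrow>\<^sub>M filtM N t RR" "\<Psi> \<in> filtM N t Y \<rightarrow>\<^sub>M filtM N t RR"
    using I \<Psi> t by (auto simp: adapted_iso_def adapted_def)
  have [measurable]: "(\<lambda>z. cv m s (\<Phi> (fst z))) \<in> prodM N X \<Otimes>\<^sub>M prodM N Y \<rightarrow>\<^sub>M count_space UNIV"
      "(\<lambda>z. cv m s (\<Psi> (snd z))) \<in> prodM N X \<Otimes>\<^sub>M prodM N Y \<rightarrow>\<^sub>M count_space UNIV" if "s \<le> N" for s
    using that by (auto intro!: measurable_cv_prodM)
  have sp: "space \<pi> = space (prodM N X) \<times> space (prodM N Y)"
    using sets_eq_imp_space_eq[OF \<pi>(2)] by (simp add: space_pair_measure)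
  define A where "A = {x \<in> space (prodM N X). cv m t (\<Phi> x) = a}"
  define B where "B = {y \<in> space (prodM N Y). cv m t (\<Psi> y) = b}"
  define D where "D = {x \<in> space (prodM N X). \<Phi> x t \<in> {u. cell m u = i}}"
  have A: "A \<in> sets (filtM N t X)" and B: "B \<in> sets (filtM N t Y)"
    using t by (auto simp: A_def B_def intro!: cv_in_filtM ad)
  have "(\<lambda>x. \<Phi> x t) \<in> borel_measurable (prodM N X)" using prodM_measurable_component[OF t \<Phi>m] by simp
  then have D: "D \<in> sets (prodM N X)" unfolding D_def by measurable
  let ?S = "\<lambda>j. {z \<in> space \<pi>. cv m (Suc t) (\<Phi> (fst z)) = a @ [i] \<and> cv m (Suc t) (\<Psi> (snd z)) = b @ [j]}"
  have "(\<Sum>j<m. measure \<pi> (?S j)) = measure \<pi> (\<Union>j<m. ?S j)"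
    using t by (intro \<pi>.finite_measure_finite_Union[symmetric]) (auto simp: disjoint_family_on_def)
  also have "(\<Union>j<m. ?S j) = (A \<inter> D) \<times> B"
    using cell_less[OF m] by (auto simp: sp A_def B_def D_def cv_Suc)
  also have "measure \<pi> ((A \<inter> D) \<times> B) = measure \<pi> (A \<times> B) / m"
  proof -
    have "emeasure \<pi> ((A \<inter> D) \<times> B) = ennreal (1 / m) * emeasure \<pi> (A \<times> B)"
    proof (rule causal_cond_indep[OF \<mu> c t A B D])
      fix A assume "A \<in> sets (filtM N t X)"
      then show "emeasure \<mu> (A \<inter> D) = ennreal (1 / m) * emeasure \<mu> A"
        unfolding D_def using iso_cube_indep[OF \<mu>(1) t I, of A "{u. cell m u = i}"] emeasure_unif_cell[OF i] by simp
    qed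
    then show ?thesis by (simp add: measure_def enn2real_mult)
  qed
  also have "A \<times> B = {z \<in> space \<pi>. cv m t (\<Phi> (fst z)) = a \<and> cv m t (\<Psi> (snd z)) = b}"
    by (auto simp: A_def B_def sp)
  finally show ?thesis .
qed

lemma Cpl_sets: "\<pi> \<in> Cpl \<mu> \<nu> \<Longrightarrow> sets \<mu> = sets M \<Longrightarrow> sets \<nu> = sets N \<Longrightarrow> sets \<pi> = sets (M \<Otimes>\<^sub>M N)"
  unfolding Cpl_def using sets_pair_measure_cong[of \<mu> M \<nu> N] by simp

lemma Cpl_prob_space: "\<pi> \<in> Cpl \<mu> \<nu> \<Longrightarrow> prob_space \<mu> \<Longrightarrow> prob_space \<pi>"
proof -
  assume \<pi>: "\<pi> \<in> Cpl \<mu> \<nu>" and "prob_space \<mu>"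
  then have d: "prob_space (distr \<pi> \<mu> fst)" and [measurable_cong]: "sets \<pi> = sets (\<mu> \<Otimes>\<^sub>M \<nu>)" by (simp_all add: Cpl_def)
  show "prob_space \<pi>" by (rule prob_space_distrD[OF _ d]) measurable
qed

text \<open>The cell masses of \<pi> satisfy the row condition by causality from X to Y and the
  column condition by causality of the swapped coupling. The exchange \<open>\<tau>\<close> of the
  cube is then conjugated with the two isomorphisms. The masses agree exactly, which later allows
  \<pi> to be coupled with the Monge coupling inside cells.\<close>

theorem bicausal_matching:
  assumes \<mu>: "path_measure N X \<mu>" and \<nu>: "path_measure N Y \<nu>" and \<pi>: "\<pi> \<in> Cpl_bc N X Y \<mu> \<nu>"
    and I: "adapted_iso N X RR \<mu> (cube N) \<Phi> \<Theta>" and J: "adapted_iso N Y RR \<nu> (cube N) \<Psi> \<Xi>" and m: "0 < m"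
  shows "\<exists>T S. adapted_iso N X Y \<mu> \<nu> T S \<and> (\<forall>a\<in>cells m N. \<forall>b\<in>cells m N.
    emeasure \<mu> {x \<in> space \<mu>. cv m N (\<Phi> x) = a \<and> cv m N (\<Psi> (T x)) = b} =
    emeasure \<pi> {z \<in> space \<pi>. cv m N (\<Phi> (fst z)) = a \<and> cv m N (\<Psi> (snd z)) = b})"
proof -
  have s: "sets \<mu> = sets (prodM N X)" "sets \<nu> = sets (prodM N Y)" and pr: "prob_space \<mu>" "prob_space \<nu>"
    using \<mu> \<nu> by (auto simp: path_measure_def)
  note [measurable_cong] = s sets_cube
  have C: "\<pi> \<in> Cpl \<mu> \<nu>" and c1: "causal N X Y \<mu> \<pi>"
    and c2: "causal N Y X \<nu> (distr \<pi> (prodM N Y \<Otimes>\<^sub>M prodM N X) (\<lambda>(x, y). (y, x)))" (is "causal _ _ _ _ ?\<pi>'")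
    using \<pi> by (auto simp: Cpl_bc_def)
  have s\<pi>[measurable_cong]: "sets \<pi> = sets (prodM N X \<Otimes>\<^sub>M prodM N Y)" by (rule Cpl_sets[OF C s])
  interpret \<pi>: prob_space \<pi> by (rule Cpl_prob_space[OF C pr(1)])
  interpret \<pi>': prob_space ?\<pi>' by (rule \<pi>.prob_space_distr) measurable
  have \<Phi>m[measurable]: "\<Phi> \<in> prodM N X \<rightarrow>\<^sub>M prodM N RR" and \<Psi>m[measurable]: "\<Psi> \<in> prodM N Y \<rightarrow>\<^sub>M prodM N RR"
    and \<Xi>m[measurable]: "\<Xi> \<in> prodM N RR \<rightarrow>\<^sub>M prodM N Y"
    and ad: "adapted N X RR \<Phi>" "adapted N Y RR \<Psi>"
    using I J by (auto simp: adapted_iso_def adapted_def)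
  have cvm[measurable]: "(\<lambda>z. cv m t (\<Phi> (fst z))) \<in> prodM N X \<Otimes>\<^sub>M prodM N Y \<rightarrow>\<^sub>M count_space UNIV"
      "(\<lambda>z. cv m t (\<Psi> (snd z))) \<in> prodM N X \<Otimes>\<^sub>M prodM N Y \<rightarrow>\<^sub>M count_space UNIV"
      "(\<lambda>z. cv m t (\<Psi> (fst z))) \<in> prodM N Y \<Otimes>\<^sub>M prodM N X \<rightarrow>\<^sub>M count_space UNIV"
      "(\<lambda>z. cv m t (\<Phi> (snd z))) \<in> prodM N Y \<Otimes>\<^sub>M prodM N X \<rightarrow>\<^sub>M count_space UNIV" if "t \<le> N" for t
    using that by (auto intro!: measurable_cv_prodM)
  define p where "p t a b = measure \<pi> {z \<in> space \<pi>. cv m t (\<Phi> (fst z)) = a \<and> cv m t (\<Psi> (snd z)) = b}" for t a b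
  \<comment> \<open>The swapped coupling has the transposed cell masses, so its row condition is the
    column condition for \<open>p\<close>.\<close>
  have p': "p t a b = measure ?\<pi>' {z \<in> space ?\<pi>'. cv m t (\<Psi> (fst z)) = b \<and> cv m t (\<Phi> (snd z)) = a}" if "t \<le> N" for t a b
  proof -
    have "(\<lambda>(x, y). (y, x)) -` {z \<in> space (prodM N Y \<Otimes>\<^sub>M prodM N X). cv m t (\<Psi> (fst z)) = b \<and> cv m t (\<Phi> (snd z)) = a} \<inter> space \<pi>
        = {z \<in> space \<pi>. cv m t (\<Phi> (fst z)) = a \<and> cv m t (\<Psi> (snd z)) = b}"
      unfolding sets_eq_imp_space_eq[OF s\<pi>] space_pair_measure by fastforce
    then show ?thesis unfolding p_def space_distr using cvm(3,4)[OF that]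
      by (subst measure_distr) simp_all
  qed
  have "\<exists>T S. adapted_iso N RR RR (cube N) (cube N) T S \<and>
    (\<forall>a\<in>cells m N. \<forall>b\<in>cells m N. emeasure (cube N) {u \<in> space (cube N). cv m N u = a \<and> cv m N (T u) = b} = ennreal (p N a b))"
  proof (rule adapted_iso_prescribed_cells[OF m])
    show "p 0 [] [] = 1" by (simp add: p_def \<pi>.prob_space)
    show "0 \<le> p t a b" for t a b by (simp add: p_def)
    fix t a b i assume t: "t < N" and i: "i < m"
    show "(\<Sum>j<m. p (Suc t) (a @ [i]) (b @ [j])) = p t a b / m"
      unfolding p_def by (rule causal_cell_row[OF s(1) pr(1) c1 \<pi>.prob_space_axioms s\<pi> I ad(2) t i])
    have "(\<Sum>j<m. p (Suc t) (a @ [j]) (b @ [i])) = p t a b / m"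
      using causal_cell_row[OF s(2) pr(2) c2 \<pi>'.prob_space_axioms _ J ad(1) t i, of b a] t by (simp add: p')
    then show "(\<Sum>j<m. p (Suc t) (a @ [j]) (b @ [i])) = p t a b / m" .
  qed
  then obtain \<tau> \<sigma> where \<tau>: "adapted_iso N RR RR (cube N) (cube N) \<tau> \<sigma>"
    and mass: "\<And>a b. a \<in> cells m N \<Longrightarrow> b \<in> cells m N \<Longrightarrow>
      emeasure (cube N) {u \<in> space (cube N). cv m N u = a \<and> cv m N (\<tau> u) = b} = ennreal (p N a b)" by blast
  have \<tau>m[measurable]: "\<tau> \<in> prodM N RR \<rightarrow>\<^sub>M prodM N RR" using \<tau> by (auto simp: adapted_iso_def adapted_def)
  have J': "adapted_iso N RR Y (cube N) \<nu> \<Xi> \<Psi>" by (rule adapted_iso_sym[OF \<nu> path_measure_cube J])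
  define T where "T x = \<Xi> (\<tau> (\<Phi> x))" for x
  define S where "S y = \<Theta> (\<sigma> (\<Psi> y))" for y
  have iso: "adapted_iso N X Y \<mu> \<nu> T S"
    unfolding T_def S_def
    by (rule adapted_iso_trans[OF s(1) sets_cube s(2) I adapted_iso_trans[OF sets_cube sets_cube s(2) \<tau> J']])
  moreover have "emeasure \<mu> {x \<in> space \<mu>. cv m N (\<Phi> x) = a \<and> cv m N (\<Psi> (T x)) = b} =
    emeasure \<pi> {z \<in> space \<pi>. cv m N (\<Phi> (fst z)) = a \<and> cv m N (\<Psi> (snd z)) = b}"
    if ab: "a \<in> cells m N" "b \<in> cells m N" for a b
  proof -
    have c[measurable]: "cv m N \<in> prodM N RR \<rightarrow>\<^sub>M count_space UNIV" using measurable_cv_prodM[of "\<lambda>x. x" "prodM N RR" N N m] by simp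
    have d: "distr \<mu> (cube N) \<Phi> = cube N" "distr (cube N) (cube N) \<tau> = cube N" using I \<tau> by (auto simp: adapted_iso_def)
    have "{x \<in> space \<mu>. cv m N (\<Phi> x) = a \<and> cv m N (\<Psi> (T x)) = b} =
        \<Phi> -` {u \<in> space (cube N). cv m N u = a \<and> cv m N (\<Psi> (\<Xi> (\<tau> u))) = b} \<inter> space \<mu>"
      using measurable_space[OF \<Phi>m] sets_eq_imp_space_eq[OF s(1)] sets_eq_imp_space_eq[OF sets_cube, of N] by (auto simp: T_def)
    then have "emeasure \<mu> {x \<in> space \<mu>. cv m N (\<Phi> x) = a \<and> cv m N (\<Psi> (T x)) = b} =
        emeasure (distr \<mu> (cube N) \<Phi>) {u \<in> space (cube N). cv m N u = a \<and> cv m N (\<Psi> (\<Xi> (\<tau> u))) = b}"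
      by (subst emeasure_distr) auto
    also have "\<dots> = emeasure (cube N) {u \<in> space (cube N). cv m N u = a \<and> cv m N (\<Psi> (\<Xi> (\<tau> u))) = b}" by (simp only: d)
    also have "\<dots> = emeasure (cube N) {u \<in> space (cube N). cv m N u = a \<and> cv m N (\<tau> u) = b}"
    proof (rule emeasure_eq_AE)
      \<comment> \<open>\<open>\<Psi>\<close> undoes \<open>\<Xi>\<close> only almost surely on the
        cube; as \<open>\<tau>\<close> preserves the cube law, the preimage of the exceptional set
        stays null.\<close>
      have "AE v in distr (cube N) (cube N) \<tau>. \<Psi> (\<Xi> v) = v" using J' unfolding d by (simp add: adapted_iso_def)
      then have "AE u in cube N. \<Psi> (\<Xi> (\<tau> u)) = \<tau> u" by (rule AE_distrD[rotated]) measurable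
      then show "AE u in cube N. (u \<in> {u \<in> space (cube N). cv m N (u) = a \<and> cv m N (\<Psi> (\<Xi> (\<tau> u))) = b}) =
          (u \<in> {u \<in> space (cube N). cv m N u = a \<and> cv m N (\<tau> u) = b})"
        by eventually_elim simp
    qed measurable
    also have "\<dots> = ennreal (p N a b)" by (rule mass[OF ab])
    also have "\<dots> = emeasure \<pi> {z \<in> space \<pi>. cv m N (\<Phi> (fst z)) = a \<and> cv m N (\<Psi> (snd z)) = b}"
      by (simp add: p_def \<pi>.emeasure_eq_measure)
    finally show ?thesis .
  qed
  ultimately show ?thesis by blast
qed

section \<open>Causality as a family of linear constraints\<close>

text \<open>Sublevel sets of the encoding at rational levels. Countability is the point: identities
  that hold almost surely for each set hold for all of them at once, and equality of two kernels at
  a point becomes a measurable condition.\<close>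

lemma standard_determining:
  assumes S: "standard S"
  obtains \<G> where "countable \<G>" "\<G> \<subseteq> sets S"
    "\<And>P Q. prob_space P \<Longrightarrow> sets P = sets S \<Longrightarrow> prob_space Q \<Longrightarrow> sets Q = sets S \<Longrightarrow>
      \<forall>G\<in>\<G>. emeasure P G = emeasure Q G \<Longrightarrow> P = Q"
proof -
  obtain e r where e[measurable]: "e \<in> borel_measurable S" and r[measurable]: "r \<in> borel \<rightarrow>\<^sub>M S"
    and er: "\<And>x. x \<in> space S \<Longrightarrow> r (e x) = x" and e01: "\<And>x. 0 \<le> e x" "\<And>x. e x < (1::real)"
    by (rule standard_realE[OF S]) (rule that)
  define E where "E q = {x \<in> space S. e x \<le> q}" for q
  have E[measurable]: "E q \<in> sets S" for q unfolding E_def by measurable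
  show ?thesis
  proof (rule that[of "E ` \<rat>"])
    fix P Q assume P: "prob_space P" "sets P = sets S" and Q: "prob_space Q" "sets Q = sets S"
      and eq: "\<forall>G\<in>E ` \<rat>. emeasure P G = emeasure Q G"
    interpret P: prob_space P by fact
    interpret Q: prob_space Q by fact
    note [measurable_cong] = P(2) Q(2)
    have lim: "emeasure (distr R borel e) {..<s} = (SUP n. emeasure R (E (dya s n)))"
      if R[measurable_cong]: "sets R = sets S" for R s
    proof -
      have "emeasure (distr R borel e) {..<s} = emeasure R (\<Union>n. E (dya s n))"
        using dya_less[of s] dya_exceeds[of _ s] sets_eq_imp_space_eq[OF R]
        by (subst emeasure_distr) (auto simp: E_def intro!: arg_cong2[where f = emeasure] intro: le_less_trans)
      also have "\<dots> = (SUP n. emeasure R (E (dya s n)))"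
        using incseq_dya[of s] E R by (intro SUP_emeasure_incseq[symmetric]) (auto simp: E_def incseq_def intro: order_trans)
      finally show ?thesis .
    qed
    have "distr P borel e = distr Q borel e"
    proof (rule measure_eqI_lessThan_real)
      show "finite_measure (distr P borel e)" by (rule P.finite_measure_distr) measurable
      show "emeasure (distr P borel e) {..<s} = emeasure (distr Q borel e) {..<s}" for s
        unfolding lim[OF P(2)] lim[OF Q(2)] using eq dya_Rats by simp
    qed simp_all
    then have "distr (distr P borel e) S r = distr (distr Q borel e) S r" by simp
    then have "distr P S (\<lambda>x. r (e x)) = distr Q S (\<lambda>x. r (e x))" by (simp add: distr_distr comp_def)
    moreover have "distr R S (\<lambda>x. r (e x)) = R" if R: "sets R = sets S" for R
    proof -
      have "distr R S (\<lambda>x. r (e x)) = distr R S (\<lambda>x. x)"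
        by (rule distr_cong) (use er sets_eq_imp_space_eq[OF R] in auto)
      then show ?thesis using distr_id2[of S R] R by simp
    qed
    ultimately show "P = Q" using P Q by simp
  qed (auto simp: countable_rat)
qed

text \<open>Both sides are integrals against weighted image measures on F, and the hypothesis says
  that these coincide. The two underlying spaces may differ, as when a coupling is compared with its
  marginal.\<close>

lemma nn_integral_eq_of_sets:
  assumes p[measurable]: "p \<in> P \<rightarrow>\<^sub>M F" and q[measurable]: "q \<in> Q \<rightarrow>\<^sub>M F"
    and [measurable]: "v \<in> borel_measurable P" "w \<in> borel_measurable Q"
    and eq: "\<And>A. A \<in> sets F \<Longrightarrow> (\<integral>\<^sup>+z. v z * indicator A (p z) \<partial>P) = (\<integral>\<^sup>+z. w z * indicator A (q z) \<partial>Q)"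
    and \<phi>[measurable]: "\<phi> \<in> borel_measurable F"
  shows "(\<integral>\<^sup>+z. v z * \<phi> (p z) \<partial>P) = (\<integral>\<^sup>+z. w z * \<phi> (q z) \<partial>Q)"
proof -
  have "emeasure (distr (density P v) F p) A = emeasure (distr (density Q w) F q) A" if A: "A \<in> sets F" for A
  proof -
    have 1: "emeasure (distr (density P v) F p) A = (\<integral>\<^sup>+z. v z * indicator A (p z) \<partial>P)"
    proof -
      have "emeasure (distr (density P v) F p) A = (\<integral>\<^sup>+z. indicator A z \<partial>distr (density P v) F p)" using A by simp
      also have "\<dots> = (\<integral>\<^sup>+z. v z * indicator A (p z) \<partial>P)"
        using A by (subst nn_integral_distr) (auto simp: nn_integral_density)
      finally show ?thesis .
    qed
    have 2: "emeasure (distr (density Q w) F q) A = (\<integral>\<^sup>+z. w z * indicator A (q z) \<partial>Q)"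
    proof -
      have "emeasure (distr (density Q w) F q) A = (\<integral>\<^sup>+z. indicator A z \<partial>distr (density Q w) F q)" using A by simp
      also have "\<dots> = (\<integral>\<^sup>+z. w z * indicator A (q z) \<partial>Q)"
        using A by (subst nn_integral_distr) (auto simp: nn_integral_density)
      finally show ?thesis .
    qed
    show ?thesis using eq[OF A] 1 2 by simp
  qed
  then have "distr (density P v) F p = distr (density Q w) F q" by (intro measure_eqI) simp_all
  then have "(\<integral>\<^sup>+z. \<phi> z \<partial>distr (density P v) F p) = (\<integral>\<^sup>+z. \<phi> z \<partial>distr (density Q w) F q)" by simp
  then show ?thesis by (simp add: nn_integral_distr nn_integral_density)
qed

definition cexp :: "nat \<Rightarrow> (nat \<Rightarrow> 'a topology) \<Rightarrow> (nat \<Rightarrow> 'a) measure \<Rightarrow> nat \<Rightarrow> (nat \<Rightarrow> 'a) set \<Rightarrow> (nat \<Rightarrow> 'a) \<Rightarrow> ennreal" where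
  "cexp N X \<mu> t D = nn_cond_exp \<mu> (filtM N t X) (indicator D)"

text \<open>Conditional independence of the first path and the past of the second given the past of
  the first, stated without kernels. \<open>cexp\<close> is the conditional probability of
  D.\<close>

definition causal_constraint :: "nat \<Rightarrow> (nat \<Rightarrow> 'a topology) \<Rightarrow> (nat \<Rightarrow> 'b topology)
    \<Rightarrow> (nat \<Rightarrow> 'a) measure \<Rightarrow> ((nat \<Rightarrow> 'a) \<times> (nat \<Rightarrow> 'b)) measure \<Rightarrow> bool" where
  "causal_constraint N X Y \<mu> \<pi> \<longleftrightarrow> (\<forall>t<N. \<forall>B\<in>sets (filtM N t Y). \<forall>D\<in>sets (prodM N X).
     emeasure \<pi> (D \<times> B) = (\<integral>\<^sup>+z. cexp N X \<mu> t D (fst z) * indicator B (snd z) \<partial>\<pi>))"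

lemma filtM_finite_subalgebra:
  assumes \<mu>: "sets \<mu> = sets (prodM N X)" "prob_space \<mu>" and t: "t \<le> N"
  shows "finite_measure_subalgebra \<mu> (filtM N t X)"
proof -
  interpret prob_space \<mu> by fact
  have "subalgebra \<mu> (filtM N t X)"
    using subalgebra_filtM[OF t, of X] \<mu>(1) sets_eq_imp_space_eq[OF \<mu>(1)] by (simp add: subalgebra_def)
  then show ?thesis by unfold_locales
qed

lemma measurable_cexp: "cexp N X \<mu> t D \<in> borel_measurable (filtM N t X)"
  unfolding cexp_def by (rule borel_measurable_nn_cond_exp)

lemma cexp_intg:
  assumes \<mu>: "sets \<mu> = sets (prodM N X)" "prob_space \<mu>" and t: "t \<le> N"
    and f: "f \<in> borel_measurable (filtM N t X)" and D: "D \<in> sets (prodM N X)"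
  shows "(\<integral>\<^sup>+x. f x * cexp N X \<mu> t D x \<partial>\<mu>) = (\<integral>\<^sup>+x. f x * indicator D x \<partial>\<mu>)"
proof -
  interpret finite_measure_subalgebra \<mu> "filtM N t X" by (rule filtM_finite_subalgebra[OF \<mu> t])
  show ?thesis unfolding cexp_def using f D \<mu>(1) by (intro nn_cond_exp_intg) auto
qed

lemma measurable_ident_filtM: "t \<le> N \<Longrightarrow> sets \<mu> = sets (prodM N X) \<Longrightarrow> (\<lambda>x. x) \<in> \<mu> \<rightarrow>\<^sub>M filtM N t X"
proof (rule measurable_to_filtM)
  assume t: "t \<le> N" and \<mu>: "sets \<mu> = sets (prodM N X)"
  show "t \<le> N" by (rule t)
  show "(\<lambda>x. x) \<in> space \<mu> \<rightarrow> space (prodM N X)" using sets_eq_imp_space_eq[OF \<mu>] by simp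
  show "(\<lambda>x. restrict x {..<t}) \<in> \<mu> \<rightarrow>\<^sub>M prodM t X"
    unfolding measurable_cong_sets[OF \<mu> refl] by (rule measurable_prefix[OF t])
qed

text \<open>The conditional probability of B given the first path is measurable with respect to its
  past, so under the integral D may be replaced by its conditional expectation.\<close>

lemma causal_imp_constraint:
  assumes \<mu>: "sets \<mu> = sets (prodM N X)" "prob_space \<mu>" and c: "causal N X Y \<mu> \<pi>"
  shows "causal_constraint N X Y \<mu> \<pi>"
  unfolding causal_constraint_def
proof (intro allI impI ballI)
  fix t B D assume t: "t < N" and B: "B \<in> sets (filtM N t Y)" and D: "D \<in> sets (prodM N X)"
  obtain k where k: "k \<in> prodM N X \<rightarrow>\<^sub>M prob_algebra (prodM N Y)"
    and \<pi>: "\<pi> = sdp \<mu> (prodM N Y) k"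
    and ad: "(\<lambda>x. emeasure (k x) B) \<in> borel_measurable (filtM N t X)"
    using c t B unfolding causal_def bind_eq_sdp[OF \<mu>(1)] by blast
  note [measurable_cong] = \<mu>(1)
  have k'[measurable]: "k \<in> \<mu> \<rightarrow>\<^sub>M prob_algebra (prodM N Y)" using k by measurable
  have B'[measurable]: "B \<in> sets (prodM N Y)" using filtM_subset[OF _ B] t by simp
  have D'[measurable]: "D \<in> sets \<mu>" using D \<mu> by simp
  have cm[measurable]: "cexp N X \<mu> t D \<in> borel_measurable \<mu>"
    using measurable_compose[OF measurable_ident_filtM[OF less_imp_le[OF t] \<mu>(1)] measurable_cexp] by simp
  have "emeasure \<pi> (D \<times> B) = (\<integral>\<^sup>+x. emeasure (k x) B * indicator D x \<partial>\<mu>)"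
    unfolding \<pi> by (rule emeasure_sdp_times[OF \<mu>(2) k' D' B'])
  also have "\<dots> = (\<integral>\<^sup>+x. emeasure (k x) B * cexp N X \<mu> t D x \<partial>\<mu>)"
    using t by (intro cexp_intg[symmetric] \<mu> ad D) simp
  also have "\<dots> = (\<integral>\<^sup>+x. \<integral>\<^sup>+y. cexp N X \<mu> t D x * indicator B y \<partial>k x \<partial>\<mu>)"
  proof (rule nn_integral_cong)
    fix x assume x: "x \<in> space \<mu>"
    show "emeasure (k x) B * cexp N X \<mu> t D x = (\<integral>\<^sup>+y. cexp N X \<mu> t D x * indicator B y \<partial>k x)"
      using prob_kernelD(2)[OF k' x] by (subst nn_integral_cmult_indicator) (auto simp: mult.commute)
  qed
  also have "\<dots> = (\<integral>\<^sup>+z. cexp N X \<mu> t D (fst z) * indicator B (snd z) \<partial>\<pi>)"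
    unfolding \<pi> by (subst nn_integral_sdp[OF \<mu>(2) k']) auto
  finally show "emeasure \<pi> (D \<times> B) = (\<integral>\<^sup>+z. cexp N X \<mu> t D (fst z) * indicator B (snd z) \<partial>\<pi>)" .
qed

text \<open>Disintegrating the law of the two prefixes gives a kernel \<open>\<kappa>\<close> that
  depends on the prefix of x alone. The constraint identifies it with the prefix law of
  \<open>k x\<close>, for each event almost surely, and a countable determining family turns this
  into equality of measures.\<close>

lemma prefix_kernel:
  assumes \<mu>: "sets \<mu> = sets (prodM N X)" "prob_space \<mu>"
    and st: "\<And>t. t < N \<Longrightarrow> standard (borel_of (Y t))"
    and k: "k \<in> prodM N X \<rightarrow>\<^sub>M prob_algebra (prodM N Y)"
    and c: "causal_constraint N X Y \<mu> (sdp \<mu> (prodM N Y) k)" and t: "t < N"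
  shows "\<exists>\<kappa>\<in>prodM t X \<rightarrow>\<^sub>M prob_algebra (prodM t Y).
    AE x in \<mu>. \<kappa> (restrict x {..<t}) = distr (k x) (prodM t Y) (\<lambda>y. restrict y {..<t})"
proof -
  let ?\<pi> = "sdp \<mu> (prodM N Y) k"
  note [measurable_cong] = \<mu>(1)
  have k'[measurable]: "k \<in> \<mu> \<rightarrow>\<^sub>M prob_algebra (prodM N Y)" using k by measurable
  interpret \<mu>: prob_space \<mu> by fact
  interpret \<pi>: prob_space ?\<pi> by (rule prob_space_sdp[OF \<mu>(2) k'])
  note [measurable_cong] = sets_sdp[OF \<mu>(2) k']
  have pX[measurable]: "(\<lambda>x. restrict x {..<t}) \<in> prodM N X \<rightarrow>\<^sub>M prodM t X"
    and pY[measurable]: "(\<lambda>y. restrict y {..<t}) \<in> prodM N Y \<rightarrow>\<^sub>M prodM t Y"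
    using t by (auto intro!: measurable_prefix)
  define \<mu>t where "\<mu>t = distr \<mu> (prodM t X) (\<lambda>x. restrict x {..<t})"
  have s\<mu>t[measurable_cong]: "sets \<mu>t = sets (prodM t X)" by (simp add: \<mu>t_def)
  have p\<mu>t: "prob_space \<mu>t" unfolding \<mu>t_def by (rule \<mu>.prob_space_distr) measurable
  define \<pi>t where "\<pi>t = distr ?\<pi> (\<mu>t \<Otimes>\<^sub>M prodM t Y) (\<lambda>z. (restrict (fst z) {..<t}, restrict (snd z) {..<t}))"
  have "\<exists>\<kappa>\<in>\<mu>t \<rightarrow>\<^sub>M prob_algebra (prodM t Y). \<pi>t = sdp \<mu>t (prodM t Y) \<kappa>"
  proof (rule disintegration[OF p\<mu>t])
    show "standard (prodM t Y)" using st t by (intro standard_prodM) auto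
    have "distr \<pi>t \<mu>t fst = distr ?\<pi> \<mu>t (\<lambda>z. restrict (fst z) {..<t})"
      unfolding \<pi>t_def by (subst distr_distr) (auto simp: comp_def)
    also have "\<dots> = distr (distr ?\<pi> \<mu> fst) \<mu>t (\<lambda>x. restrict x {..<t})"
      by (subst distr_distr) (auto simp: comp_def)
    also have "\<dots> = \<mu>t" unfolding distr_fst_sdp[OF \<mu>(2) k'] \<mu>t_def by (rule distr_cong) auto
    finally show "distr \<pi>t \<mu>t fst = \<mu>t" .
  qed (simp add: \<pi>t_def)
  then obtain \<kappa> where \<kappa>': "\<kappa> \<in> \<mu>t \<rightarrow>\<^sub>M prob_algebra (prodM t Y)" and \<pi>t: "\<pi>t = sdp \<mu>t (prodM t Y) \<kappa>" by blast
  have \<kappa>[measurable]: "\<kappa> \<in> prodM t X \<rightarrow>\<^sub>M prob_algebra (prodM t Y)" using \<kappa>' by measurable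
  let ?F = "filtM N t X"
  have idF[measurable]: "(\<lambda>x. x) \<in> \<mu> \<rightarrow>\<^sub>M ?F" using t by (intro measurable_ident_filtM \<mu>) simp
  have AEB: "AE x in \<mu>. emeasure (\<kappa> (restrict x {..<t})) B' = emeasure (distr (k x) (prodM t Y) (\<lambda>y. restrict y {..<t})) B'"
    if B': "B' \<in> sets (prodM t Y)" for B'
  proof -
    define B where "B = (\<lambda>y. restrict y {..<t}) -` B' \<inter> space (prodM N Y)"
    have BF: "B \<in> sets (filtM N t Y)" using B' t by (auto simp: sets_filtM B_def)
    have B[measurable]: "B \<in> sets (prodM N Y)" using filtM_subset[OF _ BF] t by simp
    define f where "f x = emeasure (\<kappa> (restrict x {..<t})) B'" for x
    note B'[measurable]
    have fF[measurable]: "f \<in> borel_measurable ?F"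
    proof -
      have "(\<lambda>w. emeasure (\<kappa> w) B') \<in> borel_measurable (prodM t X)"
        by (rule measurable_emeasure_kernel[OF measurable_prob_algebraD[OF \<kappa>] B'])
      from measurable_compose[OF measurable_from_filtM[OF less_imp_le[OF t]] this] show ?thesis by (simp add: f_def[abs_def])
    qed
    have f\<mu>[measurable]: "f \<in> borel_measurable \<mu>" using measurable_compose[OF idF fF] by simp
    have gm[measurable]: "(\<lambda>x. emeasure (k x) B) \<in> borel_measurable \<mu>"
      by (rule measurable_emeasure_kernel[OF measurable_prob_algebraD[OF k'] B])
    have kB: "emeasure (distr (k x) (prodM t Y) (\<lambda>y. restrict y {..<t})) B' = emeasure (k x) B" if x: "x \<in> space \<mu>" for x
    proof -
      note [measurable_cong] = prob_kernelD(2)[OF k' x]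
      show ?thesis using prob_kernelD(3)[OF k' x] by (subst emeasure_distr) (auto simp: B_def)
    qed
    have sF: "emeasure ?\<pi> (A \<times> B) = (\<integral>\<^sup>+x. f x * indicator A x \<partial>\<mu>)" if A: "A \<in> sets ?F" for A
    proof -
      obtain A' where A'[measurable]: "A' \<in> sets (prodM t X)" and AA: "A = (\<lambda>x. restrict x {..<t}) -` A' \<inter> space (prodM N X)"
        using A t by (auto simp: sets_filtM)
      have "emeasure ?\<pi> (A \<times> B) = emeasure \<pi>t (A' \<times> B')"
        unfolding \<pi>t_def using space_sdp[OF \<mu>(2) k'] sets_eq_imp_space_eq[OF \<mu>(1)]
        by (subst emeasure_distr) (auto simp: AA B_def intro!: arg_cong2[where f = emeasure])
      also have "\<dots> = (\<integral>\<^sup>+w. emeasure (\<kappa> w) B' * indicator A' w \<partial>\<mu>t)"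
        unfolding \<pi>t by (rule emeasure_sdp_times[OF p\<mu>t \<kappa>']) (simp_all add: s\<mu>t)
      also have "\<dots> = (\<integral>\<^sup>+x. emeasure (\<kappa> (restrict x {..<t})) B' * indicator A' (restrict x {..<t}) \<partial>\<mu>)"
        unfolding \<mu>t_def using measurable_emeasure_kernel[OF measurable_prob_algebraD[OF \<kappa>] B']
        by (subst nn_integral_distr) auto
      also have "\<dots> = (\<integral>\<^sup>+x. f x * indicator A x \<partial>\<mu>)"
        using sets_eq_imp_space_eq[OF \<mu>(1)] by (intro nn_integral_cong) (auto simp: f_def AA indicator_def)
      finally show ?thesis .
    qed
    have spm[measurable]: "fst \<in> ?\<pi> \<rightarrow>\<^sub>M ?F" using measurable_compose[OF measurable_fst idF] by measurable
    \<comment> \<open>Equality of the integrals over every D, not only over events of the past: the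
      constraint replaces D by \<open>cexp\<close>, the disintegration of the prefixes replaces the
      kernel by \<open>f\<close>, and \<open>cexp\<close> then turns back into D.\<close>
    have main: "(\<integral>\<^sup>+x. emeasure (k x) B * indicator D x \<partial>\<mu>) = (\<integral>\<^sup>+x. f x * indicator D x \<partial>\<mu>)" if D: "D \<in> sets \<mu>" for D
    proof -
      have D': "D \<in> sets (prodM N X)" using D \<mu> by simp
      have "(\<integral>\<^sup>+x. emeasure (k x) B * indicator D x \<partial>\<mu>) = emeasure ?\<pi> (D \<times> B)"
        by (rule emeasure_sdp_times[OF \<mu>(2) k' D B, symmetric])
      also have "\<dots> = (\<integral>\<^sup>+z. cexp N X \<mu> t D (fst z) * indicator B (snd z) \<partial>?\<pi>)"
        using c t BF D' unfolding causal_constraint_def by blast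
      also have "\<dots> = (\<integral>\<^sup>+z. indicator B (snd z) * cexp N X \<mu> t D (fst z) \<partial>?\<pi>)" by (simp add: mult.commute)
      also have "\<dots> = (\<integral>\<^sup>+x. f x * cexp N X \<mu> t D x \<partial>\<mu>)"
      proof (rule nn_integral_eq_of_sets[OF spm idF])
        fix A assume A: "A \<in> sets ?F"
        have "(\<integral>\<^sup>+z. indicator B (snd z) * indicator A (fst z) \<partial>?\<pi>) = (\<integral>\<^sup>+z. indicator (A \<times> B) z \<partial>?\<pi>)"
          by (intro nn_integral_cong) (auto simp: indicator_def)
        also have "\<dots> = emeasure ?\<pi> (A \<times> B)"
          using filtM_subset[OF less_imp_le[OF t] A] by (intro nn_integral_indicator) simp
        also have "\<dots> = (\<integral>\<^sup>+x. f x * indicator A x \<partial>\<mu>)" by (rule sF[OF A])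
        finally show "(\<integral>\<^sup>+z. indicator B (snd z) * indicator A (fst z) \<partial>?\<pi>) = (\<integral>\<^sup>+x. f x * indicator A x \<partial>\<mu>)" .
      qed (simp_all add: measurable_cexp)
      also have "\<dots> = (\<integral>\<^sup>+x. f x * indicator D x \<partial>\<mu>)"
        using t by (intro cexp_intg \<mu> fF D') simp
      finally show ?thesis .
    qed
    have "density \<mu> (\<lambda>x. emeasure (k x) B) = density \<mu> f"
      by (rule measure_eqI) (simp_all add: emeasure_density main)
    then have "AE x in \<mu>. emeasure (k x) B = f x"
      by (subst (asm) \<mu>.density_unique_iff) auto
    then show ?thesis using AE_space by eventually_elim (simp add: kB f_def)
  qed
  have "standard (prodM t Y)" using st t by (intro standard_prodM) auto
  then obtain \<G> where G: "countable \<G>" "\<G> \<subseteq> sets (prodM t Y)"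
    "\<And>P Q. prob_space P \<Longrightarrow> sets P = sets (prodM t Y) \<Longrightarrow> prob_space Q \<Longrightarrow> sets Q = sets (prodM t Y) \<Longrightarrow>
      \<forall>G\<in>\<G>. emeasure P G = emeasure Q G \<Longrightarrow> P = Q"
    by (rule standard_determining) (rule that)
  have "AE x in \<mu>. \<forall>B\<in>\<G>. emeasure (\<kappa> (restrict x {..<t})) B = emeasure (distr (k x) (prodM t Y) (\<lambda>y. restrict y {..<t})) B"
    using G(1,2) AEB by (subst AE_ball_countable) auto
  then have "AE x in \<mu>. \<kappa> (restrict x {..<t}) = distr (k x) (prodM t Y) (\<lambda>y. restrict y {..<t})"
    using AE_space
  proof eventually_elim
    case (elim x)
    note x = elim(2)
    have "restrict x {..<t} \<in> space (prodM t X)"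
      using measurable_space[OF pX] x sets_eq_imp_space_eq[OF \<mu>(1)] by simp
    note r = prob_kernelD[OF \<kappa> this]
    note [measurable_cong] = prob_kernelD(2)[OF k' x]
    have "prob_space (distr (k x) (prodM t Y) (\<lambda>y. restrict y {..<t}))"
      by (rule prob_space.prob_space_distr[OF prob_kernelD(1)[OF k' x]]) measurable
    then show ?case using elim(1) r by (intro G(3)) auto
  qed
  then show ?thesis using \<kappa> by blast
qed

text \<open>Kernels for the prefixes agree only almost surely; at the first disagreement the adapted kernel is
  continued deterministically, which keeps all prefixes consistent everywhere.\<close>

lemma constraint_imp_causal:
  assumes \<mu>: "sets \<mu> = sets (prodM N X)" "prob_space \<mu>"
    and st: "\<And>t. t < N \<Longrightarrow> standard (borel_of (Y t))"
    and k: "k \<in> prodM N X \<rightarrow>\<^sub>M prob_algebra (prodM N Y)"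
    and c: "causal_constraint N X Y \<mu> (sdp \<mu> (prodM N Y) k)"
  shows "causal N X Y \<mu> (sdp \<mu> (prodM N Y) k)"
proof -
  note [measurable_cong] = \<mu>(1)
  have k'[measurable]: "k \<in> \<mu> \<rightarrow>\<^sub>M prob_algebra (prodM N Y)" using k by measurable
  interpret \<mu>: prob_space \<mu> by fact
  have spk: "distr (k x) (prodM N Y) (\<lambda>y. restrict y {..<N}) = k x" if x: "x \<in> space \<mu>" for x
  proof -
    have "distr (k x) (prodM N Y) (\<lambda>y. restrict y {..<N}) = distr (k x) (prodM N Y) (\<lambda>y. y)"
      by (rule distr_cong) (use prob_kernelD(3)[OF k' x] prefix_id in auto)
    then show ?thesis using distr_id2[of "prodM N Y" "k x"] prob_kernelD(2)[OF k' x] by simp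
  qed
  \<comment> \<open>The constraint speaks of t < N only; at t = N the kernel \<open>k\<close> serves
    itself.\<close>
  have pk: "\<exists>\<kappa>\<in>prodM t X \<rightarrow>\<^sub>M prob_algebra (prodM t Y).
    AE x in \<mu>. \<kappa> (restrict x {..<t}) = distr (k x) (prodM t Y) (\<lambda>y. restrict y {..<t})" if t: "t \<le> N" for t
  proof (cases "t = N")
    case True
    have "AE x in \<mu>. k (restrict x {..<N}) = distr (k x) (prodM N Y) (\<lambda>y. restrict y {..<N})"
      using AE_space by eventually_elim (use prefix_id[of _ N X] sets_eq_imp_space_eq[OF \<mu>(1)] in \<open>simp add: spk\<close>)
    then show ?thesis using True k by blast
  next
    case False
    then show ?thesis using prefix_kernel[OF \<mu> st k c] t by simp
  qed
  have ex: "\<exists>\<kappa>. \<kappa> \<in> prodM t X \<rightarrow>\<^sub>M prob_algebra (prodM t Y) \<and>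
      (AE x in \<mu>. \<kappa> (restrict x {..<t}) = distr (k x) (prodM t Y) (\<lambda>y. restrict y {..<t})) \<and>
      (\<forall>s<t. \<forall>B\<in>sets (filtM t s Y). (\<lambda>x. emeasure (\<kappa> x) B) \<in> borel_measurable (filtM t s X))" if "t \<le> N" for t
    using that
  proof (induction t)
    case 0
    obtain \<kappa> where a: "\<kappa> \<in> prodM 0 X \<rightarrow>\<^sub>M prob_algebra (prodM 0 Y)"
      and b: "AE x in \<mu>. \<kappa> (restrict x {..<0}) = distr (k x) (prodM 0 Y) (\<lambda>y. restrict y {..<0})"
      using pk[OF le0] by blast
    show ?case by (rule exI[of _ \<kappa>], rule conjI[OF a conjI[OF b]]) simp
  next
    case (Suc t)
    from Suc.IH[OF Suc_leD[OF Suc.prems]] obtain \<kappa> where \<kappa>[measurable]: "\<kappa> \<in> prodM t X \<rightarrow>\<^sub>M prob_algebra (prodM t Y)"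
      and \<kappa>ae: "AE x in \<mu>. \<kappa> (restrict x {..<t}) = distr (k x) (prodM t Y) (\<lambda>y. restrict y {..<t})"
      and \<kappa>ad: "\<And>s B. s < t \<Longrightarrow> B \<in> sets (filtM t s Y) \<Longrightarrow> (\<lambda>x. emeasure (\<kappa> x) B) \<in> borel_measurable (filtM t s X)"
      by blast
    obtain l where l[measurable]: "l \<in> prodM (Suc t) X \<rightarrow>\<^sub>M prob_algebra (prodM (Suc t) Y)"
      and lae: "AE x in \<mu>. l (restrict x {..<Suc t}) = distr (k x) (prodM (Suc t) Y) (\<lambda>y. restrict y {..<Suc t})"
      using pk[OF Suc.prems] by blast
    have pX[measurable]: "(\<lambda>x. restrict x {..<t}) \<in> prodM (Suc t) X \<rightarrow>\<^sub>M prodM t X"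
      and pY[measurable]: "(\<lambda>y. restrict y {..<t}) \<in> prodM (Suc t) Y \<rightarrow>\<^sub>M prodM t Y"
      by (auto intro!: measurable_prefix)
    have "space \<mu> \<noteq> {}" by (rule \<mu>.not_empty)
    then obtain x0 where "x0 \<in> space \<mu>" by blast
    then have "space (prodM N Y) \<noteq> {}"
      using prob_space.not_empty[OF prob_kernelD(1)[OF k']] prob_kernelD(3)[OF k'] by metis
    then obtain y0 where "y0 \<in> space (prodM N Y)" by blast
    then have c: "y0 t \<in> topspace (Y t)" using Suc.prems by (auto simp: space_prodM PiE_iff)
    \<comment> \<open>Continuation of the adapted kernel by the constant \<open>y0 t\<close>; its
      prefix law is that of \<open>\<kappa>\<close> for every x.\<close>
    define d where "d x = distr (\<kappa> (restrict x {..<t})) (prodM (Suc t) Y) (\<lambda>y. y(t := y0 t))" for x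
    have upm[measurable]: "(\<lambda>y. y(t := y0 t)) \<in> prodM t Y \<rightarrow>\<^sub>M prodM (Suc t) Y"
      using measurable_compose[OF measurable_Pair2'[of "y0 t" "borel_of (Y t)" "prodM t Y"] measurable_upd[of t Y]] c by simp
    have dm: "d \<in> prodM (Suc t) X \<rightarrow>\<^sub>M prob_algebra (prodM (Suc t) Y)"
      unfolding d_def by (rule measurable_compose[OF pX measurable_compose[OF \<kappa> measurable_distr_prob_space[OF upm]]])
    define push where "push P = distr P (prodM t Y) (\<lambda>y. restrict y {..<t})" for P
    have pushm: "(\<lambda>x. push (l x)) \<in> prodM (Suc t) X \<rightarrow>\<^sub>M prob_algebra (prodM t Y)"
      unfolding push_def by (rule measurable_compose[OF l measurable_distr_prob_space[OF pY]])
    have \<kappa>r: "(\<lambda>x. \<kappa> (restrict x {..<t})) \<in> prodM (Suc t) X \<rightarrow>\<^sub>M prob_algebra (prodM t Y)"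
      by (rule measurable_compose[OF pX \<kappa>])
    define \<kappa>' where "\<kappa>' x = (if push (l x) = \<kappa> (restrict x {..<t}) then l x else d x)" for x
    have "standard (prodM t Y)" using st Suc.prems by (intro standard_prodM) auto
    then obtain \<G> where G: "countable \<G>" "\<G> \<subseteq> sets (prodM t Y)"
      "\<And>P Q. prob_space P \<Longrightarrow> sets P = sets (prodM t Y) \<Longrightarrow> prob_space Q \<Longrightarrow> sets Q = sets (prodM t Y) \<Longrightarrow>
        \<forall>G\<in>\<G>. emeasure P G = emeasure Q G \<Longrightarrow> P = Q"
      by (rule standard_determining) (rule that)
    have "{x \<in> space (prodM (Suc t) X). push (l x) = \<kappa> (restrict x {..<t})} =
      {x \<in> space (prodM (Suc t) X). \<forall>B\<in>\<G>. emeasure (push (l x)) B = emeasure (\<kappa> (restrict x {..<t})) B}"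
    proof (intro Collect_cong conj_cong refl iffI)
      fix x assume x: "x \<in> space (prodM (Suc t) X)"
      show "push (l x) = \<kappa> (restrict x {..<t})"
        if "\<forall>B\<in>\<G>. emeasure (push (l x)) B = emeasure (\<kappa> (restrict x {..<t})) B"
        by (rule G(3)[OF prob_kernelD(1,2)[OF pushm x] prob_kernelD(1,2)[OF \<kappa>r x] that])
    qed simp
    also have "\<dots> = space (prodM (Suc t) X) -
      (\<Union>B\<in>\<G>. {x \<in> space (prodM (Suc t) X). emeasure (push (l x)) B \<noteq> emeasure (\<kappa> (restrict x {..<t})) B})" by auto
    also have "\<dots> \<in> sets (prodM (Suc t) X)"
    proof (intro sets.Diff sets.top sets.countable_UN'[OF G(1)] image_subsetI)
      fix B assume "B \<in> \<G>"
      then have B: "B \<in> sets (prodM t Y)" using G by auto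
      show "{x \<in> space (prodM (Suc t) X). emeasure (push (l x)) B \<noteq> emeasure (\<kappa> (restrict x {..<t})) B} \<in> sets (prodM (Suc t) X)"
        by (rule borel_measurable_neq)
           (rule measurable_emeasure_kernel[OF measurable_prob_algebraD B], rule pushm,
            rule measurable_emeasure_kernel[OF measurable_prob_algebraD B], rule \<kappa>r)
    qed
    finally have cond: "{x \<in> space (prodM (Suc t) X). push (l x) = \<kappa> (restrict x {..<t})} \<in> sets (prodM (Suc t) X)" .
    have \<kappa>'m: "\<kappa>' \<in> prodM (Suc t) X \<rightarrow>\<^sub>M prob_algebra (prodM (Suc t) Y)"
      unfolding \<kappa>'_def by (rule measurable_If[OF l dm cond])
    have push_d: "push (d x) = \<kappa> (restrict x {..<t})" if x: "x \<in> space (prodM (Suc t) X)" for x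
    proof -
      have rx: "restrict x {..<t} \<in> space (prodM t X)" by (rule measurable_space[OF pX x])
      note [measurable_cong] = prob_kernelD(2)[OF \<kappa> rx]
      have "push (d x) = distr (\<kappa> (restrict x {..<t})) (prodM t Y) (\<lambda>y. restrict (y(t := y0 t)) {..<t})"
        unfolding push_def d_def by (subst distr_distr) (auto simp: comp_def)
      also have "\<dots> = distr (\<kappa> (restrict x {..<t})) (prodM t Y) (\<lambda>y. y)"
        by (rule distr_cong) (use prob_kernelD(3)[OF \<kappa> rx] in \<open>auto simp: prefix_upd prefix_id\<close>)
      also have "\<dots> = \<kappa> (restrict x {..<t})" by (rule distr_id2) (simp add: prob_kernelD(2)[OF \<kappa> rx])
      finally show ?thesis .
    qed
    \<comment> \<open>Consistency holds for every x, not just almost every one. Events of the first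
      s \<le> t coordinates therefore have the probabilities given by the earlier kernel, which is
      adapted already.\<close>
    have push_\<kappa>': "push (\<kappa>' x) = \<kappa> (restrict x {..<t})" if "x \<in> space (prodM (Suc t) X)" for x
      using push_d[OF that] by (simp add: \<kappa>'_def)
    have ae: "AE x in \<mu>. \<kappa>' (restrict x {..<Suc t}) = distr (k x) (prodM (Suc t) Y) (\<lambda>y. restrict y {..<Suc t})"
      using \<kappa>ae lae AE_space
    proof eventually_elim
      case (elim x)
      note x = elim(3)
      note [measurable_cong] = prob_kernelD(2)[OF k' x]
      have [measurable]: "(\<lambda>y. restrict y {..<Suc t}) \<in> prodM N Y \<rightarrow>\<^sub>M prodM (Suc t) Y"
        using Suc.prems by (intro measurable_prefix) simp
      have "push (l (restrict x {..<Suc t})) = distr (k x) (prodM t Y) (\<lambda>y. restrict (restrict y {..<Suc t}) {..<t})"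
        unfolding push_def elim(2) by (subst distr_distr) (auto simp: comp_def)
      also have "\<dots> = \<kappa> (restrict (restrict x {..<Suc t}) {..<t})"
        unfolding prefix_prefix[OF le_SucI[OF order_refl]] elim(1) ..
      finally show ?case using elim(2) by (simp add: \<kappa>'_def)
    qed
    have ad: "(\<lambda>x. emeasure (\<kappa>' x) B) \<in> borel_measurable (filtM (Suc t) s X)"
      if s: "s < Suc t" and B: "B \<in> sets (filtM (Suc t) s Y)" for s B
    proof -
      obtain B' where B'[measurable]: "B' \<in> sets (prodM s Y)" and BB: "B = (\<lambda>y. restrict y {..<s}) -` B' \<inter> space (prodM (Suc t) Y)"
        using B s by (auto simp: sets_filtM)
      define C where "C = (\<lambda>y. restrict y {..<s}) -` B' \<inter> space (prodM t Y)"
      have Cs: "C \<in> sets (filtM t s Y)" using s B' by (auto simp: sets_filtM C_def)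
      have C[measurable]: "C \<in> sets (prodM t Y)" using filtM_subset[OF _ Cs] s by simp
      have eq: "emeasure (\<kappa>' x) B = emeasure (\<kappa> (restrict x {..<t})) C" if x: "x \<in> space (prodM (Suc t) X)" for x
      proof -
        note [measurable_cong] = prob_kernelD(2)[OF \<kappa>'m x]
        have "emeasure (\<kappa> (restrict x {..<t})) C = emeasure (push (\<kappa>' x)) C" by (simp add: push_\<kappa>'[OF x])
        also have "\<dots> = emeasure (\<kappa>' x) ((\<lambda>y. restrict y {..<t}) -` C \<inter> space (\<kappa>' x))"
          unfolding push_def by (rule emeasure_distr) measurable
        also have "(\<lambda>y. restrict y {..<t}) -` C \<inter> space (\<kappa>' x) = B"
          using measurable_space[OF pY] prob_kernelD(3)[OF \<kappa>'m x]
          by (auto simp: C_def BB prefix_prefix[OF less_Suc_eq_le[THEN iffD1, OF s]] simp del: restrict_restrict)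
        finally show ?thesis by (rule sym)
      qed
      have "(\<lambda>x. restrict x {..<t}) \<in> filtM (Suc t) s X \<rightarrow>\<^sub>M filtM t s X"
      proof (rule measurable_to_filtM)
        show "s \<le> t" using s by simp
        show "(\<lambda>x. restrict x {..<t}) \<in> space (filtM (Suc t) s X) \<rightarrow> space (prodM t X)"
          using measurable_space[OF pX] by auto
        show "(\<lambda>x. restrict (restrict x {..<t}) {..<s}) \<in> filtM (Suc t) s X \<rightarrow>\<^sub>M prodM s X"
          unfolding prefix_prefix[OF \<open>s \<le> t\<close>] using s by (intro measurable_from_filtM) simp
      qed
      moreover have "(\<lambda>x. emeasure (\<kappa> x) C) \<in> borel_measurable (filtM t s X)"
      \<comment> \<open>At s = t adaptedness of \<open>\<kappa>\<close> amounts to its measurability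
        in the whole prefix.\<close>
      proof (cases "s = t")
        case True
        have "(\<lambda>x. emeasure (\<kappa> (restrict x {..<t})) C) \<in> borel_measurable (filtM t t X)"
          by (rule measurable_compose[OF measurable_from_filtM[OF order_refl]
                measurable_emeasure_kernel[OF measurable_prob_algebraD[OF \<kappa>] C]])
        then show ?thesis unfolding True
          by (rule measurable_cong[THEN iffD1, rotated]) (simp add: prefix_id)
      next
        case False then show ?thesis using \<kappa>ad Cs s by simp
      qed
      ultimately have "(\<lambda>x. emeasure (\<kappa> (restrict x {..<t})) C) \<in> borel_measurable (filtM (Suc t) s X)"
        by (rule measurable_compose)
      then show ?thesis by (rule measurable_cong[THEN iffD1, rotated]) (simp add: eq)
    qed
    show ?case using \<kappa>'m ae ad by blast
  qed
  obtain \<kappa> where \<kappa>: "\<kappa> \<in> prodM N X \<rightarrow>\<^sub>M prob_algebra (prodM N Y)"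
    and ae: "AE x in \<mu>. \<kappa> (restrict x {..<N}) = distr (k x) (prodM N Y) (\<lambda>y. restrict y {..<N})"
    and ad: "\<And>s B. s < N \<Longrightarrow> B \<in> sets (filtM N s Y) \<Longrightarrow> (\<lambda>x. emeasure (\<kappa> x) B) \<in> borel_measurable (filtM N s X)"
    using ex[OF order_refl] by blast
  have \<kappa>2: "\<kappa> \<in> \<mu> \<rightarrow>\<^sub>M prob_algebra (prodM N Y)" using \<kappa> by measurable
  have ae2: "AE x in \<mu>. k x = \<kappa> x"
    using ae AE_space by eventually_elim (use prefix_id[of _ N X] sets_eq_imp_space_eq[OF \<mu>(1)] in \<open>simp add: spk\<close>)
  have "sdp \<mu> (prodM N Y) k = sdp \<mu> (prodM N Y) \<kappa>"
    unfolding sdp_def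
  proof (rule bind_cong_AE')
    show "\<mu> \<in> space (prob_algebra \<mu>)" by (rule M_in_prob_algebra[OF \<mu>(2) k'])
    show "(\<lambda>x. distr (k x) (\<mu> \<Otimes>\<^sub>M prodM N Y) (Pair x)) \<in> \<mu> \<rightarrow>\<^sub>M prob_algebra (\<mu> \<Otimes>\<^sub>M prodM N Y)"
      by (rule kernel_pair[OF \<mu>(2) k'])
    show "(\<lambda>x. distr (\<kappa> x) (\<mu> \<Otimes>\<^sub>M prodM N Y) (Pair x)) \<in> \<mu> \<rightarrow>\<^sub>M prob_algebra (\<mu> \<Otimes>\<^sub>M prodM N Y)"
      by (rule kernel_pair[OF \<mu>(2) \<kappa>2])
    show "AE x in \<mu>. distr (k x) (\<mu> \<Otimes>\<^sub>M prodM N Y) (Pair x) = distr (\<kappa> x) (\<mu> \<Otimes>\<^sub>M prodM N Y) (Pair x)"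
      using ae2 by eventually_elim simp
  qed
  then show ?thesis unfolding causal_def bind_eq_sdp[OF \<mu>(1)] using \<kappa> ad by blast
qed

section \<open>Topology of path spaces\<close>

lemma second_countable_Polish: "Polish_space T \<Longrightarrow> second_countable T"
proof (cases "topspace T = {}")
  case True
  then show ?thesis unfolding second_countable_def
    by (intro exI[of _ "{}"]) (auto dest: openin_subset)
next
  case False
  assume "Polish_space T"
  then obtain d a where MS: "Metric_space (topspace T) d" and mt: "Metric_space.mtopology (topspace T) d = T"
    and a: "range a \<subseteq> topspace T" and dense: "\<And>x \<epsilon>. x \<in> topspace T \<Longrightarrow> \<epsilon> > 0 \<Longrightarrow> \<exists>n::nat. d x (a n) < \<epsilon>"
    by (rule Polish_spaceE[OF _ False]) (rule that)
  interpret Metric_space "topspace T" d by fact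
  let ?B = "(\<lambda>(m, q). mball (a m) q) ` (UNIV \<times> \<rat>)"
  show ?thesis unfolding second_countable_def
  proof (intro exI[of _ ?B] conjI allI impI ballI)
    show "countable ?B" by (intro countable_image countable_SIGMA) (auto simp: countable_rat)
    show "openin T V" if "V \<in> ?B" for V using that openin_mball mt by auto
    fix U x assume Ux: "openin T U \<and> x \<in> U"
    then have x: "x \<in> topspace T" using openin_subset by blast
    have "openin mtopology U" using Ux mt by simp
    then obtain r where r: "r > 0" "mball x r \<subseteq> U" using Ux by (auto simp: openin_mtopology)
    obtain m where m: "d x (a m) < r/3" using dense[OF x, of "r/3"] r by auto
    have am: "a m \<in> topspace T" using a by auto
    obtain q where q: "q \<in> \<rat>" "r/3 < q" "q < r/2" using Rats_dense_in_real[of "r/3" "r/2"] r by auto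
    have "mball (a m) q \<subseteq> mball x r"
    proof
      fix z assume z: "z \<in> mball (a m) q"
      then have "d x z \<le> d x (a m) + d (a m) z" using x am by (intro triangle) auto
      then show "z \<in> mball x r" using m q z x r by auto
    qed
    moreover have "x \<in> mball (a m) q" using m q x am by (auto simp: commute)
    ultimately show "\<exists>V\<in>?B. x \<in> V \<and> V \<subseteq> U" using q r by blast
  qed
qed

definition path_top :: "nat \<Rightarrow> (nat \<Rightarrow> 'a topology) \<Rightarrow> (nat \<Rightarrow> 'a) topology" where
  "path_top n X = product_topology X {..<n}"

lemma topspace_path_top: "topspace (path_top n X) = space (prodM n X)"
  by (simp add: path_top_def space_prodM)

text \<open>Boxes of base sets over finitely many factors. Being measurable boxes and countable in
  number, they place every open set of the product topology into the product sigma-algebra.\<close>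

lemma path_top_base:
  assumes X: "\<And>t. t < n \<Longrightarrow> second_countable (X t)"
  obtains \<B> where "countable \<B>" "\<B> \<subseteq> sets (prodM n X)" "\<And>V. V \<in> \<B> \<Longrightarrow> openin (path_top n X) V"
    "\<And>U x. openin (path_top n X) U \<Longrightarrow> x \<in> U \<Longrightarrow> \<exists>V\<in>\<B>. x \<in> V \<and> V \<subseteq> U"
proof -
  have "\<forall>t\<in>{..<n}. \<exists>B. countable B \<and> (\<forall>V\<in>B. openin (X t) V) \<and> (\<forall>U x. openin (X t) U \<and> x \<in> U \<longrightarrow> (\<exists>V\<in>B. x \<in> V \<and> V \<subseteq> U))"
    using X unfolding second_countable_def by auto
  then obtain B where B: "\<forall>t\<in>{..<n}. countable (B t) \<and> (\<forall>V\<in>B t. openin (X t) V) \<and> (\<forall>U x. openin (X t) U \<and> x \<in> U \<longrightarrow> (\<exists>V\<in>B t. x \<in> V \<and> V \<subseteq> U))"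
    by (rule bchoice[THEN exE])
  let ?B = "PiE {..<n} ` PiE {..<n} B"
  have op: "openin (path_top n X) V" if "V \<in> ?B" for V
    using that B unfolding path_top_def by (auto simp: openin_PiE_gen PiE_iff)
  show ?thesis
  proof (rule that[of ?B])
    show "countable ?B" using B by (intro countable_image countable_PiE) auto
    show "?B \<subseteq> sets (prodM n X)"
      unfolding prodM_def using B by (auto intro!: sets_PiM_I_finite borel_of_open simp: PiE_iff)
    show "openin (path_top n X) V" if "V \<in> ?B" for V by (rule op[OF that])
    fix U x assume U: "openin (path_top n X) U" and x: "x \<in> U"
    then obtain W where W: "\<forall>i\<in>{..<n}. openin (X i) (W i)" "x \<in> PiE {..<n} W" "PiE {..<n} W \<subseteq> U"
      unfolding path_top_def openin_product_topology_alt by metis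
    have "\<forall>t\<in>{..<n}. \<exists>V\<in>B t. x t \<in> V \<and> V \<subseteq> W t" using B W by (auto simp: PiE_iff)
    then have "\<forall>t\<in>{..<n}. \<exists>V. V \<in> B t \<and> x t \<in> V \<and> V \<subseteq> W t" by blast
    then obtain V where V: "\<forall>t\<in>{..<n}. V t \<in> B t \<and> x t \<in> V t \<and> V t \<subseteq> W t" by (rule bchoice[THEN exE])
    let ?V = "PiE {..<n} (restrict V {..<n})"
    have "?V \<in> ?B" using V by (intro imageI) auto
    moreover have "x \<in> ?V" using V W by (auto simp: PiE_iff)
    moreover have "?V \<subseteq> PiE {..<n} W" by (rule PiE_mono) (use V in auto)
    then have "?V \<subseteq> U" using W(3) by (rule order_trans)
    ultimately show "\<exists>V\<in>?B. x \<in> V \<and> V \<subseteq> U" by blast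
  qed
qed

lemma open_in_prodM:
  assumes X: "\<And>t. t < n \<Longrightarrow> second_countable (X t)" and U: "openin (path_top n X) U"
  shows "U \<in> sets (prodM n X)"
proof -
  obtain \<B> where B: "countable \<B>" "\<B> \<subseteq> sets (prodM n X)" "\<And>V. V \<in> \<B> \<Longrightarrow> openin (path_top n X) V"
    "\<And>U x. openin (path_top n X) U \<Longrightarrow> x \<in> U \<Longrightarrow> \<exists>V\<in>\<B>. x \<in> V \<and> V \<subseteq> U"
    by (rule path_top_base[of n X]) (use X in auto)
  have "U = \<Union>{V \<in> \<B>. V \<subseteq> U}" using B(4)[OF U] by blast
  also have "\<dots> \<in> sets (prodM n X)"
    using B(1,2) by (intro sets.countable_Union) (auto intro: countable_subset)
  finally show ?thesis .
qed

lemma continuous_path_measurable: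
  assumes X: "\<And>t. t < n \<Longrightarrow> second_countable (X t)" and f: "continuous_map (path_top n X) euclideanreal f"
  shows "f \<in> borel_measurable (prodM n X)"
proof (rule borel_measurableI)
  fix S :: "real set" assume "open S"
  then have "openin (path_top n X) {x \<in> topspace (path_top n X). f x \<in> S}"
    using f by (intro openin_continuous_map_preimage[OF f]) simp
  from open_in_prodM[OF X this] show "f -` S \<inter> space (prodM n X) \<in> sets (prodM n X)"
    by (simp add: topspace_path_top vimage_def Int_def conj_commute)
qed

lemma open_rectangles:
  assumes X: "\<And>t. t < n \<Longrightarrow> second_countable (X t)" and Y: "\<And>t. t < n \<Longrightarrow> second_countable (Y t)"
    and U: "openin (prod_topology (path_top n X) (path_top n Y)) U"
  obtains A B :: "nat \<Rightarrow> _" where "\<And>i. A i \<in> sets (prodM n X)" "\<And>i. B i \<in> sets (prodM n Y)" "U = (\<Union>i. A i \<times> B i)"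
proof -
  obtain \<A> where A: "countable \<A>" "\<A> \<subseteq> sets (prodM n X)" "\<And>V. V \<in> \<A> \<Longrightarrow> openin (path_top n X) V"
    "\<And>U x. openin (path_top n X) U \<Longrightarrow> x \<in> U \<Longrightarrow> \<exists>V\<in>\<A>. x \<in> V \<and> V \<subseteq> U"
    by (rule path_top_base[of n X]) (use X in auto)
  obtain \<B> where B: "countable \<B>" "\<B> \<subseteq> sets (prodM n Y)" "\<And>V. V \<in> \<B> \<Longrightarrow> openin (path_top n Y) V"
    "\<And>U x. openin (path_top n Y) U \<Longrightarrow> x \<in> U \<Longrightarrow> \<exists>V\<in>\<B>. x \<in> V \<and> V \<subseteq> U"
    by (rule path_top_base[of n Y]) (use Y in auto)
  \<comment> \<open>The empty rectangle keeps the countable family nonempty, so that it can be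
    enumerated by the naturals.\<close>
  define R where "R = insert ({}, {}) {(V, W) \<in> \<A> \<times> \<B>. V \<times> W \<subseteq> U}"
  have cR: "countable R"
    unfolding R_def by (intro countable_insert countable_subset[OF _ countable_SIGMA[OF A(1) B(1)]]) auto
  have ne: "R \<noteq> {}" by (simp add: R_def)
  have inR: "fst (from_nat_into R i) \<in> sets (prodM n X) \<and> snd (from_nat_into R i) \<in> sets (prodM n Y) \<and>
      fst (from_nat_into R i) \<times> snd (from_nat_into R i) \<subseteq> U" for i
  proof -
    have "\<And>p. p \<in> R \<Longrightarrow> fst p \<in> sets (prodM n X) \<and> snd p \<in> sets (prodM n Y) \<and> fst p \<times> snd p \<subseteq> U"
      using A(2) B(2) unfolding R_def by auto
    then show ?thesis using from_nat_into[OF ne] by metis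
  qed
  have "U = (\<Union>i. fst (from_nat_into R i) \<times> snd (from_nat_into R i))"
  proof (intro equalityI subsetI)
    fix z assume z: "z \<in> U"
    obtain x y where xy: "z = (x, y)" by force
    obtain G H where GH: "openin (path_top n X) G" "openin (path_top n Y) H" "x \<in> G" "y \<in> H" "G \<times> H \<subseteq> U"
    proof -
      have "\<exists>G H. openin (path_top n X) G \<and> openin (path_top n Y) H \<and> x \<in> G \<and> y \<in> H \<and> G \<times> H \<subseteq> U"
        using U[unfolded openin_prod_topology_alt, rule_format, of x y] z unfolding xy by simp
      then show ?thesis using that by blast
    qed
    obtain V where V: "V \<in> \<A>" "x \<in> V" "V \<subseteq> G" using A(4) GH by blast
    obtain W where W: "W \<in> \<B>" "y \<in> W" "W \<subseteq> H" using B(4) GH by blast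
    have "(V, W) \<in> R" using V W GH by (auto simp: R_def)
    then obtain i where "from_nat_into R i = (V, W)" using range_from_nat_into[OF ne cR] by (metis imageE)
    then show "z \<in> (\<Union>i. fst (from_nat_into R i) \<times> snd (from_nat_into R i))" using V W xy by (auto intro!: exI[of _ i])
  qed (use inR in blast)
  then show ?thesis using that[of "\<lambda>i. fst (from_nat_into R i)" "\<lambda>i. snd (from_nat_into R i)"] inR by blast
qed

lemma continuous_pair_measurable:
  assumes X: "\<And>t. t < n \<Longrightarrow> second_countable (X t)" and Y: "\<And>t. t < n \<Longrightarrow> second_countable (Y t)"
    and f: "continuous_map (prod_topology (path_top n X) (path_top n Y)) euclideanreal f"
  shows "f \<in> borel_measurable (prodM n X \<Otimes>\<^sub>M prodM n Y)"
proof (rule borel_measurableI)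
  fix S :: "real set" assume "open S"
  then have op: "openin (prod_topology (path_top n X) (path_top n Y)) {x \<in> topspace (prod_topology (path_top n X) (path_top n Y)). f x \<in> S}"
    by (intro openin_continuous_map_preimage[OF f]) simp
  obtain A B where AB: "\<And>i::nat. A i \<in> sets (prodM n X)" "\<And>i. B i \<in> sets (prodM n Y)"
    "{x \<in> topspace (prod_topology (path_top n X) (path_top n Y)). f x \<in> S} = (\<Union>i. A i \<times> B i)"
    by (rule open_rectangles[OF _ _ op]) (use X Y that in auto)
  have "f -` S \<inter> space (prodM n X \<Otimes>\<^sub>M prodM n Y) = (\<Union>i. A i \<times> B i)"
    unfolding AB(3)[symmetric] by (auto simp: topspace_path_top space_pair_measure)
  also have "\<dots> \<in> sets (prodM n X \<Otimes>\<^sub>M prodM n Y)" using AB(1,2) by auto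
  finally show "f -` S \<inter> space (prodM n X \<Otimes>\<^sub>M prodM n Y) \<in> sets (prodM n X \<Otimes>\<^sub>M prodM n Y)" .
qed

text \<open>The sets with the approximation property form a sigma-algebra, and it contains the
  preimages of balls under coordinates. One function serves all measures of the finite family, which
  \<open>marginal_closed\<close> uses with two laws at once.\<close>

lemma approx_set_continuous:
  fixes X :: "nat \<Rightarrow> 'a topology"
  assumes X: "\<And>t. t < n \<Longrightarrow> Polish_space (X t)" and fin: "finite F"
    and F: "\<And>\<mu>. \<mu> \<in> F \<Longrightarrow> prob_space \<mu> \<and> sets \<mu> = sets (prodM n X)"
    and A: "A \<in> sets (prodM n X)" and \<eta>: "0 < (\<eta>::real)"
  shows "\<exists>g. continuous_map (path_top n X) euclideanreal g \<and> (\<forall>x. 0 \<le> g x \<and> g x \<le> 1) \<and>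
    (\<forall>\<mu>\<in>F. (\<integral>x. \<bar>indicator A x - g x\<bar> \<partial>\<mu>) < \<eta>)"
proof -
  let ?\<Omega> = "space (prodM n X)"
  have sc: "second_countable (X t)" if "t < n" for t by (rule second_countable_Polish[OF X[OF that]])
  define good where "good A g \<eta> \<longleftrightarrow> continuous_map (path_top n X) euclideanreal g \<and> (\<forall>x. 0 \<le> g x \<and> g x \<le> 1) \<and>
    (\<forall>\<mu>\<in>F. (\<integral>x. \<bar>indicator A x - g x\<bar> \<partial>\<mu>) < \<eta>)" for A g and \<eta> :: real
  define C where "C = {A \<in> sets (prodM n X). \<forall>\<eta>>0. \<exists>g. good A g \<eta>}"
  have meas: "g \<in> borel_measurable \<mu>" if "continuous_map (path_top n X) euclideanreal g" "\<mu> \<in> F" for g \<mu>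
    using continuous_path_measurable[OF sc that(1)] F[OF that(2)] measurable_cong_sets by blast
  have int: "integrable \<mu> (\<lambda>x. \<bar>indicator A x - g x\<bar>)"
    if "continuous_map (path_top n X) euclideanreal g" "\<forall>x. 0 \<le> g x \<and> g x \<le> 1" "\<mu> \<in> F" "A \<in> sets (prodM n X)" for g \<mu> A
  proof -
    interpret prob_space \<mu> using F[OF that(3)] by simp
    have [measurable]: "g \<in> borel_measurable \<mu>" "A \<in> sets \<mu>" using meas that F by auto
    have b: "\<bar>indicator A x - g x\<bar> \<le> 1" for x using that(2)[rule_format, of x] by (auto simp: indicator_def)
    show ?thesis by (intro integrable_const_bound[where B = 1]) (auto intro!: AE_I2 b)
  qed
  have sa: "sigma_algebra ?\<Omega> C"
    unfolding sigma_algebra_iff2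
  proof (intro conjI ballI allI impI)
    show "C \<subseteq> Pow ?\<Omega>" using sets.sets_into_space by (auto simp: C_def)
    show "{} \<in> C" by (auto simp: C_def good_def intro!: exI[of _ "\<lambda>_. 0"])
  next
    fix A assume A: "A \<in> C"
    show "?\<Omega> - A \<in> C" unfolding C_def
    proof (intro CollectI conjI allI impI)
      show "?\<Omega> - A \<in> sets (prodM n X)" using A by (auto simp: C_def)
      fix \<eta> :: real assume "\<eta> > 0"
      then obtain g where g: "good A g \<eta>" using A by (auto simp: C_def)
      have "(\<integral>x. \<bar>indicator (?\<Omega> - A) x - (1 - g x)\<bar> \<partial>\<mu>) = (\<integral>x. \<bar>indicator A x - g x\<bar> \<partial>\<mu>)" if "\<mu> \<in> F" for \<mu>
      proof (intro Bochner_Integration.integral_cong refl)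
        fix x assume "x \<in> space \<mu>"
        then have "x \<in> ?\<Omega>" using sets_eq_imp_space_eq F[OF that] by metis
        then show "\<bar>indicator (?\<Omega> - A) x - (1 - g x)\<bar> = \<bar>indicator A x - g x\<bar>" by (auto simp: indicator_def)
      qed
      then have "good (?\<Omega> - A) (\<lambda>x. 1 - g x) \<eta>"
        using g by (auto simp: good_def intro!: continuous_intros)
      then show "\<exists>g. good (?\<Omega> - A) g \<eta>" by blast
    qed
  next
    fix A :: "nat \<Rightarrow> _" assume A: "range A \<subseteq> C"
    then have As: "A i \<in> sets (prodM n X)" for i by (auto simp: C_def)
    show "(\<Union>i. A i) \<in> C" unfolding C_def
    proof (intro CollectI conjI allI impI)
      show "(\<Union>i. A i) \<in> sets (prodM n X)" using As by auto
      fix \<eta> :: real assume \<eta>: "\<eta> > 0"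
      have "eventually (\<lambda>k. measure \<mu> ((\<Union>i. A i) - (\<Union>i<k. A i)) < \<eta> / 2) sequentially" if \<mu>: "\<mu> \<in> F" for \<mu>
      proof -
        interpret prob_space \<mu> using F[OF \<mu>] by simp
        have [simp]: "A i \<in> sets \<mu>" for i using As F[OF \<mu>] by simp
        have "(\<lambda>k. measure \<mu> ((\<Union>i. A i) - (\<Union>i<k. A i))) \<longlonglongrightarrow> measure \<mu> (\<Inter>k. (\<Union>i. A i) - (\<Union>i<k. A i))"
        proof (rule finite_Lim_measure_decseq)
          show "range (\<lambda>k. (\<Union>i. A i) - (\<Union>i<k. A i)) \<subseteq> events"
            by (intro image_subsetI sets.Diff sets.countable_UN sets.finite_UN) auto
          show "decseq (\<lambda>k. (\<Union>i. A i) - (\<Union>i<k. A i))"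
            unfolding decseq_def by (intro allI impI Diff_mono UN_mono) auto
        qed
        moreover have "(\<Inter>k. (\<Union>i. A i) - (\<Union>i<k. A i)) = {}" by auto
        ultimately have lim0: "(\<lambda>k. measure \<mu> ((\<Union>i. A i) - (\<Union>i<k. A i))) \<longlonglongrightarrow> 0"
          by (simp only: measure_empty)
        show ?thesis by (rule order_tendstoD(2)[OF lim0]) (use \<eta> in simp)
      qed
      then have "eventually (\<lambda>k. \<forall>\<mu>\<in>F. measure \<mu> ((\<Union>i. A i) - (\<Union>i<k. A i)) < \<eta> / 2) sequentially"
        using fin by (intro eventually_ball_finite) auto
      from eventually_happens'[OF _ this] obtain k where
        k: "\<And>\<mu>. \<mu> \<in> F \<Longrightarrow> measure \<mu> ((\<Union>i. A i) - (\<Union>i<k. A i)) < \<eta> / 2" by auto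
      \<comment> \<open>Finitely many sets carry all but \<eta>/2 of the union for every measure;
        the other \<eta>/2 is shared by k functions, with k + 1 in the denominator so that k = 0 is
        covered.\<close>
      have "\<exists>g. good (A i) g (\<eta> / (2 * (real k + 1)))" for i
      proof -
        have "A i \<in> C" using A by auto
        moreover have "0 < \<eta> / (2 * (real k + 1))" using \<eta> by simp
        ultimately show ?thesis unfolding C_def by blast
      qed
      then obtain G where G: "\<And>i. good (A i) (G i) (\<eta> / (2 * (real k + 1)))" by metis
      have Gc: "continuous_map (path_top n X) euclideanreal (G i)" and G01: "\<forall>x. 0 \<le> G i x \<and> G i x \<le> 1" for i
        using G[of i] by (auto simp: good_def)
      define g where "g x = min 1 (\<Sum>i<k. G i x)" for x
      have gc: "continuous_map (path_top n X) euclideanreal g"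
        unfolding g_def by (intro continuous_intros Gc) auto
      have g01: "\<forall>x. 0 \<le> g x \<and> g x \<le> 1" using G01 by (auto simp: g_def intro!: sum_nonneg)
      have bound: "\<bar>indicator (\<Union>i. A i) x - g x\<bar> \<le>
        indicator ((\<Union>i. A i) - (\<Union>i<k. A i)) x + (\<Sum>i<k. \<bar>indicator (A i) x - G i x\<bar>)" for x
      proof -
        have "\<bar>(\<Sum>i<k. indicator (A i) x) - (\<Sum>i<k. G i x)\<bar> \<le> (\<Sum>i<k. \<bar>indicator (A i) x - G i x\<bar>)"
          unfolding sum_subtractf[symmetric] by (rule sum_abs)
        moreover have "indicator (\<Union>i<k. A i) x = min 1 (\<Sum>i<k. indicator (A i) x :: real)"
        proof (cases "x \<in> (\<Union>i<k. A i)")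
          case True
          then obtain i where i: "i < k" "x \<in> A i" by auto
          have "(\<Sum>i\<in>{i}. indicator (A i) x :: real) \<le> (\<Sum>i<k. indicator (A i) x)"
            using i by (intro sum_mono2) auto
          then show ?thesis using i True by simp
        next
          case False
          then show ?thesis by (simp add: indicator_def)
        qed
        moreover have "indicator (\<Union>i. A i) x = indicator (\<Union>i<k. A i) x + (indicator ((\<Union>i. A i) - (\<Union>i<k. A i)) x :: real)"
          by (auto simp: indicator_def)
        moreover have "(0::real) \<le> indicator ((\<Union>i. A i) - (\<Union>i<k. A i)) x" by simp
        ultimately show ?thesis unfolding g_def by linarith
      qed
      have "(\<integral>x. \<bar>indicator (\<Union>i. A i) x - g x\<bar> \<partial>\<mu>) < \<eta>" if \<mu>: "\<mu> \<in> F" for \<mu>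
      proof -
        interpret prob_space \<mu> using F[OF \<mu>] by simp
        have As': "A i \<in> sets \<mu>" for i using As F[OF \<mu>] by simp
        then have T: "(\<Union>i. A i) - (\<Union>i<k. A i) \<in> sets \<mu>" by auto
        have "(\<integral>x. \<bar>indicator (\<Union>i. A i) x - g x\<bar> \<partial>\<mu>) \<le>
          (\<integral>x. indicator ((\<Union>i. A i) - (\<Union>i<k. A i)) x + (\<Sum>i<k. \<bar>indicator (A i) x - G i x\<bar>) \<partial>\<mu>)"
          using T As by (intro integral_mono Bochner_Integration.integrable_add Bochner_Integration.integrable_sum bound
              int[OF gc g01 \<mu>] int[OF Gc G01 \<mu>]) (auto simp: less_top[symmetric])
        also have "\<dots> = measure \<mu> ((\<Union>i. A i) - (\<Union>i<k. A i)) + (\<Sum>i<k. \<integral>x. \<bar>indicator (A i) x - G i x\<bar> \<partial>\<mu>)"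
          using T As int[OF Gc G01 \<mu>]
          by (subst Bochner_Integration.integral_add) (auto simp: less_top[symmetric] Bochner_Integration.integral_sum)
        also have "\<dots> < \<eta> / 2 + \<eta> / 2"
        proof (rule add_less_le_mono[OF k[OF \<mu>]])
          have "(\<Sum>i<k. \<integral>x. \<bar>indicator (A i) x - G i x\<bar> \<partial>\<mu>) \<le> (\<Sum>i<k. \<eta> / (2 * (real k + 1)))"
            using G \<mu> by (intro sum_mono) (auto simp: good_def less_imp_le)
          also have "\<dots> = \<eta> / 2 * (real k / (real k + 1))" by (simp add: field_simps)
          also have "\<dots> \<le> \<eta> / 2 * 1" using \<eta> by (intro mult_left_mono) (auto simp: field_simps)
          finally show "(\<Sum>i<k. \<integral>x. \<bar>indicator (A i) x - G i x\<bar> \<partial>\<mu>) \<le> \<eta> / 2" by simp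
        qed
        finally show ?thesis by simp
      qed
      then show "\<exists>g. good (\<Union>i. A i) g \<eta>" using gc g01 unfolding good_def by blast
    qed
  qed
  have setsC: "sets (sigma ?\<Omega> C) = C" "space (sigma ?\<Omega> C) = ?\<Omega>"
    using sigma_algebra.sets_measure_of_eq[OF sa] by (auto simp: C_def space_measure_of_conv dest: sets.sets_into_space)
  have comp: "(\<lambda>x. x t) \<in> sigma ?\<Omega> C \<rightarrow>\<^sub>M borel_of (X t)" if t: "t < n" for t
  proof (cases "topspace (X t) = {}")
    case True
    then have "?\<Omega> = {}" using t by (auto simp: space_prodM)
    moreover have "{} \<in> C" using sets.empty_sets[of "sigma ?\<Omega> C"] unfolding setsC .
    ultimately show ?thesis using setsC by (simp add: measurable_def)
  next
    case False
    obtain d a where MS: "Metric_space (topspace (X t)) d" and mt: "Metric_space.mtopology (topspace (X t)) d = X t"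
      and a: "range a \<subseteq> topspace (X t)" and dense: "\<And>x \<epsilon>. x \<in> topspace (X t) \<Longrightarrow> \<epsilon> > 0 \<Longrightarrow> \<exists>m::nat. d x (a m) < \<epsilon>"
      by (rule Polish_spaceE[OF X[OF t] False]) (rule that)
    interpret Metric_space "topspace (X t)" d by fact
    have "(\<lambda>x. x t) \<in> sigma ?\<Omega> C \<rightarrow>\<^sub>M borel_of mtopology"
    proof (rule measurable_borel_of_mballs[OF a dense])
      show "(\<lambda>x. x t) \<in> space (sigma ?\<Omega> C) \<rightarrow> topspace (X t)" using t unfolding setsC by (auto simp: space_prodM)
      fix m q
      have am: "a m \<in> topspace (X t)" using a by auto
      have "continuous_map (mtopology_of (metric (topspace (X t), d))) euclideanreal (mdist (metric (topspace (X t), d)) (a m))"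
        using am by (intro continuous_on_mdist) simp
      then have dc: "continuous_map (X t) euclideanreal (d (a m))" by (simp add: mt)
      have "continuous_map (path_top n X) (X t) (\<lambda>x. x t)"
        unfolding path_top_def using t by (intro continuous_map_product_projection) auto
      from continuous_map_compose[OF this dc] have dc': "continuous_map (path_top n X) euclideanreal (\<lambda>x. d (a m) (x t))"
        by (simp add: comp_def)
      let ?A = "{x \<in> ?\<Omega>. d (x t) (a m) < q}"
      have eqA: "?A = {x \<in> topspace (path_top n X). d (a m) (x t) \<in> {..<q}}"
        by (auto simp: topspace_path_top commute)
      have As: "?A \<in> sets (prodM n X)" unfolding eqA
        by (rule open_in_prodM[OF sc], assumption, rule openin_continuous_map_preimage[OF dc']) simp
      \<comment> \<open>Ramps that vanish outside the open ball and equal 1 once the distance is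
        below the radius by at least 1/k; their pointwise limit is the indicator.\<close>
      define g where "g k x = min 1 (real k * max 0 (q - d (a m) (x t)))" for k :: nat and x
      have gc: "continuous_map (path_top n X) euclideanreal (g k)" for k
        unfolding g_def by (intro continuous_intros dc' continuous_map_real_mult_left) auto
      have g01: "\<forall>x. 0 \<le> g k x \<and> g k x \<le> 1" for k by (auto simp: g_def)
      have "?A \<in> C" unfolding C_def
      proof (intro CollectI conjI allI impI As)
        fix \<eta> :: real assume \<eta>: "\<eta> > 0"
        have "eventually (\<lambda>k. (\<integral>x. \<bar>indicator ?A x - g k x\<bar> \<partial>\<mu>) < \<eta>) sequentially" if \<mu>: "\<mu> \<in> F" for \<mu>
        proof -
          interpret prob_space \<mu> using F[OF \<mu>] by simp
          have [measurable]: "g k \<in> borel_measurable \<mu>" for k using meas[OF gc \<mu>] .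
          have [measurable]: "?A \<in> sets \<mu>" using As F[OF \<mu>] by simp
          have "(\<lambda>k. \<integral>x. \<bar>indicator ?A x - g k x\<bar> \<partial>\<mu>) \<longlonglongrightarrow> (\<integral>x. 0 \<partial>\<mu>)"
          proof (rule integral_dominated_convergence[where w = "\<lambda>_. 1"])
            show "AE x in \<mu>. (\<lambda>k. \<bar>indicator ?A x - g k x\<bar>) \<longlonglongrightarrow> 0"
            proof (rule AE_I2)
              fix x assume "x \<in> space \<mu>"
              then have x: "x \<in> ?\<Omega>" using sets_eq_imp_space_eq F[OF \<mu>] by metis
              show "(\<lambda>k. \<bar>indicator ?A x - g k x\<bar>) \<longlonglongrightarrow> 0"
              proof (cases "x \<in> ?A")
                case True
                then have pos: "0 < q - d (a m) (x t)" by (simp add: commute)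
                obtain k0 where k0: "1 / (q - d (a m) (x t)) < real k0" using reals_Archimedean2 by blast
                have "g k x = 1" if "k0 \<le> k" for k
                proof -
                  have "1 / (q - d (a m) (x t)) < real k" using k0 that by linarith
                  then have "1 < real k * (q - d (a m) (x t))" using pos by (simp add: field_simps)
                  then show ?thesis using pos by (simp add: g_def)
                qed
                then have "eventually (\<lambda>k. \<bar>indicator ?A x - g k x\<bar> = 0) sequentially"
                  using True by (intro eventually_sequentiallyI[of k0]) auto
                then show ?thesis by (rule tendsto_eventually)
              next
                case False
                then have "g k x = 0" for k using x by (simp add: g_def commute)
                then show ?thesis using False by simp
              qed
            qed
            show "AE x in \<mu>. norm \<bar>indicator ?A x - g k x\<bar> \<le> 1" for k
            proof (rule AE_I2)
              fix x show "norm \<bar>indicator ?A x - g k x\<bar> \<le> 1"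
                using g01[of k, rule_format, of x] by (auto simp: indicator_def)
            qed
          qed auto
          then show ?thesis using \<eta> by (auto dest: order_tendstoD(2))
        qed
        then have "eventually (\<lambda>k. \<forall>\<mu>\<in>F. (\<integral>x. \<bar>indicator ?A x - g k x\<bar> \<partial>\<mu>) < \<eta>) sequentially"
          using fin by (intro eventually_ball_finite) auto
        then obtain k where "\<forall>\<mu>\<in>F. (\<integral>x. \<bar>indicator ?A x - g k x\<bar> \<partial>\<mu>) < \<eta>"
          by (auto dest: eventually_happens)
        then show "\<exists>g. good ?A g \<eta>" using gc g01 unfolding good_def by blast
      qed
      then show "{x \<in> space (sigma ?\<Omega> C). d (x t) (a m) < q} \<in> sets (sigma ?\<Omega> C)" unfolding setsC .
    qed
    then show ?thesis by (simp add: mt)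
  qed
  have "(\<lambda>x. x) \<in> sigma ?\<Omega> C \<rightarrow>\<^sub>M prodM n X"
  proof -
    have "(\<lambda>\<omega> i. \<omega> i) \<in> sigma ?\<Omega> C \<rightarrow>\<^sub>M PiM {..<n} (\<lambda>t. borel_of (X t))"
    proof (rule measurable_PiM_single')
      show "(\<lambda>\<omega>. \<omega> i) \<in> sigma ?\<Omega> C \<rightarrow>\<^sub>M borel_of (X i)" if "i \<in> {..<n}" for i using comp that by simp
      show "(\<lambda>\<omega> i. \<omega> i) \<in> space (sigma ?\<Omega> C) \<rightarrow> (\<Pi>\<^sub>E i\<in>{..<n}. space (borel_of (X i)))"
        unfolding setsC by (simp add: space_prodM)
    qed
    then show ?thesis by (simp add: prodM_def)
  qed
  from measurable_sets[OF this A] have "A \<in> C"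
    unfolding setsC using sets.sets_into_space[OF A] by (simp add: Int_absorb2)
  then show ?thesis using \<eta> unfolding C_def good_def by blast
qed

section \<open>Weak closedness of the set of bicausal couplings\<close>

text \<open>Induction over integrable functions, from indicators through sums to dominated limits.
  The bound B may grow with the accuracy, which suffices for a test function.\<close>

lemma approx_function_continuous:
  fixes X :: "nat \<Rightarrow> 'a topology" and h :: "(nat \<Rightarrow> 'a) \<Rightarrow> real"
  assumes X: "\<And>t. t < n \<Longrightarrow> Polish_space (X t)"
    and \<mu>: "prob_space \<mu>" "sets \<mu> = sets (prodM n X)" and h: "integrable \<mu> h" and \<eta>: "0 < \<eta>"
  shows "\<exists>g B. continuous_map (path_top n X) euclideanreal g \<and> (\<forall>x. \<bar>g x\<bar> \<le> B) \<and> (\<integral>x. \<bar>h x - g x\<bar> \<partial>\<mu>) < \<eta>"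
  using h \<eta>
proof (induction h arbitrary: \<eta> rule: integrable_induct)
  case (base A c)
  interpret prob_space \<mu> by fact
  have A: "A \<in> sets (prodM n X)" using base \<mu> by simp
  \<comment> \<open>The added 1 covers c = 0 and makes the final estimate strict.\<close>
  have "0 < \<eta> / (\<bar>c\<bar> + 1)" using base by simp
  then obtain g where g: "continuous_map (path_top n X) euclideanreal g" "\<forall>x. 0 \<le> g x \<and> g x \<le> 1"
    "(\<integral>x. \<bar>indicator A x - g x\<bar> \<partial>\<mu>) < \<eta> / (\<bar>c\<bar> + 1)"
    using approx_set_continuous[OF X _ _ A, of "{\<mu>}" "\<eta> / (\<bar>c\<bar> + 1)"] \<mu> by auto
  have "(\<integral>x. \<bar>indicator A x *\<^sub>R c - c * g x\<bar> \<partial>\<mu>) = (\<integral>x. \<bar>c\<bar> * \<bar>indicator A x - g x\<bar> \<partial>\<mu>)"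
    by (intro Bochner_Integration.integral_cong) (auto simp: abs_mult[symmetric] algebra_simps)
  also have "\<dots> = \<bar>c\<bar> * (\<integral>x. \<bar>indicator A x - g x\<bar> \<partial>\<mu>)" by simp
  also have "\<dots> \<le> \<bar>c\<bar> * (\<eta> / (\<bar>c\<bar> + 1))" using g(3) by (intro mult_left_mono) auto
  also have "\<dots> < \<eta>" using base by (simp add: field_simps)
  finally have "(\<integral>x. \<bar>indicator A x *\<^sub>R c - c * g x\<bar> \<partial>\<mu>) < \<eta>" .
  moreover have "\<bar>c * g x\<bar> \<le> \<bar>c\<bar>" for x using g(2) by (simp add: abs_mult mult_left_le)
  moreover have "continuous_map (path_top n X) euclideanreal (\<lambda>x. c * g x)" by (rule continuous_map_real_mult_left[OF g(1)])
  ultimately show ?case by blast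
next
  case (add f f')
  interpret prob_space \<mu> by fact
  have sc: "second_countable (X t)" if "t < n" for t by (rule second_countable_Polish[OF X[OF that]])
  obtain g B where g: "continuous_map (path_top n X) euclideanreal g" "\<forall>x. \<bar>g x\<bar> \<le> B" "(\<integral>x. \<bar>f x - g x\<bar> \<partial>\<mu>) < \<eta> / 2"
    using add.IH(1)[of "\<eta> / 2"] add.prems by auto
  obtain g' B' where g': "continuous_map (path_top n X) euclideanreal g'" "\<forall>x. \<bar>g' x\<bar> \<le> B'" "(\<integral>x. \<bar>f' x - g' x\<bar> \<partial>\<mu>) < \<eta> / 2"
    using add.IH(2)[of "\<eta> / 2"] add.prems by auto
  have [measurable]: "g \<in> borel_measurable \<mu>" "g' \<in> borel_measurable \<mu>"
    unfolding measurable_cong_sets[OF \<mu>(2) refl]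
    by (rule continuous_path_measurable[OF sc g(1)], assumption) (rule continuous_path_measurable[OF sc g'(1)], assumption)
  have i: "integrable \<mu> g" "integrable \<mu> g'"
    using g(2) g'(2) by (auto intro: integrable_const_bound[where B = B] integrable_const_bound[where B = B'])
  have "(\<integral>x. \<bar>(f x + f' x) - (g x + g' x)\<bar> \<partial>\<mu>) \<le> (\<integral>x. \<bar>f x - g x\<bar> + \<bar>f' x - g' x\<bar> \<partial>\<mu>)"
    using add i by (intro integral_mono) auto
  also have "\<dots> = (\<integral>x. \<bar>f x - g x\<bar> \<partial>\<mu>) + (\<integral>x. \<bar>f' x - g' x\<bar> \<partial>\<mu>)"
    using add i by (intro Bochner_Integration.integral_add) auto
  also have "\<dots> < \<eta>" using g(3) g'(3) by simp
  finally have "(\<integral>x. \<bar>(f x + f' x) - (g x + g' x)\<bar> \<partial>\<mu>) < \<eta>" .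
  moreover have "\<bar>g x + g' x\<bar> \<le> B + B'" for x
    using abs_triangle_ineq[of "g x" "g' x"] g(2)[rule_format, of x] g'(2)[rule_format, of x] by linarith
  moreover have "continuous_map (path_top n X) euclideanreal (\<lambda>x. g x + g' x)" using g(1) g'(1) by (rule continuous_map_add)
  ultimately show ?case by blast
next
  case (lim f s)
  interpret prob_space \<mu> by fact
  have sc: "second_countable (X t)" if "t < n" for t by (rule second_countable_Polish[OF X[OF that]])
  have [measurable]: "f \<in> borel_measurable \<mu>" "\<And>i. s i \<in> borel_measurable \<mu>" using lim by auto
  have "(\<lambda>i. \<integral>x. \<bar>f x - s i x\<bar> \<partial>\<mu>) \<longlonglongrightarrow> (\<integral>x. 0 \<partial>\<mu>)"
  \<comment> \<open>The approximants of the induction satisfy |s i x| \<le> 2 |f x|, whence the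
    factor 3.\<close>
  proof (rule integral_dominated_convergence[where w = "\<lambda>x. 3 * \<bar>f x\<bar>"])
    show "integrable \<mu> (\<lambda>x. 3 * \<bar>f x\<bar>)" using lim by auto
    show "AE x in \<mu>. (\<lambda>i. \<bar>f x - s i x\<bar>) \<longlonglongrightarrow> 0"
    proof (rule AE_I2)
      fix x assume "x \<in> space \<mu>"
      then have "(\<lambda>i. s i x) \<longlonglongrightarrow> f x" by (rule lim.hyps)
      then have "(\<lambda>i. \<bar>f x - s i x\<bar>) \<longlonglongrightarrow> \<bar>f x - f x\<bar>" by (intro tendsto_intros)
      then show "(\<lambda>i. \<bar>f x - s i x\<bar>) \<longlonglongrightarrow> 0" by simp
    qed
    show "AE x in \<mu>. norm \<bar>f x - s i x\<bar> \<le> 3 * \<bar>f x\<bar>" for i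
    proof (rule AE_I2)
      fix x assume "x \<in> space \<mu>"
      then have "norm (s i x) \<le> 2 * norm (f x)" by (rule lim.hyps)
      then show "norm \<bar>f x - s i x\<bar> \<le> 3 * \<bar>f x\<bar>" by simp
    qed
  qed auto
  then have "eventually (\<lambda>i. (\<integral>x. \<bar>f x - s i x\<bar> \<partial>\<mu>) < \<eta> / 2) sequentially"
    using lim.prems by (auto dest: order_tendstoD(2)[of _ _ _ "\<eta> / 2"])
  then obtain i where i: "(\<integral>x. \<bar>f x - s i x\<bar> \<partial>\<mu>) < \<eta> / 2" by (auto dest: eventually_happens)
  obtain g B where g: "continuous_map (path_top n X) euclideanreal g" "\<forall>x. \<bar>g x\<bar> \<le> B" "(\<integral>x. \<bar>s i x - g x\<bar> \<partial>\<mu>) < \<eta> / 2"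
    using lim.IH[of "\<eta> / 2" i] lim.prems by auto
  have [measurable]: "g \<in> borel_measurable \<mu>"
    unfolding measurable_cong_sets[OF \<mu>(2) refl] by (rule continuous_path_measurable[OF sc g(1)])
  have ig: "integrable \<mu> g" using g(2) by (auto intro!: integrable_const_bound[of _ B])
  have "(\<integral>x. \<bar>f x - g x\<bar> \<partial>\<mu>) \<le> (\<integral>x. \<bar>f x - s i x\<bar> + \<bar>s i x - g x\<bar> \<partial>\<mu>)"
    using lim ig by (intro integral_mono) auto
  also have "\<dots> = (\<integral>x. \<bar>f x - s i x\<bar> \<partial>\<mu>) + (\<integral>x. \<bar>s i x - g x\<bar> \<partial>\<mu>)"
    using lim ig by (intro Bochner_Integration.integral_add) auto
  also have "\<dots> < \<eta>" using i g(3) by simp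
  finally show ?case using g by blast
qed

lemma Cpl_integral_fst:
  fixes f :: "'a \<Rightarrow> real"
  assumes \<sigma>: "\<sigma> \<in> Cpl \<mu> \<nu>" and f: "f \<in> borel_measurable \<mu>"
  shows "(\<integral>z. f (fst z) \<partial>\<sigma>) = (\<integral>x. f x \<partial>\<mu>)" "integrable \<mu> f \<Longrightarrow> integrable \<sigma> (\<lambda>z. f (fst z))"
proof -
  have d: "distr \<sigma> \<mu> fst = \<mu>" and [measurable_cong]: "sets \<sigma> = sets (\<mu> \<Otimes>\<^sub>M \<nu>)" using \<sigma> by (auto simp: Cpl_def)
  have m: "fst \<in> \<sigma> \<rightarrow>\<^sub>M \<mu>" by measurable
  show "(\<integral>z. f (fst z) \<partial>\<sigma>) = (\<integral>x. f x \<partial>\<mu>)" using integral_distr[OF m f] by (simp add: d)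
  show "integrable \<mu> f \<Longrightarrow> integrable \<sigma> (\<lambda>z. f (fst z))" using integrable_distr_eq[OF m f] by (simp add: d)
qed

lemma Cpl_integral_snd:
  fixes f :: "'b \<Rightarrow> real"
  assumes \<sigma>: "\<sigma> \<in> Cpl \<mu> \<nu>" and f: "f \<in> borel_measurable \<nu>"
  shows "(\<integral>z. f (snd z) \<partial>\<sigma>) = (\<integral>x. f x \<partial>\<nu>)" "integrable \<nu> f \<Longrightarrow> integrable \<sigma> (\<lambda>z. f (snd z))"
proof -
  have d: "distr \<sigma> \<nu> snd = \<nu>" and [measurable_cong]: "sets \<sigma> = sets (\<mu> \<Otimes>\<^sub>M \<nu>)" using \<sigma> by (auto simp: Cpl_def)
  have m: "snd \<in> \<sigma> \<rightarrow>\<^sub>M \<nu>" by measurable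
  show "(\<integral>z. f (snd z) \<partial>\<sigma>) = (\<integral>x. f x \<partial>\<nu>)" using integral_distr[OF m f] by (simp add: d)
  show "integrable \<nu> f \<Longrightarrow> integrable \<sigma> (\<lambda>z. f (snd z))" using integrable_distr_eq[OF m f] by (simp add: d)
qed

lemma Cpl_swap:
  assumes \<sigma>: "\<sigma> \<in> Cpl \<mu> \<nu>" and s: "sets M = sets \<mu>" "sets N = sets \<nu>"
  shows "distr \<sigma> (N \<Otimes>\<^sub>M M) (\<lambda>(x, y). (y, x)) \<in> Cpl \<nu> \<mu>"
proof -
  note [measurable_cong] = s
  have d: "distr \<sigma> \<mu> fst = \<mu>" "distr \<sigma> \<nu> snd = \<nu>" and [measurable_cong]: "sets \<sigma> = sets (\<mu> \<Otimes>\<^sub>M \<nu>)"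
    using \<sigma> by (auto simp: Cpl_def)
  let ?s = "distr \<sigma> (N \<Otimes>\<^sub>M M) (\<lambda>(x, y). (y, x))"
  have "distr ?s \<nu> fst = distr \<sigma> \<nu> snd" by (subst distr_distr) (auto simp: comp_def split_beta')
  moreover have "distr ?s \<mu> snd = distr \<sigma> \<mu> fst" by (subst distr_distr) (auto simp: comp_def split_beta')
  ultimately show ?thesis using d sets_pair_measure_cong[OF s(2,1)] by (simp add: Cpl_def)
qed

text \<open>The constraint pairs a bounded function of the first path with an indicator of the second one;
  both marginals being fixed, it passes to weak limits after continuous approximation in
  \<open>L\<^sup>1\<close> of the marginals.\<close>

lemma causal_constraint_closed:
  fixes X :: "nat \<Rightarrow> 'a topology" and Y :: "nat \<Rightarrow> 'b topology"
  assumes X: "\<And>t. t < N \<Longrightarrow> Polish_space (X t)" and Y: "\<And>t. t < N \<Longrightarrow> Polish_space (Y t)"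
    and \<mu>: "sets \<mu> = sets (prodM N X)" "prob_space \<mu>" and \<nu>: "sets \<nu> = sets (prodM N Y)" "prob_space \<nu>"
    and \<pi>: "\<pi> \<in> Cpl \<mu> \<nu>"
    and approx: "\<And>f g C \<epsilon>. continuous_map (path_top N X) euclideanreal f \<Longrightarrow> continuous_map (path_top N Y) euclideanreal g \<Longrightarrow>
      (\<And>x. \<bar>f x\<bar> \<le> C) \<Longrightarrow> (\<And>y. \<bar>g y\<bar> \<le> C) \<Longrightarrow> 0 < \<epsilon> \<Longrightarrow>
      \<exists>\<rho>\<in>Cpl \<mu> \<nu>. causal_constraint N X Y \<mu> \<rho> \<and> \<bar>(\<integral>z. f (fst z) * g (snd z) \<partial>\<rho>) - (\<integral>z. f (fst z) * g (snd z) \<partial>\<pi>)\<bar> < \<epsilon>"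
  shows "causal_constraint N X Y \<mu> \<pi>"
  unfolding causal_constraint_def
proof (intro allI impI ballI)
  fix t B D assume t: "t < N" and B: "B \<in> sets (filtM N t Y)" and D: "D \<in> sets (prodM N X)"
  interpret \<mu>: prob_space \<mu> by fact
  interpret \<nu>: prob_space \<nu> by fact
  have scX: "second_countable (X t)" if "t < N" for t by (rule second_countable_Polish[OF X[OF that]])
  have scY: "second_countable (Y t)" if "t < N" for t by (rule second_countable_Polish[OF Y[OF that]])
  have B'[measurable]: "B \<in> sets \<nu>" using filtM_subset[OF _ B] t \<nu> by simp
  have D'[measurable]: "D \<in> sets \<mu>" using D \<mu> by simp
  have cm[measurable]: "cexp N X \<mu> t D \<in> borel_measurable \<mu>"
    using measurable_compose[OF measurable_ident_filtM[OF less_imp_le[OF t] \<mu>(1)] measurable_cexp] by simp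
  \<comment> \<open>A version of the conditional expectation with real values in [0, 1] at every x;
    the two agree almost everywhere.\<close>
  define c where "c x = min 1 (enn2real (cexp N X \<mu> t D x))" for x
  have c[measurable]: "c \<in> borel_measurable \<mu>" unfolding c_def by measurable
  have c01: "0 \<le> c x" "c x \<le> 1" for x by (simp_all add: c_def)
  have cc: "AE x in \<mu>. cexp N X \<mu> t D x = ennreal (c x)"
  proof -
    interpret F: finite_measure_subalgebra \<mu> "filtM N t X" using t by (intro filtM_finite_subalgebra \<mu>) simp
    have "AE x in \<mu>. cexp N X \<mu> t D x \<le> nn_cond_exp \<mu> (filtM N t X) (\<lambda>_. 1) x"
      unfolding cexp_def by (rule F.nn_cond_exp_mono) (auto simp: indicator_def)
    moreover have "AE x in \<mu>. 1 = nn_cond_exp \<mu> (filtM N t X) (\<lambda>_. 1) x"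
      by (rule F.nn_cond_exp_F_meas) simp
    ultimately show ?thesis
    proof eventually_elim
      case (elim x)
      then have le: "cexp N X \<mu> t D x \<le> 1" by simp
      then have "enn2real (cexp N X \<mu> t D x) \<le> 1" by (metis enn2real_1 enn2real_mono ennreal_one_less_top)
      moreover have "cexp N X \<mu> t D x < top" using le by (rule le_less_trans) simp
      ultimately show ?case by (simp add: c_def)
    qed
  qed
  \<comment> \<open>The constraint becomes the vanishing of \<open>J\<close>, which is linear in the
    coupling and has a bounded real integrand.\<close>
  define h where "h x = indicator D x - c x" for x
  have h[measurable]: "h \<in> borel_measurable \<mu>" unfolding h_def by measurable
  have h1: "\<bar>h x\<bar> \<le> 1" for x using c01[of x] by (auto simp: h_def indicator_def)
  have ih: "integrable \<mu> h" using h1 by (intro \<mu>.integrable_const_bound[of _ 1]) auto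
  define J where "J \<sigma> = (\<integral>z. h (fst z) * indicator B (snd z) \<partial>\<sigma>)" for \<sigma> :: "((nat \<Rightarrow> 'a) \<times> (nat \<Rightarrow> 'b)) measure"
  have iff: "emeasure \<sigma> (D \<times> B) = (\<integral>\<^sup>+z. cexp N X \<mu> t D (fst z) * indicator B (snd z) \<partial>\<sigma>) \<longleftrightarrow> J \<sigma> = 0"
    if \<sigma>: "\<sigma> \<in> Cpl \<mu> \<nu>" for \<sigma>
  proof -
    interpret \<sigma>: prob_space \<sigma> by (rule Cpl_prob_space[OF \<sigma> \<mu>(2)])
    have d: "distr \<sigma> \<mu> fst = \<mu>" and [measurable_cong]: "sets \<sigma> = sets (\<mu> \<Otimes>\<^sub>M \<nu>)" using \<sigma> by (auto simp: Cpl_def)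
    have "AE x in distr \<sigma> \<mu> fst. cexp N X \<mu> t D x = ennreal (c x)" unfolding d by (rule cc)
    then have "AE z in \<sigma>. cexp N X \<mu> t D (fst z) = ennreal (c (fst z))" by (rule AE_distrD[rotated]) measurable
    then have "(\<integral>\<^sup>+z. cexp N X \<mu> t D (fst z) * indicator B (snd z) \<partial>\<sigma>) = (\<integral>\<^sup>+z. ennreal (c (fst z) * indicator B (snd z)) \<partial>\<sigma>)"
      by (intro nn_integral_cong_AE) (auto elim!: eventually_mono simp: indicator_def)
    also have i1: "integrable \<sigma> (\<lambda>z. c (fst z) * indicator B (snd z))"
      using c01 by (intro \<sigma>.integrable_const_bound[of _ 1]) (auto simp: indicator_def)
    then have "(\<integral>\<^sup>+z. ennreal (c (fst z) * indicator B (snd z)) \<partial>\<sigma>) = ennreal (\<integral>z. c (fst z) * indicator B (snd z) \<partial>\<sigma>)"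
      using c01 by (intro nn_integral_eq_integral) auto
    finally have 1: "(\<integral>\<^sup>+z. cexp N X \<mu> t D (fst z) * indicator B (snd z) \<partial>\<sigma>) = ennreal (\<integral>z. c (fst z) * indicator B (snd z) \<partial>\<sigma>)" .
    have "J \<sigma> = (\<integral>z. indicator (D \<times> B) z - c (fst z) * indicator B (snd z) \<partial>\<sigma>)"
      unfolding J_def by (intro Bochner_Integration.integral_cong) (auto simp: h_def indicator_def)
    also have "\<dots> = measure \<sigma> (D \<times> B) - (\<integral>z. c (fst z) * indicator B (snd z) \<partial>\<sigma>)"
      using i1 by (subst Bochner_Integration.integral_diff) (auto simp: less_top[symmetric])
    finally have 2: "J \<sigma> = measure \<sigma> (D \<times> B) - (\<integral>z. c (fst z) * indicator B (snd z) \<partial>\<sigma>)" .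
    have "0 \<le> (\<integral>z. c (fst z) * indicator B (snd z) \<partial>\<sigma>)" using c01 by (intro integral_nonneg_AE) auto
    then show ?thesis unfolding 1 2 by (simp add: \<sigma>.emeasure_eq_measure)
  qed
  \<comment> \<open>2\<eta> for replacing \<open>h\<close> and the indicator by continuous functions
    under \<pi>, 2\<eta> for the same under \<rho>, and \<eta> for the weak approximation.\<close>
  have J0: "\<bar>J \<pi>\<bar> \<le> 5 * \<eta>" if \<eta>: "0 < \<eta>" for \<eta>
  proof -
    obtain f C where f: "continuous_map (path_top N X) euclideanreal f" "\<forall>x. \<bar>f x\<bar> \<le> C" "(\<integral>x. \<bar>h x - f x\<bar> \<partial>\<mu>) < \<eta>"
      using approx_function_continuous[OF X \<mu>(2,1) ih \<eta>] by blast
    have BB: "B \<in> sets (prodM N Y)" using B' \<nu> by simp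
    obtain g where g: "continuous_map (path_top N Y) euclideanreal g" "\<forall>x. 0 \<le> g x \<and> g x \<le> 1"
      "(\<integral>y. \<bar>indicator B y - g y\<bar> \<partial>\<nu>) < \<eta>"
      using approx_set_continuous[OF Y _ _ BB \<eta>, of "{\<nu>}"] \<nu> by auto
    have fm[measurable]: "f \<in> borel_measurable \<mu>"
      unfolding measurable_cong_sets[OF \<mu>(1) refl] by (rule continuous_path_measurable[OF scX f(1)])
    have gm[measurable]: "g \<in> borel_measurable \<nu>"
      unfolding measurable_cong_sets[OF \<nu>(1) refl] by (rule continuous_path_measurable[OF scY g(1)])
    have i_f: "integrable \<mu> f" using f(2) by (intro \<mu>.integrable_const_bound[of _ C]) auto
    have i_g: "integrable \<nu> (\<lambda>y. \<bar>indicator B y - g y\<bar>)"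
    proof (rule \<nu>.integrable_const_bound[of _ 1])
      show "AE y in \<nu>. norm \<bar>indicator B y - g y\<bar> \<le> 1"
      proof (rule AE_I2)
        fix y show "norm \<bar>indicator B y - g y\<bar> \<le> 1" using g(2)[rule_format, of y] by (auto simp: indicator_def)
      qed
    qed measurable
    \<comment> \<open>The error is estimated by integrals over the marginals only, hence uniformly
      over all couplings; this is what lets one pair of test functions serve \<pi> and
      \<rho>.\<close>
    have est: "\<bar>J \<sigma> - (\<integral>z. f (fst z) * g (snd z) \<partial>\<sigma>)\<bar> \<le> 2 * \<eta>" if \<sigma>: "\<sigma> \<in> Cpl \<mu> \<nu>" for \<sigma>
    proof -
      interpret \<sigma>: prob_space \<sigma> by (rule Cpl_prob_space[OF \<sigma> \<mu>(2)])
      have [measurable_cong]: "sets \<sigma> = sets (\<mu> \<Otimes>\<^sub>M \<nu>)" using \<sigma> by (auto simp: Cpl_def)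
      have C0: "0 \<le> C" using f(2) abs_ge_zero order_trans by blast
      have 1: "integrable \<sigma> (\<lambda>z. h (fst z) * indicator B (snd z))"
        using h1 by (intro \<sigma>.integrable_const_bound[of _ 1]) (auto simp: indicator_def)
      have 2: "integrable \<sigma> (\<lambda>z. f (fst z) * g (snd z))"
      proof (rule \<sigma>.integrable_const_bound[of _ C])
        show "AE z in \<sigma>. norm (f (fst z) * g (snd z)) \<le> C"
        proof (rule AE_I2)
          fix z
          have "\<bar>f (fst z)\<bar> * \<bar>g (snd z)\<bar> \<le> C * 1" using f(2) g(2) C0 by (intro mult_mono) auto
          then show "norm (f (fst z) * g (snd z)) \<le> C" by (simp add: abs_mult)
        qed
      qed measurable
      have 3: "integrable \<sigma> (\<lambda>z. \<bar>h (fst z) - f (fst z)\<bar>)"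
        by (rule Cpl_integral_fst(2)[OF \<sigma>, of "\<lambda>x. \<bar>h x - f x\<bar>"]) (use ih i_f in auto)
      have 4: "integrable \<sigma> (\<lambda>z. \<bar>indicator B (snd z) - g (snd z)\<bar>)"
        by (rule Cpl_integral_snd(2)[OF \<sigma>, of "\<lambda>y. \<bar>indicator B y - g y\<bar>"]) (use i_g in auto)
      have "\<bar>J \<sigma> - (\<integral>z. f (fst z) * g (snd z) \<partial>\<sigma>)\<bar> = \<bar>\<integral>z. h (fst z) * indicator B (snd z) - f (fst z) * g (snd z) \<partial>\<sigma>\<bar>"
        unfolding J_def using 1 2 by simp
      also have "\<dots> \<le> (\<integral>z. \<bar>h (fst z) * indicator B (snd z) - f (fst z) * g (snd z)\<bar> \<partial>\<sigma>)" by (rule integral_abs_bound)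
      also have "\<dots> \<le> (\<integral>z. \<bar>h (fst z) - f (fst z)\<bar> + \<bar>indicator B (snd z) - g (snd z)\<bar> \<partial>\<sigma>)"
      proof (rule integral_mono)
        fix z
        have "h (fst z) * indicator B (snd z) - f (fst z) * g (snd z) =
            h (fst z) * (indicator B (snd z) - g (snd z)) + (h (fst z) - f (fst z)) * g (snd z)" by (simp add: algebra_simps)
        also have "\<bar>\<dots>\<bar> \<le> \<bar>h (fst z)\<bar> * \<bar>indicator B (snd z) - g (snd z)\<bar> + \<bar>h (fst z) - f (fst z)\<bar> * \<bar>g (snd z)\<bar>"
          unfolding abs_mult[symmetric] by (rule abs_triangle_ineq)
        also have "\<dots> \<le> 1 * \<bar>indicator B (snd z) - g (snd z)\<bar> + \<bar>h (fst z) - f (fst z)\<bar> * 1"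
          using h1 g(2) by (intro add_mono mult_mono) auto
        finally show "\<bar>h (fst z) * indicator B (snd z) - f (fst z) * g (snd z)\<bar> \<le> \<bar>h (fst z) - f (fst z)\<bar> + \<bar>indicator B (snd z) - g (snd z)\<bar>"
          by simp
      qed (use 1 2 3 4 in auto)
      also have "\<dots> = (\<integral>z. \<bar>h (fst z) - f (fst z)\<bar> \<partial>\<sigma>) + (\<integral>z. \<bar>indicator B (snd z) - g (snd z)\<bar> \<partial>\<sigma>)"
        using 3 4 by (rule Bochner_Integration.integral_add)
      also have "(\<integral>z. \<bar>h (fst z) - f (fst z)\<bar> \<partial>\<sigma>) = (\<integral>x. \<bar>h x - f x\<bar> \<partial>\<mu>)"
        by (rule Cpl_integral_fst(1)[OF \<sigma>, of "\<lambda>x. \<bar>h x - f x\<bar>"]) measurable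
      also have "(\<integral>z. \<bar>indicator B (snd z) - g (snd z)\<bar> \<partial>\<sigma>) = (\<integral>y. \<bar>indicator B y - g y\<bar> \<partial>\<nu>)"
        by (rule Cpl_integral_snd(1)[OF \<sigma>, of "\<lambda>y. \<bar>indicator B y - g y\<bar>"]) measurable
      finally show ?thesis using f(3) g(3) by simp
    qed
    obtain \<rho> where \<rho>: "\<rho> \<in> Cpl \<mu> \<nu>" "causal_constraint N X Y \<mu> \<rho>"
      "\<bar>(\<integral>z. f (fst z) * g (snd z) \<partial>\<rho>) - (\<integral>z. f (fst z) * g (snd z) \<partial>\<pi>)\<bar> < \<eta>"
    proof -
      have "\<bar>f x\<bar> \<le> max C 1" for x using f(2) by (simp add: le_max_iff_disj)
      moreover have "\<bar>g y\<bar> \<le> max C 1" for y using g(2) by (simp add: le_max_iff_disj)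
      ultimately show ?thesis using approx[OF f(1) g(1) _ _ \<eta>, of "max C 1"] that by blast
    qed
    have "J \<rho> = 0" using \<rho>(2) t B D iff[OF \<rho>(1)] unfolding causal_constraint_def by blast
    then show ?thesis using est[OF \<pi>] est[OF \<rho>(1)] \<rho>(3) by linarith
  qed
  have "J \<pi> = 0"
  proof (rule ccontr)
    assume "J \<pi> \<noteq> 0"
    then show False using J0[of "\<bar>J \<pi>\<bar> / 10"] by auto
  qed
  then show "emeasure \<pi> (D \<times> B) = (\<integral>\<^sup>+z. cexp N X \<mu> t D (fst z) * indicator B (snd z) \<partial>\<pi>)"
    using iff[OF \<pi>] by simp
qed

text \<open>The hypothesis says that the law of p and \<mu> have the same integrals of bounded
  continuous functions. A function close to the indicator of A under both laws carries this over to
  A, with error 3\<eta>.\<close>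

lemma marginal_closed:
  fixes X :: "nat \<Rightarrow> 'a topology" and \<pi> :: "'c measure"
  assumes X: "\<And>t. t < N \<Longrightarrow> Polish_space (X t)"
    and \<mu>: "sets \<mu> = sets (prodM N X)" "prob_space \<mu>" and \<pi>: "prob_space \<pi>" and p: "p \<in> \<pi> \<rightarrow>\<^sub>M \<mu>"
    and eq: "\<And>f C \<epsilon>. continuous_map (path_top N X) euclideanreal f \<Longrightarrow> (\<And>x. \<bar>f x\<bar> \<le> C) \<Longrightarrow> 0 < \<epsilon> \<Longrightarrow>
      \<bar>(\<integral>x. f x \<partial>\<mu>) - (\<integral>z. f (p z) \<partial>\<pi>)\<bar> < \<epsilon>"
  shows "distr \<pi> \<mu> p = \<mu>"
proof (rule measure_eqI)
  interpret \<mu>: prob_space \<mu> by fact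
  interpret \<pi>: prob_space \<pi> by fact
  interpret D: prob_space "distr \<pi> \<mu> p" by (rule \<pi>.prob_space_distr[OF p])
  have scX: "second_countable (X t)" if "t < N" for t by (rule second_countable_Polish[OF X[OF that]])
  fix A assume "A \<in> sets (distr \<pi> \<mu> p)"
  then have A[measurable]: "A \<in> sets \<mu>" by simp
  have AX: "A \<in> sets (prodM N X)" using A \<mu> by simp
  have close: "\<bar>measure (distr \<pi> \<mu> p) A - measure \<mu> A\<bar> \<le> 3 * \<eta>" if \<eta>: "0 < \<eta>" for \<eta>
  proof -
    obtain g where g: "continuous_map (path_top N X) euclideanreal g" "\<forall>x. 0 \<le> g x \<and> g x \<le> 1"
      "(\<integral>x. \<bar>indicator A x - g x\<bar> \<partial>\<mu>) < \<eta>" "(\<integral>x. \<bar>indicator A x - g x\<bar> \<partial>distr \<pi> \<mu> p) < \<eta>"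
    proof -
      have "\<exists>g. continuous_map (path_top N X) euclideanreal g \<and> (\<forall>x. 0 \<le> g x \<and> g x \<le> 1) \<and>
        (\<forall>\<sigma>\<in>{\<mu>, distr \<pi> \<mu> p}. (\<integral>x. \<bar>indicator A x - g x\<bar> \<partial>\<sigma>) < \<eta>)"
      proof (rule approx_set_continuous[OF X _ _ AX \<eta>])
        show "prob_space \<sigma> \<and> sets \<sigma> = sets (prodM N X)" if "\<sigma> \<in> {\<mu>, distr \<pi> \<mu> p}" for \<sigma>
          using \<mu> D.prob_space_axioms that by (elim insertE) simp_all
      qed simp_all
      then show ?thesis using that by simp blast
    qed
    have gm[measurable]: "g \<in> borel_measurable \<mu>"
      unfolding measurable_cong_sets[OF \<mu>(1) refl] by (rule continuous_path_measurable[OF scX g(1)])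
    have est: "\<bar>measure \<sigma> A - (\<integral>x. g x \<partial>\<sigma>)\<bar> \<le> (\<integral>x. \<bar>indicator A x - g x\<bar> \<partial>\<sigma>)"
      if \<sigma>: "prob_space \<sigma>" and [measurable_cong]: "sets \<sigma> = sets \<mu>" for \<sigma>
    proof -
      interpret \<sigma>: prob_space \<sigma> by fact
      have "integrable \<sigma> g" using g(2) by (intro \<sigma>.integrable_const_bound[of _ 1]) auto
      then have "measure \<sigma> A - (\<integral>x. g x \<partial>\<sigma>) = (\<integral>x. indicator A x - g x \<partial>\<sigma>)"
        using sets_eq_imp_space_eq[OF that(2)] by (subst Bochner_Integration.integral_diff) (auto simp: less_top[symmetric])
      then show ?thesis by (simp add: integral_abs_bound)
    qed
    have "\<bar>(\<integral>x. g x \<partial>\<mu>) - (\<integral>z. g (p z) \<partial>\<pi>)\<bar> < \<eta>" using g(2) by (intro eq[OF g(1) _ \<eta>, of 1]) auto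
    moreover have "(\<integral>z. g (p z) \<partial>\<pi>) = (\<integral>x. g x \<partial>distr \<pi> \<mu> p)" by (rule integral_distr[OF p gm, symmetric])
    ultimately show ?thesis
      using est[OF \<mu>(2)] est[OF D.prob_space_axioms] g(3,4) by simp
  qed
  have "measure (distr \<pi> \<mu> p) A = measure \<mu> A"
  proof (rule ccontr)
    assume "measure (distr \<pi> \<mu> p) A \<noteq> measure \<mu> A"
    then show False using close[of "\<bar>measure (distr \<pi> \<mu> p) A - measure \<mu> A\<bar> / 6"] by auto
  qed
  then show "emeasure (distr \<pi> \<mu> p) A = emeasure \<mu> A" by (simp add: D.emeasure_eq_measure \<mu>.emeasure_eq_measure)
qed simp

text \<open>The marginals have to be recovered first, because the passage of the constraint to the
  limit uses them. The swapped coupling is approximated by swapped couplings. The kernel obtained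
  from disintegration is merely measurable; \<open>constraint_imp_causal\<close> makes it
  adapted.\<close>

theorem weak_closure_Cpl_bc_subset:
  assumes X: "\<And>t. t < N \<Longrightarrow> Polish_space (X t)" and Y: "\<And>t. t < N \<Longrightarrow> Polish_space (Y t)"
    and \<mu>: "path_measure N X \<mu>" and \<nu>: "path_measure N Y \<nu>"
    and stX: "\<And>t. t < N \<Longrightarrow> standard (borel_of (X t))" and stY: "\<And>t. t < N \<Longrightarrow> standard (borel_of (Y t))"
    and S: "S \<subseteq> Cpl_bc N X Y \<mu> \<nu>"
  shows "weak_closure (prod_topology (path_top N X) (path_top N Y))
    {\<pi>. prob_space \<pi> \<and> sets \<pi> = sets (prodM N X \<Otimes>\<^sub>M prodM N Y)} S \<subseteq> Cpl_bc N X Y \<mu> \<nu>"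
proof
  let ?T = "prod_topology (path_top N X) (path_top N Y)"
  fix \<pi> assume "\<pi> \<in> weak_closure ?T {\<pi>. prob_space \<pi> \<and> sets \<pi> = sets (prodM N X \<Otimes>\<^sub>M prodM N Y)} S"
  then have pr: "prob_space \<pi>" and s\<pi>: "sets \<pi> = sets (prodM N X \<Otimes>\<^sub>M prodM N Y)"
    and cl: "\<And>F \<epsilon>. finite F \<Longrightarrow> F \<subseteq> Cb ?T \<Longrightarrow> \<epsilon> > 0 \<Longrightarrow> \<exists>\<rho>\<in>S. \<forall>f\<in>F. \<bar>(\<integral>z. f z \<partial>\<rho>) - (\<integral>z. f z \<partial>\<pi>)\<bar> < \<epsilon>"
    by (auto simp: weak_closure_def)
  have s: "sets \<mu> = sets (prodM N X)" "sets \<nu> = sets (prodM N Y)" and p: "prob_space \<mu>" "prob_space \<nu>"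
    using \<mu> \<nu> by (auto simp: path_measure_def)
  note [measurable_cong] = s\<pi> s
  have sp: "sets (\<mu> \<Otimes>\<^sub>M \<nu>) = sets (prodM N X \<Otimes>\<^sub>M prodM N Y)" by (intro sets_pair_measure_cong s)
  have one: "\<exists>\<rho>\<in>S. \<bar>(\<integral>z. f z \<partial>\<rho>) - (\<integral>z. f z \<partial>\<pi>)\<bar> < \<epsilon>"
    if "continuous_map ?T euclideanreal f" "\<And>z. \<bar>f z\<bar> \<le> C" "\<epsilon> > 0" for f C \<epsilon>
    using cl[of "{f}" \<epsilon>] that by (auto simp: Cb_def)
  have cf: "continuous_map ?T euclideanreal (\<lambda>z. f (fst z))" if "continuous_map (path_top N X) euclideanreal f" for f
    using continuous_map_compose[OF continuous_map_fst that] by (simp add: comp_def)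
  have cs: "continuous_map ?T euclideanreal (\<lambda>z. f (snd z))" if "continuous_map (path_top N Y) euclideanreal f" for f
    using continuous_map_compose[OF continuous_map_snd that] by (simp add: comp_def)
  have scX: "second_countable (X t)" if "t < N" for t by (rule second_countable_Polish[OF X[OF that]])
  have scY: "second_countable (Y t)" if "t < N" for t by (rule second_countable_Polish[OF Y[OF that]])
  have fmX: "f \<in> borel_measurable \<mu>" if "continuous_map (path_top N X) euclideanreal f" for f
    unfolding measurable_cong_sets[OF s(1) refl] by (rule continuous_path_measurable[OF scX that])
  have fmY: "f \<in> borel_measurable \<nu>" if "continuous_map (path_top N Y) euclideanreal f" for f
    unfolding measurable_cong_sets[OF s(2) refl] by (rule continuous_path_measurable[OF scY that])
  have SC: "\<rho> \<in> Cpl \<mu> \<nu>" if "\<rho> \<in> S" for \<rho> using S that by (auto simp: Cpl_bc_def)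
  have m1: "distr \<pi> \<mu> fst = \<mu>"
  proof (rule marginal_closed[OF X s(1) p(1) pr])
    fix f C and \<epsilon> :: real assume f: "continuous_map (path_top N X) euclideanreal f" "\<And>x. \<bar>f x\<bar> \<le> C" "0 < \<epsilon>"
    then obtain \<rho> where \<rho>: "\<rho> \<in> S" "\<bar>(\<integral>z. f (fst z) \<partial>\<rho>) - (\<integral>z. f (fst z) \<partial>\<pi>)\<bar> < \<epsilon>"
      using one[OF cf[OF f(1)] f(2,3)] by blast
    then show "\<bar>(\<integral>x. f x \<partial>\<mu>) - (\<integral>z. f (fst z) \<partial>\<pi>)\<bar> < \<epsilon>"
      using Cpl_integral_fst(1)[OF SC fmX[OF f(1)]] by simp
  qed measurable
  have m2: "distr \<pi> \<nu> snd = \<nu>"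
  proof (rule marginal_closed[OF Y s(2) p(2) pr])
    fix f C and \<epsilon> :: real assume f: "continuous_map (path_top N Y) euclideanreal f" "\<And>x. \<bar>f x\<bar> \<le> C" "0 < \<epsilon>"
    then obtain \<rho> where \<rho>: "\<rho> \<in> S" "\<bar>(\<integral>z. f (snd z) \<partial>\<rho>) - (\<integral>z. f (snd z) \<partial>\<pi>)\<bar> < \<epsilon>"
      using one[OF cs[OF f(1)] f(2,3)] by blast
    then show "\<bar>(\<integral>x. f x \<partial>\<nu>) - (\<integral>z. f (snd z) \<partial>\<pi>)\<bar> < \<epsilon>"
      using Cpl_integral_snd(1)[OF SC fmY[OF f(1)]] by simp
  qed measurable
  have C: "\<pi> \<in> Cpl \<mu> \<nu>" using m1 m2 s\<pi> sp by (simp add: Cpl_def)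
  have near: "\<exists>\<rho>\<in>S. \<bar>(\<integral>z. f (fst z) * g (snd z) \<partial>\<rho>) - (\<integral>z. f (fst z) * g (snd z) \<partial>\<pi>)\<bar> < \<epsilon>"
    if "continuous_map (path_top N X) euclideanreal f" "continuous_map (path_top N Y) euclideanreal g"
      "\<And>x. \<bar>f x\<bar> \<le> C" "\<And>y. \<bar>g y\<bar> \<le> C" "0 < \<epsilon>" for f g C \<epsilon>
  proof (rule one[where C = "C * C"])
    show "continuous_map ?T euclideanreal (\<lambda>z. f (fst z) * g (snd z))" using that by (intro continuous_map_real_mult cf cs)
    have "0 \<le> C" using that(3) abs_ge_zero order_trans by blast
    then show "\<bar>f (fst z) * g (snd z)\<bar> \<le> C * C" for z unfolding abs_mult using that by (intro mult_mono) auto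
  qed (rule that(5))
  have sw: "(\<lambda>(x, y). (y, x)) \<in> \<mu> \<Otimes>\<^sub>M \<nu> \<rightarrow>\<^sub>M prodM N Y \<Otimes>\<^sub>M prodM N X" by measurable
  let ?sw = "\<lambda>\<rho>. distr \<rho> (prodM N Y \<Otimes>\<^sub>M prodM N X) (\<lambda>(x, y). (y, x))"
  have int_sw: "(\<integral>z. g (fst z) * f (snd z) \<partial>?sw \<rho>) = (\<integral>z. f (fst z) * g (snd z) \<partial>\<rho>)"
    if "continuous_map (path_top N X) euclideanreal f" "continuous_map (path_top N Y) euclideanreal g"
      "\<rho> \<in> Cpl \<mu> \<nu>" for f g \<rho>
  proof -
    have [measurable_cong]: "sets \<rho> = sets (\<mu> \<Otimes>\<^sub>M \<nu>)" using that(3) by (simp add: Cpl_def)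
    have [measurable]: "f \<in> borel_measurable (prodM N X)" "g \<in> borel_measurable (prodM N Y)"
      using continuous_path_measurable[OF scX that(1)] continuous_path_measurable[OF scY that(2)] by auto
    show ?thesis by (subst integral_distr) (auto simp: split_beta' mult.commute)
  qed
  have c1: "causal_constraint N X Y \<mu> \<pi>"
  proof (rule causal_constraint_closed[OF X Y s(1) p(1) s(2) p(2) C])
    fix f g C and \<epsilon> :: real
    assume fg: "continuous_map (path_top N X) euclideanreal f" "continuous_map (path_top N Y) euclideanreal g"
      "\<And>x. \<bar>f x\<bar> \<le> C" "\<And>y. \<bar>g y\<bar> \<le> C" "0 < \<epsilon>"
    obtain \<rho> where \<rho>: "\<rho> \<in> S" "\<bar>(\<integral>z. f (fst z) * g (snd z) \<partial>\<rho>) - (\<integral>z. f (fst z) * g (snd z) \<partial>\<pi>)\<bar> < \<epsilon>"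
      using near[OF fg] by blast
    have "causal_constraint N X Y \<mu> \<rho>" using \<rho>(1) S by (intro causal_imp_constraint s p) (auto simp: Cpl_bc_def)
    then show "\<exists>\<rho>\<in>Cpl \<mu> \<nu>. causal_constraint N X Y \<mu> \<rho> \<and>
      \<bar>(\<integral>z. f (fst z) * g (snd z) \<partial>\<rho>) - (\<integral>z. f (fst z) * g (snd z) \<partial>\<pi>)\<bar> < \<epsilon>" using \<rho> SC by blast
  qed
  have C': "?sw \<pi> \<in> Cpl \<nu> \<mu>" by (rule Cpl_swap[OF C s(1)[symmetric] s(2)[symmetric]])
  have c2: "causal_constraint N Y X \<nu> (?sw \<pi>)"
  proof (rule causal_constraint_closed[OF Y X s(2) p(2) s(1) p(1) C'])
    fix g f C and \<epsilon> :: real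
    assume fg: "continuous_map (path_top N Y) euclideanreal g" "continuous_map (path_top N X) euclideanreal f"
      "\<And>x. \<bar>g x\<bar> \<le> C" "\<And>y. \<bar>f y\<bar> \<le> C" "0 < \<epsilon>"
    obtain \<rho> where \<rho>: "\<rho> \<in> S" "\<bar>(\<integral>z. f (fst z) * g (snd z) \<partial>\<rho>) - (\<integral>z. f (fst z) * g (snd z) \<partial>\<pi>)\<bar> < \<epsilon>"
      using near[OF fg(2,1,4,3,5)] by blast
    have "causal_constraint N Y X \<nu> (?sw \<rho>)" using \<rho>(1) S by (intro causal_imp_constraint s p) (auto simp: Cpl_bc_def)
    moreover have "?sw \<rho> \<in> Cpl \<nu> \<mu>" by (rule Cpl_swap[OF SC[OF \<rho>(1)] s(1)[symmetric] s(2)[symmetric]])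
    ultimately show "\<exists>\<rho>\<in>Cpl \<nu> \<mu>. causal_constraint N Y X \<nu> \<rho> \<and>
      \<bar>(\<integral>z. g (fst z) * f (snd z) \<partial>\<rho>) - (\<integral>z. g (fst z) * f (snd z) \<partial>?sw \<pi>)\<bar> < \<epsilon>"
      using \<rho>(2) int_sw[OF fg(2,1) SC[OF \<rho>(1)]] int_sw[OF fg(2,1) C] by (intro bexI[of _ "?sw \<rho>"]) simp_all
  qed
  have causal: "causal N X Y \<mu> \<pi>"
  proof -
    have "sets \<pi> = sets (\<mu> \<Otimes>\<^sub>M prodM N Y)" unfolding s\<pi> by (intro sets_pair_measure_cong) (simp_all add: s)
    moreover have "standard (prodM N Y)" using \<nu> by (simp add: path_measure_def)
    ultimately obtain k where k: "k \<in> \<mu> \<rightarrow>\<^sub>M prob_algebra (prodM N Y)" "\<pi> = sdp \<mu> (prodM N Y) k"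
      using disintegration[of \<mu> "prodM N Y" \<pi>, OF p(1) _ _ m1] by metis
    have k': "k \<in> prodM N X \<rightarrow>\<^sub>M prob_algebra (prodM N Y)" using k(1) by measurable
    show ?thesis unfolding k(2) using c1 unfolding k(2) by (intro constraint_imp_causal[OF s(1) p(1) stY k'])
  qed
  have causal': "causal N Y X \<nu> (?sw \<pi>)"
  proof -
    have "sets (?sw \<pi>) = sets (\<nu> \<Otimes>\<^sub>M prodM N X)" unfolding sets_distr by (intro sets_pair_measure_cong) (simp_all add: s)
    moreover have "standard (prodM N X)" using \<mu> by (simp add: path_measure_def)
    moreover have "distr (?sw \<pi>) \<nu> fst = \<nu>" using C' by (simp add: Cpl_def)
    ultimately obtain k where k: "k \<in> \<nu> \<rightarrow>\<^sub>M prob_algebra (prodM N X)" "?sw \<pi> = sdp \<nu> (prodM N X) k"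
      using disintegration[OF p(2), of "prodM N X" "?sw \<pi>"] by metis
    have k': "k \<in> prodM N Y \<rightarrow>\<^sub>M prob_algebra (prodM N X)" using k(1) by measurable
    show ?thesis unfolding k(2) using c2 unfolding k(2) by (intro constraint_imp_causal[OF s(2) p(2) stX k'])
  qed
  show "\<pi> \<in> Cpl_bc N X Y \<mu> \<nu>" using C causal causal' by (simp add: Cpl_bc_def)
qed

section \<open>Paths in the same cell\<close>

text \<open>Given the first point, the second is drawn from Q conditioned on the cell of the first.
  Equal cell masses are exactly what makes Q the second marginal.\<close>

lemma cell_coupling:
  assumes P: "prob_space P" and Q: "prob_space Q" and sP: "sets P = sets M" and sQ: "sets Q = sets M"
    and c[measurable]: "c \<in> M \<rightarrow>\<^sub>M count_space I" and I: "finite I"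
    and eq: "\<And>i. i \<in> I \<Longrightarrow> emeasure P {z \<in> space P. c z = i} = emeasure Q {z \<in> space Q. c z = i}"
  obtains \<gamma> where "\<gamma> \<in> Cpl P Q" "prob_space \<gamma>" "AE z in \<gamma>. c (fst z) = c (snd z)"
proof -
  interpret P: prob_space P by fact
  interpret Q: prob_space Q by fact
  note [measurable_cong] = sP sQ
  have sp: "space P = space M" "space Q = space M" using sP sQ by (auto dest: sets_eq_imp_space_eq)
  have cI: "c z \<in> I" if "z \<in> space M" for z using measurable_space[OF c that] by simp
  define E where "E i = {z \<in> space M. c z = i}" for i
  have E[measurable]: "E i \<in> sets M" if "i \<in> I" for i unfolding E_def using that by measurable
  have PE: "emeasure P (E i) = emeasure Q (E i)" if "i \<in> I" for i using eq[OF that] by (simp add: E_def sp)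
  \<comment> \<open>On a null cell conditioning is undefined; Q is a placeholder there, met with
    probability zero.\<close>
  define L where "L i = (if emeasure Q (E i) = 0 then Q else uniform_measure Q (E i))" for i
  have L: "L i \<in> space (prob_algebra M)" if "i \<in> I" for i
    unfolding L_def using sQ Q Q.emeasure_finite[of "E i"]
    by (auto simp: space_prob_algebra intro!: prob_space_uniform_measure)
  have LL: "L \<in> count_space I \<rightarrow>\<^sub>M prob_algebra M" using L by (simp add: measurable_count_space_eq1)
  have k: "(\<lambda>z. L (c z)) \<in> P \<rightarrow>\<^sub>M prob_algebra M" using measurable_compose[OF c LL] measurable_cong_sets[OF sP refl] by blast
  let ?\<gamma> = "sdp P M (\<lambda>z. L (c z))"
  note [measurable_cong] = sets_sdp[OF P k]
  have "prob_space ?\<gamma>" by (rule prob_space_sdp[OF P k])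
  moreover have "?\<gamma> \<in> Cpl P Q"
    unfolding Cpl_def
  proof (intro CollectI conjI)
    show "sets ?\<gamma> = sets (P \<Otimes>\<^sub>M Q)" unfolding sets_sdp[OF P k] by (intro sets_pair_measure_cong) (simp_all add: sP sQ)
    show "distr ?\<gamma> P fst = P" by (rule distr_fst_sdp[OF P k])
    show "distr ?\<gamma> Q snd = Q"
    proof (rule measure_eqI)
      fix B assume "B \<in> sets (distr ?\<gamma> Q snd)"
      then have B[measurable]: "B \<in> sets M" by (simp add: sQ)
      have "emeasure (distr ?\<gamma> Q snd) B = emeasure ?\<gamma> (space P \<times> B)"
        using sets.sets_into_space[OF B] space_sdp[OF P k] by (subst emeasure_distr) (auto simp: sp intro!: arg_cong2[where f = emeasure])
      also have "\<dots> = (\<integral>\<^sup>+z. emeasure (L (c z)) B * indicator (space P) z \<partial>P)"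
        by (rule emeasure_sdp_times[OF P k]) auto
      also have "\<dots> = (\<integral>\<^sup>+z. (\<Sum>i\<in>I. emeasure (L i) B * indicator (E i) z) \<partial>P)"
      proof (rule nn_integral_cong)
        fix z assume z: "z \<in> space P"
        have "(\<Sum>i\<in>I. emeasure (L i) B * indicator (E i) z) = (\<Sum>i\<in>I. if i = c z then emeasure (L (c z)) B else 0)"
          using z by (intro sum.cong) (auto simp: E_def sp indicator_def)
        then show "emeasure (L (c z)) B * indicator (space P) z = (\<Sum>i\<in>I. emeasure (L i) B * indicator (E i) z)"
          using z I cI[of z] by (simp add: sp)
      qed
      also have "\<dots> = (\<Sum>i\<in>I. emeasure (L i) B * emeasure P (E i))"
        by (subst nn_integral_sum) (auto simp: nn_integral_cmult_indicator)
      also have "\<dots> = (\<Sum>i\<in>I. emeasure Q (E i \<inter> B))"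
      proof (rule sum.cong)
        fix i assume i: "i \<in> I"
        have [measurable]: "E i \<in> sets M" by (rule E[OF i])
        show "emeasure (L i) B * emeasure P (E i) = emeasure Q (E i \<inter> B)"
        proof (cases "emeasure Q (E i) = 0")
          case True
          have "emeasure Q (E i \<inter> B) \<le> emeasure Q (E i)" by (intro emeasure_mono) auto
          then show ?thesis using True PE[OF i] by simp
        next
          case False
          have "emeasure (L i) B = emeasure Q (E i \<inter> B) / emeasure Q (E i)"
            unfolding L_def using False by (simp add: sQ)
          moreover have "emeasure Q (E i) / emeasure Q (E i) = 1"
            using False Q.emeasure_finite[of "E i"] by (intro ennreal_divide_self) (auto simp: less_top[symmetric])
          ultimately show ?thesis by (simp only: PE[OF i] ennreal_divide_times mult_1_right)
        qed
      qed simp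
      also have "\<dots> = emeasure Q (\<Union>i\<in>I. E i \<inter> B)"
        using I by (intro sum_emeasure) (auto simp: disjoint_family_on_def E_def)
      also have "(\<Union>i\<in>I. E i \<inter> B) = B" using sets.sets_into_space[OF B] cI by (auto simp: E_def)
      finally show "emeasure (distr ?\<gamma> Q snd) B = emeasure Q B" .
    qed simp
  qed
  moreover have "AE z in ?\<gamma>. c (fst z) = c (snd z)"
  proof -
    have pm: "Measurable.pred (P \<Otimes>\<^sub>M M) (\<lambda>z. c (fst z) = c (snd z))"
    proof -
      have "{z \<in> space (P \<Otimes>\<^sub>M M). c (fst z) = c (snd z)} = (\<Union>i\<in>I. E i \<times> E i)"
        using cI by (auto simp: space_pair_measure E_def sp)
      also have "\<dots> \<in> sets (P \<Otimes>\<^sub>M M)" using I by (intro sets.finite_UN) auto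
      finally show ?thesis by (simp add: pred_def)
    qed
    have "AE z in P. \<forall>i\<in>{i \<in> I. emeasure P (E i) = 0}. z \<notin> E i"
      using I by (intro AE_finite_allI) (auto intro!: AE_not_in simp: null_sets_def)
    then have "AE x in P. AE y in L (c x). c x = c y"
      using AE_space
    proof eventually_elim
      case (elim x)
      then have cx: "c x \<in> I" "x \<in> E (c x)" using cI sp by (auto simp: E_def)
      then have "emeasure Q (E (c x)) \<noteq> 0" using elim(1) PE by auto
      then show ?case unfolding L_def
        using E[OF cx(1)] by (auto simp: E_def intro!: AE_uniform_measureI)
    qed
    then show ?thesis by (subst AE_sdp[OF P k pm]) simp
  qed
  ultimately show ?thesis using that by blast
qed

lemma cube_coordinates_AE: "AE u in cube N. \<forall>t<N. 0 < u t \<and> u t < 1"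
proof -
  have "AE u in cube N. t < N \<longrightarrow> 0 < u t \<and> u t < 1" for t
  proof (cases "t < N")
    case True
    have [measurable]: "(\<lambda>u. u t) \<in> borel_measurable (prodM N RR)"
      using prodM_measurable_component[OF True, of "\<lambda>x. x" "prodM N RR" RR] by simp
    have "emeasure (cube N) (space (prodM N RR) \<inter> {u \<in> space (prodM N RR). u t \<in> - {0<..<1}}) =
        emeasure unif (- {0<..<1}) * emeasure (cube N) (space (prodM N RR))"
      using sets.top[of "filtM N t RR"] by (intro cube_indep[OF True]) auto
    also have "emeasure unif (- {0<..<1}) = 0" by (subst emeasure_unif) auto
    finally have "emeasure (cube N) {u \<in> space (cube N). \<not> (0 < u t \<and> u t < 1)} = 0"
      by (simp add: sets_eq_imp_space_eq[OF sets_cube] Int_def conj_assoc greaterThanLessThan_iff)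
    then show ?thesis using True by (intro AE_I[of _ _ "{u \<in> space (cube N). \<not> (0 < u t \<and> u t < 1)}"])
       (auto simp: sets_cube sets_eq_imp_space_eq[OF sets_cube])
  qed simp
  then show ?thesis by (simp add: AE_all_countable)
qed

lemma cube_marginal:
  assumes t: "t < N" and E: "E \<in> sets borel"
  shows "emeasure (cube N) {u \<in> space (cube N). u t \<in> E} = emeasure unif E"
proof -
  have "space (prodM N RR) \<in> sets (filtM N t RR)" using sets.top[of "filtM N t RR"] by simp
  from cube_indep[OF t this E] show ?thesis
    using prob_space.emeasure_space_1[OF prob_space_cube[of N]] by (simp add: sets_eq_imp_space_eq[OF sets_cube] Int_def)
qed

lemma same_cell_close:
  assumes "0 < m" "cell m a = cell m b" "0 < a" "a < 1" "0 < b" "b < 1"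
  shows "\<bar>a - b\<bar> < 1 / m"
  using cell_eq_iff[of m a "cell m a"] cell_eq_iff[of m b "cell m a"] assms by auto

lemma cv_eqD: "cv m N u = cv m N v \<Longrightarrow> t < N \<Longrightarrow> cell m (u t) = cell m (v t)"
  unfolding cv_def by (metis (no_types, lifting) atLeastLessThan_iff le0 map_eq_conv set_upt)

text \<open>The two random points live on an arbitrary space G, so that components of a coupling of
  couplings can be inserted directly.\<close>

definition cell_pair :: "nat \<Rightarrow> nat \<Rightarrow> 'z measure \<Rightarrow> ('z \<Rightarrow> nat \<Rightarrow> real) \<Rightarrow> ('z \<Rightarrow> nat \<Rightarrow> real) \<Rightarrow> bool" where
  "cell_pair N m G U V \<longleftrightarrow> prob_space G \<and> U \<in> G \<rightarrow>\<^sub>M prodM N RR \<and> V \<in> G \<rightarrow>\<^sub>M prodM N RR \<and>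
    distr G (cube N) U = cube N \<and> distr G (cube N) V = cube N \<and> (AE z in G. cv m N (U z) = cv m N (V z))"

lemma cell_pair_sym: "cell_pair N m G U V \<Longrightarrow> cell_pair N m G V U"
  unfolding cell_pair_def by (auto elim!: eventually_mono)

text \<open>The estimate is uniform over all pairs with law \<open>cube\<close> and common cells,
  since later the second point varies with m. Sets with this property form a sigma-algebra. For a
  half-space \<open>u t \<le> q\<close>, a common cell forces the coordinates within 1/m of each
  other, so a disagreement confines one of them to an interval of length 1/m. The threshold serves
  all larger m, as cells of different meshes need not be nested.\<close>

lemma same_cell_same_set:
  assumes E: "E \<in> sets (prodM N RR)" and \<eta>: "0 < (\<eta>::real)"
  shows "\<exists>m0. \<forall>m\<ge>m0. \<forall>(G::'z measure) U V. cell_pair N m G U V \<longrightarrow> measure G {z \<in> space G. U z \<in> E \<and> V z \<notin> E} \<le> \<eta>"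
proof -
  let ?\<Omega> = "space (prodM N RR)"
  define good where "good E \<eta> m0 \<longleftrightarrow>
    (\<forall>m\<ge>m0. \<forall>(G::'z measure) U V. cell_pair N m G U V \<longrightarrow> measure G {z \<in> space G. U z \<in> E \<and> V z \<notin> E} \<le> \<eta>)" for E and \<eta> :: real and m0
  define C where "C = {E \<in> sets (prodM N RR). \<forall>\<eta>>0. \<exists>m0. good E \<eta> m0}"
  note [measurable_cong] = sets_cube
  have spc: "space (cube N) = ?\<Omega>" by (rule sets_eq_imp_space_eq[OF sets_cube])
  interpret cube: prob_space "cube N" by (rule prob_space_cube)
  have sa: "sigma_algebra ?\<Omega> C"
    unfolding sigma_algebra_iff2
  proof (intro conjI ballI allI impI)
    show "C \<subseteq> Pow ?\<Omega>" using sets.sets_into_space by (auto simp: C_def)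
    show "{} \<in> C" by (auto simp: C_def good_def)
  next
    fix E assume E: "E \<in> C"
    show "?\<Omega> - E \<in> C" unfolding C_def
    proof (intro CollectI conjI allI impI)
      show "?\<Omega> - E \<in> sets (prodM N RR)" using E by (auto simp: C_def)
      fix \<eta> :: real assume "\<eta> > 0"
      then obtain m0 where m0: "good E \<eta> m0" using E by (auto simp: C_def)
      \<comment> \<open>For the complement the roles of U and V are exchanged, which the symmetry of
        \<open>cell_pair\<close> allows.\<close>
      have "good (?\<Omega> - E) \<eta> m0"
        unfolding good_def
      proof (intro allI impI)
        fix m and G :: "'z measure" and U V assume m: "m0 \<le> m" and p: "cell_pair N m G U V"
        have "measure G {z \<in> space G. V z \<in> E \<and> U z \<notin> E} \<le> \<eta>"
          using m0 m cell_pair_sym[OF p] unfolding good_def by blast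
        moreover have "{z \<in> space G. U z \<in> ?\<Omega> - E \<and> V z \<notin> ?\<Omega> - E} = {z \<in> space G. V z \<in> E \<and> U z \<notin> E}"
          using p measurable_space[of U G "prodM N RR"] measurable_space[of V G "prodM N RR"] by (auto simp: cell_pair_def)
        ultimately show "measure G {z \<in> space G. U z \<in> ?\<Omega> - E \<and> V z \<notin> ?\<Omega> - E} \<le> \<eta>" by simp
      qed
      then show "\<exists>m0. good (?\<Omega> - E) \<eta> m0" by blast
    qed
  next
    fix A :: "nat \<Rightarrow> _" assume A: "range A \<subseteq> C"
    then have As[measurable]: "A i \<in> sets (prodM N RR)" for i by (auto simp: C_def)
    show "(\<Union>i. A i) \<in> C" unfolding C_def
    proof (intro CollectI conjI allI impI)
      show "(\<Union>i. A i) \<in> sets (prodM N RR)" by measurable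
      fix \<eta> :: real assume \<eta>: "\<eta> > 0"
      let ?R = "\<lambda>k. (\<Union>i. A i) - (\<Union>i<k. A i)"
      have R[measurable]: "?R k \<in> sets (prodM N RR)" for k by measurable
      have "(\<lambda>k. measure (cube N) (?R k)) \<longlonglongrightarrow> measure (cube N) (\<Inter>k. ?R k)"
      proof (rule cube.finite_Lim_measure_decseq)
        show "range ?R \<subseteq> cube.events" using R by (auto simp: sets_cube)
        show "decseq ?R" unfolding decseq_def by (intro allI impI Diff_mono UN_mono) auto
      qed
      moreover have "(\<Inter>k. ?R k) = {}" by auto
      ultimately have lim0: "(\<lambda>k. measure (cube N) (?R k)) \<longlonglongrightarrow> 0" by (simp only: measure_empty)
      have "eventually (\<lambda>k. measure (cube N) (?R k) < \<eta> / 2) sequentially"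
        by (rule order_tendstoD(2)[OF lim0]) (use \<eta> in simp)
      from eventually_happens'[OF _ this] obtain k where k: "measure (cube N) (?R k) < \<eta> / 2" by auto
      have "\<exists>m0. good (A i) (\<eta> / (2 * (real k + 1))) m0" for i
      proof -
        have "A i \<in> C" using A by auto
        moreover have "0 < \<eta> / (2 * (real k + 1))" using \<eta> by simp
        ultimately show ?thesis unfolding C_def by blast
      qed
      then obtain M where M: "\<And>i. good (A i) (\<eta> / (2 * (real k + 1))) (M i)" by metis
      \<comment> \<open>The sum is a convenient upper bound for all thresholds involved.\<close>
      define m0 where "m0 = (\<Sum>i<k. M i)"
      have "good (\<Union>i. A i) \<eta> m0"
        unfolding good_def
      proof (intro allI impI)
        fix m and G :: "'z measure" and U V assume m: "m0 \<le> m" and p: "cell_pair N m G U V"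
        interpret G: prob_space G using p by (simp add: cell_pair_def)
        have [measurable]: "U \<in> G \<rightarrow>\<^sub>M prodM N RR" "V \<in> G \<rightarrow>\<^sub>M prodM N RR" and dU: "distr G (cube N) U = cube N"
          using p by (auto simp: cell_pair_def)
        let ?S = "\<lambda>i. {z \<in> space G. U z \<in> A i \<and> V z \<notin> A i}"
        let ?Q = "{z \<in> space G. U z \<in> ?R k}"
        have "{z \<in> space G. U z \<in> (\<Union>i. A i) \<and> V z \<notin> (\<Union>i. A i)} \<subseteq> ?Q \<union> (\<Union>i<k. ?S i)" by auto
        then have "measure G {z \<in> space G. U z \<in> (\<Union>i. A i) \<and> V z \<notin> (\<Union>i. A i)} \<le> measure G (?Q \<union> (\<Union>i<k. ?S i))"
          by (rule G.finite_measure_mono) measurable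
        also have "\<dots> \<le> measure G ?Q + measure G (\<Union>i<k. ?S i)"
          by (rule measure_Un_le) measurable
        also have "\<dots> \<le> measure G ?Q + (\<Sum>i<k. measure G (?S i))"
          by (intro add_left_mono G.finite_measure_subadditive_finite) (simp, intro image_subsetI, measurable)
        also have "measure G ?Q = measure (distr G (cube N) U) (?R k)"
          by (subst measure_distr) (auto intro!: arg_cong2[where f = measure])
        also have "(\<Sum>i<k. measure G (?S i)) \<le> (\<Sum>i<k. \<eta> / (2 * (real k + 1)))"
        proof (rule sum_mono)
          fix i assume "i \<in> {..<k}"
          then have "M i \<le> m0" unfolding m0_def by (intro member_le_sum) auto
          then show "measure G (?S i) \<le> \<eta> / (2 * (real k + 1))" using M[of i] m p unfolding good_def by (meson order_trans)
        qed
        also have "(\<Sum>i<k. \<eta> / (2 * (real k + 1))) = \<eta> / 2 * (real k / (real k + 1))" by (simp add: field_simps)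
        also have "\<dots> \<le> \<eta> / 2 * 1" using \<eta> by (intro mult_left_mono) (auto simp: field_simps)
        finally show "measure G {z \<in> space G. U z \<in> (\<Union>i. A i) \<and> V z \<notin> (\<Union>i. A i)} \<le> \<eta>"
          using k unfolding dU by simp
      qed
      then show "\<exists>m0. good (\<Union>i. A i) \<eta> m0" by blast
    qed
  qed
  have setsC: "sets (sigma ?\<Omega> C) = C" "space (sigma ?\<Omega> C) = ?\<Omega>"
    using sigma_algebra.sets_measure_of_eq[OF sa] by (auto simp: C_def space_measure_of_conv dest: sets.sets_into_space)
  have comp: "(\<lambda>u. u t) \<in> borel_measurable (sigma ?\<Omega> C)" if t: "t < N" for t
  proof (rule borel_measurableI_le)
    fix q :: real
    have tm[measurable]: "(\<lambda>u. u t) \<in> borel_measurable (prodM N RR)"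
      using prodM_measurable_component[OF t, of "\<lambda>x. x" "prodM N RR" RR] by simp
    let ?A = "{u \<in> ?\<Omega>. u t \<le> q}"
    have "?A \<in> C" unfolding C_def
    proof (intro CollectI conjI allI impI)
      show "?A \<in> sets (prodM N RR)" by measurable
      fix \<eta> :: real assume \<eta>: "\<eta> > 0"
      obtain m0 :: nat where m0: "1 / \<eta> < real m0" using reals_Archimedean2 by blast
      have "good ?A \<eta> m0" unfolding good_def
      proof (intro allI impI)
        fix m and G :: "'z measure" and U V assume m: "m0 \<le> m" and p: "cell_pair N m G U V"
        have mpos: "0 < m" using m0 m \<eta> by (metis divide_nonneg_pos gr0I le_zero_eq less_le_not_le of_nat_0 order.strict_implies_order zero_le_one)
        have m\<eta>: "1 / real m \<le> \<eta>"
        proof -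
          have "1 / \<eta> < real m" using m0 m by linarith
          then show ?thesis using \<eta> mpos by (simp add: field_simps)
        qed
        interpret G: prob_space G using p by (simp add: cell_pair_def)
        have [measurable]: "U \<in> G \<rightarrow>\<^sub>M prodM N RR" "V \<in> G \<rightarrow>\<^sub>M prodM N RR"
          and d: "distr G (cube N) U = cube N" "distr G (cube N) V = cube N"
          and cv: "AE z in G. cv m N (U z) = cv m N (V z)"
          using p by (auto simp: cell_pair_def)
        have UV: "U \<in> G \<rightarrow>\<^sub>M cube N" "V \<in> G \<rightarrow>\<^sub>M cube N" by measurable
        have "AE z in G. \<forall>t<N. 0 < U z t \<and> U z t < 1"
          by (rule AE_distrD[OF UV(1)], unfold d, rule cube_coordinates_AE)
        moreover have "AE z in G. \<forall>t<N. 0 < V z t \<and> V z t < 1"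
          by (rule AE_distrD[OF UV(2)], unfold d, rule cube_coordinates_AE)
        ultimately have close: "AE z in G. \<bar>U z t - V z t\<bar> < 1 / m"
          using cv by eventually_elim (rule same_cell_close[OF mpos cv_eqD[OF _ t]], use t in auto)
        have "measure G {z \<in> space G. U z \<in> ?A \<and> V z \<notin> ?A} \<le> measure G {z \<in> space G. U z t \<in> {q - 1 / m..q}}"
        proof (rule G.finite_measure_mono_AE)
          show "AE z in G. z \<in> {z \<in> space G. U z \<in> ?A \<and> V z \<notin> ?A} \<longrightarrow> z \<in> {z \<in> space G. U z t \<in> {q - 1 / m..q}}"
            using close AE_space
            by eventually_elim (use measurable_space[OF UV(2)] in \<open>auto simp: spc\<close>)
        qed measurable
        also have "\<dots> = measure (distr G (cube N) U) {u \<in> space (cube N). u t \<in> {q - 1 / m..q}}"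
          using measurable_space[OF UV(1)] by (subst measure_distr[OF UV(1)]) (auto simp: spc intro!: arg_cong2[where f = measure])
        also have "\<dots> = measure unif {q - 1 / m..q}"
          unfolding d measure_def using cube_marginal[OF t, of "{q - 1 / m..q}"] by simp
        also have "\<dots> \<le> 1 / m"
        proof -
          have "emeasure unif {q - 1 / m..q} = emeasure lborel ({q - 1 / m..q} \<inter> {0<..<1})"
            by (rule emeasure_unif) simp
          also have "\<dots> \<le> emeasure lborel {q - 1 / m..q}" by (rule emeasure_mono) auto
          also have "\<dots> = ennreal (1 / m)" by simp
          finally show ?thesis unfolding measure_def by (simp add: enn2real_leI)
        qed
        finally show "measure G {z \<in> space G. U z \<in> ?A \<and> V z \<notin> ?A} \<le> \<eta>" using m\<eta> by linarith
      qed
      then show "\<exists>m0. good ?A \<eta> m0" by blast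
    qed
    then show "{u \<in> space (sigma ?\<Omega> C). u t \<le> q} \<in> sets (sigma ?\<Omega> C)" unfolding setsC .
  qed
  have "(\<lambda>x. x) \<in> sigma ?\<Omega> C \<rightarrow>\<^sub>M prodM N RR"
  proof -
    have "(\<lambda>\<omega> i. \<omega> i) \<in> sigma ?\<Omega> C \<rightarrow>\<^sub>M PiM {..<N} (\<lambda>t. borel_of (RR t))"
    proof (rule measurable_PiM_single')
      show "(\<lambda>\<omega>. \<omega> i) \<in> sigma ?\<Omega> C \<rightarrow>\<^sub>M borel_of (RR i)" if "i \<in> {..<N}" for i using comp that by simp
      show "(\<lambda>\<omega> i. \<omega> i) \<in> space (sigma ?\<Omega> C) \<rightarrow> (\<Pi>\<^sub>E i\<in>{..<N}. space (borel_of (RR i)))"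
        unfolding setsC by (simp add: space_prodM)
    qed
    then show ?thesis by (simp add: prodM_def)
  qed
  from measurable_sets[OF this E] have "E \<in> C"
    unfolding setsC using sets.sets_into_space[OF E] by (simp add: Int_absorb2)
  then show ?thesis using \<eta> unfolding C_def good_def by blast
qed

definition path_pair :: "nat \<Rightarrow> (nat \<Rightarrow> 'a topology) \<Rightarrow> (nat \<Rightarrow> 'a) measure \<Rightarrow> ((nat \<Rightarrow> 'a) \<Rightarrow> nat \<Rightarrow> real) \<Rightarrow> nat \<Rightarrow>
    'z measure \<Rightarrow> ('z \<Rightarrow> nat \<Rightarrow> 'a) \<Rightarrow> ('z \<Rightarrow> nat \<Rightarrow> 'a) \<Rightarrow> bool" where
  "path_pair N X \<mu> \<Phi> m G U V \<longleftrightarrow> prob_space G \<and> U \<in> G \<rightarrow>\<^sub>M prodM N X \<and> V \<in> G \<rightarrow>\<^sub>M prodM N X \<and>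
    distr G \<mu> U = \<mu> \<and> distr G \<mu> V = \<mu> \<and> (AE z in G. cv m N (\<Phi> (U z)) = cv m N (\<Phi> (V z)))"

text \<open>Almost surely x lies in A if and only if its image in the cube lies in the preimage of A
  under \<open>\<Theta>\<close>, so the uniform estimate in the cube carries over. As
  \<open>\<Phi>\<close> is only measurable, this is the substitute for closeness of paths in a
  common cell.\<close>

lemma path_pair_same_set:
  assumes \<mu>: "sets \<mu> = sets (prodM N X)" and I: "adapted_iso N X RR \<mu> (cube N) \<Phi> \<Theta>"
    and A: "A \<in> sets (prodM N X)" and \<eta>: "0 < (\<eta>::real)"
  shows "\<exists>m0. \<forall>m\<ge>m0. \<forall>(G::'z measure) U V. path_pair N X \<mu> \<Phi> m G U V \<longrightarrow>
    measure G {z \<in> space G. U z \<in> A \<and> V z \<notin> A} \<le> \<eta>"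
proof -
  note [measurable_cong] = \<mu> sets_cube
  have \<Phi>[measurable]: "\<Phi> \<in> prodM N X \<rightarrow>\<^sub>M prodM N RR" and \<Theta>[measurable]: "\<Theta> \<in> prodM N RR \<rightarrow>\<^sub>M prodM N X"
    and d: "distr \<mu> (cube N) \<Phi> = cube N" and inv: "AE x in \<mu>. \<Theta> (\<Phi> x) = x"
    using I by (auto simp: adapted_iso_def adapted_def)
  define E where "E = \<Theta> -` A \<inter> space (prodM N RR)"
  have E[measurable]: "E \<in> sets (prodM N RR)" unfolding E_def by (rule measurable_sets[OF \<Theta> A])
  note A[measurable]
  obtain m0 where m0: "\<And>m (G::'z measure) U V. m0 \<le> m \<Longrightarrow> cell_pair N m G U V \<Longrightarrow>
      measure G {z \<in> space G. U z \<in> E \<and> V z \<notin> E} \<le> \<eta>"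
    using same_cell_same_set[OF E \<eta>, where 'z = 'z] by blast
  have "measure G {z \<in> space G. U z \<in> A \<and> V z \<notin> A} \<le> \<eta>"
    if m: "m0 \<le> m" and p: "path_pair N X \<mu> \<Phi> m G U V" for m and G :: "'z measure" and U V
  proof -
    interpret G: prob_space G using p by (simp add: path_pair_def)
    have UV[measurable]: "U \<in> G \<rightarrow>\<^sub>M prodM N X" "V \<in> G \<rightarrow>\<^sub>M prodM N X"
      and dUV: "distr G \<mu> U = \<mu>" "distr G \<mu> V = \<mu>" and cv: "AE z in G. cv m N (\<Phi> (U z)) = cv m N (\<Phi> (V z))"
      using p by (auto simp: path_pair_def)
    have dd: "distr G (cube N) (\<lambda>z. \<Phi> (W z)) = cube N"
      if [measurable]: "W \<in> G \<rightarrow>\<^sub>M prodM N X" and "distr G \<mu> W = \<mu>" for W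
    proof -
      have "distr G (cube N) (\<lambda>z. \<Phi> (W z)) = distr (distr G \<mu> W) (cube N) \<Phi>"
        by (subst distr_distr) (auto simp: comp_def)
      then show ?thesis by (simp add: that(2) d)
    qed
    have inE: "AE z in G. (W z \<in> A) = (\<Phi> (W z) \<in> E)"
      if W[measurable]: "W \<in> G \<rightarrow>\<^sub>M prodM N X" and "distr G \<mu> W = \<mu>" for W
    proof -
      have W': "W \<in> G \<rightarrow>\<^sub>M \<mu>" by measurable
      have "AE z in G. \<Theta> (\<Phi> (W z)) = W z" by (rule AE_distrD[OF W'], unfold that(2), rule inv)
      then show ?thesis using AE_space
        by eventually_elim (use measurable_space[OF measurable_compose[OF W \<Phi>]] in \<open>auto simp: E_def\<close>)
    qed
    have "cell_pair N m G (\<lambda>z. \<Phi> (U z)) (\<lambda>z. \<Phi> (V z))"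
      unfolding cell_pair_def using dd[OF UV(1) dUV(1)] dd[OF UV(2) dUV(2)] cv G.prob_space_axioms by simp
    from m0[OF m this] have "measure G {z \<in> space G. \<Phi> (U z) \<in> E \<and> \<Phi> (V z) \<notin> E} \<le> \<eta>" .
    also have "measure G {z \<in> space G. \<Phi> (U z) \<in> E \<and> \<Phi> (V z) \<notin> E} = measure G {z \<in> space G. U z \<in> A \<and> V z \<notin> A}"
    proof (rule G.finite_measure_eq_AE)
      show "AE z in G. (z \<in> {z \<in> space G. \<Phi> (U z) \<in> E \<and> \<Phi> (V z) \<notin> E}) = (z \<in> {z \<in> space G. U z \<in> A \<and> V z \<notin> A})"
        using inE[OF UV(1) dUV(1)] inE[OF UV(2) dUV(2)] by eventually_elim auto
    qed measurable
    finally show ?thesis .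
  qed
  then show ?thesis by blast
qed

section \<open>Cell couplings are close\<close>

definition same_cells :: "nat \<Rightarrow> ((nat \<Rightarrow> 'a) \<Rightarrow> nat \<Rightarrow> real) \<Rightarrow> ((nat \<Rightarrow> 'b) \<Rightarrow> nat \<Rightarrow> real) \<Rightarrow> nat \<Rightarrow>
    (((nat \<Rightarrow> 'a) \<times> (nat \<Rightarrow> 'b)) \<times> ((nat \<Rightarrow> 'a) \<times> (nat \<Rightarrow> 'b))) measure \<Rightarrow> bool" where
  "same_cells N \<Phi> \<Psi> m \<gamma> \<longleftrightarrow> (AE w in \<gamma>. cv m N (\<Phi> (fst (fst w))) = cv m N (\<Phi> (fst (snd w))) \<and>
     cv m N (\<Psi> (snd (fst w))) = cv m N (\<Psi> (snd (snd w))))"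

text \<open>Passes from a coupling of couplings to its two components, each a pair of paths with the
  right law and common cells.\<close>

lemma same_cells_path_pairs:
  assumes \<mu>: "sets \<mu> = sets (prodM N X)" and \<nu>: "sets \<nu> = sets (prodM N Y)" and p: "prob_space \<mu>"
    and \<pi>: "\<pi> \<in> Cpl \<mu> \<nu>" and \<rho>: "\<rho> \<in> Cpl \<mu> \<nu>" and \<gamma>: "\<gamma> \<in> Cpl \<pi> \<rho>" and s: "same_cells N \<Phi> \<Psi> m \<gamma>"
  shows "path_pair N X \<mu> \<Phi> m \<gamma> (\<lambda>w. fst (fst w)) (\<lambda>w. fst (snd w))"
    "path_pair N Y \<nu> \<Psi> m \<gamma> (\<lambda>w. snd (fst w)) (\<lambda>w. snd (snd w))"
proof -
  have s\<pi>: "sets \<pi> = sets (prodM N X \<Otimes>\<^sub>M prodM N Y)" by (rule Cpl_sets[OF \<pi> \<mu> \<nu>])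
  have s\<rho>: "sets \<rho> = sets (prodM N X \<Otimes>\<^sub>M prodM N Y)" by (rule Cpl_sets[OF \<rho> \<mu> \<nu>])
  have s\<gamma>: "sets \<gamma> = sets ((prodM N X \<Otimes>\<^sub>M prodM N Y) \<Otimes>\<^sub>M (prodM N X \<Otimes>\<^sub>M prodM N Y))" by (rule Cpl_sets[OF \<gamma> s\<pi> s\<rho>])
  note [measurable_cong] = \<mu> \<nu> s\<pi> s\<rho> s\<gamma>
  have pr: "prob_space \<gamma>" by (rule Cpl_prob_space[OF \<gamma> Cpl_prob_space[OF \<pi> p]])
  have d: "distr \<gamma> \<pi> fst = \<pi>" "distr \<gamma> \<rho> snd = \<rho>" "distr \<pi> \<mu> fst = \<mu>" "distr \<pi> \<nu> snd = \<nu>"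
    "distr \<rho> \<mu> fst = \<mu>" "distr \<rho> \<nu> snd = \<nu>" using \<pi> \<rho> \<gamma> by (auto simp: Cpl_def)
  have "distr \<gamma> \<mu> (\<lambda>w. fst (fst w)) = distr (distr \<gamma> \<pi> fst) \<mu> fst" "distr \<gamma> \<mu> (\<lambda>w. fst (snd w)) = distr (distr \<gamma> \<rho> snd) \<mu> fst"
    "distr \<gamma> \<nu> (\<lambda>w. snd (fst w)) = distr (distr \<gamma> \<pi> fst) \<nu> snd" "distr \<gamma> \<nu> (\<lambda>w. snd (snd w)) = distr (distr \<gamma> \<rho> snd) \<nu> snd"
    by (subst distr_distr; simp add: comp_def)+
  then have dd: "distr \<gamma> \<mu> (\<lambda>w. fst (fst w)) = \<mu>" "distr \<gamma> \<mu> (\<lambda>w. fst (snd w)) = \<mu>"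
    "distr \<gamma> \<nu> (\<lambda>w. snd (fst w)) = \<nu>" "distr \<gamma> \<nu> (\<lambda>w. snd (snd w)) = \<nu>" by (simp_all only: d)
  have ae: "AE w in \<gamma>. cv m N (\<Phi> (fst (fst w))) = cv m N (\<Phi> (fst (snd w)))"
    "AE w in \<gamma>. cv m N (\<Psi> (snd (fst w))) = cv m N (\<Psi> (snd (snd w)))"
    using s unfolding same_cells_def by (auto elim!: eventually_mono)
  show "path_pair N X \<mu> \<Phi> m \<gamma> (\<lambda>w. fst (fst w)) (\<lambda>w. fst (snd w))"
    unfolding path_pair_def by (intro conjI pr dd ae; measurable)
  show "path_pair N Y \<nu> \<Psi> m \<gamma> (\<lambda>w. snd (fst w)) (\<lambda>w. snd (snd w))"
    unfolding path_pair_def by (intro conjI pr dd ae; measurable)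
qed

context
  fixes N :: nat and X :: "nat \<Rightarrow> 'a topology" and Y :: "nat \<Rightarrow> 'b topology" and \<mu> \<nu> \<Phi> \<Theta> \<Psi> \<Xi>
  assumes \<mu>: "sets \<mu> = sets (prodM N X)" "prob_space \<mu>" and \<nu>: "sets \<nu> = sets (prodM N Y)" "prob_space \<nu>"
    and I: "adapted_iso N X RR \<mu> (cube N) \<Phi> \<Theta>" and J: "adapted_iso N Y RR \<nu> (cube N) \<Psi> \<Xi>"
begin

text \<open>Finitely many rectangles carry all but \<eta>/2 of the mass of W under \<pi>; a point
  leaving such a rectangle must leave one of its sides, which is unlikely. The threshold depends on
  \<pi> and W but not on \<rho>, which is chosen only after m. The estimate is one-sided because
  only the law of the first component is fixed.\<close>

lemma same_cells_open:
  assumes scX: "\<And>t. t < N \<Longrightarrow> second_countable (X t)" and scY: "\<And>t. t < N \<Longrightarrow> second_countable (Y t)"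
    and \<pi>: "\<pi> \<in> Cpl \<mu> \<nu>" and W: "openin (prod_topology (path_top N X) (path_top N Y)) W" and \<eta>: "0 < (\<eta>::real)"
  shows "\<exists>m0. \<forall>m\<ge>m0. \<forall>\<rho>\<in>Cpl \<mu> \<nu>. \<forall>\<gamma>\<in>Cpl \<pi> \<rho>. same_cells N \<Phi> \<Psi> m \<gamma> \<longrightarrow>
    measure \<gamma> {w \<in> space \<gamma>. fst w \<in> W \<and> snd w \<notin> W} \<le> \<eta>"
proof -
  obtain A B :: "nat \<Rightarrow> _" where A[measurable]: "\<And>i. A i \<in> sets (prodM N X)" and B[measurable]: "\<And>i. B i \<in> sets (prodM N Y)"
    and OAB: "W = (\<Union>i. A i \<times> B i)"
    by (rule open_rectangles[OF _ _ W]) (use scX scY in auto)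
  have s\<pi>: "sets \<pi> = sets (prodM N X \<Otimes>\<^sub>M prodM N Y)" by (rule Cpl_sets[OF \<pi> \<mu>(1) \<nu>(1)])
  note [measurable_cong] = \<mu>(1) \<nu>(1) s\<pi>
  interpret \<pi>: prob_space \<pi> by (rule Cpl_prob_space[OF \<pi> \<mu>(2)])
  let ?R = "\<lambda>k. (\<Union>i. A i \<times> B i) - (\<Union>i<k. A i \<times> B i)"
  have R[measurable]: "?R k \<in> sets (prodM N X \<Otimes>\<^sub>M prodM N Y)" for k by measurable
  have "(\<lambda>k. measure \<pi> (?R k)) \<longlonglongrightarrow> measure \<pi> (\<Inter>k. ?R k)"
  proof (rule \<pi>.finite_Lim_measure_decseq)
    show "range ?R \<subseteq> \<pi>.events" using R by (auto simp: s\<pi>)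
    show "decseq ?R" unfolding decseq_def by (intro allI impI Diff_mono UN_mono) auto
  qed
  moreover have "(\<Inter>k. ?R k) = {}" by auto
  ultimately have lim0: "(\<lambda>k. measure \<pi> (?R k)) \<longlonglongrightarrow> 0" by (simp only: measure_empty)
  have "eventually (\<lambda>k. measure \<pi> (?R k) < \<eta> / 2) sequentially"
    by (rule order_tendstoD(2)[OF lim0]) (use \<eta> in simp)
  from eventually_happens'[OF _ this] obtain k where k: "measure \<pi> (?R k) < \<eta> / 2" by auto
  \<comment> \<open>Two sides for each of k rectangles: 2k\<delta> is below \<eta>/2.\<close>
  define \<delta> where "\<delta> = \<eta> / (4 * (real k + 1))"
  have k1: "0 < real k + 1" by simp
  have \<delta>: "0 < \<delta>" using \<eta> by (simp add: \<delta>_def)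
  define goodMA where "goodMA i m0 \<longleftrightarrow> (\<forall>m\<ge>m0. \<forall>(G::(((nat \<Rightarrow> 'a) \<times> (nat \<Rightarrow> 'b)) \<times> ((nat \<Rightarrow> 'a) \<times> (nat \<Rightarrow> 'b))) measure) U V.
      path_pair N X \<mu> \<Phi> m G U V \<longrightarrow> measure G {z \<in> space G. U z \<in> A i \<and> V z \<notin> A i} \<le> \<delta>)" for i m0
  have "\<exists>m0. goodMA i m0" for i
    unfolding goodMA_def by (rule path_pair_same_set[OF \<mu>(1) I A \<delta>])
  then obtain MA where "\<And>i. goodMA i (MA i)" by metis
  then have MA: "\<And>i m (G::(((nat \<Rightarrow> 'a) \<times> (nat \<Rightarrow> 'b)) \<times> ((nat \<Rightarrow> 'a) \<times> (nat \<Rightarrow> 'b))) measure) U V.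
      MA i \<le> m \<Longrightarrow> path_pair N X \<mu> \<Phi> m G U V \<Longrightarrow> measure G {z \<in> space G. U z \<in> A i \<and> V z \<notin> A i} \<le> \<delta>"
    unfolding goodMA_def by blast
  define goodMB where "goodMB i m0 \<longleftrightarrow> (\<forall>m\<ge>m0. \<forall>(G::(((nat \<Rightarrow> 'a) \<times> (nat \<Rightarrow> 'b)) \<times> ((nat \<Rightarrow> 'a) \<times> (nat \<Rightarrow> 'b))) measure) U V.
      path_pair N Y \<nu> \<Psi> m G U V \<longrightarrow> measure G {z \<in> space G. U z \<in> B i \<and> V z \<notin> B i} \<le> \<delta>)" for i m0
  have "\<exists>m0. goodMB i m0" for i
    unfolding goodMB_def by (rule path_pair_same_set[OF \<nu>(1) J B \<delta>])
  then obtain MB where "\<And>i. goodMB i (MB i)" by metis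
  then have MB: "\<And>i m (G::(((nat \<Rightarrow> 'a) \<times> (nat \<Rightarrow> 'b)) \<times> ((nat \<Rightarrow> 'a) \<times> (nat \<Rightarrow> 'b))) measure) U V.
      MB i \<le> m \<Longrightarrow> path_pair N Y \<nu> \<Psi> m G U V \<Longrightarrow> measure G {z \<in> space G. U z \<in> B i \<and> V z \<notin> B i} \<le> \<delta>"
    unfolding goodMB_def by blast
  define m0 where "m0 = (\<Sum>i<k. MA i + MB i)"
  have "measure \<gamma> {w \<in> space \<gamma>. fst w \<in> W \<and> snd w \<notin> W} \<le> \<eta>"
    if m: "m0 \<le> m" and \<rho>: "\<rho> \<in> Cpl \<mu> \<nu>" and \<gamma>: "\<gamma> \<in> Cpl \<pi> \<rho>" and s: "same_cells N \<Phi> \<Psi> m \<gamma>" for m \<rho> \<gamma>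
  proof -
    have s\<rho>: "sets \<rho> = sets (prodM N X \<Otimes>\<^sub>M prodM N Y)" by (rule Cpl_sets[OF \<rho> \<mu>(1) \<nu>(1)])
    have [measurable_cong]: "sets \<gamma> = sets ((prodM N X \<Otimes>\<^sub>M prodM N Y) \<Otimes>\<^sub>M (prodM N X \<Otimes>\<^sub>M prodM N Y))" by (rule Cpl_sets[OF \<gamma> s\<pi> s\<rho>])
    interpret \<gamma>: prob_space \<gamma> by (rule Cpl_prob_space[OF \<gamma> \<pi>.prob_space_axioms])
    note pp = same_cells_path_pairs[OF \<mu>(1) \<nu>(1) \<mu>(2) \<pi> \<rho> \<gamma> s]
    let ?Q = "{w \<in> space \<gamma>. fst w \<in> ?R k}"
    let ?SA = "\<lambda>i. {w \<in> space \<gamma>. fst (fst w) \<in> A i \<and> fst (snd w) \<notin> A i}"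
    let ?SB = "\<lambda>i. {w \<in> space \<gamma>. snd (fst w) \<in> B i \<and> snd (snd w) \<notin> B i}"
    have "{w \<in> space \<gamma>. fst w \<in> W \<and> snd w \<notin> W} \<subseteq> ?Q \<union> (\<Union>i<k. ?SA i \<union> ?SB i)"
    proof
      fix w assume w: "w \<in> {w \<in> space \<gamma>. fst w \<in> W \<and> snd w \<notin> W}"
      show "w \<in> ?Q \<union> (\<Union>i<k. ?SA i \<union> ?SB i)"
      proof (cases "fst w \<in> (\<Union>i<k. A i \<times> B i)")
        case True
        then obtain i where i: "i < k" "fst w \<in> A i \<times> B i" by auto
        have "A i \<times> B i \<subseteq> W" unfolding OAB by (rule UN_upper) simp
        moreover have "snd w \<notin> W" using w by simp
        ultimately have "snd w \<notin> A i \<times> B i" by (rule contra_subsetD)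
        moreover have "w \<in> space \<gamma>" using w by simp
        ultimately have "w \<in> ?SA i \<union> ?SB i" using i(2) unfolding mem_Times_iff by simp
        then show ?thesis using i(1) by blast
      next
        case False
        moreover have "w \<in> space \<gamma>" "fst w \<in> W" using w by simp_all
        ultimately show ?thesis unfolding OAB by simp
      qed
    qed
    then have "measure \<gamma> {w \<in> space \<gamma>. fst w \<in> W \<and> snd w \<notin> W} \<le> measure \<gamma> (?Q \<union> (\<Union>i<k. ?SA i \<union> ?SB i))"
      by (rule \<gamma>.finite_measure_mono) measurable
    also have "\<dots> \<le> measure \<gamma> ?Q + measure \<gamma> (\<Union>i<k. ?SA i \<union> ?SB i)"
      by (rule measure_Un_le) measurable
    also have "\<dots> \<le> measure \<gamma> ?Q + (\<Sum>i<k. measure \<gamma> (?SA i \<union> ?SB i))"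
      by (intro add_left_mono \<gamma>.finite_measure_subadditive_finite) (simp, intro image_subsetI, measurable)
    also have "measure \<gamma> ?Q = measure \<pi> (?R k)"
    proof -
      have "distr \<gamma> \<pi> fst = \<pi>" using \<gamma> by (simp add: Cpl_def)
      then have "measure \<pi> (?R k) = measure (distr \<gamma> \<pi> fst) (?R k)" by simp
      also have "\<dots> = measure \<gamma> ?Q" by (subst measure_distr) (auto intro!: arg_cong2[where f = measure])
      finally show ?thesis by simp
    qed
    also have "(\<Sum>i<k. measure \<gamma> (?SA i \<union> ?SB i)) \<le> (\<Sum>i<k. \<delta> + \<delta>)"
    proof (rule sum_mono)
      fix i assume i: "i \<in> {..<k}"
      have "MA i + MB i \<le> m0" unfolding m0_def using i by (intro member_le_sum) auto
      then have "MA i \<le> m" "MB i \<le> m" using m by auto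
      then have "measure \<gamma> (?SA i) \<le> \<delta>" "measure \<gamma> (?SB i) \<le> \<delta>" using MA[OF _ pp(1)] MB[OF _ pp(2)] by blast+
      moreover have "measure \<gamma> (?SA i \<union> ?SB i) \<le> measure \<gamma> (?SA i) + measure \<gamma> (?SB i)"
        by (rule measure_Un_le) measurable
      ultimately show "measure \<gamma> (?SA i \<union> ?SB i) \<le> \<delta> + \<delta>" by linarith
    qed
    also have "(\<Sum>i<k. \<delta> + \<delta>) = real k * (2 * \<delta>)" by simp
    also have "\<dots> = \<eta> / 2 * (real k / (real k + 1))" unfolding \<delta>_def using k1 by (simp add: field_simps)
    also have "\<dots> \<le> \<eta> / 2 * 1" using \<eta> by (intro mult_left_mono) (auto simp: field_simps)
    finally show ?thesis using k by simp
  qed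
  then show ?thesis by blast
qed

text \<open>A one-sided comparison in the manner of the portmanteau theorem: if f drops by at least
  \<delta> between the two points, one of finitely many levels separates them, and superlevel sets
  of f are open. The opposite inequality follows by applying the result to -f.\<close>

lemma same_cells_upper:
  assumes scX: "\<And>t. t < N \<Longrightarrow> second_countable (X t)" and scY: "\<And>t. t < N \<Longrightarrow> second_countable (Y t)"
    and \<pi>: "\<pi> \<in> Cpl \<mu> \<nu>" and f: "continuous_map (prod_topology (path_top N X) (path_top N Y)) euclideanreal f"
    and C: "\<And>z. z \<in> topspace (prod_topology (path_top N X) (path_top N Y)) \<Longrightarrow> \<bar>f z\<bar> \<le> C" and \<epsilon>: "0 < (\<epsilon>::real)"
  shows "\<exists>m0. \<forall>m\<ge>m0. \<forall>\<rho>\<in>Cpl \<mu> \<nu>. \<forall>\<gamma>\<in>Cpl \<pi> \<rho>. same_cells N \<Phi> \<Psi> m \<gamma> \<longrightarrow> (\<integral>z. f z \<partial>\<pi>) - (\<integral>z. f z \<partial>\<rho>) \<le> \<epsilon>"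
proof -
  let ?T = "prod_topology (path_top N X) (path_top N Y)"
  have fm[measurable]: "f \<in> borel_measurable (prodM N X \<Otimes>\<^sub>M prodM N Y)"
    by (rule continuous_pair_measurable[OF _ _ f]) (use scX scY in auto)
  have s\<pi>: "sets \<pi> = sets (prodM N X \<Otimes>\<^sub>M prodM N Y)" by (rule Cpl_sets[OF \<pi> \<mu>(1) \<nu>(1)])
  interpret \<pi>: prob_space \<pi> by (rule Cpl_prob_space[OF \<pi> \<mu>(2)])
  define D where "D = max C 1"
  have D: "1 \<le> D" by (simp add: D_def)
  have fD: "\<bar>f z\<bar> \<le> D" if "z \<in> topspace ?T" for z using C[OF that] by (simp add: D_def)
  define \<delta> where "\<delta> = \<epsilon> / 2"
  have \<delta>: "0 < \<delta>" using \<epsilon> by (simp add: \<delta>_def)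
  \<comment> \<open>Levels \<open>q j\<close> climb from -D in steps of \<delta>; index r suffices
    to reach D, the bound of |f|.\<close>
  define r where "r = nat \<lceil>2 * D / \<delta>\<rceil>"
  define q where "q j = real j * \<delta> - D" for j :: nat
  define W where "W j = {z \<in> topspace ?T. f z \<in> {q j<..}}" for j
  have Oj: "openin ?T (W j)" for j unfolding W_def by (rule openin_continuous_map_preimage[OF f]) simp
  \<comment> \<open>There are r + 1 levels and a separated pair costs at most 2D, so the total is
    2D(r + 1)\<eta> = \<epsilon>/2.\<close>
  define \<eta> where "\<eta> = \<epsilon> / (4 * D * (real r + 1))"
  have \<eta>: "0 < \<eta>" using \<epsilon> D by (simp add: \<eta>_def)
  define goodM where "goodM j m0 \<longleftrightarrow> (\<forall>m\<ge>m0. \<forall>\<rho>\<in>Cpl \<mu> \<nu>. \<forall>\<gamma>\<in>Cpl \<pi> \<rho>. same_cells N \<Phi> \<Psi> m \<gamma> \<longrightarrow>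
      measure \<gamma> {w \<in> space \<gamma>. fst w \<in> W j \<and> snd w \<notin> W j} \<le> \<eta>)" for j m0
  have "\<exists>m0. goodM j m0" for j
    unfolding goodM_def by (rule same_cells_open[OF _ _ \<pi> Oj \<eta>]) (use scX scY in auto)
  then obtain M where "\<And>j. goodM j (M j)" by metis
  then have M: "\<And>j m \<rho> \<gamma>. M j \<le> m \<Longrightarrow> \<rho> \<in> Cpl \<mu> \<nu> \<Longrightarrow> \<gamma> \<in> Cpl \<pi> \<rho> \<Longrightarrow> same_cells N \<Phi> \<Psi> m \<gamma> \<Longrightarrow>
      measure \<gamma> {w \<in> space \<gamma>. fst w \<in> W j \<and> snd w \<notin> W j} \<le> \<eta>"
    unfolding goodM_def by blast
  define m0 where "m0 = (\<Sum>j\<le>r. M j)"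
  have "(\<integral>z. f z \<partial>\<pi>) - (\<integral>z. f z \<partial>\<rho>) \<le> \<epsilon>"
    if m: "m0 \<le> m" and \<rho>: "\<rho> \<in> Cpl \<mu> \<nu>" and \<gamma>: "\<gamma> \<in> Cpl \<pi> \<rho>" and s: "same_cells N \<Phi> \<Psi> m \<gamma>" for m \<rho> \<gamma>
  proof -
    have s\<rho>: "sets \<rho> = sets (prodM N X \<Otimes>\<^sub>M prodM N Y)" by (rule Cpl_sets[OF \<rho> \<mu>(1) \<nu>(1)])
    have s\<gamma>: "sets \<gamma> = sets ((prodM N X \<Otimes>\<^sub>M prodM N Y) \<Otimes>\<^sub>M (prodM N X \<Otimes>\<^sub>M prodM N Y))" by (rule Cpl_sets[OF \<gamma> s\<pi> s\<rho>])
    note [measurable_cong] = s\<pi> s\<rho> s\<gamma>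
    interpret \<gamma>: prob_space \<gamma> by (rule Cpl_prob_space[OF \<gamma> \<pi>.prob_space_axioms])
    have sp: "fst w \<in> topspace ?T" "snd w \<in> topspace ?T" if "w \<in> space \<gamma>" for w
      using that unfolding sets_eq_imp_space_eq[OF s\<gamma>] space_pair_measure topspace_prod_topology topspace_path_top mem_Times_iff by blast+
    have Om[measurable]: "W j \<in> sets (prodM N X \<Otimes>\<^sub>M prodM N Y)" for j
    proof -
      have "W j = {z \<in> space (prodM N X \<Otimes>\<^sub>M prodM N Y). q j < f z}"
        by (auto simp: W_def space_pair_measure topspace_path_top)
      then show ?thesis by simp
    qed
    let ?S = "\<lambda>j. {w \<in> space \<gamma>. fst w \<in> W j \<and> snd w \<notin> W j}"
    have fm\<pi>: "f \<in> borel_measurable \<pi>" and fm\<rho>: "f \<in> borel_measurable \<rho>" by measurable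
    have i1: "integrable \<gamma> (\<lambda>w. f (fst w))" and i2: "integrable \<gamma> (\<lambda>w. f (snd w))"
      using sp fD by (auto intro!: \<gamma>.integrable_const_bound[of _ D] AE_I2)
    have iS: "integrable \<gamma> (\<lambda>w. indicator (?S j) w :: real)" for j by (simp add: less_top[symmetric])
    have "(\<integral>z. f z \<partial>\<pi>) - (\<integral>z. f z \<partial>\<rho>) = (\<integral>w. f (fst w) - f (snd w) \<partial>\<gamma>)"
      using Cpl_integral_fst(1)[OF \<gamma> fm\<pi>] Cpl_integral_snd(1)[OF \<gamma> fm\<rho>] i1 i2 by simp
    also have "\<dots> \<le> (\<integral>w. \<delta> + 2 * D * (\<Sum>j\<le>r. indicator (?S j) w) \<partial>\<gamma>)"
    proof (rule integral_mono)
      show "integrable \<gamma> (\<lambda>w. f (fst w) - f (snd w))" using i1 i2 by simp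
      show "integrable \<gamma> (\<lambda>w. \<delta> + 2 * D * (\<Sum>j\<le>r. indicator (?S j) w))" using iS by simp
      fix w assume w: "w \<in> space \<gamma>"
      show "f (fst w) - f (snd w) \<le> \<delta> + 2 * D * (\<Sum>j\<le>r. indicator (?S j) w)"
      proof (cases "f (fst w) - f (snd w) < \<delta>")
        case True
        have "0 \<le> 2 * D * (\<Sum>j\<le>r. indicator (?S j) w)" using D by (intro mult_nonneg_nonneg sum_nonneg) auto
        then show ?thesis using True by simp
      next
        case False
        \<comment> \<open>The lowest level not below f at the second point; it exceeds that value by
          less than \<delta>, hence lies strictly below f at the first point.\<close>
        let ?j = "nat \<lceil>(f (snd w) + D) / \<delta>\<rceil>"
        have nn: "0 \<le> (f (snd w) + D) / \<delta>" using fD[OF sp(2)[OF w]] \<delta> by simp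
        have le: "(f (snd w) + D) / \<delta> \<le> 2 * D / \<delta>" using fD[OF sp(2)[OF w]] \<delta> by (intro divide_right_mono) auto
        have jr: "?j \<le> r" unfolding r_def by (intro nat_mono ceiling_mono le)
        have j1: "(f (snd w) + D) / \<delta> \<le> real ?j" using nn by (simp add: of_nat_nat)
        have j2: "real ?j < (f (snd w) + D) / \<delta> + 1" using nn by (simp add: of_nat_nat) linarith
        have "f (snd w) \<le> q ?j" using j1 \<delta> by (simp add: q_def field_simps)
        moreover have "q ?j < f (snd w) + \<delta>" using j2 \<delta> by (simp add: q_def field_simps)
        ultimately have "w \<in> ?S ?j" using False w sp[OF w] by (auto simp: W_def)
        then have "(\<Sum>j\<in>{?j}. indicator (?S j) w :: real) = 1" by simp
        moreover have "(\<Sum>j\<in>{?j}. indicator (?S j) w :: real) \<le> (\<Sum>j\<le>r. indicator (?S j) w)"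
          using jr by (intro sum_mono2) auto
        ultimately have "2 * D * 1 \<le> 2 * D * (\<Sum>j\<le>r. indicator (?S j) w)" using D by (intro mult_left_mono) auto
        then show ?thesis using fD[OF sp(1)[OF w]] fD[OF sp(2)[OF w]] \<delta> by linarith
      qed
    qed
    also have "\<dots> = \<delta> + 2 * D * (\<Sum>j\<le>r. measure \<gamma> (?S j))"
      using iS by (simp add: Bochner_Integration.integral_add \<gamma>.prob_space Int_def conj_ac)
    also have "\<dots> \<le> \<delta> + 2 * D * (\<Sum>j\<le>r. \<eta>)"
    proof -
      have "measure \<gamma> (?S j) \<le> \<eta>" if "j \<in> {..r}" for j
      proof -
        have "M j \<le> m0" unfolding m0_def using that by (intro member_le_sum) auto
        then show ?thesis using M[OF _ \<rho> \<gamma> s] m by simp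
      qed
      then show ?thesis using D by (intro add_left_mono mult_left_mono sum_mono) auto
    qed
    also have "\<dots> = \<delta> + 2 * D * (real r + 1) * \<eta>" by simp
    also have "2 * D * (real r + 1) * \<eta> = \<epsilon> / 2"
    proof -
      have "D * (real r + 1) \<noteq> 0" using D by simp
      moreover have "2 * c * (\<epsilon> / (4 * c)) = \<epsilon> / 2" if "c \<noteq> 0" for c using that by simp
      ultimately have "2 * (D * (real r + 1)) * (\<epsilon> / (4 * (D * (real r + 1)))) = \<epsilon> / 2" by blast
      then show ?thesis unfolding \<eta>_def by (simp only: mult.assoc)
    qed
    also have "\<delta> + \<epsilon> / 2 = \<epsilon>" by (simp add: \<delta>_def)
    finally show ?thesis .
  qed
  then show ?thesis by blast
qed

end

text \<open>On a common piece of small diameter the distance is small; the remaining event is unlikely and the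
  \<open>p\<close>-th moment is uniformly integrable.\<close>

lemma path_pair_distance:
  fixes X :: "nat \<Rightarrow> 'a topology"
  assumes \<mu>: "sets \<mu> = sets (prodM N X)" "prob_space \<mu>" and I: "adapted_iso N X RR \<mu> (cube N) \<Phi> \<Theta>"
    and sc: "\<And>t. t < N \<Longrightarrow> second_countable (X t)"
    and MS: "Metric_space (topspace (path_top N X)) d" and mt: "Metric_space.mtopology (topspace (path_top N X)) d = path_top N X"
    and x0: "x0 \<in> topspace (path_top N X)" and mom: "(\<integral>\<^sup>+x. ennreal (d x0 x powr p) \<partial>\<mu>) < \<infinity>"
    and p: "1 \<le> p" and \<epsilon>: "0 < (\<epsilon>::real)"
  shows "\<exists>m0. \<forall>m\<ge>m0. \<forall>(G::'z measure) U V. path_pair N X \<mu> \<Phi> m G U V \<longrightarrow>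
    (\<integral>\<^sup>+z. ennreal (d (U z) (V z) powr p) \<partial>G) \<le> ennreal \<epsilon>"
proof -
  interpret Metric_space "topspace (path_top N X)" d by (rule MS)
  interpret \<mu>: prob_space \<mu> by (rule \<mu>(2))
  note [measurable_cong] = \<mu>(1)
  have dc: "continuous_map (path_top N X) euclideanreal (d x0)"
  proof -
    have "continuous_map (mtopology_of (metric (topspace (path_top N X), d))) euclideanreal (mdist (metric (topspace (path_top N X), d)) x0)"
      using x0 by (intro continuous_on_mdist) simp
    then show ?thesis by (simp add: mt)
  qed
  have [measurable]: "d x0 \<in> borel_measurable (prodM N X)" by (rule continuous_path_measurable[OF sc dc])
  define f where "f x = d x0 x powr p" for x
  have fm[measurable]: "f \<in> borel_measurable (prodM N X)" unfolding f_def by measurable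
  have f0: "0 \<le> f x" for x by (simp add: f_def)
  have "(\<lambda>n. \<integral>\<^sup>+x. ennreal (max 0 (f x - real n)) \<partial>\<mu>) \<longlonglongrightarrow> (\<integral>\<^sup>+x. 0 \<partial>\<mu>)"
  proof (rule nn_integral_dominated_convergence[where w = "\<lambda>x. ennreal (f x)"])
    show "(\<integral>\<^sup>+x. ennreal (f x) \<partial>\<mu>) < \<infinity>" using mom by (simp add: f_def)
    show "AE x in \<mu>. ennreal (max 0 (f x - real n)) \<le> ennreal (f x)" for n
      using f0 by (intro AE_I2 ennreal_leI) (simp add: max_def)
    show "AE x in \<mu>. (\<lambda>n. ennreal (max 0 (f x - real n))) \<longlonglongrightarrow> 0"
    proof (rule AE_I2)
      fix x
      obtain n0 :: nat where "f x < real n0" using reals_Archimedean2 by blast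
      then have "eventually (\<lambda>n. ennreal (max 0 (f x - real n)) = 0) sequentially"
        by (intro eventually_sequentiallyI[of n0]) (simp add: max_def)
      then show "(\<lambda>n. ennreal (max 0 (f x - real n))) \<longlonglongrightarrow> 0" by (rule tendsto_eventually)
    qed
  qed measurable
  then have lim: "(\<lambda>n. \<integral>\<^sup>+x. ennreal (max 0 (f x - real n)) \<partial>\<mu>) \<longlonglongrightarrow> 0" by simp
  \<comment> \<open>By the triangle inequality through x0 the distance is at most twice the larger
    of the two distances to x0, so its p-th power is at most 2^p times the sum of their p-th
    powers.\<close>
  define c where "c = 2 powr p"
  have c: "0 < c" by (simp add: c_def)
  \<comment> \<open>The budget: \<epsilon>/4 from pairs in a common small piece, at most
    \<epsilon>/4 from the bounded part 2R on the bad event, and \<epsilon>/8 from the excess of each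
    path over R.\<close>
  define e1 where "e1 = \<epsilon> / (8 * c)"
  have e1: "0 < e1" using \<epsilon> c by (simp add: e1_def)
  have "eventually (\<lambda>n. (\<integral>\<^sup>+x. ennreal (max 0 (f x - real n)) \<partial>\<mu>) < ennreal e1) sequentially"
    using order_tendstoD(2)[OF lim, of "ennreal e1"] e1 by simp
  from eventually_happens'[OF _ this] obtain n where n: "(\<integral>\<^sup>+x. ennreal (max 0 (f x - real n)) \<partial>\<mu>) < ennreal e1" by auto
  define R where "R = real n"
  define b where "b = \<epsilon> / (8 * c * (R + 1))"
  have R0: "0 \<le> R" by (simp add: R_def)
  have b: "0 < b" using \<epsilon> c R0 by (simp add: b_def)
  define \<delta> where "\<delta> = (\<epsilon> / 4) powr (1 / p)"
  have \<delta>: "0 < \<delta>" using \<epsilon> by (simp add: \<delta>_def)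
  have \<delta>p: "\<delta> powr p = \<epsilon> / 4" using \<epsilon> p by (simp add: \<delta>_def powr_powr)
  obtain \<B> where B: "countable \<B>" "\<B> \<subseteq> sets (prodM N X)" "\<And>V. V \<in> \<B> \<Longrightarrow> openin (path_top N X) V"
    "\<And>U x. openin (path_top N X) U \<Longrightarrow> x \<in> U \<Longrightarrow> \<exists>V\<in>\<B>. x \<in> V \<and> V \<subseteq> U"
    by (rule path_top_base[of N X]) (use sc in auto)
  \<comment> \<open>Countably many open sets, the points of each less than \<delta> apart, that
    cover the space. The empty set ensures that there is something to enumerate.\<close>
  define S where "S = insert {} {V \<in> \<B>. \<exists>x. V \<subseteq> mball x (\<delta> / 2)}"
  have cS: "countable S" unfolding S_def using B(1) by (auto intro: countable_subset)
  have neS: "S \<noteq> {}" by (simp add: S_def)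
  define E where "E i = from_nat_into S i" for i
  have ES: "E i \<in> S" for i unfolding E_def by (rule from_nat_into[OF neS])
  have Em[measurable]: "E i \<in> sets (prodM N X)" for i using ES[of i] B(2) by (auto simp: S_def)
  have small: "d x y < \<delta>" if "x \<in> E i" "y \<in> E i" for x y i
  proof -
    obtain w where w: "E i \<subseteq> mball w (\<delta> / 2)" using ES[of i] that by (auto simp: S_def)
    then have "x \<in> mball w (\<delta> / 2)" "y \<in> mball w (\<delta> / 2)" using that by auto
    then have xy: "w \<in> topspace (path_top N X)" "x \<in> topspace (path_top N X)" "y \<in> topspace (path_top N X)"
      "d w x < \<delta> / 2" "d w y < \<delta> / 2" by (auto simp only: in_mball)
    have "d x y \<le> d x w + d w y" by (rule triangle[OF xy(2,1,3)])
    then show ?thesis using xy(4,5) by (simp add: commute)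
  qed
  have cover: "topspace (path_top N X) \<subseteq> (\<Union>i. E i)"
  proof
    fix x assume x: "x \<in> topspace (path_top N X)"
    have "openin (path_top N X) (mball x (\<delta> / 2))" using openin_mball[of x "\<delta> / 2"] unfolding mt .
    moreover have "x \<in> mball x (\<delta> / 2)" using x \<delta> by simp
    ultimately obtain V where V: "V \<in> \<B>" "x \<in> V" "V \<subseteq> mball x (\<delta> / 2)" using B(4) by blast
    then have "V \<in> S" by (auto simp: S_def)
    then obtain i where "E i = V" using range_from_nat_into[OF neS cS] unfolding E_def by (metis imageE)
    then show "x \<in> (\<Union>i. E i)" using V by blast
  qed
  let ?R = "\<lambda>k. topspace (path_top N X) - (\<Union>i<k. E i)"
  have Rm[measurable]: "?R k \<in> sets (prodM N X)" for k unfolding topspace_path_top by measurable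
  have "(\<lambda>k. measure \<mu> (?R k)) \<longlonglongrightarrow> measure \<mu> (\<Inter>k. ?R k)"
  proof (rule \<mu>.finite_Lim_measure_decseq)
    show "range ?R \<subseteq> \<mu>.events" using Rm unfolding \<mu>(1) by blast
    show "decseq ?R" unfolding decseq_def by (intro allI impI Diff_mono UN_mono) auto
  qed
  moreover have "(\<Inter>k. ?R k) = {}" using cover by auto
  ultimately have lim0: "(\<lambda>k. measure \<mu> (?R k)) \<longlonglongrightarrow> 0" by (simp only: measure_empty)
  have "eventually (\<lambda>k. measure \<mu> (?R k) < b / 2) sequentially" by (rule order_tendstoD(2)[OF lim0]) (use b in simp)
  from eventually_happens'[OF _ this] obtain k where k: "measure \<mu> (?R k) < b / 2" by auto
  define \<eta> where "\<eta> = b / (2 * (real k + 1))"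
  have \<eta>: "0 < \<eta>" using b by (simp add: \<eta>_def)
  define goodM where "goodM i m0 \<longleftrightarrow> (\<forall>m\<ge>m0. \<forall>(G::'z measure) U V. path_pair N X \<mu> \<Phi> m G U V \<longrightarrow>
      measure G {z \<in> space G. U z \<in> E i \<and> V z \<notin> E i} \<le> \<eta>)" for i m0
  have "\<exists>m0. goodM i m0" for i
    unfolding goodM_def by (rule path_pair_same_set[OF \<mu>(1) I Em \<eta>])
  then obtain M where "\<And>i. goodM i (M i)" by metis
  then have M: "\<And>i m (G::'z measure) U V. M i \<le> m \<Longrightarrow> path_pair N X \<mu> \<Phi> m G U V \<Longrightarrow>
      measure G {z \<in> space G. U z \<in> E i \<and> V z \<notin> E i} \<le> \<eta>"
    unfolding goodM_def by blast
  define m0 where "m0 = (\<Sum>i<k. M i)"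
  have "(\<integral>\<^sup>+z. ennreal (d (U z) (V z) powr p) \<partial>G) \<le> ennreal \<epsilon>"
    if m: "m0 \<le> m" and pp: "path_pair N X \<mu> \<Phi> m G U V" for m and G :: "'z measure" and U V
  proof -
    interpret G: prob_space G using pp by (simp add: path_pair_def)
    have UV[measurable]: "U \<in> G \<rightarrow>\<^sub>M prodM N X" "V \<in> G \<rightarrow>\<^sub>M prodM N X"
      and dUV: "distr G \<mu> U = \<mu>" "distr G \<mu> V = \<mu>" using pp by (auto simp: path_pair_def)
    have spUV: "U z \<in> topspace (path_top N X)" "V z \<in> topspace (path_top N X)" if "z \<in> space G" for z
      using measurable_space[OF UV(1) that] measurable_space[OF UV(2) that] by (auto simp: topspace_path_top)
    define Q where "Q = {z \<in> space G. U z \<in> ?R k} \<union> (\<Union>i<k. {z \<in> space G. U z \<in> E i \<and> V z \<notin> E i})"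
    have Q[measurable]: "Q \<in> sets G" unfolding Q_def by measurable
    have Qb: "measure G Q \<le> b"
    proof -
      have "measure G Q \<le> measure G {z \<in> space G. U z \<in> ?R k} + measure G (\<Union>i<k. {z \<in> space G. U z \<in> E i \<and> V z \<notin> E i})"
        unfolding Q_def by (rule measure_Un_le) measurable
      also have "\<dots> \<le> measure G {z \<in> space G. U z \<in> ?R k} + (\<Sum>i<k. measure G {z \<in> space G. U z \<in> E i \<and> V z \<notin> E i})"
        by (intro add_left_mono G.finite_measure_subadditive_finite) (simp, intro image_subsetI, measurable)
      also have "measure G {z \<in> space G. U z \<in> ?R k} = measure \<mu> (?R k)"
      proof -
        have "measure \<mu> (?R k) = measure (distr G \<mu> U) (?R k)" by (simp only: dUV)
        also have "\<dots> = measure G (U -` ?R k \<inter> space G)"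
          by (rule measure_distr) (simp_all only: measurable_cong_sets[OF refl \<mu>(1)] UV \<mu>(1) Rm)
        also have "U -` ?R k \<inter> space G = {z \<in> space G. U z \<in> ?R k}" by auto
        finally show ?thesis by simp
      qed
      also have "(\<Sum>i<k. measure G {z \<in> space G. U z \<in> E i \<and> V z \<notin> E i}) \<le> (\<Sum>i<k. \<eta>)"
      proof (rule sum_mono)
        fix i assume "i \<in> {..<k}"
        then have "M i \<le> m0" unfolding m0_def by (intro member_le_sum) auto
        then show "measure G {z \<in> space G. U z \<in> E i \<and> V z \<notin> E i} \<le> \<eta>" using M[OF _ pp] m by simp
      qed
      also have "(\<Sum>i<k. \<eta>) = b / 2 * (real k / (real k + 1))" by (simp add: \<eta>_def field_simps)
      also have "\<dots> \<le> b / 2 * 1" using b by (intro mult_left_mono) (auto simp: field_simps)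
      finally show ?thesis using k by simp
    qed
    \<comment> \<open>\<open>f \<le> R + h\<close> splits the moment into a bounded part and an
      excess. The excess has the same integral along U and V as under \<mu>, which makes the
      estimate uniform in G.\<close>
    define h where "h x = max 0 (f x - R)" for x
    have hm[measurable]: "h \<in> borel_measurable (prodM N X)" unfolding h_def by measurable
    have h0: "0 \<le> h x" for x by (simp add: h_def)
    have hint: "(\<integral>\<^sup>+z. ennreal (h (W z)) \<partial>G) \<le> ennreal e1"
      if [measurable]: "W \<in> G \<rightarrow>\<^sub>M prodM N X" and "distr G \<mu> W = \<mu>" for W
    proof -
      have "(\<integral>\<^sup>+z. ennreal (h (W z)) \<partial>G) = (\<integral>\<^sup>+x. ennreal (h x) \<partial>distr G \<mu> W)"
        by (subst nn_integral_distr) auto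
      also have "\<dots> \<le> ennreal e1" unfolding that(2) using n by (simp add: h_def R_def)
      finally show ?thesis .
    qed
    have pw: "d (U z) (V z) powr p \<le> \<epsilon> / 4 + c * (2 * R * indicator Q z + (h (U z) + h (V z)))" if z: "z \<in> space G" for z
    proof (cases "z \<in> Q")
      case True
      have "d (U z) (V z) \<le> d (U z) x0 + d x0 (V z)" using spUV[OF z] x0 by (intro triangle)
      also have "\<dots> \<le> 2 * max (d x0 (U z)) (d x0 (V z))" by (simp add: commute)
      finally have "d (U z) (V z) powr p \<le> (2 * max (d x0 (U z)) (d x0 (V z))) powr p"
        using p by (intro powr_mono2) auto
      also have "\<dots> = c * (max (d x0 (U z)) (d x0 (V z)) powr p)" by (simp add: powr_mult c_def)
      also have "max (d x0 (U z)) (d x0 (V z)) powr p \<le> f (U z) + f (V z)" by (simp add: f_def max_def)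
      also have "f (U z) + f (V z) \<le> 2 * R + (h (U z) + h (V z))" by (simp add: h_def)
      finally have "d (U z) (V z) powr p \<le> c * (2 * R + (h (U z) + h (V z)))" using c by (simp add: mult_left_mono)
      then show ?thesis using True \<epsilon> by simp
    next
      case False
      have "U z \<notin> ?R k" using False z by (auto simp: Q_def)
      then obtain i where i: "i < k" "U z \<in> E i" using spUV[OF z] by auto
      then have "V z \<in> E i" using False z by (auto simp: Q_def)
      then have "d (U z) (V z) powr p \<le> \<delta> powr p" using small[OF i(2)] p by (intro powr_mono2) (auto intro: less_imp_le)
      moreover have "0 \<le> c * (h (U z) + h (V z))" using c h0 by simp
      ultimately show ?thesis using False \<delta>p by simp
    qed
    have "(\<integral>\<^sup>+z. ennreal (d (U z) (V z) powr p) \<partial>G) \<le>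
        (\<integral>\<^sup>+z. ennreal (\<epsilon> / 4) + (ennreal (c * 2 * R) * indicator Q z + (ennreal c * ennreal (h (U z)) + ennreal c * ennreal (h (V z)))) \<partial>G)"
    proof (rule nn_integral_mono)
      fix z assume z: "z \<in> space G"
      have "ennreal (d (U z) (V z) powr p) \<le> ennreal (\<epsilon> / 4 + c * (2 * R * indicator Q z + (h (U z) + h (V z))))"
        by (rule ennreal_leI[OF pw[OF z]])
      also have "\<dots> = ennreal (\<epsilon> / 4) + (ennreal (c * 2 * R) * indicator Q z + (ennreal c * ennreal (h (U z)) + ennreal c * ennreal (h (V z))))"
        using \<epsilon> c h0 R0
        by (cases "z \<in> Q") (simp_all add: ennreal_plus[symmetric] ennreal_mult[symmetric] algebra_simps del: ennreal_plus)
      finally show "ennreal (d (U z) (V z) powr p) \<le> \<dots>" .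
    qed
    also have "\<dots> = ennreal (\<epsilon> / 4) + (ennreal (c * 2 * R) * emeasure G Q + (ennreal c * (\<integral>\<^sup>+z. ennreal (h (U z)) \<partial>G) + ennreal c * (\<integral>\<^sup>+z. ennreal (h (V z)) \<partial>G)))"
      by (simp add: nn_integral_add nn_integral_cmult nn_integral_cmult_indicator G.emeasure_space_1)
    also have "\<dots> \<le> ennreal (\<epsilon> / 4) + (ennreal (c * 2 * R) * ennreal b + (ennreal c * ennreal e1 + ennreal c * ennreal e1))"
      using Qb hint[OF UV(1) dUV(1)] hint[OF UV(2) dUV(2)]
      by (intro add_mono mult_left_mono) (auto simp: G.emeasure_eq_measure ennreal_leI)
    also have "\<dots> = ennreal (\<epsilon> / 4 + (c * 2 * R * b + (c * e1 + c * e1)))"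
      using \<epsilon> c R0 b e1 by (simp add: ennreal_plus[symmetric] ennreal_mult[symmetric] del: ennreal_plus)
    also have "\<dots> \<le> ennreal \<epsilon>"
    proof (rule ennreal_leI)
      have "c * 2 * R * (\<epsilon> / (8 * c * r)) = \<epsilon> / 4 * (R / r)" if "0 < r" for r using c that by (simp add: field_simps)
      then have "c * 2 * R * b = \<epsilon> / 4 * (R / (R + 1))" unfolding b_def using R0 by simp
      also have "\<dots> \<le> \<epsilon> / 4 * 1" using \<epsilon> R0 by (intro mult_left_mono) (auto simp: field_simps)
      finally have 1: "c * 2 * R * b \<le> \<epsilon> / 4" by simp
      have 2: "c * e1 = \<epsilon> / 8" using c by (simp add: e1_def)
      show "\<epsilon> / 4 + (c * 2 * R * b + (c * e1 + c * e1)) \<le> \<epsilon>" using 1 2 \<epsilon> by linarith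
    qed
    finally show ?thesis .
  qed
  then show ?thesis by blast
qed

section \<open>Density of the biadapted Monge couplings\<close>

text \<open>Existence of the kernels forces each factor space to be nonempty, hence standard. For N
  > 0 the atomless first kernel embeds the unit interval into the first factor, the other
  coordinates being frozen, and this yields a null copy of the Cantor space.\<close>

lemma cont_disint_path:
  assumes pol: "\<And>t. t < N \<Longrightarrow> Polish_space (X t)" and d: "cont_disint N X \<mu>"
  shows "path_measure N X \<mu>" "\<And>t. t < N \<Longrightarrow> standard (borel_of (X t))"
    "\<exists>\<Phi> \<Theta>. adapted_iso N X RR \<mu> (cube N) \<Phi> \<Theta>" "0 < N \<Longrightarrow> null_cantor \<mu>"
proof -
  obtain K where Km: "\<And>t. t < N \<Longrightarrow> K t \<in> prodM t X \<rightarrow>\<^sub>M prob_algebra (borel_of (X t))"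
    and at: "\<And>t x a. t < N \<Longrightarrow> x \<in> space (prodM t X) \<Longrightarrow> emeasure (K t x) {a} = 0" and \<mu>: "\<mu> = seqcomp X K N"
    using d unfolding cont_disint_def by blast
  have kern: "kern N X K" using Km by (simp add: kern_def)
  have st: "standard (borel_of (X t))" if t: "t < N" for t
  proof (rule standard_Polish[OF pol[OF t]])
    have M: "sets (seqcomp X K t) = sets (prodM t X)" "prob_space (seqcomp X K t)"
      using seqcomp_sets_prob[OF kern less_imp_le[OF t]] by auto
    obtain x where "x \<in> space (prodM t X)" using prob_space.not_empty[OF M(2)] sets_eq_imp_space_eq[OF M(1)] by auto
    from prob_space.not_empty[OF prob_kernelD(1)[OF Km[OF t] this]] prob_kernelD(3)[OF Km[OF t] this]
    show "topspace (X t) \<noteq> {}" by simp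
  qed
  then show "\<And>t. t < N \<Longrightarrow> standard (borel_of (X t))" .
  have s: "sets \<mu> = sets (prodM N X)" "prob_space \<mu>" using seqcomp_sets_prob[OF kern order_refl] by (auto simp: \<mu>)
  show pm: "path_measure N X \<mu>" unfolding path_measure_def using s standard_prodM[of N X, OF st] by simp
  obtain T S where "adapted_iso N RR X (cube N) \<mu> T S" using iso_cube[OF kern st at] unfolding \<mu> by blast
  then show "\<exists>\<Phi> \<Theta>. adapted_iso N X RR \<mu> (cube N) \<Phi> \<Theta>" using adapted_iso_sym[OF path_measure_cube pm] by blast
  assume N: "0 < N"
  have u: "(\<lambda>_. undefined) \<in> space (prodM 0 X)" by (simp add: space_prodM)
  obtain i F where i: "i \<in> borel \<rightarrow>\<^sub>M borel_of (X 0)" and F: "F \<in> borel_measurable (borel_of (X 0))"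
    and Fi: "\<And>u. 0 < u \<Longrightarrow> u < (1::real) \<Longrightarrow> F (i u) = u"
    by (rule embed_unit_interval[OF st[OF N] prob_kernelD(1)[OF Km[OF N] u] prob_kernelD(2)[OF Km[OF N] u] at[OF N u]]) (rule that)
  obtain c where c: "c \<in> space (prodM N X)" using prob_space.not_empty[OF s(2)] sets_eq_imp_space_eq[OF s(1)] by auto
  show "null_cantor \<mu>"
  proof (rule null_cantorI[OF s(2)])
    have "(\<lambda>u. \<lambda>t\<in>{..<N}. if t = 0 then i u else c t) \<in> borel \<rightarrow>\<^sub>M prodM N X"
      unfolding prodM_def
    proof (rule measurable_restrict)
      fix t assume "t \<in> {..<N}"
      then have "c t \<in> topspace (X t)" using c unfolding space_prodM by (rule PiE_mem[rotated])
      then have "(\<lambda>_. c t) \<in> borel \<rightarrow>\<^sub>M borel_of (X t)" by (intro measurable_const) simp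
      then show "(\<lambda>u. if t = 0 then i u else c t) \<in> borel \<rightarrow>\<^sub>M borel_of (X t)"
        using i by (cases "t = 0") simp_all
    qed
    then show "(\<lambda>u. \<lambda>t\<in>{..<N}. if t = 0 then i u else c t) \<in> borel \<rightarrow>\<^sub>M \<mu>" by (simp only: measurable_cong_sets[OF refl s(1)])
    have "(\<lambda>x. x 0) \<in> prodM N X \<rightarrow>\<^sub>M borel_of (X 0)" by (rule prodM_measurable_component[OF N]) simp
    then have "(\<lambda>x. F (x 0)) \<in> borel_measurable (prodM N X)" by (rule measurable_compose[OF _ F])
    then show "(\<lambda>x. F (x 0)) \<in> borel_measurable \<mu>" by (simp only: measurable_cong_sets[OF s(1) refl])
    show "F ((\<lambda>t\<in>{..<N}. if t = 0 then i u else c t) 0) = u" if "0 < u" "u < 1" for u using Fi[OF that] N by simp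
  qed
qed

text \<open>Two roles of the adapted isomorphism meet here: its graph law is bicausal and the law of
  a Borel bijection, and its masses on pairs of cells equal those of \<pi>, so that
  \<open>cell_coupling\<close> applies with pairs of cell vectors as labels.\<close>

lemma biadapted_Monge_same_cells:
  assumes \<mu>: "path_measure N X \<mu>" "0 < N \<Longrightarrow> null_cantor \<mu>" and \<nu>: "path_measure N Y \<nu>" "0 < N \<Longrightarrow> null_cantor \<nu>"
    and I: "adapted_iso N X RR \<mu> (cube N) \<Phi> \<Theta>" and J: "adapted_iso N Y RR \<nu> (cube N) \<Psi> \<Xi>"
    and \<pi>: "\<pi> \<in> Cpl_bc N X Y \<mu> \<nu>" and m: "0 < m"
  shows "\<exists>\<rho>\<in>Cpl_bc N X Y \<mu> \<nu> \<inter> Cpl_biM \<mu> \<nu>. \<exists>\<gamma>\<in>Cpl \<pi> \<rho>. same_cells N \<Phi> \<Psi> m \<gamma>"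
proof -
  have s: "sets \<mu> = sets (prodM N X)" "sets \<nu> = sets (prodM N Y)" and pr: "prob_space \<mu>" "prob_space \<nu>"
    using \<mu>(1) \<nu>(1) by (auto simp: path_measure_def)
  note [measurable_cong] = s sets_cube
  have [measurable]: "\<Phi> \<in> prodM N X \<rightarrow>\<^sub>M prodM N RR" "\<Psi> \<in> prodM N Y \<rightarrow>\<^sub>M prodM N RR"
    using I J by (auto simp: adapted_iso_def adapted_def)
  obtain T S where T: "adapted_iso N X Y \<mu> \<nu> T S"
    and eq: "\<And>a b. a \<in> cells m N \<Longrightarrow> b \<in> cells m N \<Longrightarrow>
      emeasure \<mu> {x \<in> space \<mu>. cv m N (\<Phi> x) = a \<and> cv m N (\<Psi> (T x)) = b} =
      emeasure \<pi> {z \<in> space \<pi>. cv m N (\<Phi> (fst z)) = a \<and> cv m N (\<Psi> (snd z)) = b}"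
    using bicausal_matching[OF \<mu>(1) \<nu>(1) \<pi> I J m] by blast
  have Tm[measurable]: "T \<in> prodM N X \<rightarrow>\<^sub>M prodM N Y" and d: "distr \<mu> \<nu> T = \<nu>"
    using T by (auto simp: adapted_iso_def adapted_def)
  define \<rho> where "\<rho> = distr \<mu> (\<mu> \<Otimes>\<^sub>M \<nu>) (\<lambda>x. (x, T x))"
  have bc: "\<rho> \<in> Cpl_bc N X Y \<mu> \<nu>" unfolding \<rho>_def by (rule adapted_iso_Cpl_bc[OF \<mu>(1) \<nu>(1) T])
  have biM: "\<rho> \<in> Cpl_biM \<mu> \<nu>"
  proof (cases "0 < N")
    case True
    then show ?thesis unfolding \<rho>_def using adapted_iso_Cpl_biM[OF \<mu>(1) \<mu>(2) \<nu>(1) \<nu>(2) T] by blast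
  next
    \<comment> \<open>For N = 0 both path spaces are single points: no Cantor set fits in, but
      \<open>T\<close> is trivially a bijection.\<close>
    case False
    have "space \<mu> = {\<lambda>_. undefined}" "space \<nu> = {\<lambda>_. undefined}"
      using False sets_eq_imp_space_eq[OF s(1)] sets_eq_imp_space_eq[OF s(2)] by (auto simp: space_prodM)
    moreover have Tmn: "T \<in> \<mu> \<rightarrow>\<^sub>M \<nu>" by measurable
    ultimately have "bij_betw T (space \<mu>) (space \<nu>)" using measurable_space[OF Tmn] by (auto simp: bij_betw_def)
    then show ?thesis unfolding \<rho>_def Cpl_biM_def using Tmn d by blast
  qed
  have C: "\<pi> \<in> Cpl \<mu> \<nu>" "\<rho> \<in> Cpl \<mu> \<nu>" using \<pi> bc by (simp_all add: Cpl_bc_def)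
  have s\<pi>: "sets \<pi> = sets (prodM N X \<Otimes>\<^sub>M prodM N Y)" and s\<rho>: "sets \<rho> = sets (prodM N X \<Otimes>\<^sub>M prodM N Y)"
    using Cpl_sets[OF C(1) s] Cpl_sets[OF C(2) s] .
  let ?c = "\<lambda>z. (cv m N (\<Phi> (fst z)), cv m N (\<Psi> (snd z)))"
  have cm: "(\<lambda>z. cv m N (\<Phi> (fst z))) \<in> prodM N X \<Otimes>\<^sub>M prodM N Y \<rightarrow>\<^sub>M count_space UNIV"
    "(\<lambda>z. cv m N (\<Psi> (snd z))) \<in> prodM N X \<Otimes>\<^sub>M prodM N Y \<rightarrow>\<^sub>M count_space UNIV"
    by (rule measurable_cv_prodM[OF _ order_refl], measurable)+
  have cm': "?c \<in> prodM N X \<Otimes>\<^sub>M prodM N Y \<rightarrow>\<^sub>M count_space (cells m N \<times> cells m N)"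
  proof (rule measurable_count_space_eq2[THEN iffD2], intro finite_cartesian_product finite_cells, intro conjI ballI funcsetI)
    show "?c z \<in> cells m N \<times> cells m N" for z using cv_in_cells[OF m] by simp
    fix ab assume "ab \<in> cells m N \<times> cells m N"
    have "?c -` {ab} \<inter> space (prodM N X \<Otimes>\<^sub>M prodM N Y) =
        ((\<lambda>z. cv m N (\<Phi> (fst z))) -` {fst ab} \<inter> space (prodM N X \<Otimes>\<^sub>M prodM N Y)) \<inter>
        ((\<lambda>z. cv m N (\<Psi> (snd z))) -` {snd ab} \<inter> space (prodM N X \<Otimes>\<^sub>M prodM N Y))" by (cases ab) auto
    also have "\<dots> \<in> sets (prodM N X \<Otimes>\<^sub>M prodM N Y)" by (intro sets.Int measurable_sets[OF cm(1)] measurable_sets[OF cm(2)]) auto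
    finally show "?c -` {ab} \<inter> space (prodM N X \<Otimes>\<^sub>M prodM N Y) \<in> sets (prodM N X \<Otimes>\<^sub>M prodM N Y)" .
  qed
  have meq: "emeasure \<pi> {z \<in> space \<pi>. ?c z = ab} = emeasure \<rho> {z \<in> space \<rho>. ?c z = ab}" if ab: "ab \<in> cells m N \<times> cells m N" for ab
  proof -
    obtain a b where [simp]: "ab = (a, b)" and a: "a \<in> cells m N" and b: "b \<in> cells m N" using ab by auto
    have "{z \<in> space (prodM N X \<Otimes>\<^sub>M prodM N Y). ?c z = ab} \<in> sets (prodM N X \<Otimes>\<^sub>M prodM N Y)"
      using measurable_sets[OF cm', of "{ab}"] ab by (simp add: vimage_def Int_def conj_commute)
    then have E: "{z \<in> space \<rho>. ?c z = ab} \<in> sets (\<mu> \<Otimes>\<^sub>M \<nu>)"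
      unfolding sets_eq_imp_space_eq[OF s\<rho>] sets_pair_measure_cong[OF s] .
    have "emeasure \<rho> {z \<in> space \<rho>. ?c z = ab} = emeasure \<mu> ((\<lambda>x. (x, T x)) -` {z \<in> space \<rho>. ?c z = ab} \<inter> space \<mu>)"
      by (subst (1) \<rho>_def, rule emeasure_distr[OF _ E]) measurable
    also have "(\<lambda>x. (x, T x)) -` {z \<in> space \<rho>. ?c z = ab} \<inter> space \<mu> = {x \<in> space \<mu>. cv m N (\<Phi> x) = a \<and> cv m N (\<Psi> (T x)) = b}"
      using measurable_space[OF Tm] by (auto simp: sets_eq_imp_space_eq[OF s\<rho>] sets_eq_imp_space_eq[OF s(1)] space_pair_measure)
    finally show ?thesis using eq[OF a b] by simp
  qed
  obtain \<gamma> where \<gamma>: "\<gamma> \<in> Cpl \<pi> \<rho>" "AE z in \<gamma>. ?c (fst z) = ?c (snd z)"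
    by (rule cell_coupling[OF Cpl_prob_space[OF C(1) pr(1)] Cpl_prob_space[OF C(2) pr(1)] s\<pi> s\<rho> cm' _ meq])
       (simp_all add: finite_cells)
  have "same_cells N \<Phi> \<Psi> m \<gamma>" unfolding same_cells_def using \<gamma>(2) by simp
  then show ?thesis using \<gamma>(1) bc biM by blast
qed

lemma Metric_space_dist_measurable:
  fixes X :: "nat \<Rightarrow> 'a topology"
  assumes sc: "\<And>t. t < N \<Longrightarrow> second_countable (X t)"
    and MS: "Metric_space (topspace (path_top N X)) d" and mt: "Metric_space.mtopology (topspace (path_top N X)) d = path_top N X"
  shows "(\<lambda>z. d (fst z) (snd z)) \<in> borel_measurable (prodM N X \<Otimes>\<^sub>M prodM N X)"
proof (rule continuous_pair_measurable[OF sc sc])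
  interpret Metric_space "topspace (path_top N X)" d by (rule MS)
  show "continuous_map (prod_topology (path_top N X) (path_top N X)) euclideanreal (\<lambda>z. d (fst z) (snd z))"
    using continuous_map_metric[of "metric (topspace (path_top N X), d)"] by (simp add: mt case_prod_unfold)
qed

text \<open>The coupling \<gamma> is one competitor in the infimum, and the p-th power of the
  product metric is a sum over the two components.\<close>

lemma Wp_pow_prod_metric_le:
  fixes X :: "nat \<Rightarrow> 'a topology" and Y :: "nat \<Rightarrow> 'b topology"
  assumes \<gamma>: "\<gamma> \<in> Cpl \<pi> \<rho>" and s: "sets \<gamma> = sets ((prodM N X \<Otimes>\<^sub>M prodM N Y) \<Otimes>\<^sub>M (prodM N X \<Otimes>\<^sub>M prodM N Y))"
    and dX: "(\<lambda>z. dX (fst z) (snd z)) \<in> borel_measurable (prodM N X \<Otimes>\<^sub>M prodM N X)"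
    and dY: "(\<lambda>z. dY (fst z) (snd z)) \<in> borel_measurable (prodM N Y \<Otimes>\<^sub>M prodM N Y)" and p: "1 \<le> p"
  shows "Wp_pow p (prod_metric_p p dX dY) \<pi> \<rho> \<le>
    (\<integral>\<^sup>+w. ennreal (dX (fst (fst w)) (fst (snd w)) powr p) \<partial>\<gamma>) + (\<integral>\<^sup>+w. ennreal (dY (snd (fst w)) (snd (snd w)) powr p) \<partial>\<gamma>)"
proof -
  note [measurable_cong] = s
  have "(\<lambda>w. (fst (fst w), fst (snd w))) \<in> \<gamma> \<rightarrow>\<^sub>M prodM N X \<Otimes>\<^sub>M prodM N X"
    "(\<lambda>w. (snd (fst w), snd (snd w))) \<in> \<gamma> \<rightarrow>\<^sub>M prodM N Y \<Otimes>\<^sub>M prodM N Y" by measurable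
  from measurable_compose[OF this(1) dX] measurable_compose[OF this(2) dY]
  have [measurable]: "(\<lambda>w. dX (fst (fst w)) (fst (snd w))) \<in> borel_measurable \<gamma>"
    "(\<lambda>w. dY (snd (fst w)) (snd (snd w))) \<in> borel_measurable \<gamma>" by simp_all
  have pw: "prod_metric_p p dX dY z w powr p = dX (fst z) (fst w) powr p + dY (snd z) (snd w) powr p" for z w
    using p by (simp add: prod_metric_p_def powr_powr)
  have "Wp_pow p (prod_metric_p p dX dY) \<pi> \<rho> \<le> (\<integral>\<^sup>+w. ennreal (prod_metric_p p dX dY (fst w) (snd w) powr p) \<partial>\<gamma>)"
    unfolding Wp_pow_def by (rule INF_lower[OF \<gamma>])
  also have "\<dots> = (\<integral>\<^sup>+w. ennreal (dX (fst (fst w)) (fst (snd w)) powr p) + ennreal (dY (snd (fst w)) (snd (snd w)) powr p) \<partial>\<gamma>)"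
    by (simp add: pw)
  also have "\<dots> = (\<integral>\<^sup>+w. ennreal (dX (fst (fst w)) (fst (snd w)) powr p) \<partial>\<gamma>) + (\<integral>\<^sup>+w. ennreal (dY (snd (fst w)) (snd (snd w)) powr p) \<partial>\<gamma>)"
    by (intro nn_integral_add) measurable
  finally show ?thesis .
qed

theorem theorem3p11:
  fixes N :: nat
    and X :: "nat \<Rightarrow> 'a topology" and Y :: "nat \<Rightarrow> 'b topology"
    and \<mu> :: "(nat \<Rightarrow> 'a) measure" and \<nu> :: "(nat \<Rightarrow> 'b) measure"
  assumes polX: "\<forall>t<N. Polish_space (X t)"
    and polY: "\<forall>t<N. Polish_space (Y t)"
    and dmu: "cont_disint N X \<mu>"
    and dnu: "cont_disint N Y \<nu>"
  shows "weak_closure (prod_topology (product_topology X {..<N}) (product_topology Y {..<N}))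
           {\<pi>. prob_space \<pi> \<and> sets \<pi> = sets (prodM N X \<Otimes>\<^sub>M prodM N Y)}
           (Cpl_bc N X Y \<mu> \<nu> \<inter> Cpl_biM \<mu> \<nu>)
         = Cpl_bc N X Y \<mu> \<nu>
       \<and> (\<forall>p dX dY.
           1 \<le> p \<longrightarrow>
           Metric_space (topspace (product_topology X {..<N})) dX \<longrightarrow>
           Metric_space.mtopology (topspace (product_topology X {..<N})) dX
             = product_topology X {..<N} \<longrightarrow>
           Metric_space (topspace (product_topology Y {..<N})) dY \<longrightarrow>
           Metric_space.mtopology (topspace (product_topology Y {..<N})) dY
             = product_topology Y {..<N} \<longrightarrow>
           (\<exists>x0\<in>topspace (product_topology X {..<N}).
               (\<integral>\<^sup>+ x. ennreal (dX x0 x powr p) \<partial>\<mu>) < \<infinity>) \<longrightarrow>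
           (\<exists>y0\<in>topspace (product_topology Y {..<N}).
               (\<integral>\<^sup>+ y. ennreal (dY y0 y powr p) \<partial>\<nu>) < \<infinity>) \<longrightarrow>
           (\<forall>\<pi>\<in>Cpl_bc N X Y \<mu> \<nu>. (\<forall>\<epsilon>::real. \<epsilon> > 0 \<longrightarrow> (\<exists>\<rho>\<in>Cpl_bc N X Y \<mu> \<nu> \<inter> Cpl_biM \<mu> \<nu>.
             Wp_pow p (prod_metric_p p dX dY) \<pi> \<rho> < ennreal (\<epsilon> powr p)))))"
  unfolding path_top_def[symmetric]
proof -
  have PX: "Polish_space (X t)" and PY: "Polish_space (Y t)" if "t < N" for t using polX polY that by auto
  have X: "path_measure N X \<mu>" "\<And>t. t < N \<Longrightarrow> standard (borel_of (X t))"
      "\<exists>\<Phi> \<Theta>. adapted_iso N X RR \<mu> (cube N) \<Phi> \<Theta>" "0 < N \<Longrightarrow> null_cantor \<mu>"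
    by (rule cont_disint_path[OF PX dmu]; assumption)+
  have Y: "path_measure N Y \<nu>" "\<And>t. t < N \<Longrightarrow> standard (borel_of (Y t))"
      "\<exists>\<Psi> \<Xi>. adapted_iso N Y RR \<nu> (cube N) \<Psi> \<Xi>" "0 < N \<Longrightarrow> null_cantor \<nu>"
    by (rule cont_disint_path[OF PY dnu]; assumption)+
  have scX: "second_countable (X t)" and scY: "second_countable (Y t)" if "t < N" for t
    using PX[OF that] PY[OF that] by (auto intro: second_countable_Polish)
  have s: "sets \<mu> = sets (prodM N X)" "sets \<nu> = sets (prodM N Y)" and pr: "prob_space \<mu>" "prob_space \<nu>"
    using X(1) Y(1) by (auto simp: path_measure_def)
  obtain \<Phi> \<Theta> where I: "adapted_iso N X RR \<mu> (cube N) \<Phi> \<Theta>" using X(3) by blast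
  obtain \<Psi> \<Xi> where J: "adapted_iso N Y RR \<nu> (cube N) \<Psi> \<Xi>" using Y(3) by blast
  have approx: "\<exists>\<rho>\<in>Cpl_bc N X Y \<mu> \<nu> \<inter> Cpl_biM \<mu> \<nu>. \<exists>\<gamma>\<in>Cpl \<pi> \<rho>. same_cells N \<Phi> \<Psi> m \<gamma>"
    if "\<pi> \<in> Cpl_bc N X Y \<mu> \<nu>" "0 < m" for \<pi> m
    by (rule biadapted_Monge_same_cells[OF X(1) X(4) Y(1) Y(4) I J that])
  let ?T = "prod_topology (path_top N X) (path_top N Y)"
  let ?P = "{\<pi>. prob_space \<pi> \<and> sets \<pi> = sets (prodM N X \<Otimes>\<^sub>M prodM N Y)}"
  let ?S = "Cpl_bc N X Y \<mu> \<nu> \<inter> Cpl_biM \<mu> \<nu>"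
  have Cb: "\<pi> \<in> Cpl \<mu> \<nu>" if "\<pi> \<in> Cpl_bc N X Y \<mu> \<nu>" for \<pi> using that by (simp add: Cpl_bc_def)
  have "weak_closure ?T ?P ?S \<subseteq> Cpl_bc N X Y \<mu> \<nu>"
    by (rule weak_closure_Cpl_bc_subset) (use PX PY X(1,2) Y(1,2) in auto)
  moreover have "Cpl_bc N X Y \<mu> \<nu> \<subseteq> weak_closure ?T ?P ?S"
  proof
    fix \<pi> assume \<pi>: "\<pi> \<in> Cpl_bc N X Y \<mu> \<nu>"
    note C = Cb[OF \<pi>]
    have "\<exists>\<rho>\<in>?S. \<forall>f\<in>F. \<bar>(\<integral>z. f z \<partial>\<rho>) - (\<integral>z. f z \<partial>\<pi>)\<bar> < \<epsilon>"
      if F: "finite F" "F \<subseteq> Cb ?T" and \<epsilon>: "0 < \<epsilon>" for F and \<epsilon> :: real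
    proof -
      have e2: "0 < \<epsilon> / 2" using \<epsilon> by simp
      define good where "good f m0 \<longleftrightarrow> (\<forall>m\<ge>m0. \<forall>\<rho>\<in>Cpl \<mu> \<nu>. \<forall>\<gamma>\<in>Cpl \<pi> \<rho>. same_cells N \<Phi> \<Psi> m \<gamma> \<longrightarrow>
          \<bar>(\<integral>z. f z \<partial>\<rho>) - (\<integral>z. f z \<partial>\<pi>)\<bar> \<le> \<epsilon> / 2)" for f m0
      have ex: "\<exists>m0. good f m0" if f: "f \<in> F" for f
      proof -
        obtain B where cf: "continuous_map ?T euclideanreal f" and B: "\<And>z. z \<in> topspace ?T \<Longrightarrow> \<bar>f z\<bar> \<le> B"
          using f F(2) unfolding Cb_def by blast
        \<comment> \<open>The bound from the other side comes from -f, since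
          \<open>same_cells_upper\<close> is one-sided.\<close>
        have cf': "continuous_map ?T euclideanreal (\<lambda>z. - f z)" by (rule continuous_map_minus[OF cf])
        obtain m1 where m1: "\<And>m \<rho> \<gamma>. m1 \<le> m \<Longrightarrow> \<rho> \<in> Cpl \<mu> \<nu> \<Longrightarrow> \<gamma> \<in> Cpl \<pi> \<rho> \<Longrightarrow> same_cells N \<Phi> \<Psi> m \<gamma> \<Longrightarrow>
            (\<integral>z. f z \<partial>\<pi>) - (\<integral>z. f z \<partial>\<rho>) \<le> \<epsilon> / 2"
          using same_cells_upper[OF s(1) pr(1) s(2) pr(2) I J scX scY C cf B e2] by blast
        obtain m2 where m2: "\<And>m \<rho> \<gamma>. m2 \<le> m \<Longrightarrow> \<rho> \<in> Cpl \<mu> \<nu> \<Longrightarrow> \<gamma> \<in> Cpl \<pi> \<rho> \<Longrightarrow> same_cells N \<Phi> \<Psi> m \<gamma> \<Longrightarrow>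
            (\<integral>z. - f z \<partial>\<pi>) - (\<integral>z. - f z \<partial>\<rho>) \<le> \<epsilon> / 2"
          using same_cells_upper[OF s(1) pr(1) s(2) pr(2) I J scX scY C cf' _ e2] B by (metis abs_minus_cancel)
        have "good f (max m1 m2)" unfolding good_def
        proof (intro allI ballI impI)
          fix m \<rho> \<gamma> assume a: "max m1 m2 \<le> m" "\<rho> \<in> Cpl \<mu> \<nu>" "\<gamma> \<in> Cpl \<pi> \<rho>" "same_cells N \<Phi> \<Psi> m \<gamma>"
          have "(\<integral>z. f z \<partial>\<pi>) - (\<integral>z. f z \<partial>\<rho>) \<le> \<epsilon> / 2" "(\<integral>z. - f z \<partial>\<pi>) - (\<integral>z. - f z \<partial>\<rho>) \<le> \<epsilon> / 2"
            using m1[OF _ a(2-4)] m2[OF _ a(2-4)] a(1) by auto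
          then show "\<bar>(\<integral>z. f z \<partial>\<rho>) - (\<integral>z. f z \<partial>\<pi>)\<bar> \<le> \<epsilon> / 2" unfolding integral_minus by linarith
        qed
        then show ?thesis by blast
      qed
      then obtain M where M: "\<And>f. f \<in> F \<Longrightarrow> good f (M f)" by metis
      \<comment> \<open>Beyond every threshold, and positive as the construction of the coupling
        requires.\<close>
      define m where "m = Suc (\<Sum>f\<in>F. M f)"
      obtain \<rho> \<gamma> where \<rho>: "\<rho> \<in> ?S" and \<gamma>: "\<gamma> \<in> Cpl \<pi> \<rho>" "same_cells N \<Phi> \<Psi> m \<gamma>"
        using approx[OF \<pi>, of m] unfolding m_def by blast
      have "\<bar>(\<integral>z. f z \<partial>\<rho>) - (\<integral>z. f z \<partial>\<pi>)\<bar> < \<epsilon>" if f: "f \<in> F" for f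
      proof -
        have "M f \<le> (\<Sum>f\<in>F. M f)" using f F(1) by (intro member_le_sum) auto
        then have "M f \<le> m" by (simp add: m_def)
        then have "\<bar>(\<integral>z. f z \<partial>\<rho>) - (\<integral>z. f z \<partial>\<pi>)\<bar> \<le> \<epsilon> / 2" using M[OF f] \<gamma> \<rho> Cb unfolding good_def by blast
        then show ?thesis using \<epsilon> by simp
      qed
      then show ?thesis using \<rho> by blast
    qed
    then show "\<pi> \<in> weak_closure ?T ?P ?S"
      unfolding weak_closure_def using Cpl_prob_space[OF C pr(1)] Cpl_sets[OF C s] by simp
  qed
  moreover have "\<exists>\<rho>\<in>?S. Wp_pow p (prod_metric_p p dX dY) \<pi> \<rho> < ennreal (\<epsilon> powr p)"
    if p: "1 \<le> p" and MX: "Metric_space (topspace (path_top N X)) dX" "Metric_space.mtopology (topspace (path_top N X)) dX = path_top N X"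
      and MY: "Metric_space (topspace (path_top N Y)) dY" "Metric_space.mtopology (topspace (path_top N Y)) dY = path_top N Y"
      and x0: "x0 \<in> topspace (path_top N X)" "(\<integral>\<^sup>+x. ennreal (dX x0 x powr p) \<partial>\<mu>) < \<infinity>"
      and y0: "y0 \<in> topspace (path_top N Y)" "(\<integral>\<^sup>+y. ennreal (dY y0 y powr p) \<partial>\<nu>) < \<infinity>"
      and \<pi>: "\<pi> \<in> Cpl_bc N X Y \<mu> \<nu>" and \<epsilon>: "0 < \<epsilon>" for p dX dY x0 y0 \<pi> and \<epsilon> :: real
  proof -
    \<comment> \<open>A quarter for each component, so that the sum \<epsilon>^p / 2 is strictly
      below \<epsilon>^p.\<close>
    have e4: "0 < \<epsilon> powr p / 4" using \<epsilon> by simp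
    obtain m1 where m1: "\<And>m (G :: (((nat \<Rightarrow> 'a) \<times> (nat \<Rightarrow> 'b)) \<times> ((nat \<Rightarrow> 'a) \<times> (nat \<Rightarrow> 'b))) measure) U V.
        m1 \<le> m \<Longrightarrow> path_pair N X \<mu> \<Phi> m G U V \<Longrightarrow> (\<integral>\<^sup>+z. ennreal (dX (U z) (V z) powr p) \<partial>G) \<le> ennreal (\<epsilon> powr p / 4)"
      using path_pair_distance[OF s(1) pr(1) I scX MX x0 p e4] by blast
    obtain m2 where m2: "\<And>m (G :: (((nat \<Rightarrow> 'a) \<times> (nat \<Rightarrow> 'b)) \<times> ((nat \<Rightarrow> 'a) \<times> (nat \<Rightarrow> 'b))) measure) U V.
        m2 \<le> m \<Longrightarrow> path_pair N Y \<nu> \<Psi> m G U V \<Longrightarrow> (\<integral>\<^sup>+z. ennreal (dY (U z) (V z) powr p) \<partial>G) \<le> ennreal (\<epsilon> powr p / 4)"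
      using path_pair_distance[OF s(2) pr(2) J scY MY y0 p e4] by blast
    define m where "m = Suc (max m1 m2)"
    obtain \<rho> \<gamma> where \<rho>: "\<rho> \<in> ?S" and \<gamma>: "\<gamma> \<in> Cpl \<pi> \<rho>" "same_cells N \<Phi> \<Psi> m \<gamma>"
      using approx[OF \<pi>, of m] unfolding m_def by blast
    have C: "\<pi> \<in> Cpl \<mu> \<nu>" "\<rho> \<in> Cpl \<mu> \<nu>" using \<pi> \<rho> Cb by auto
    note pp = same_cells_path_pairs[OF s pr(1) C \<gamma>]
    have "Wp_pow p (prod_metric_p p dX dY) \<pi> \<rho> \<le>
        (\<integral>\<^sup>+w. ennreal (dX (fst (fst w)) (fst (snd w)) powr p) \<partial>\<gamma>) + (\<integral>\<^sup>+w. ennreal (dY (snd (fst w)) (snd (snd w)) powr p) \<partial>\<gamma>)"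
      by (rule Wp_pow_prod_metric_le[OF \<gamma>(1) Cpl_sets[OF \<gamma>(1) Cpl_sets[OF C(1) s] Cpl_sets[OF C(2) s]]
            Metric_space_dist_measurable[OF scX MX] Metric_space_dist_measurable[OF scY MY] p])
    also have "\<dots> \<le> ennreal (\<epsilon> powr p / 4) + ennreal (\<epsilon> powr p / 4)"
      by (intro add_mono m1[OF _ pp(1)] m2[OF _ pp(2)]) (simp_all add: m_def)
    also have "\<dots> = ennreal (\<epsilon> powr p / 2)" using e4 by (simp flip: ennreal_plus)
    also have "\<dots> < ennreal (\<epsilon> powr p)" using \<epsilon> by (intro ennreal_lessI) auto
    finally show ?thesis using \<rho> by blast
  qed
  ultimately show "weak_closure ?T ?P ?S = Cpl_bc N X Y \<mu> \<nu> \<and> (\<forall>p dX dY.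
      1 \<le> p \<longrightarrow> Metric_space (topspace (path_top N X)) dX \<longrightarrow> Metric_space.mtopology (topspace (path_top N X)) dX = path_top N X \<longrightarrow>
      Metric_space (topspace (path_top N Y)) dY \<longrightarrow> Metric_space.mtopology (topspace (path_top N Y)) dY = path_top N Y \<longrightarrow>
      (\<exists>x0\<in>topspace (path_top N X). (\<integral>\<^sup>+x. ennreal (dX x0 x powr p) \<partial>\<mu>) < \<infinity>) \<longrightarrow>
      (\<exists>y0\<in>topspace (path_top N Y). (\<integral>\<^sup>+y. ennreal (dY y0 y powr p) \<partial>\<nu>) < \<infinity>) \<longrightarrow>
      (\<forall>\<pi>\<in>Cpl_bc N X Y \<mu> \<nu>. \<forall>\<epsilon>::real. 0 < \<epsilon> \<longrightarrow> (\<exists>\<rho>\<in>?S. Wp_pow p (prod_metric_p p dX dY) \<pi> \<rho> < ennreal (\<epsilon> powr p))))"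
    by blast
qed

end
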